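(* Let $\chi\in\widehat{\mathcal O_{\mathbb E}^\times}$, $\eta\in\widehat{\mathcal O_{\mathbb F}^\times}$, $s,t\in\mathbb C$. (1) Assume $\chi^2=1$. Then $\widetilde A_{s,t}^{\chi,\eta}\varphi_{\chi,s}=0$ unless $\eta=\chi|_{\mathcal O_{\mathbb F}^\times}$, in which case $$\widetilde A_{s,t}^{\chi,\eta}\varphi_{\chi,s}=(1-q_{\mathbb F}^{-1})\psi_{\eta,t}\times\begin{cases}(1-q_{\mathbb E}^{-(2s+1)})&\text{for }\mathbb E/\mathbb F\text{ unramified},\\ (1-q_{\mathbb E}^{-(2s+1)})(1+q_{\mathbb F}^{t-\frac12})&\text{for }\mathbb E/\mathbb F\text{ ramified}.\end{cases}$$ (2) Assume $\chi|_{\mathcal O_{\mathbb F}^\times}\cdot\eta=\chi|_{\mathcal O_{\mathbb F}^\times}\cdot\eta^{-1}=1$. With $s$ read modulo $\frac{2\pi i}{\ln q_{\mathbb E}}\mathbb Z$ and $t$ modulo $\frac{2\pi i}{\ln q_{\mathbb F}}\mathbb Z$, the image of $\widetilde A_{s,t}^{\chi,\eta}:\pi_{\chi,s}|_{G'}\to\tau_{\eta,t}$ is as follows. (2a) If $\chi^2\ne1$ and $\mathbb E/\mathbb F$ is unramified, let $L^{\chi,\eta}=\{(0,\frac12),(\frac{\pi i}{\ln q_{\mathbb E}},\frac12+\frac{\pi i}{\ln q_{\mathbb F}})\}$. The image is $\{0\}$ if $(s,t)\in L^{\chi,\eta}$; $\mathbb C\psi_{\eta,t}$ if $(s,t)\in\{(0,-\frac12),(\frac{\pi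 i}{\ln q_{\mathbb E}},-\frac12+\frac{\pi i}{\ln q_{\mathbb F}})\}$; $\tau_{\eta,t}^0$ if $(s,t)\in[\mathbb C\times(\frac12+\frac{\pi i}{\ln q_{\mathbb F}}\mathbb Z)]\setminus L^{\chi,\eta}$; and $\tau_{\eta,t}$ otherwise. (2b) If $\chi^2\neq1$ and $\mathbb E/\mathbb F$ is ramified, let $L^{\chi,\eta}=\{(0,\frac12),(\frac{\pi i}{\ln q_{\mathbb E}},\frac12),(\frac{\pi i}{2\ln q_{\mathbb E}},\frac12+\frac{\pi i}{\ln q_{\mathbb F}}),(\frac{3\pi i}{2\ln q_{\mathbb E}},\frac12+\frac{\pi i}{\ln q_{\mathbb F}})\}$. The image is $\{0\}$ if $(s,t)\in L^{\chi,\eta}$; $\mathbb C\psi_{\eta,t}$ if $(s,t)\in\{(0,-\frac12),(\frac{\pi i}{\ln q_{\mathbb E}},-\frac12),(\frac{\pi i}{2\ln q_{\mathbb E}},-\frac12+\frac{\pi i}{\ln q_{\mathbb F}}),(\frac{3\pi i}{2\ln q_{\mathbb E}},-\frac12+\frac{\pi i}{\ln q_{\mathbb F}})\}$; $\tau_{\eta,t}^0$ if $(s,t)\in[\mathbb C\times(\frac12+\frac{\pi i}{\ln q_{\mathbb F}}\mathbb Z)]\setminus L^{\chi,\eta}$; and $\tau_{\eta,t}$ otherwise. (2c) If $\chi^2=1$ and $\mathbb E/\mathbb F$ is unramified, let $L^{\chi,\eta}=\{(-\frac12,-\frac12),(-\frac12+\frac{\pi i}{\ln q_{\mathbb E}},-\frac12+\frac{\pi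 i}{\ln q_{\mathbb F}})\}$. The image is $\{0\}$ if $(s,t)\in L^{\chi,\eta}$; $\mathbb C\psi_{\eta,t}$ if $(s,t)\in[\mathbb C\times(-\frac12+\frac{\pi i}{\ln q_{\mathbb F}}\mathbb Z)]\setminus L^{\chi,\eta}$; $\tau_{\eta,t}^0$ if $(s,t)\in\{(-\frac12,\frac12),(-\frac12+\frac{\pi i}{\ln q_{\mathbb E}},\frac12+\frac{\pi i}{\ln q_{\mathbb F}})\}$; and $\tau_{\eta,t}$ otherwise. (2d) If $\chi^2=1$ and $\mathbb E/\mathbb F$ is ramified: the image is $\{0\}$ if $(s,t)\in\{(-\frac12,-\frac12),(-\frac12+\frac{\pi i}{\ln q_{\mathbb E}},-\frac12),(\frac{\pi i}{2\ln q_{\mathbb E}},\frac12+\frac{\pi i}{\ln q_{\mathbb F}}),(\frac{3\pi i}{2\ln q_{\mathbb E}},\frac12+\frac{\pi i}{\ln q_{\mathbb F}})\}$; $\mathbb C\psi_{\eta,t}$ if $(s,t)\in[(\mathbb C\setminus(-\frac12+\frac{\pi i}{\ln q_{\mathbb E}}\mathbb Z))\times\{-\frac12\}]\cup\{(\frac{\pi i}{2\ln q_{\mathbb E}},-\frac12+\frac{\pi i}{\ln q_{\mathbb F}}),(\frac{3\pi i}{2\ln q_{\mathbb E}},-\frac12+\frac{\pi i}{\ln q_{\mathbb F}})\}$; $\tau_{\eta,t}^0$ if $(s,t)\in[(\mathbb C\times\{\frac12+\frac{\pi i}{\ln q_{\mathbb F}}\})\setminus\{(\frac{\pi i}{2\ln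 q_{\mathbb E}},\frac12+\frac{\pi i}{\ln q_{\mathbb F}}),(\frac{3\pi i}{2\ln q_{\mathbb E}},\frac12+\frac{\pi i}{\ln q_{\mathbb F}})\}]\cup\{(-\frac12,\frac12),(-\frac12+\frac{\pi i}{\ln q_{\mathbb E}},\frac12)\}$; and $\tau_{\eta,t}$ otherwise.
   Context: Fields. $\mathbb E/\mathbb F$ is a quadratic extension of non-archimedean local fields, $\mathbb E=\mathbb F(\alpha)$ with $\alpha\in\mathbb E\setminus\mathbb F$, $\alpha^2\in\mathbb F^\times\setminus\mathbb F^{\times2}$. For $k\in\{\mathbb E,\mathbb F\}$: $\mathcal O_k$ is the ring of integers, $\mathcal O_k^\times$ its units, $\varpi_k$ a chosen uniformizer, $q_k$ the residue cardinality, $\nu_k$ the valuation, $|\cdot|_k$ the absolute value with $d(ax)=|a|_k\,dx$ for Haar measure $dx$ on $k$ (so $|\varpi_k|_k=q_k^{-1}$). After possibly multiplying $\alpha$ by a power of $\varpi_{\mathbb F}$, either $\alpha^2\in\mathcal O_{\mathbb F}^\times$ (the case where $\mathbb E/\mathbb F$ is unramified, $q_{\mathbb E}=q_{\mathbb F}^2$) or $\alpha^2\in\varpi_{\mathbb F}\mathcal O_{\mathbb F}^\times$ (the case where $\mathbb E/\mathbb F$ is ramified, $q_{\mathbb E}=q_{\mathbb F}$). Elements of $\mathbb E$ are written $x=x_1+x_2\alpha$ with $x_1,x_2\in\mathbb F$. Haar measures are normalized so that $\mathcal O_k$ has measure $1$, and $dx=dx_1\,dx_2$. Characters. $\widehat{\mathcal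 O_k^\times}$ is the set of (continuous) characters of $\mathcal O_k^\times$; for $\chi\in\widehat{\mathcal O_k^\times}$, $s\in\mathbb C$, $\chi_s(x)=\chi(\varpi_k^{-\nu_k(x)}x)|x|_k^s$ ($x\in k^\times$). Representations. $G=\mathrm{PGL}(2,\mathbb E)\supseteq G'=\mathrm{PGL}(2,\mathbb F)$, with upper triangular Borel subgroups $B,B'$; $\chi_s\begin{pmatrix}a&b\\ 0&1\end{pmatrix}=\chi_s(a)$ on $B$. $\pi_{\chi,s}$ is left translation on $\operatorname{Ind}_B^G(\chi_s)=\{f\in C^\infty(G):f(gb)=\chi_{s+\frac12}(b)^{-1}f(g)\ \forall g\in G,b\in B\}$ ($C^\infty$ = locally constant); $\tau_{\eta,t}$ is defined likewise for $G'$, $B'$, $\eta_t$. $\overline n_x=\begin{pmatrix}1&0\\ x&1\end{pmatrix}$, $\overline N=\{\overline n_x:x\in\mathbb E\}$. For $\chi^2=1$, $\varphi_{\chi,s}\in\pi_{\chi,s}$ is given by $\varphi_{\chi,s}(kb)=\chi_{s+\frac12}(b)^{-1}\chi(\det k)^{-1}$ for $k\in\mathrm{PGL}(2,\mathcal O_{\mathbb E})$, $b\in B$. For $\eta^2=1$, $\psi_{\eta,t}\in\tau_{\eta,t}$ is defined in the same way for $G'$. For $\eta^2=1$ and $t\in-\frac12+\frac{\pi i}{\ln q_{\mathbb F}}\mathbb Z$, $\mathbb C\psi_{\eta,t}$ is the one-dimensional $G'$-subrepresentation of $\tau_{\eta,t}$. For $\eta^2=1$ and $t\in\frac12+\frac{\pi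 i}{\ln q_{\mathbb F}}\mathbb Z$, $\tau_{\eta,t}^0=\{f\in\tau_{\eta,t}:\int_{\mathbb F}f(\overline n_y)\,dy=0\}$ (Steinberg representation), the unique irreducible subrepresentation. Distributions and kernels. $\mathcal D'(\mathbb E)$ is the space of all linear functionals on $C_c^\infty(\mathbb E)$ (locally constant compactly supported functions); locally integrable functions are viewed as distributions via $dx$. For $x\in\mathbb E\setminus\mathbb F$ put $K_{s,t}^{\chi,\eta}(x)=\chi_{s-\frac12}(x^2)\,(\chi_{s-\frac12}\eta_{t+\frac12})\big(\frac{x_2}{x_1^2-x_2^2\alpha^2}\big)$. This is locally integrable on $\mathbb E$ for $\operatorname{Re}(2s\pm t+\frac12)>0$ and extends to a meromorphic family of distributions in $(s,t)\in\mathbb C^2$. Put $\widetilde K_{s,t}^{\chi,\eta}=\lambda_+\lambda_-K_{s,t}^{\chi,\eta}$, where $\lambda_\pm=1-q_{\mathbb F}^{-(2s\pm t+\frac12)}$ if $\chi|_{\mathcal O_{\mathbb F}^\times}\cdot\eta^{\pm1}=1$ and $\lambda_\pm=1$ otherwise (the inverse local $L$-factors $L(\frac12,\chi_s|_{\mathbb F^\times}\cdot\eta_t^{\pm1})^{-1}$); this family is holomorphic on $\mathbb C^2$. $\widetilde A_{s,t}^{\chi,\eta}:\pi_{\chi,s}|_{G'}\to\tau_{\eta,t}$ is the $G'$-intertwining operator with distribution kernel $\widetilde K_{s,t}^{\chi,\eta}$, i.e. $\widetilde A_{s,t}^{\chi,\eta}f(\overline n_y)=\int_{\mathbb E}\widetilde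 K_{s,t}^{\chi,\eta}(x)f(\overline n_{x+y})\,dx$ ($y\in\mathbb F$) in the sense of distributions; it is uniquely determined by this formula for those $f\in\operatorname{Ind}_B^G(\chi_s)$ supported in $\overline NB$ with $x\mapsto f(\overline n_x)$ compactly supported.
   Formalization: The chosen uniformizers are assumed compatible: if χ|·η=1 or χ|·η⁻¹=1 on the units of F, then χ_0(ϖ_F)=1. Otherwise the printed λ_± are not the inverse L-factors, the normalized kernel is not holomorphic and the operator is not defined for all s,t. *)

theory Defs
  imports "HOL-Analysis.Analysis"
begin

section \<open>Non-archimedean local fields\<close>

text \<open>
  A local field is given by its discrete valuation \<open>nu\<close> (only meaningful away from 0), a chosen
  uniformizer and the Haar measure normalized by giving the ring of integers measure 1.  Its
  topology is that of the type class \<open>metric_space\<close>, tied to the valuation by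
  \<open>nonarch_local_field\<close> below.
\<close>

record 'k lf =
  nu :: "'k \<Rightarrow> int"
  unif :: 'k
  haar :: "'k measure"

definition integer_ring :: "'k::{field,metric_space} lf \<Rightarrow> 'k set" where
  "integer_ring K = {x. x = 0 \<or> 0 \<le> nu K x}"

definition unit_group :: "'k::{field,metric_space} lf \<Rightarrow> 'k set" where
  "unit_group K = {x. x \<noteq> 0 \<and> nu K x = 0}"

definition residue_classes :: "'k::{field,metric_space} lf \<Rightarrow> 'k set set" where
  "residue_classes K =
     integer_ring K //
       {(x, y). x \<in> integer_ring K \<and> y \<in> integer_ring K \<and> (x = y \<or> 0 < nu K (x - y))}"

definition residue_card :: "'k::{field,metric_space} lf \<Rightarrow> nat" where
  "residue_card K = card (residue_classes K)"

definition absv :: "'k::{field,metric_space} lf \<Rightarrow> 'k \<Rightarrow> real" where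
  "absv K x = (if x = 0 then 0 else real (residue_card K) powi (- nu K x))"

definition nonarch_local_field :: "'k::{field,metric_space} lf \<Rightarrow> bool" where
  "nonarch_local_field K \<longleftrightarrow>
     (\<forall>x y. x \<noteq> 0 \<and> y \<noteq> 0 \<longrightarrow> nu K (x * y) = nu K x + nu K y) \<and>
     (\<forall>x y. x \<noteq> 0 \<and> y \<noteq> 0 \<and> x + y \<noteq> 0 \<longrightarrow> min (nu K x) (nu K y) \<le> nu K (x + y)) \<and>
     unif K \<noteq> 0 \<and> nu K (unif K) = 1 \<and>
     finite (residue_classes K) \<and>
     (\<forall>x y. dist x y = absv K (x - y)) \<and>
     complete (UNIV :: 'k set) \<and>
     sets (haar K) = sets borel \<and>
     (\<forall>a. distr (haar K) borel (\<lambda>x. a + x) = haar K) \<and>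
     emeasure (haar K) (integer_ring K) = 1"


section \<open>The quadratic extension\<close>

text \<open>
  \<open>j\<close> is the inclusion of F into E and \<open>\<alpha>\<close> the generator of E.
\<close>

definition unramified ::
  "'f::{field,metric_space} lf \<Rightarrow> 'e::{field,metric_space} lf \<Rightarrow> ('f \<Rightarrow> 'e) \<Rightarrow> bool" where
  "unramified F E j \<longleftrightarrow> nu E (j (unif F)) = 1"

definition alpha_sq :: "('f::field \<Rightarrow> 'e::field) \<Rightarrow> 'e \<Rightarrow> 'f" where
  "alpha_sq j \<alpha> = (THE d. j d = \<alpha>\<^sup>2)"

definition coord1 :: "('f::field \<Rightarrow> 'e::field) \<Rightarrow> 'e \<Rightarrow> 'e \<Rightarrow> 'f" where
  "coord1 j \<alpha> x = (THE a. \<exists>b. x = j a + j b * \<alpha>)"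

definition coord2 :: "('f::field \<Rightarrow> 'e::field) \<Rightarrow> 'e \<Rightarrow> 'e \<Rightarrow> 'f" where
  "coord2 j \<alpha> x = (THE b. \<exists>a. x = j a + j b * \<alpha>)"

text \<open>
  The last two conjuncts are the normalization of \<open>\<alpha>\<close> and the identity of Haar measures
  \<open>dx = dx1 dx2\<close>.  Both can be achieved for every quadratic extension in odd residue
  characteristic; in residue characteristic 2 they are genuine restrictions.
\<close>

definition quadratic_extension ::
  "'f::{field,metric_space} lf \<Rightarrow> 'e::{field,metric_space} lf \<Rightarrow> ('f \<Rightarrow> 'e) \<Rightarrow> 'e \<Rightarrow> bool" where
  "quadratic_extension F E j \<alpha> \<longleftrightarrow>
     nonarch_local_field F \<and> nonarch_local_field E \<and>
     j 1 = 1 \<and> (\<forall>a b. j (a + b) = j a + j b) \<and> (\<forall>a b. j (a * b) = j a * j b) \<and>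
     continuous_on UNIV j \<and>
     \<alpha> \<notin> range j \<and> (\<forall>x. \<exists>a b. x = j a + j b * \<alpha>) \<and>
     (\<exists>d. d \<noteq> 0 \<and> (\<forall>c. d \<noteq> c\<^sup>2) \<and> \<alpha>\<^sup>2 = j d) \<and>
     (alpha_sq j \<alpha> \<in> unit_group F \<and> unramified F E j \<or>
      alpha_sq j \<alpha> \<in> (\<lambda>u. unif F * u) ` unit_group F \<and> \<not> unramified F E j) \<and>
     haar E = distr (haar F \<Otimes>\<^sub>M haar F) borel (\<lambda>(x1, x2). j x1 + j x2 * \<alpha>)"


section \<open>Characters\<close>

definition unit_character ::
  "'k::{field,metric_space} lf \<Rightarrow> ('k \<Rightarrow> complex) \<Rightarrow> bool" where
  "unit_character K chi \<longleftrightarrow>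
     (\<forall>u\<in>unit_group K. chi u \<noteq> 0) \<and>
     (\<forall>u\<in>unit_group K. \<forall>v\<in>unit_group K. chi (u * v) = chi u * chi v) \<and>
     continuous_on (unit_group K) chi"

definition trivial_on_units ::
  "'k::{field,metric_space} lf \<Rightarrow> ('k \<Rightarrow> complex) \<Rightarrow> bool" where
  "trivial_on_units K chi \<longleftrightarrow> (\<forall>u\<in>unit_group K. chi u = 1)"

text \<open>The quasi-character \<open>chi_s\<close>, meaningful at nonzero arguments.\<close>

definition qchar ::
  "'k::{field,metric_space} lf \<Rightarrow> ('k \<Rightarrow> complex) \<Rightarrow> complex \<Rightarrow> 'k \<Rightarrow> complex" where
  "qchar K chi s x = chi (unif K powi (- nu K x) * x) * of_real (absv K x) powr s"


section \<open>Principal series of PGL(2)\<close>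

text \<open>
  Functions on PGL(2,k) are functions on invertible 2x2 matrices that are invariant under
  nonzero scalars, extended by 0 to all matrices so that equality of functions is
  equality on PGL(2,k).
\<close>

definition mat2 :: "'k::zero \<Rightarrow> 'k \<Rightarrow> 'k \<Rightarrow> 'k \<Rightarrow> 'k^2^2" where
  "mat2 a b c d = vector [vector [a, b], vector [c, d]]"

definition nbar :: "'k::field \<Rightarrow> 'k^2^2" where
  "nbar x = mat2 1 0 x 1"

definition smooth_PGL :: "('k::{field,metric_space}^2^2 \<Rightarrow> complex) \<Rightarrow> bool" where
  "smooth_PGL f \<longleftrightarrow>
     (\<forall>g. \<not> invertible g \<longrightarrow> f g = 0) \<and>
     (\<forall>g z. z \<noteq> 0 \<longrightarrow> f (mat z ** g) = f g) \<and>
     (\<forall>g. invertible g \<longrightarrow> (\<forall>\<^sub>F h in nhds g. f h = f g))"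

text \<open>
  Every class of the Borel subgroup has a unique representative with lower right entry 1, so
  it suffices to impose equivariance under those.
\<close>

definition Ind ::
  "'k::{field,metric_space} lf \<Rightarrow> ('k \<Rightarrow> complex) \<Rightarrow> complex \<Rightarrow> ('k^2^2 \<Rightarrow> complex) set" where
  "Ind K chi s =
     {f. smooth_PGL f \<and>
         (\<forall>g a b. invertible g \<and> a \<noteq> 0 \<longrightarrow>
            f (g ** mat2 a b 0 1) = inverse (qchar K chi (s + 1/2) a) * f g)}"

definition left_translate ::
  "'k::field^2^2 \<Rightarrow> ('k^2^2 \<Rightarrow> complex) \<Rightarrow> 'k^2^2 \<Rightarrow> complex" where
  "left_translate g f = (\<lambda>h. f (matrix_inv g ** h))"

definition GL2_integers :: "'k::{field,metric_space} lf \<Rightarrow> ('k^2^2) set" where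
  "GL2_integers K = {k. (\<forall>i l. k $ i $ l \<in> integer_ring K) \<and> det k \<in> unit_group K}"

text \<open>The vector \<open>\<phi>\<close> (or \<open>\<psi>\<close>), for \<open>chi^2 = 1\<close>; unique by the Iwasawa decomposition.\<close>

definition spherical ::
  "'k::{field,metric_space} lf \<Rightarrow> ('k \<Rightarrow> complex) \<Rightarrow> complex \<Rightarrow> 'k^2^2 \<Rightarrow> complex" where
  "spherical K chi s =
     (THE f. f \<in> Ind K chi s \<and>
        (\<forall>k\<in>GL2_integers K. \<forall>a b. a \<noteq> 0 \<longrightarrow>
           f (k ** mat2 a b 0 1) = inverse (qchar K chi (s + 1/2) a) * inverse (chi (det k))))"

definition steinberg ::
  "'k::{field,metric_space} lf \<Rightarrow> ('k \<Rightarrow> complex) \<Rightarrow> complex \<Rightarrow> ('k^2^2 \<Rightarrow> complex) set" where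
  "steinberg K eta t = {f \<in> Ind K eta t. (LINT y|haar K. f (nbar y)) = 0}"


section \<open>Distribution kernels\<close>

definition test_function :: "('k::metric_space \<Rightarrow> complex) \<Rightarrow> bool" where
  "test_function u \<longleftrightarrow>
     (\<forall>x. \<forall>\<^sub>F y in nhds x. u y = u x) \<and> compact (closure {x. u x \<noteq> 0})"

definition kern ::
  "'f::{field,metric_space} lf \<Rightarrow> 'e::{field,metric_space} lf \<Rightarrow> ('f \<Rightarrow> 'e) \<Rightarrow> 'e \<Rightarrow>
   ('e \<Rightarrow> complex) \<Rightarrow> ('f \<Rightarrow> complex) \<Rightarrow> complex \<Rightarrow> complex \<Rightarrow> 'e \<Rightarrow> complex" where
  "kern F E j \<alpha> chi eta s t x =
     (let x1 = coord1 j \<alpha> x; x2 = coord2 j \<alpha> x;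
          z = x2 / (x1\<^sup>2 - x2\<^sup>2 * alpha_sq j \<alpha>)
      in qchar E chi (s - 1/2) (x\<^sup>2) * (qchar E chi (s - 1/2) (j z) * qchar F eta (t + 1/2) z))"

text \<open>
  These agree with the inverse local L-factors at 1/2 of the quasi-characters
  \<open>chi_s|F eta_t\<close> and \<open>chi_s|F eta_t^-1\<close> provided
  \<open>qchar E chi 0 (j (unif F)) = 1\<close>, a compatibility of the two chosen uniformizers that holds
  if \<open>j (unif F)\<close> is a power of \<open>unif E\<close>.
\<close>

definition lambda_plus ::
  "'f::{field,metric_space} lf \<Rightarrow> ('f \<Rightarrow> 'e) \<Rightarrow> ('e \<Rightarrow> complex) \<Rightarrow> ('f \<Rightarrow> complex) \<Rightarrow>
   complex \<Rightarrow> complex \<Rightarrow> complex" where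
  "lambda_plus F j chi eta s t =
     (if trivial_on_units F (\<lambda>u. chi (j u) * eta u)
      then 1 - of_nat (residue_card F) powr (- (2 * s + t + 1/2)) else 1)"

definition lambda_minus ::
  "'f::{field,metric_space} lf \<Rightarrow> ('f \<Rightarrow> 'e) \<Rightarrow> ('e \<Rightarrow> complex) \<Rightarrow> ('f \<Rightarrow> complex) \<Rightarrow>
   complex \<Rightarrow> complex \<Rightarrow> complex" where
  "lambda_minus F j chi eta s t =
     (if trivial_on_units F (\<lambda>u. chi (j u) * inverse (eta u))
      then 1 - of_nat (residue_card F) powr (- (2 * s - t + 1/2)) else 1)"

text \<open>Holomorphic functions of two variables: the real derivative is complex linear.\<close>

definition holomorphic2 :: "(complex \<times> complex \<Rightarrow> complex) \<Rightarrow> bool" where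
  "holomorphic2 \<Phi> \<longleftrightarrow> (\<forall>p. \<exists>a b. (\<Phi> has_derivative (\<lambda>(v, w). a * v + b * w)) (at p))"

text \<open>
  The normalized kernel as a distribution: for each test function, the holomorphic extension
  to all (s,t) of the convergent integral against \<open>\<lambda>\<^sub>+ \<lambda>\<^sub>- K\<close>, evaluated at (s,t).
  The domain of convergence is open, convex and nonempty, so there is at most one extension.
\<close>

definition Ktilde ::
  "'f::{field,metric_space} lf \<Rightarrow> 'e::{field,metric_space} lf \<Rightarrow> ('f \<Rightarrow> 'e) \<Rightarrow> 'e \<Rightarrow>
   ('e \<Rightarrow> complex) \<Rightarrow> ('f \<Rightarrow> complex) \<Rightarrow> complex \<Rightarrow> complex \<Rightarrow> ('e \<Rightarrow> complex) \<Rightarrow> complex" where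
  "Ktilde F E j \<alpha> chi eta s t u =
     (THE \<Phi>. holomorphic2 \<Phi> \<and>
        (\<forall>s t. 0 < Re (2 * s + t + 1/2) \<and> 0 < Re (2 * s - t + 1/2) \<longrightarrow>
           \<Phi> (s, t) = lambda_plus F j chi eta s t * lambda_minus F j chi eta s t *
                      (LINT x|haar E. kern F E j \<alpha> chi eta s t x * u x))) (s, t)"


section \<open>The intertwining operators\<close>

definition big_cell :: "('k::field^2^2) set" where
  "big_cell = {mat z ** (nbar x ** mat2 a b 0 1) | z x a b. z \<noteq> 0 \<and> a \<noteq> 0}"

text \<open>
  \<open>is_Atilde \<dots> A\<close>: the operator A is the G'-intertwining operator from the restriction of
  \<open>\<pi>\<close> to \<open>\<tau>\<close> with distribution kernel \<open>Ktilde\<close>.  Only its values on \<open>Ind E chi s\<close> matter, and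
  these are determined by the last conjunct.
\<close>

definition is_Atilde ::
  "'f::{field,metric_space} lf \<Rightarrow> 'e::{field,metric_space} lf \<Rightarrow> ('f \<Rightarrow> 'e) \<Rightarrow> 'e \<Rightarrow>
   ('e \<Rightarrow> complex) \<Rightarrow> ('f \<Rightarrow> complex) \<Rightarrow> complex \<Rightarrow> complex \<Rightarrow>
   (('e^2^2 \<Rightarrow> complex) \<Rightarrow> ('f^2^2 \<Rightarrow> complex)) \<Rightarrow> bool" where
  "is_Atilde F E j \<alpha> chi eta s t A \<longleftrightarrow>
     (\<forall>f\<in>Ind E chi s. A f \<in> Ind F eta t) \<and>
     (\<forall>f\<in>Ind E chi s. \<forall>h\<in>Ind E chi s. A (\<lambda>g. f g + h g) = (\<lambda>g. A f g + A h g)) \<and>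
     (\<forall>c. \<forall>f\<in>Ind E chi s. A (\<lambda>g. c * f g) = (\<lambda>g. c * A f g)) \<and>
     (\<forall>g. invertible g \<longrightarrow> (\<forall>f\<in>Ind E chi s.
        A (left_translate (map_matrix j g) f) = left_translate g (A f))) \<and>
     (\<forall>f\<in>Ind E chi s. {g. f g \<noteq> 0} \<subseteq> big_cell \<and> compact (closure {x. f (nbar x) \<noteq> 0}) \<longrightarrow>
        (\<forall>y. A f (nbar y) = Ktilde F E j \<alpha> chi eta s t (\<lambda>x. f (nbar (x + j y)))))"


section \<open>Parameters modulo periods\<close>

text \<open>\<open>\<pi>i / ln q\<close>, half the period of \<open>s \<mapsto> chi_s\<close>.\<close>

definition half_period :: "'k::{field,metric_space} lf \<Rightarrow> complex" where
  "half_period K = of_real pi * \<i> / of_real (ln (real (residue_card K)))"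

definition half_period_coset :: "'k::{field,metric_space} lf \<Rightarrow> complex \<Rightarrow> complex set" where
  "half_period_coset K c = {c + half_period K * of_int n | n. True}"

definition mod_periods ::
  "'f::{field,metric_space} lf \<Rightarrow> 'e::{field,metric_space} lf \<Rightarrow>
   (complex \<times> complex) set \<Rightarrow> (complex \<times> complex) set" where
  "mod_periods F E S =
     {(s + 2 * half_period E * of_int m, t + 2 * half_period F * of_int n) | s t m n. (s, t) \<in> S}"

text \<open>
  The image of A is 0 on \<open>Z\<close>, spanned by \<open>\<psi>\<close> on \<open>P\<close>, the Steinberg representation on \<open>S\<close>, and
  everything elsewhere.
\<close>

definition image_table ::
  "'f::{field,metric_space} lf \<Rightarrow> 'e::{field,metric_space} lf \<Rightarrow>
   ('e \<Rightarrow> complex) \<Rightarrow> ('f \<Rightarrow> complex) \<Rightarrow> complex \<Rightarrow> complex \<Rightarrow>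
   (('e^2^2 \<Rightarrow> complex) \<Rightarrow> ('f^2^2 \<Rightarrow> complex)) \<Rightarrow>
   (complex \<times> complex) set \<Rightarrow> (complex \<times> complex) set \<Rightarrow> (complex \<times> complex) set \<Rightarrow> bool" where
  "image_table F E chi eta s t A Z P S \<longleftrightarrow>
     ((s, t) \<in> Z \<longrightarrow> A ` Ind E chi s = {\<lambda>g. 0}) \<and>
     ((s, t) \<in> P \<longrightarrow> A ` Ind E chi s = {\<lambda>g. c * spherical F eta t g | c. True}) \<and>
     ((s, t) \<in> S \<longrightarrow> A ` Ind E chi s = steinberg F eta t) \<and>
     ((s, t) \<notin> Z \<union> P \<union> S \<longrightarrow> A ` Ind E chi s = Ind F eta t)"

end

theory Submission
  imports Defs "HOL-Complex_Analysis.Conformal_Mappings"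
begin

text \<open>
  Put \<open>q = q\<^sub>F\<close>, \<open>Y = q powr -(2s + t + 1/2)\<close>, \<open>X = q powr -(2s - t + 1/2)\<close> and \<open>\<tau> = q powr (t + 1/2)\<close>, so that
  \<open>q X = Y \<tau>\<^sup>2\<close>.  Assume that both L-factors are nontrivial.  Off F the kernel is
  \<open>\<kappa>(x) (q Y)^\<nu>(x\<^sub>2) \<tau>^(f \<nu>(x))\<close>, where \<open>\<kappa> = \<chi>\<^sup>2\<close> is trivial on \<open>F\<^sup>\<times>\<close> and \<open>f\<close> is the residue degree.  Test
  functions on E are spanned by indicators of balls around points off F, around points of \<open>F\<^sup>\<times>\<close> and
  around 0.  Geometric series evaluate the kernel on these balls; after multiplication by
  \<open>(1 - X)(1 - Y)\<close> the results are Laurent polynomials in \<open>X\<close>, \<open>Y\<close>, \<open>\<tau>\<close>, which gives the holomorphic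
  extension.
  
  A \<open>G'\<close>-invariant subspace of \<open>\<tau>\<^sub>\<eta>\<^sub>,\<^sub>t\<close> with an element that is not constant on F contains all test
  functions of integral zero.  Hence it contains the Steinberg representation when \<open>\<tau>\<^sup>2 = q\<^sup>2\<close> and is
  everything otherwise; a nonzero subspace without such an element can occur only for \<open>\<tau>\<^sup>2 = 1\<close> and
  is then the line of \<open>\<psi>\<close>.  If \<open>X = 1\<close>, the kernel is a multiple of the Dirac distribution at 0.
  If \<open>X \<noteq> 1\<close>, the image is not zero; it remains to see for \<open>\<tau>\<^sup>2 = q\<^sup>2\<close> whether \<open>A f\<close> always has integral zero,
  which comes down to the integral of the kernel over the line \<open>\<alpha> + F\<close>, and for \<open>\<tau>\<^sup>2 = 1\<close> whether the
  kernel is invariant under translation by F.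
  
  The image of the spherical vector is an eigenvector of \<open>GL\<^sub>2(O\<^sub>F)\<close>, hence a multiple of \<open>\<psi>\<close>; the
  factor is its value at \<open>nbar 1\<close>.
\<close>

section \<open>Valuations\<close>

text \<open>The factors 1 - X and 1 - Y belong to the two singular sets 0 and F. Off F the kernel is
  locally constant, so both factors stay in front of the regularized value. Near a nonzero point of
  F a geometric series in Y cancels 1 - Y. At 0, dilation by the uniformizer of F adds a geometric
  series in X, which cancels 1 - X as well. So X = 1 kills every small ball not centred at 0, Y = 1
  kills every small ball off F, and at 0 a single number remains, \<open>Mf\<close>, the regularized
  integral of the kernel over a shell; its zeros on X = 1 give the zero images. The cases \<tau>^2 =
  q^2 and \<tau>^2 = 1 are special because there the twist by the Weyl element is the Jacobian of x
  -> 1/x, respectively trivial, so that integration over F, respectively the constant function, is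
  invariant up to characters. The measure theory stays elementary: the modulus of a dilation is
  computed on cosets, and inversion and Fubini are verified on balls and extended linearly to test
  functions. The parameter s enters only through Y \<tau> = q^(-2s), which at the end turns
  conditions on Y into conditions on s.\<close>

definition pid :: "'k::{field,metric_space} lf \<Rightarrow> int \<Rightarrow> 'k set" where
  "pid K n = {x. x = 0 \<or> n \<le> nu K x}"

locale local_field =
  fixes K :: "'k::{field,metric_space} lf"
  assumes lf: "nonarch_local_field K"
begin

abbreviation q :: real where "q \<equiv> real (residue_card K)"

lemma nu_mult: "x \<noteq> 0 \<Longrightarrow> y \<noteq> 0 \<Longrightarrow> nu K (x * y) = nu K x + nu K y"
  using lf by (simp add: nonarch_local_field_def)

lemma nu_add: "x \<noteq> 0 \<Longrightarrow> y \<noteq> 0 \<Longrightarrow> x + y \<noteq> 0 \<Longrightarrow> min (nu K x) (nu K y) \<le> nu K (x + y)"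
  using lf by (simp add: nonarch_local_field_def)

lemma unif_nz [simp]: "unif K \<noteq> 0" and nu_unif [simp]: "nu K (unif K) = 1"
  using lf by (simp_all add: nonarch_local_field_def)

lemma nu_one [simp]: "nu K 1 = 0"
  using nu_mult[of 1 1] by simp

lemma nu_minus [simp]: "nu K (- x) = nu K x"
proof (cases "x = 0")
  case False
  have "nu K (- 1) = 0" using nu_mult[of "-1" "-1"] by simp
  then show ?thesis using nu_mult[of "-1" x] False by simp
qed simp

lemma nu_inverse: "x \<noteq> 0 \<Longrightarrow> nu K (inverse x) = - nu K x"
  using nu_mult[of x "inverse x"] by simp

lemma nu_divide: "x \<noteq> 0 \<Longrightarrow> y \<noteq> 0 \<Longrightarrow> nu K (x / y) = nu K x - nu K y"
  by (simp add: divide_inverse nu_mult nu_inverse)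

lemma nu_power: "x \<noteq> 0 \<Longrightarrow> nu K (x ^ n) = int n * nu K x"
  by (induction n) (auto simp: nu_mult algebra_simps)

lemma nu_powi: "x \<noteq> 0 \<Longrightarrow> nu K (x powi n) = n * nu K x"
  by (auto simp: power_int_def nu_power nu_inverse)

lemma zero_pid [simp]: "0 \<in> pid K n"
  by (simp add: pid_def)

lemma one_pid [simp]: "1 \<in> pid K n \<longleftrightarrow> n \<le> 0"
  by (simp add: pid_def)

lemma pid_add: "x \<in> pid K n \<Longrightarrow> y \<in> pid K n \<Longrightarrow> x + y \<in> pid K n"
  using nu_add[of x y] by (fastforce simp: pid_def)

lemma pid_minus [simp]: "- x \<in> pid K n \<longleftrightarrow> x \<in> pid K n"
  by (simp add: pid_def)

lemma pid_diff: "x \<in> pid K n \<Longrightarrow> y \<in> pid K n \<Longrightarrow> x - y \<in> pid K n"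
  using pid_add[of x n "- y"] by simp

lemma pid_diff_commute: "x - y \<in> pid K n \<longleftrightarrow> y - x \<in> pid K n"
  using pid_minus[of "x - y" n] by (simp del: pid_minus)

lemma pid_mult: "x \<in> pid K m \<Longrightarrow> y \<in> pid K n \<Longrightarrow> x * y \<in> pid K (m + n)"
  by (cases "x = 0"; cases "y = 0") (auto simp: pid_def nu_mult)

lemma pid_mono: "x \<in> pid K n \<Longrightarrow> m \<le> n \<Longrightarrow> x \<in> pid K m"
  by (auto simp: pid_def)

lemma pid_mult_iff: "a \<noteq> 0 \<Longrightarrow> a * x \<in> pid K n \<longleftrightarrow> x \<in> pid K (n - nu K a)"
  by (cases "x = 0") (auto simp: pid_def nu_mult)

lemma pid_divide_iff: "a \<noteq> 0 \<Longrightarrow> x / a \<in> pid K n \<longleftrightarrow> x \<in> pid K (n + nu K a)"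
  by (cases "x = 0") (auto simp: pid_def nu_divide)

lemma pid_add_cancel: "h \<in> pid K n \<Longrightarrow> x + h \<in> pid K n \<longleftrightarrow> x \<in> pid K n"
  by (metis add_diff_cancel_right' pid_add pid_diff)

lemma pid_trans: "x - y \<in> pid K n \<Longrightarrow> y - z \<in> pid K n \<Longrightarrow> x - z \<in> pid K n"
  using pid_add[of "x - y" n "y - z"] by simp

lemma notin_pidD: "x \<notin> pid K n \<Longrightarrow> x \<noteq> 0 \<and> nu K x < n"
  by (auto simp: pid_def)

text \<open>The equality case of the ultrametric inequality: if x + h were deeper than x, then x =
  (x + h) - h would be deeper than itself.\<close>

lemma nu_add_eq:
  assumes "x \<notin> pid K n" "h \<in> pid K n" shows "x + h \<noteq> 0" "nu K (x + h) = nu K x"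
proof -
  have x: "x \<noteq> 0" "nu K x < n" using assms(1) by (auto simp: pid_def)
  show nz: "x + h \<noteq> 0" using assms pid_add_cancel zero_pid by metis
  have "\<not> nu K x < nu K (x + h)"
    using pid_add[of "x + h" "nu K x + 1" "-h"] pid_mono[OF assms(2), of "nu K x + 1"] x nz
    by (auto simp: pid_def)
  moreover have "nu K x \<le> nu K (x + h)"
    using pid_add[of x "nu K x" h] pid_mono[OF assms(2), of "nu K x"] x nz
    by (auto simp: pid_def)
  ultimately show "nu K (x + h) = nu K x" by simp
qed

lemma unit_iff: "u \<in> unit_group K \<longleftrightarrow> u \<noteq> 0 \<and> nu K u = 0"
  by (simp add: unit_group_def)

lemma pid_0: "pid K 0 = integer_ring K"
  by (simp add: pid_def integer_ring_def)

lemma unif_powi_nz [simp]: "unif K powi n \<noteq> 0" and nu_unif_powi [simp]: "nu K (unif K powi n) = n"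
  by (simp_all add: nu_powi)

text \<open>The predicate under \<open>SOME\<close> depends only on the coset of x, so equal cosets
  receive the same representative. Cosets thereby become elements of the field over which one can
  sum and count.\<close>

definition rp :: "int \<Rightarrow> 'k \<Rightarrow> 'k" where
  "rp n x = (SOME y. y - x \<in> pid K n)"

lemma rp_diff: "rp n x - x \<in> pid K n"
  unfolding rp_def by (rule someI[of _ x]) simp

lemma rp_diff': "x - rp n x \<in> pid K n"
  using rp_diff pid_diff_commute by blast

lemma rp_eq_iff: "rp n x = rp n y \<longleftrightarrow> x - y \<in> pid K n"
proof
  assume "rp n x = rp n y"
  then show "x - y \<in> pid K n" using rp_diff'[of x n] rp_diff[of n y] pid_trans by metis
next
  assume "x - y \<in> pid K n"
  then have "z - x \<in> pid K n \<longleftrightarrow> z - y \<in> pid K n" for z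
    using pid_trans pid_diff_commute by metis
  then show "rp n x = rp n y" by (simp add: rp_def)
qed

lemma rp_rp [simp]: "rp n (rp n x) = rp n x"
  by (simp add: rp_eq_iff rp_diff)

lemma rp_pid_iff: "m \<le> n \<Longrightarrow> rp n x \<in> pid K m \<longleftrightarrow> x \<in> pid K m"
  using pid_add_cancel[of "rp n x - x" m x] pid_mono[OF rp_diff, of m n x] by simp

text \<open>Connects the residue cardinality, defined by equivalence classes, with the
  representatives \<open>rp 1\<close> that serve as digits below.\<close>

lemma residue_classes_rp: "bij_betw (\<lambda>C. rp 1 (SOME x. x \<in> C)) (residue_classes K) (rp 1 ` pid K 0)"
proof -
  let ?r = "{(x, y). x \<in> integer_ring K \<and> y \<in> integer_ring K \<and> (x = y \<or> 0 < nu K (x - y))}"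
  have r: "(x, y) \<in> ?r \<longleftrightarrow> x \<in> pid K 0 \<and> y \<in> pid K 0 \<and> x - y \<in> pid K 1" for x y
    by (auto simp: pid_def integer_ring_def)
  have im: "?r `` {x} = {y \<in> pid K 0. x - y \<in> pid K 1}" if "x \<in> pid K 0" for x
    using that r by (auto simp: Image_iff simp del: mem_Collect_eq) (auto simp: r)
  have cls: "\<exists>x\<in>pid K 0. C = {y \<in> pid K 0. x - y \<in> pid K 1}" if "C \<in> residue_classes K" for C
    using that im unfolding residue_classes_def pid_0[symmetric] by (auto elim!: quotientE)
  have cls2: "{y \<in> pid K 0. x - y \<in> pid K 1} \<in> residue_classes K" if "x \<in> pid K 0" for x
    using quotientI[of x "integer_ring K" ?r] im[OF that] that unfolding residue_classes_def pid_0 by simp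
  have some: "rp 1 (SOME x. x \<in> C) = rp 1 x" if "x \<in> pid K 0" "C = {y \<in> pid K 0. x - y \<in> pid K 1}" for C x
  proof -
    have "x \<in> C" using that by simp
    then have "(SOME x. x \<in> C) \<in> C" by (rule someI)
    then show ?thesis using that(2) by (subst eq_commute) (simp add: rp_eq_iff)
  qed
  show ?thesis
  proof (rule bij_betwI')
    fix C D assume "C \<in> residue_classes K" "D \<in> residue_classes K"
    then obtain x y where xy: "x \<in> pid K 0" "C = {z \<in> pid K 0. x - z \<in> pid K 1}"
      "y \<in> pid K 0" "D = {z \<in> pid K 0. y - z \<in> pid K 1}"
      using cls by meson
    have "x - z \<in> pid K 1 \<longleftrightarrow> y - z \<in> pid K 1" if "x - y \<in> pid K 1" for z
      using that pid_trans[of x y 1 z] pid_trans[of y x 1 z] pid_diff_commute[of x y 1] by blast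
    then have "C = D" if "x - y \<in> pid K 1"
      unfolding xy using that by blast
    moreover have "y \<in> D" unfolding xy using xy(3) by simp
    then have "x - y \<in> pid K 1" if "C = D" using that unfolding xy by blast
    ultimately have "rp 1 x = rp 1 y \<longleftrightarrow> C = D" unfolding rp_eq_iff by blast
    moreover have "rp 1 (SOME x. x \<in> C) = rp 1 x" "rp 1 (SOME x. x \<in> D) = rp 1 y"
      by (rule some[OF xy(1,2)], rule some[OF xy(3,4)])
    ultimately show "(rp 1 (SOME x. x \<in> C) = rp 1 (SOME x. x \<in> D)) = (C = D)"
      by (simp only:)
  next
    fix C assume "C \<in> residue_classes K"
    then show "rp 1 (SOME x. x \<in> C) \<in> rp 1 ` pid K 0" using cls[of C] some[of _ C] by fastforce
  next
    fix z assume "z \<in> rp 1 ` pid K 0"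
    then obtain x where "x \<in> pid K 0" "z = rp 1 x" by blast
    then show "\<exists>C\<in>residue_classes K. z = rp 1 (SOME x. x \<in> C)"
      using cls2[of x] some[of x "{y \<in> pid K 0. x - y \<in> pid K 1}"] by (intro bexI) simp_all
  qed
qed

lemma finite_rp1: "finite (rp 1 ` pid K 0)" and card_rp1: "card (rp 1 ` pid K 0) = residue_card K"
  using bij_betw_finite[OF residue_classes_rp] bij_betw_same_card[OF residue_classes_rp] lf
  by (simp_all add: nonarch_local_field_def residue_card_def)

lemma q_ge_2: "2 \<le> q"
proof -
  have "rp 1 0 \<noteq> rp 1 1" by (simp add: rp_eq_iff)
  then have "card {rp 1 0, rp 1 1} = 2" by simp
  moreover have "{rp 1 0, rp 1 1} \<subseteq> rp 1 ` pid K 0" by auto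
  ultimately have "2 \<le> residue_card K" using card_mono finite_rp1 card_rp1 by metis
  then show ?thesis by linarith
qed

lemma q_gt_1: "1 < q" and q_gt_0: "0 < q" and q_nz: "q \<noteq> 0"
  using q_ge_2 by linarith+

section \<open>Topology in terms of the valuation, compactness of the ideals\<close>

lemma dist_absv: "dist x y = absv K (x - y)"
  using lf by (simp add: nonarch_local_field_def)

lemma absv_le_iff: "absv K x \<le> q powi (- n) \<longleftrightarrow> x \<in> pid K n"
proof (cases "x = 0")
  case False
  have "q powi (- nu K x) \<le> q powi (- n) \<longleftrightarrow> - nu K x \<le> - n"
    using q_gt_1 power_int_strict_increasing[of "- n" "- nu K x" q] power_int_increasing[of "- nu K x" "- n" q]
    by linarith
  then show ?thesis using False by (simp add: absv_def pid_def)
qed (use q_gt_0 in \<open>simp add: absv_def\<close>)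

lemma dist_le_iff: "dist x y \<le> q powi (- n) \<longleftrightarrow> x - y \<in> pid K n"
  by (simp add: dist_absv absv_le_iff)

lemma ex_q_powi_less: "0 < d \<Longrightarrow> \<exists>n::nat. q powi (- int n) < d"
proof -
  assume "0 < d"
  obtain n where "(1 / q) ^ n < d" using real_arch_pow_inv[of d "1/q"] \<open>0 < d\<close> q_gt_1 by auto
  then show ?thesis by (intro exI[of _ n]) (simp add: power_int_minus power_one_over inverse_eq_divide)
qed

lemma eventually_nhds_lf: "(\<forall>\<^sub>F y in nhds x. P y) \<longleftrightarrow> (\<exists>n. \<forall>h\<in>pid K n. P (x + h))"
proof
  assume "\<forall>\<^sub>F y in nhds x. P y"
  then obtain d where d: "d > 0" "\<And>y. dist y x < d \<Longrightarrow> P y" unfolding eventually_nhds_metric by auto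
  obtain n :: nat where n: "q powi (- int n) < d" using ex_q_powi_less d by blast
  have "P (x + h)" if "h \<in> pid K (int n)" for h
    using that d(2)[of "x + h"] n dist_le_iff[of "x + h" x "int n"] by simp
  then show "\<exists>n. \<forall>h\<in>pid K n. P (x + h)" by blast
next
  assume "\<exists>n. \<forall>h\<in>pid K n. P (x + h)"
  then obtain n where n: "\<And>h. h \<in> pid K n \<Longrightarrow> P (x + h)" by blast
  have "P y" if "dist y x < q powi (- n)" for y
    using n[of "y - x"] dist_le_iff[of y x n] that by simp
  then show "\<forall>\<^sub>F y in nhds x. P y"
    unfolding eventually_nhds_metric using q_gt_0 by (intro exI[of _ "q powi (- n)"]) auto
qed

lemma open_lf_iff: "open S \<longleftrightarrow> (\<forall>x\<in>S. \<exists>n. \<forall>h\<in>pid K n. x + h \<in> S)"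
  using eventually_nhds_lf[where P = "\<lambda>y. y \<in> S"] eventually_nhds_x_imp_x
  by (metis (mono_tags, lifting) open_subopen eventually_nhds subsetI)

lemma coset_add: "h \<in> pid K n \<Longrightarrow> x + h - c \<in> pid K n \<longleftrightarrow> x - c \<in> pid K n"
  using pid_add_cancel[of h n "x - c"] by (simp add: algebra_simps)

lemma open_coset: "open {x. x - c \<in> pid K n}"
  unfolding open_lf_iff by (auto intro!: exI[of _ n] simp: coset_add)

lemma closed_coset: "closed {x. x - c \<in> pid K n}"
  unfolding closed_def open_lf_iff by (auto intro!: exI[of _ n] simp: coset_add)

text \<open>Digit expansion: a representative at level n + 1 is determined by one at level n and a
  residue digit, so each level adds only finitely many choices.\<close>

lemma finite_rp: "finite (rp n ` pid K m)"
proof -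
  have fin: "finite (rp (m + int k) ` pid K m)" for k
  proof (induction k)
    case 0
    have "rp m ` pid K m \<subseteq> {rp m 0}" by (auto simp: rp_eq_iff)
    then show ?case using finite_subset by auto
  next
    case (Suc k)
    let ?n = "m + int k" and ?S = "rp (m + int k) ` pid K m \<times> rp 1 ` pid K 0"
    have "rp (m + int (Suc k)) x \<in> (\<lambda>(a, b). rp (?n + 1) (a + unif K powi ?n * b)) ` ?S"
      if "x \<in> pid K m" for x
    proof -
      let ?a = "rp ?n x" let ?y = "(x - ?a) / unif K powi ?n"
      have "?y \<in> pid K 0" using rp_diff'[of x ?n] by (simp add: pid_divide_iff)
      have "unif K powi ?n * (?y - rp 1 ?y) \<in> pid K (?n + 1)"
        using rp_diff'[of ?y 1] by (simp add: pid_mult_iff)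
      moreover have "unif K powi ?n * (?y - rp 1 ?y) = x - (?a + unif K powi ?n * rp 1 ?y)"
        by (simp add: field_simps)
      ultimately have "x - (?a + unif K powi ?n * rp 1 ?y) \<in> pid K (?n + 1)"
        by simp
      then have "rp (?n + 1) x = rp (?n + 1) (?a + unif K powi ?n * rp 1 ?y)"
        by (simp add: rp_eq_iff)
      then show ?thesis using that \<open>?y \<in> pid K 0\<close>
        by (intro image_eqI[of _ _ "(?a, rp 1 ?y)"]) (auto simp: add.commute add.left_commute)
    qed
    then have "rp (m + int (Suc k)) ` pid K m \<subseteq> (\<lambda>(a, b). rp (?n + 1) (a + unif K powi ?n * b)) ` ?S"
      by blast
    then show ?case using Suc finite_rp1 by (meson finite_SigmaI finite_imageI finite_subset)
  qed
  show ?thesis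
  proof (cases "m \<le> n")
    case True
    then show ?thesis using fin[of "nat (n - m)"] by simp
  next
    case False
    then have "rp n ` pid K m \<subseteq> {rp n 0}" using pid_mono[of _ m n] by (auto simp: rp_eq_iff)
    then show ?thesis using finite_subset by auto
  qed
qed

text \<open>The representatives of a sufficiently fine level are a finite net, and closed subsets of
  a complete space are complete.\<close>

lemma compact_pid: "compact (pid K m)"
  unfolding compact_eq_totally_bounded
proof (intro conjI allI impI)
  have "closed (pid K m)" using closed_coset[of 0 m] by simp
  then show "complete (pid K m)"
    using lf by (metis complete_Int_closed inf_top_left nonarch_local_field_def)
next
  fix e :: real assume "0 < e"
  then obtain n :: nat where n: "q powi (- int n) < e" using ex_q_powi_less by blast
  have "x \<in> ball (rp n x) e" for x
    using rp_diff[of n x] dist_le_iff[of "rp n x" x n] n by simp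
  then have "pid K m \<subseteq> (\<Union>x\<in>rp n ` pid K m. ball x e)" by auto
  then show "\<exists>k. finite k \<and> pid K m \<subseteq> (\<Union>x\<in>k. ball x e)" using finite_rp by blast
qed

end

section \<open>Test functions and Haar measure\<close>

text \<open>
  On a local field, local constancy together with compact support is the same as uniform local
  constancy together with support in some \<open>pid K M\<close>.
\<close>

definition tf :: "'k::{field,metric_space} lf \<Rightarrow> ('k \<Rightarrow> complex) \<Rightarrow> bool" where
  "tf K u \<longleftrightarrow> (\<exists>N M. (\<forall>x. \<forall>h\<in>pid K N. u (x + h) = u x) \<and> (\<forall>x. u x \<noteq> 0 \<longrightarrow> x \<in> pid K M))"

definition bl :: "'k::{field,metric_space} lf \<Rightarrow> 'k \<Rightarrow> int \<Rightarrow> 'k \<Rightarrow> complex" where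
  "bl K c n x = (if x - c \<in> pid K n then 1 else 0)"

text \<open>At every point at most one term is nonzero, so pointwise convergence is trivial and the
  norm of the sum is the sum of the norms. Summability of the L1 norms is then the only analytic
  input to all shell expansions.\<close>

lemma integrable_disjoint_series:
  fixes f :: "'a \<Rightarrow> complex"
  assumes g: "\<And>k. integrable M (g k)"
    and f: "\<And>x. x \<in> space M \<Longrightarrow> \<exists>k. f x = g k x \<and> (\<forall>i. i \<noteq> k \<longrightarrow> g i x = 0)"
    and s: "summable (\<lambda>k::nat. LINT x|M. norm (g k x))"
  shows "integrable M f" and "(\<lambda>k. LINT x|M. g k x) sums (LINT x|M. f x)"
proof -
  have fx: "(\<lambda>k. g k x) sums f x" "(\<lambda>k. norm (g k x)) sums norm (f x)" if x: "x \<in> space M" for x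
  proof -
    obtain k where k: "f x = g k x" "\<And>i. i \<noteq> k \<Longrightarrow> g i x = 0" using f[OF x] by blast
    have "(\<lambda>i. if i = k then g i x else 0) sums g k x" by (rule sums_single)
    moreover have "(\<lambda>i. if i = k then g i x else 0) = (\<lambda>i. g i x)" using k by auto
    ultimately show "(\<lambda>k. g k x) sums f x" using k by simp
    have "(\<lambda>i. if i = k then norm (g i x) else 0) sums norm (g k x)" by (rule sums_single)
    moreover have "(\<lambda>i. if i = k then norm (g i x) else 0) = (\<lambda>i. norm (g i x))" using k by auto
    ultimately show "(\<lambda>k. norm (g k x)) sums norm (f x)" using k by simp
  qed
  have ae: "AE x in M. summable (\<lambda>i. norm (g i x))"
    using fx by (intro AE_I2) (auto simp: sums_iff)
  have eq: "(\<Sum>i. g i x) = f x" if "x \<in> space M" for x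
    using fx[OF that] by (simp add: sums_iff)
  have "integrable M (\<lambda>x. \<Sum>i. g i x)"
    by (rule integrable_suminf[OF g ae s])
  moreover have "integrable M (\<lambda>x. \<Sum>i. g i x) \<longleftrightarrow> integrable M f"
    by (rule Bochner_Integration.integrable_cong) (use eq in auto)
  ultimately show "integrable M f" by simp
  have "(\<lambda>k. LINT x|M. g k x) sums (LINT x|M. (\<Sum>i. g i x))"
    by (rule sums_integral[OF g ae s])
  then show "(\<lambda>k. LINT x|M. g k x) sums (LINT x|M. f x)"
    using Bochner_Integration.integral_cong[OF refl eq, of M "\<lambda>x. x"] by simp
qed

lemma integrable_cmult_iff:
  fixes f :: "'a \<Rightarrow> complex"
  assumes "c \<noteq> 0" shows "integrable M (\<lambda>x. c * f x) \<longleftrightarrow> integrable M f"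
proof
  assume "integrable M (\<lambda>x. c * f x)"
  then have "integrable M (\<lambda>x. inverse c * (c * f x))" by (rule integrable_mult_right)
  moreover have "(\<lambda>x. inverse c * (c * f x)) = f" using assms by (simp add: mult.assoc[symmetric])
  ultimately show "integrable M f" by simp
qed (rule integrable_mult_right)

context local_field
begin

lemma tfI: "(\<And>x h. h \<in> pid K N \<Longrightarrow> u (x + h) = u x) \<Longrightarrow> (\<And>x. u x \<noteq> 0 \<Longrightarrow> x \<in> pid K M) \<Longrightarrow> tf K u"
  unfolding tf_def by blast

lemma tf_ex:
  assumes "tf K u"
  shows "\<exists>N M. (\<forall>N'\<ge>N. \<forall>x. \<forall>h\<in>pid K N'. u (x + h) = u x) \<and> (\<forall>M'\<le>M. \<forall>x. u x \<noteq> 0 \<longrightarrow> x \<in> pid K M')"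
proof -
  obtain N M where "\<forall>x. \<forall>h\<in>pid K N. u (x + h) = u x" "\<forall>x. u x \<noteq> 0 \<longrightarrow> x \<in> pid K M"
    using assms unfolding tf_def by auto
  then show ?thesis by (intro exI[of _ N] exI[of _ M]) (auto dest: pid_mono)
qed

lemma bl_0: "bl K 0 n x = (if x \<in> pid K n then 1 else 0)"
  by (simp add: bl_def)

text \<open>The factor v need be uniformly locally constant only on the support of u; this admits
  characters and other factors that are singular at 0.\<close>

lemma tf_times:
  assumes "tf K u" and v: "\<And>x h. u x \<noteq> 0 \<Longrightarrow> h \<in> pid K N \<Longrightarrow> v (x + h) = v x"
  shows "tf K (\<lambda>x. v x * u x)"
proof -
  obtain N' M where u': "\<forall>N\<ge>N'. \<forall>x. \<forall>h\<in>pid K N. u (x + h) = u x"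
    "\<forall>M'\<le>M. \<forall>x. u x \<noteq> 0 \<longrightarrow> x \<in> pid K M'" using tf_ex[OF assms(1)] by blast
  note u = u'(1)[rule_format] u'(2)[rule_format]
  show ?thesis
  proof (rule tfI[where N = "max N N'" and M = M])
    fix x h assume h: "h \<in> pid K (max N N')"
    show "v (x + h) * u (x + h) = v x * u x"
      using u(1)[OF _ h, of x] v[of x h] pid_mono[OF h, of N] by (cases "u x = 0") auto
  qed (use u(2)[of M] in auto)
qed

lemma tf_add: assumes "tf K u" "tf K v" shows "tf K (\<lambda>x. u x + v x)"
proof -
  obtain N M where u': "\<forall>N'\<ge>N. \<forall>x. \<forall>h\<in>pid K N'. u (x + h) = u x"
    "\<forall>M'\<le>M. \<forall>x. u x \<noteq> 0 \<longrightarrow> x \<in> pid K M'" using tf_ex[OF assms(1)] by blast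
  note u = u'(1)[rule_format] u'(2)[rule_format]
  obtain N' M' where v': "\<forall>N\<ge>N'. \<forall>x. \<forall>h\<in>pid K N. v (x + h) = v x"
    "\<forall>M\<le>M'. \<forall>x. v x \<noteq> 0 \<longrightarrow> x \<in> pid K M" using tf_ex[OF assms(2)] by blast
  note v = v'(1)[rule_format] v'(2)[rule_format]
  show ?thesis
  proof (rule tfI[where N = "max N N'" and M = "min M M'"])
    fix x h assume h: "h \<in> pid K (max N N')"
    show "u (x + h) + v (x + h) = u x + v x"
      using u(1)[OF _ h, of x] v(1)[OF _ h, of x] by simp
  next
    fix x assume "u x + v x \<noteq> 0"
    then have "u x \<noteq> 0 \<or> v x \<noteq> 0" by auto
    then show "x \<in> pid K (min M M')" using u(2)[of "min M M'" x] v(2)[of "min M M'" x] by auto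
  qed
qed

lemma tf_cmult: "tf K u \<Longrightarrow> tf K (\<lambda>x. c * u x)"
  by (rule tf_times) auto

lemma tf_0: "tf K (\<lambda>x. 0)"
  unfolding tf_def by simp

lemma tf_sum: "(\<And>i. i \<in> I \<Longrightarrow> tf K (u i)) \<Longrightarrow> tf K (\<lambda>x. \<Sum>i\<in>I. u i x)"
  by (induction I rule: infinite_finite_induct) (auto simp: tf_0 intro: tf_add)

lemma tf_diff: "tf K u \<Longrightarrow> tf K v \<Longrightarrow> tf K (\<lambda>x. u x - v x)"
  using tf_add[of u "\<lambda>x. (-1) * v x"] tf_cmult[of v "-1"] by simp

lemma tf_affine: assumes "tf K u" "a \<noteq> 0" shows "tf K (\<lambda>x. u (a * x + b))"
proof -
  obtain N M where u': "\<forall>N'\<ge>N. \<forall>x. \<forall>h\<in>pid K N'. u (x + h) = u x"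
    "\<forall>M'\<le>M. \<forall>x. u x \<noteq> 0 \<longrightarrow> x \<in> pid K M'" using tf_ex[OF assms(1)] by blast
  note u = u'(1)[rule_format] u'(2)[rule_format]
  define M' where "M' = min M (if b = 0 then M else nu K b)"
  have b: "b \<in> pid K M'" by (auto simp: M'_def pid_def)
  show ?thesis
  proof (rule tfI[where N = "N - nu K a" and M = "M' - nu K a"])
    fix x h assume "h \<in> pid K (N - nu K a)"
    then have "a * h \<in> pid K N" using assms by (simp add: pid_mult_iff)
    then show "u (a * (x + h) + b) = u (a * x + b)"
      using u(1)[of N "a * h" "a * x + b"] by (simp add: algebra_simps)
  next
    fix x assume "u (a * x + b) \<noteq> 0"
    then have "a * x + b \<in> pid K M'" using u(2)[of M'] by (simp add: M'_def)
    then have "a * x \<in> pid K M'" using b pid_add_cancel by blast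
    then show "x \<in> pid K (M' - nu K a)" using assms by (simp add: pid_mult_iff)
  qed
qed

lemma tf_shift: "tf K u \<Longrightarrow> tf K (\<lambda>x. u (x + b))"
  using tf_affine[of u 1 b] by simp

lemma tf_bl: "tf K (bl K c n)"
proof -
  have "tf K (bl K 0 n)"
    by (rule tfI[where N = n and M = n]) (auto simp: bl_0 pid_add_cancel split: if_splits)
  from tf_shift[OF this, of "-c"] show ?thesis by (simp add: bl_def[abs_def])
qed

lemma tf_decomp:
  assumes "\<And>x h. h \<in> pid K N \<Longrightarrow> u (x + h) = u x" "\<And>x. u x \<noteq> 0 \<Longrightarrow> x \<in> pid K M"
  shows "u x = (\<Sum>c\<in>rp N ` pid K M. u c * bl K c N x)"
proof -
  have uc: "u x = u c" if "x - c \<in> pid K N" for c using assms(1)[OF that, of c] by simp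
  have "c = rp N x" if "c \<in> rp N ` pid K M" "x - c \<in> pid K N" for c
  proof -
    have "rp N x = rp N c" using that by (simp add: rp_eq_iff)
    then show ?thesis using that by auto
  qed
  then have "u c * bl K c N x = (if c = rp N x then u x else 0)" if "c \<in> rp N ` pid K M" for c
    using uc[of c] rp_diff'[of x N] that by (cases "x - c \<in> pid K N") (auto simp: bl_def)
  then have "(\<Sum>c\<in>rp N ` pid K M. u c * bl K c N x) =
     (\<Sum>c\<in>rp N ` pid K M. if c = rp N x then u x else 0)"
    by (rule sum.cong[OF refl])
  also have "\<dots> = u x"
    using assms(2)[of x] finite_rp by (auto simp: sum.delta)
  finally show ?thesis by simp
qed

text \<open>A Lebesgue number argument: finitely many balls of local constancy cover the compact
  support, and the finest of their levels works everywhere.\<close>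

lemma loc_const_tf:
  assumes lc: "\<And>x. \<forall>\<^sub>F y in nhds x. u y = u x" and supp: "\<And>x. u x \<noteq> 0 \<Longrightarrow> x \<in> pid K M"
  shows "tf K u"
proof -
  have "\<forall>x. \<exists>n. n \<ge> M \<and> (\<forall>h\<in>pid K n. u (x + h) = u x)"
    using lc unfolding eventually_nhds_lf by (metis max.cobounded1 max.cobounded2 pid_mono)
  then obtain n where n: "\<And>x. n x \<ge> M" "\<And>x h. h \<in> pid K (n x) \<Longrightarrow> u (x + h) = u x" by metis
  have "pid K M \<subseteq> (\<Union>x\<in>pid K M. {y. y - x \<in> pid K (n x)})" by auto
  then obtain C where C: "C \<subseteq> pid K M" "finite C" "pid K M \<subseteq> (\<Union>x\<in>C. {y. y - x \<in> pid K (n x)})"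
    by (rule compactE_image[OF compact_pid open_coset])
  define N where "N = Max (insert M (n ` C))"
  have N: "n c \<le> N" if "c \<in> C" for c using that C(2) by (auto simp: N_def)
  have MN: "M \<le> N" using C(2) by (auto simp: N_def)
  show ?thesis
  proof (rule tfI[where N = N and M = M])
    fix x h assume h: "h \<in> pid K N"
    show "u (x + h) = u x"
    proof (cases "x \<in> pid K M")
      case True
      then obtain c where c: "c \<in> C" "x - c \<in> pid K (n c)" using C by blast
      have "x + h - c \<in> pid K (n c)" using c pid_mono[OF h N[OF c(1)]] coset_add by blast
      then show ?thesis using n(2)[OF c(2)] n(2)[of "x + h - c" c] by simp
    next
      case False
      then have "x + h \<notin> pid K M" using pid_add_cancel pid_mono[OF h MN] by blast
      then show ?thesis using False supp by metis
    qed
  qed (use supp in blast)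
qed

lemma tf_compact_closure: assumes "tf K u" shows "compact (closure {x. u x \<noteq> 0})"
proof -
  obtain M where "{x. u x \<noteq> 0} \<subseteq> pid K M" using assms unfolding tf_def by blast
  then have "closure {x. u x \<noteq> 0} \<subseteq> pid K M"
    using closed_coset[of 0 M] by (simp add: closure_minimal)
  then show ?thesis using compact_pid by (metis closed_closure compact_Int_closed inf.absorb_iff2)
qed

section \<open>Haar measure of cosets and its behaviour under affine maps\<close>

lemma sets_haar [simp, measurable_cong]: "sets (haar K) = sets borel"
  using lf by (simp add: nonarch_local_field_def)

lemma space_haar [simp]: "space (haar K) = UNIV"
  using sets_eq_imp_space_eq[OF sets_haar] by simp

lemma measurable_lf:
  fixes f :: "'k \<Rightarrow> 'k"
  assumes "\<And>x n. \<exists>m. \<forall>h\<in>pid K m. f (x + h) - f x \<in> pid K n"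
  shows "f \<in> borel_measurable borel"
proof (rule borel_measurable_continuous_onI, rule continuous_on_open_vimage[OF open_UNIV, THEN iffD2], intro allI impI)
  fix B :: "'k set" assume B: "open B"
  have "open (f -` B)" unfolding open_lf_iff
  proof
    fix x assume "x \<in> f -` B"
    then obtain n where n: "\<And>h. h \<in> pid K n \<Longrightarrow> f x + h \<in> B" using B unfolding open_lf_iff by fastforce
    obtain m where m: "\<And>h. h \<in> pid K m \<Longrightarrow> f (x + h) - f x \<in> pid K n" using assms by blast
    show "\<exists>n. \<forall>h\<in>pid K n. x + h \<in> f -` B" using n[OF m] by (intro exI[of _ m]) auto
  qed
  then show "open (f -` B \<inter> UNIV)" by simp
qed

lemma measurable_affine [measurable]: "(\<lambda>x. a * x + b) \<in> borel_measurable borel" for a b :: 'k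
proof (rule measurable_lf)
  fix x :: 'k and n
  show "\<exists>m. \<forall>h\<in>pid K m. a * (x + h) + b - (a * x + b) \<in> pid K n"
    by (cases "a = 0") (auto simp: distrib_left pid_mult_iff intro!: exI[of _ "n - nu K a"])
qed

lemma measurable_shift [measurable]: "(\<lambda>x. b + x) \<in> borel_measurable borel" "(\<lambda>x. x + b) \<in> borel_measurable borel" for b :: 'k
  using measurable_affine[of 1 b] by (simp_all add: add.commute)

lemma haar_translate: "distr (haar K) borel (\<lambda>x. a + x) = haar K"
  using lf by (simp add: nonarch_local_field_def)

lemma coset_borel [measurable]: "{x. x - c \<in> pid K n} \<in> sets borel"
  using open_coset by simp

lemma pid_borel [measurable]: "pid K n \<in> sets borel"
  using coset_borel[of 0 n] by simp

lemma emeasure_coset_pid: "emeasure (haar K) {x. x - c \<in> pid K n} = emeasure (haar K) (pid K n)"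
proof -
  have "emeasure (haar K) (pid K n) = emeasure (distr (haar K) borel (\<lambda>x. -c + x)) (pid K n)"
    by (simp only: haar_translate)
  also have "\<dots> = emeasure (haar K) {x. x - c \<in> pid K n}"
    by (subst emeasure_distr) (auto simp: vimage_def)
  finally show ?thesis ..
qed

lemma pid_split: "pid K n = (\<Union>r\<in>rp 1 ` pid K 0. {x. x - unif K powi n * r \<in> pid K (n + 1)})"
proof (intro set_eqI iffI)
  fix x assume x: "x \<in> pid K n"
  let ?y = "x / unif K powi n"
  have "?y \<in> pid K 0" using x by (simp add: pid_divide_iff)
  moreover have "unif K powi n * (?y - rp 1 ?y) \<in> pid K (n + 1)"
    using rp_diff'[of ?y 1] by (simp add: pid_mult_iff)
  then have "x - unif K powi n * rp 1 ?y \<in> pid K (n + 1)" by (simp add: right_diff_distrib)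
  ultimately show "x \<in> (\<Union>r\<in>rp 1 ` pid K 0. {x. x - unif K powi n * r \<in> pid K (n + 1)})" by blast
next
  fix x assume "x \<in> (\<Union>r\<in>rp 1 ` pid K 0. {x. x - unif K powi n * r \<in> pid K (n + 1)})"
  then obtain r where r: "r \<in> pid K 0" "x - unif K powi n * rp 1 r \<in> pid K (n + 1)" by blast
  have "rp 1 r \<in> pid K 0" using r rp_pid_iff[of 0 1] by simp
  then have "unif K powi n * rp 1 r \<in> pid K n" by (simp add: pid_mult_iff)
  then show "x \<in> pid K n" using pid_add[OF pid_mono[OF r(2), of n]] by fastforce
qed

lemma rp1_disjoint: "r \<in> range (rp 1) \<Longrightarrow> r' \<in> range (rp 1) \<Longrightarrow> r - r' \<in> pid K 1 \<Longrightarrow> r = r'"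
  by (metis imageE rp_eq_iff rp_rp)

text \<open>\<open>pid_split\<close> cuts the ideal into q cosets of the next level, which have
  equal measure by translation invariance.\<close>

lemma emeasure_pid_Suc: "emeasure (haar K) (pid K n) = of_nat (residue_card K) * emeasure (haar K) (pid K (n + 1))"
proof -
  let ?A = "\<lambda>r. {x. x - unif K powi n * r \<in> pid K (n + 1)}"
  have "disjoint_family_on ?A (rp 1 ` pid K 0)"
    unfolding disjoint_family_on_def
  proof (intro ballI impI, rule ccontr)
    fix r r' assume r: "r \<in> rp 1 ` pid K 0" "r' \<in> rp 1 ` pid K 0" "r \<noteq> r'" "?A r \<inter> ?A r' \<noteq> {}"
    then obtain x where "x - unif K powi n * r \<in> pid K (n + 1)" "x - unif K powi n * r' \<in> pid K (n + 1)" by blast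
    then have "unif K powi n * (r - r') \<in> pid K (n + 1)"
      using pid_diff[of "x - unif K powi n * r'" _ "x - unif K powi n * r"] by (simp add: right_diff_distrib)
    then have "r - r' \<in> pid K 1" by (simp add: pid_mult_iff)
    then show False using rp1_disjoint r by blast
  qed
  then have "emeasure (haar K) (pid K n) = (\<Sum>r\<in>rp 1 ` pid K 0. emeasure (haar K) (?A r))"
    by (subst pid_split, subst sum_emeasure) (auto simp: finite_rp1 image_subset_iff)
  then show ?thesis by (simp add: emeasure_coset_pid card_rp1)
qed

lemma emeasure_pid: "emeasure (haar K) (pid K n) = ennreal (q powi (- n))"
proof (induction n rule: int_induct[where k = 0])
  case base
  then show ?case using lf by (simp add: nonarch_local_field_def pid_0)
next
  case (step1 i)
  have "of_nat (residue_card K) * emeasure (haar K) (pid K (i + 1)) = ennreal q * ennreal (q powi (- (i + 1)))"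
    using step1 emeasure_pid_Suc[of i] q_gt_0
    by (simp add: ennreal_mult[symmetric] power_int_add[symmetric] power_int_diff power_int_minus field_simps)
  then show ?case using q_gt_0 by (simp add: ennreal_mult_cancel_left ennreal_of_nat_eq_real_of_nat)
next
  case (step2 i)
  have "q * q powi (- i) = q powi (- (i - 1))"
    using q_gt_0 by (simp add: power_int_diff power_int_minus field_simps)
  then show ?case using step2 emeasure_pid_Suc[of "i - 1"] q_gt_0
    by (simp add: ennreal_mult[symmetric] ennreal_of_nat_eq_real_of_nat)
qed

lemma emeasure_coset: "emeasure (haar K) {x. x - c \<in> pid K n} = ennreal (q powi (- n))"
  by (simp add: emeasure_coset_pid emeasure_pid)

lemma bl_indicator: "bl K c n x = indicator {x. x - c \<in> pid K n} x"
  by (simp add: bl_def indicator_def)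

lemma bl_integrable: "integrable (haar K) (bl K c n)"
  and bl_integral: "(LINT x|haar K. bl K c n x) = of_real (q powi (- n))"
proof -
  have b: "bl K c n = (\<lambda>x. of_real (indicator {x. x - c \<in> pid K n} x))"
    by (auto simp: bl_indicator fun_eq_iff indicator_def)
  have "integrable (haar K) (indicator {x. x - c \<in> pid K n} :: 'k \<Rightarrow> real)"
    by (rule integrable_real_indicator) (simp_all add: emeasure_coset)
  then show "integrable (haar K) (bl K c n)" unfolding b by (rule integrable_of_real)
  show "(LINT x|haar K. bl K c n x) = of_real (q powi (- n))"
    unfolding b integral_complex_of_real
    by (simp add: measure_def emeasure_coset q_gt_0)
qed

lemma tf_sum_rep:
  assumes "tf K u"
  obtains N C where "finite C" "u = (\<lambda>x. \<Sum>c\<in>C. u c * bl K c N x)"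
proof -
  obtain N M where "\<And>x h. h \<in> pid K N \<Longrightarrow> u (x + h) = u x" "\<And>x. u x \<noteq> 0 \<Longrightarrow> x \<in> pid K M"
    using assms unfolding tf_def by blast
  then show ?thesis using that[of "rp N ` pid K M" N] tf_decomp[of N u M] finite_rp by blast
qed

lemma tf_induct [consumes 1, case_names ball add cmult]:
  assumes "tf K u"
    and "\<And>c n. P (bl K c n)" "\<And>u v. tf K u \<Longrightarrow> P u \<Longrightarrow> tf K v \<Longrightarrow> P v \<Longrightarrow> P (\<lambda>x. u x + v x)"
    and "\<And>u c. tf K u \<Longrightarrow> P u \<Longrightarrow> P (\<lambda>x. c * u x)"
  shows "P u"
proof -
  obtain N C where C: "finite C" "u = (\<lambda>x. \<Sum>c\<in>C. u c * bl K c N x)"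
    by (rule tf_sum_rep[OF assms(1)])
  have "tf K (\<lambda>x. \<Sum>c\<in>C. u c * bl K c N x) \<and> P (\<lambda>x. \<Sum>c\<in>C. u c * bl K c N x)"
    using C(1)
  proof (induction C)
    case empty
    have "P (\<lambda>x. 0 * bl K 0 0 x)" by (rule assms(4)[OF tf_bl assms(2)])
    then show ?case by (simp add: tf_0)
  next
    case (insert a C)
    have "P (\<lambda>x. u a * bl K a N x)" using assms(4)[OF tf_bl assms(2)] .
    then have "P (\<lambda>x. u a * bl K a N x + (\<Sum>c\<in>C. u c * bl K c N x))"
      using insert.IH by (intro assms(3) tf_cmult tf_bl) auto
    moreover have "tf K (\<lambda>x. u a * bl K a N x + (\<Sum>c\<in>C. u c * bl K c N x))"
      using insert.IH by (intro tf_add tf_cmult tf_bl) auto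
    ultimately show ?case using insert.hyps by simp
  qed
  then show ?thesis by (subst C(2)) (rule conjunct2)
qed

lemma tf_integrable: "tf K u \<Longrightarrow> integrable (haar K) u"
  by (induction rule: tf_induct) (auto simp: bl_integrable)

lemma tf_measurable [measurable]: "tf K u \<Longrightarrow> u \<in> borel_measurable borel"
  using borel_measurable_integrable[OF tf_integrable] by simp

lemma pid_nat: "x \<in> pid K (- int (nat (- nu K x)))"
proof -
  have "- int (nat (- nu K x)) \<le> nu K x" by linarith
  then show ?thesis unfolding pid_def by blast
qed

text \<open>The representatives of all levels form a countable set, so every open set is a countable
  union of cosets.\<close>

lemma sigma_sets_cosets: "sets borel = sigma_sets UNIV (insert {} {{x. x - c \<in> pid K n} | c n. True})"
  (is "_ = sigma_sets UNIV ?G")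
proof
  show "sigma_sets UNIV ?G \<subseteq> sets borel"
  proof -
    have "?G \<subseteq> sets borel" using open_coset by (auto intro!: borel_open)
    then show ?thesis using sets.sigma_sets_subset[of ?G "borel :: 'k measure"] by simp
  qed
  define D where "D = (\<Union>m::nat. \<Union>n::nat. rp (int n) ` pid K (- int m))"
  have D: "countable D" unfolding D_def
    by (intro countable_UN countableI_type countable_finite finite_rp)
  let ?S = "\<lambda>p. {x. x - fst p \<in> pid K (int (snd p))}"
  have "U \<in> sigma_sets UNIV ?G" if U: "open U" for U :: "'k set"
  proof -
    define I where "I = {p \<in> D \<times> UNIV. ?S p \<subseteq> U}"
    have "U \<subseteq> (\<Union>p\<in>I. ?S p)"
    proof
      fix x assume "x \<in> U"
      then have "\<exists>n. \<forall>h\<in>pid K n. x + h \<in> U" by (rule bspec[OF U[unfolded open_lf_iff]])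
      then obtain n where n: "\<forall>h\<in>pid K n. x + h \<in> U" by blast
      define c where "c = rp (int (nat n)) x"
      have "c \<in> D" unfolding D_def c_def
        by (rule UN_I[OF UNIV_I], rule UN_I[OF UNIV_I], rule imageI, rule pid_nat)
      moreover have "?S (c, nat n) \<subseteq> U"
      proof
        fix y assume "y \<in> ?S (c, nat n)"
        then have "y - c \<in> pid K (int (nat n))" by simp
        then have "y - x \<in> pid K (int (nat n))" unfolding c_def by (rule pid_trans[OF _ rp_diff])
        then have "y - x \<in> pid K n" by (rule pid_mono) simp
        with n have "x + (y - x) \<in> U" by (rule bspec)
        then show "y \<in> U" by simp
      qed
      ultimately have "(c, nat n) \<in> I" unfolding I_def by blast
      moreover have "x \<in> ?S (c, nat n)" using rp_diff'[of x] by (simp add: c_def)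
      ultimately show "x \<in> (\<Union>p\<in>I. ?S p)" by (rule UN_I)
    qed
    moreover have "(\<Union>p\<in>I. ?S p) \<subseteq> U" unfolding I_def by blast
    ultimately have "U = \<Union>(?S ` I)" by (rule equalityI)
    moreover have "countable I"
      by (rule countable_subset[of _ "D \<times> UNIV"]) (use D in \<open>auto simp: I_def\<close>)
    then have "\<Union>(?S ` I) \<in> sigma_sets UNIV ?G"
      by (intro sigma_sets_UNION countable_image) (auto intro!: sigma_sets.Basic)
    ultimately show ?thesis by simp
  qed
  then have "sigma_sets UNIV {S. open S} \<subseteq> sigma_sets UNIV ?G"
    by (intro sigma_sets_mono) auto
  then show "sets borel \<subseteq> sigma_sets UNIV ?G" by (simp add: borel_def)
qed

text \<open>Two cosets are nested or disjoint, so together with the empty set they form an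
  intersection-stable generator.\<close>

lemma measure_eqI_cosets:
  assumes "sets M = sets borel" "sets N = sets borel"
    and eq: "\<And>c n. emeasure M {x. x - c \<in> pid K n} = emeasure N {x. x - c \<in> pid K n}"
    and fin: "\<And>n. emeasure M (pid K n) \<noteq> \<infinity>"
  shows "M = N"
proof (rule measure_eqI_generator_eq[where \<Omega> = UNIV and A = "\<lambda>i. pid K (- int i)"
      and E = "insert {} {{x. x - c \<in> pid K n} | c n. True}"])
  let ?G = "insert {} {{x. x - c \<in> pid K n} | c n. True}"
  have nested: "{x. x - c \<in> pid K n} \<inter> {x. x - c' \<in> pid K n'} \<in> ?G" if "n \<le> n'" for c n c' n'
  proof (cases "c' - c \<in> pid K n")
    case True
    have "x - c \<in> pid K n" if "x - c' \<in> pid K n'" for x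
      by (rule pid_trans[OF pid_mono[OF that \<open>n \<le> n'\<close>] True])
    then have "{x. x - c \<in> pid K n} \<inter> {x. x - c' \<in> pid K n'} = {x. x - c' \<in> pid K n'}" by auto
    then show ?thesis by auto
  next
    case False
    have "\<not> x - c \<in> pid K n" if "x - c' \<in> pid K n'" for x
      using False pid_trans[of c' x n c] pid_mono[OF that \<open>n \<le> n'\<close>] pid_diff_commute[of c' x n] by blast
    then have "{x. x - c \<in> pid K n} \<inter> {x. x - c' \<in> pid K n'} = {}" by auto
    then show ?thesis by auto
  qed
  show "Int_stable ?G"
  proof (rule Int_stableI)
    fix A B assume AB: "A \<in> ?G" "B \<in> ?G"
    show "A \<inter> B \<in> ?G"
    proof (cases "A = {} \<or> B = {}")
      case False
      then obtain c n c' n' where "A = {x. x - c \<in> pid K n}" "B = {x. x - c' \<in> pid K n'}"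
        using AB by auto
      then show ?thesis
        using nested[of n n' c c'] nested[of n' n c' c] by (cases "n \<le> n'") (simp_all add: Int_commute)
    qed auto
  qed
  show "?G \<subseteq> Pow UNIV" by simp
  show "emeasure M X = emeasure N X" if "X \<in> ?G" for X using that eq by auto
  show "sets M = sigma_sets UNIV ?G" "sets N = sigma_sets UNIV ?G"
    using assms(1,2) sigma_sets_cosets by auto
  have G: "pid K m \<in> ?G" for m by (intro insertI2 CollectI exI[of _ 0] exI[of _ m]) simp
  show "range (\<lambda>i. pid K (- int i)) \<subseteq> ?G" by (rule image_subsetI) (rule G)
  show "(\<Union>i. pid K (- int i)) = UNIV"
  proof (intro set_eqI iffI UNIV_I)
    fix x
    show "x \<in> (\<Union>i. pid K (- int i))" using pid_nat[of x] by (rule UN_I[OF UNIV_I])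
  qed
  show "emeasure M (pid K (- int i)) \<noteq> \<infinity>" for i by (rule fin)
qed

text \<open>The modulus is found by comparing cosets. The sign of the exponent is positive because
  the pushed-forward measure of a coset is that of its preimage, which grows with the valuation of
  a.\<close>

lemma haar_scale: assumes "a \<noteq> 0"
  shows "distr (haar K) borel (\<lambda>x. a * x) = density (haar K) (\<lambda>_. ennreal (q powi (nu K a)))"
proof (rule measure_eqI_cosets)
  have e1: "emeasure (distr (haar K) borel (\<lambda>x. a * x)) {x. x - c \<in> pid K n} = ennreal (q powi (nu K a - n))" for c n
  proof -
    have "a * x - c \<in> pid K n \<longleftrightarrow> x - c / a \<in> pid K (n - nu K a)" for x
      using pid_mult_iff[OF assms, of "x - c / a" n] assms by (simp add: right_diff_distrib)
    then show ?thesis using measurable_affine[of a 0]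
      by (subst emeasure_distr) (auto simp: emeasure_coset)
  qed
  have e2: "emeasure (density (haar K) (\<lambda>_. ennreal (q powi (nu K a)))) {x. x - c \<in> pid K n} = ennreal (q powi (nu K a - n))" for c n
    using q_gt_0 by (subst emeasure_density_const)
      (auto simp: emeasure_coset ennreal_mult[symmetric] power_int_add[symmetric])
  show "emeasure (distr (haar K) borel (\<lambda>x. a * x)) {x. x - c \<in> pid K n} =
     emeasure (density (haar K) (\<lambda>_. ennreal (q powi (nu K a)))) {x. x - c \<in> pid K n}" for c n
    unfolding e1 e2 ..
  show "emeasure (distr (haar K) borel (\<lambda>x. a * x)) (pid K n) \<noteq> \<infinity>" for n
    using e1[of 0 n] by simp
qed (auto simp: sets_haar)

lemma integrable_scale_iff:
  fixes f :: "'k \<Rightarrow> complex"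
  assumes "a \<noteq> 0" and f: "f \<in> borel_measurable borel"
  shows "integrable (haar K) (\<lambda>x. f (a * x)) \<longleftrightarrow> integrable (haar K) f"
    and integral_scale: "(LINT x|haar K. f (a * x)) = of_real (q powi (nu K a)) * (LINT x|haar K. f x)"
proof -
  have m: "(\<lambda>x. a * x) \<in> measurable (haar K) borel" "f \<in> borel_measurable (haar K)"
    using measurable_affine[of a 0] f by simp_all
  have "integrable (haar K) (\<lambda>x. f (a * x)) \<longleftrightarrow> integrable (density (haar K) (\<lambda>_. ennreal (q powi (nu K a)))) f"
    using integrable_distr_eq[OF m(1) f] haar_scale[OF assms(1)] by simp
  also have "\<dots> \<longleftrightarrow> integrable (haar K) f"
    using q_gt_0 integrable_cmult_iff[of "complex_of_real (q powi nu K a)"]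
    by (subst integrable_density[OF m(2)]) (auto simp: scaleR_conv_of_real simp del: of_real_power_int)
  finally show "integrable (haar K) (\<lambda>x. f (a * x)) \<longleftrightarrow> integrable (haar K) f" .
  have "(LINT x|haar K. f (a * x)) = integral\<^sup>L (density (haar K) (\<lambda>_. ennreal (q powi (nu K a)))) f"
    using integral_distr[OF m(1) f] haar_scale[OF assms(1)] by simp
  also have "\<dots> = of_real (q powi (nu K a)) * (LINT x|haar K. f x)"
    using q_gt_0 by (subst integral_density[OF m(2)]) (auto simp: scaleR_conv_of_real)
  finally show "(LINT x|haar K. f (a * x)) = of_real (q powi (nu K a)) * (LINT x|haar K. f x)" .
qed

lemma integrable_shift_iff:
  fixes f :: "'k \<Rightarrow> complex"
  assumes f: "f \<in> borel_measurable borel"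
  shows "integrable (haar K) (\<lambda>x. f (x + a)) \<longleftrightarrow> integrable (haar K) f"
    and integral_shift: "(LINT x|haar K. f (x + a)) = (LINT x|haar K. f x)"
proof -
  have m: "(\<lambda>x. a + x) \<in> measurable (haar K) borel" by simp
  show "integrable (haar K) (\<lambda>x. f (x + a)) \<longleftrightarrow> integrable (haar K) f"
    using integrable_distr_eq[OF m f] haar_translate[of a] by (simp add: add.commute[of a])
  show "(LINT x|haar K. f (x + a)) = (LINT x|haar K. f x)"
    using integral_distr[OF m f] haar_translate[of a] by (simp add: add.commute[of a])
qed

end

section \<open>Inversion and quasi-characters\<close>

text \<open>Near 1 squaring expands: |z^2 - 1| = |z + 1| |z - 1| is at least 3/2 |z - 1|, so
  repeated squaring leaves every small neighbourhood of 1.\<close>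

lemma no_small_subgroups:
  fixes z :: complex
  assumes "\<And>m::nat. norm (z ^ m - 1) \<le> 1/2" shows "z = 1"
proof (rule ccontr)
  assume "z \<noteq> 1"
  have grow: "(3/2) ^ m * norm (z - 1) \<le> norm (z ^ (2 ^ m) - 1)" for m :: nat
  proof (induction m)
    case (Suc m)
    let ?w = "z ^ (2 ^ m)"
    have "norm (?w + 1) \<ge> 3/2"
    proof -
      have "2 - norm (1 - ?w) \<le> norm (2 - (1 - ?w))"
        using norm_triangle_ineq2[of 2 "1 - ?w"] by simp
      moreover have "2 - (1 - ?w) = ?w + 1" by simp
      ultimately have "2 - norm (1 - ?w) \<le> norm (?w + 1)" by (simp only:)
      then show ?thesis using assms[of "2 ^ m"] norm_minus_commute[of 1 ?w] by linarith
    qed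
    then have "3/2 * norm (?w - 1) \<le> norm (?w + 1) * norm (?w - 1)"
      by (intro mult_right_mono) auto
    also have "\<dots> = norm ((?w + 1) * (?w - 1))" by (simp add: norm_mult)
    also have "(?w + 1) * (?w - 1) = z ^ (2 ^ Suc m) - 1"
      by (simp add: mult_2 power_add algebra_simps)
    finally show ?case using Suc by simp
  qed simp
  obtain m where "1 / norm (z - 1) < (3/2) ^ m" using real_arch_pow[of "3/2"] by auto
  then have "1 < (3/2) ^ m * norm (z - 1)" using \<open>z \<noteq> 1\<close> by (simp add: field_simps)
  then show False using grow[of m] assms[of "2 ^ m"] by linarith
qed

context local_field
begin

definition sph :: "int \<Rightarrow> 'k \<Rightarrow> complex" where
  "sph k x = (if x \<noteq> 0 \<and> nu K x = k then 1 else 0)"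

lemma sph_bl: "sph k x = bl K 0 k x - bl K 0 (k + 1) x"
  by (auto simp: sph_def bl_def pid_def)

lemma tf_sph: "tf K (sph k)"
  using tf_diff[OF tf_bl tf_bl, of 0 k 0 "k + 1"] by (simp add: sph_bl[abs_def])

lemma integral_sph: "(LINT x|haar K. sph k x) = of_real (q powi (- k) * (1 - 1 / q))"
proof -
  have "(LINT x|haar K. sph k x) = of_real (q powi (- k)) - of_real (q powi (- (k + 1)))"
    unfolding sph_bl by (subst Bochner_Integration.integral_diff) (simp_all only: bl_integrable bl_integral)
  also have "\<dots> = of_real (q powi (- k) - q powi (- (k + 1)))" by (simp only: of_real_diff)
  also have "q powi (- k) - q powi (- (k + 1)) = q powi (- k) * (1 - 1 / q)"
    using q_nz by (simp add: power_int_minus power_int_add power_int_diff field_simps)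
  finally show ?thesis .
qed

lemma integral_norm_sph: "(LINT x|haar K. norm (sph k x)) = q powi (- k) * (1 - 1 / q)"
proof -
  have "(LINT x|haar K. norm (sph k x)) = (LINT x|haar K. Re (sph k x))"
    by (intro Bochner_Integration.integral_cong) (auto simp: sph_def)
  also have "\<dots> = Re (LINT x|haar K. sph k x)"
    by (rule integral_Re) (rule tf_integrable[OF tf_sph])
  finally show ?thesis by (simp only: integral_sph Re_complex_of_real)
qed

text \<open>
  The weight \<open>q^(2 \<nu>(x))\<close> is the Jacobian of \<open>x \<mapsto> 1/x\<close>.
\<close>

definition inversion :: "('k \<Rightarrow> complex) \<Rightarrow> 'k \<Rightarrow> complex" where
  "inversion u x = (if x = 0 then 0 else of_real (q powi (2 * nu K x)) * u (1 / x))"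

text \<open>From 1/y - a = -(a/y) (y - 1/a), inversion rescales distances by a constant on a ball
  that avoids 0, because the valuation is constant there.\<close>

lemma inversion_ball:
  assumes c: "c \<notin> pid K n"
  shows "inversion (bl K c n) x = of_real (q powi (- 2 * nu K c)) * bl K (1 / c) (n - 2 * nu K c) x"
proof -
  have c0: "c \<noteq> 0" "nu K c < n" using notin_pidD[OF c] by auto
  have key: "nu K y = - nu K a \<and> 1 / y - a \<in> pid K (- 2 * nu K y + m)"
    if "y - 1 / a \<in> pid K m" "y \<noteq> 0" "a \<noteq> 0" "- nu K a < m" for y a m
  proof -
    have "1 / a \<notin> pid K m" using that by (simp add: pid_def nu_divide)
    from nu_add_eq(2)[OF this that(1)] have y: "nu K y = - nu K a" using that by (simp add: nu_divide)
    have "1 / y - a = (- (a / y)) * (y - 1 / a)" using that by (simp add: field_simps)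
    also have "\<dots> \<in> pid K (nu K (- (a / y)) + m)"
      by (rule pid_mult[OF _ that(1)]) (simp add: pid_def)
    also have "nu K (- (a / y)) + m = - 2 * nu K y + m" using y that by (simp add: nu_divide)
    finally show ?thesis using y by simp
  qed
  show ?thesis
  proof (cases "x = 0")
    case True
    have "- (1 / c) \<notin> pid K (n - 2 * nu K c)"
      using c0 by (simp add: pid_def nu_divide)
    then show ?thesis using True by (simp add: inversion_def bl_def)
  next
    case x: False
    have "1 / x - c \<in> pid K n \<longleftrightarrow> x - 1 / c \<in> pid K (n - 2 * nu K c)"
    proof
      assume "1 / x - c \<in> pid K n"
      then show "x - 1 / c \<in> pid K (n - 2 * nu K c)"
      proof -
        from \<open>1 / x - c \<in> pid K n\<close> have a: "nu K c = - nu K x" "x - 1 / c \<in> pid K (2 * nu K x + n)"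
          using key[of "1 / x" "1 / c" n] x c0 by (simp_all add: nu_divide)
        have "2 * nu K x + n = n - 2 * nu K c" using a(1) by simp
        then show ?thesis using a(2) by (simp only:)
      qed
    next
      assume "x - 1 / c \<in> pid K (n - 2 * nu K c)"
      then show "1 / x - c \<in> pid K n"
      proof -
        from \<open>x - 1 / c \<in> pid K (n - 2 * nu K c)\<close>
        have "nu K x = - nu K c \<and> 1 / x - c \<in> pid K (- 2 * nu K x + (n - 2 * nu K c))"
          using c0 by (intro key[OF _ x]) simp_all
        then have a: "nu K x = - nu K c" "1 / x - c \<in> pid K (- 2 * nu K x + (n - 2 * nu K c))" by auto
        have "- 2 * nu K x + (n - 2 * nu K c) = n" using a(1) by simp
        then show ?thesis using a(2) by (simp only:)
      qed
    qed
    moreover have "nu K x = - nu K c" if "x - 1 / c \<in> pid K (n - 2 * nu K c)"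
      using key[OF that x] c0 by simp
    ultimately show ?thesis using x by (auto simp: inversion_def bl_def)
  qed
qed

lemma bl_cong: "c - c' \<in> pid K n \<Longrightarrow> bl K c n = bl K c' n"
proof
  fix x assume "c - c' \<in> pid K n"
  then have "x - c \<in> pid K n \<longleftrightarrow> x - c' \<in> pid K n"
    using pid_trans[of x c n c'] pid_trans[of x c' n c] pid_diff_commute[of c c' n] by blast
  then show "bl K c n x = bl K c' n x" by (simp add: bl_def)
qed

text \<open>The substitution x -> 1/x, verified on balls. A ball off 0 is covered by
  \<open>inversion_ball\<close>; a ball around 0 becomes the complement of a ball and is summed over
  shells.\<close>

lemma inversion_integral:
  assumes "tf K u"
  shows "integrable (haar K) (inversion u) \<and> (LINT x|haar K. inversion u x) = (LINT x|haar K. u x)"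
  using assms
proof (induction rule: tf_induct)
  case (ball c n)
  show ?case
  proof (cases "c \<in> pid K n")
    case False
    have e: "inversion (bl K c n) = (\<lambda>x. of_real (q powi (- 2 * nu K c)) * bl K (1 / c) (n - 2 * nu K c) x)"
      using inversion_ball[OF False] by blast
    have "(LINT x|haar K. inversion (bl K c n) x) = of_real (q powi (- 2 * nu K c) * q powi (- (n - 2 * nu K c)))"
      unfolding e by (subst Bochner_Integration.integral_mult_right_zero) (simp only: bl_integral of_real_mult)
    also have "q powi (- 2 * nu K c) * q powi (- (n - 2 * nu K c)) = q powi (- n)"
      using q_nz by (simp add: power_int_add[symmetric])
    finally show ?thesis unfolding bl_integral e
      by (auto intro!: integrable_mult_right simp: bl_integrable)
  next
    case True
    then have b: "bl K c n = bl K 0 n" using bl_cong[of c 0 n] by simp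
    \<comment> \<open>The shell of valuation k = -n - i has weight q^(2k) and measure q^(-k) (1 -
      1/q), which leaves a series of ratio 1/q with total q^(-n).\<close>
    define g where "g = (\<lambda>(i::nat) x. of_real (q powi (2 * (- n - int i))) * sph (- n - int i) x)"
    have sph: "q powi (2 * (- n - int i)) * (q powi (- (- n - int i)) * (1 - 1 / q)) = q powi (- n) * (1 - 1 / q) * (1 / q) ^ i" for i
    proof -
      have "q powi (2 * (- n - int i)) * q powi (- (- n - int i)) = q powi (- n - int i)"
        using q_nz by (subst power_int_add[symmetric]) (auto simp: algebra_simps)
      moreover have "q powi (- n - int i) = q powi (- n) * (1 / q) ^ i"
        using q_nz by (simp add: power_int_diff power_divide)
      ultimately show ?thesis by (simp add: mult_ac)
    qed
    have gi: "(LINT x|haar K. g i x) = of_real (q powi (- n) * (1 - 1 / q) * (1 / q) ^ i)" for i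
      unfolding g_def by (subst Bochner_Integration.integral_mult_right_zero)
        (simp only: integral_sph of_real_mult[symmetric] sph)
    have gn: "(LINT x|haar K. norm (g i x)) = q powi (- n) * (1 - 1 / q) * (1 / q) ^ i" for i
    proof -
      have "(LINT x|haar K. norm (g i x)) = (LINT x|haar K. q powi (2 * (- n - int i)) * norm (sph (- n - int i) x))"
        using q_gt_0 unfolding g_def by (simp add: norm_mult norm_power_int)
      also have "\<dots> = q powi (2 * (- n - int i)) * (q powi (- (- n - int i)) * (1 - 1 / q))"
        by (subst Bochner_Integration.integral_mult_right_zero) (simp only: integral_norm_sph)
      finally show ?thesis using sph by simp
    qed
    have geo: "(\<lambda>i. q powi (- n) * (1 - 1 / q) * (1 / q) ^ i) sums (q powi (- n))"
    proof -
      have "(\<lambda>i. q powi (- n) * (1 - 1 / q) * (1 / q) ^ i) sums (q powi (- n) * (1 - 1 / q) * (1 / (1 - 1 / q)))"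
        using q_gt_1 by (intro sums_mult geometric_sums) simp
      moreover have "q powi (- n) * (1 - 1 / q) * (1 / (1 - 1 / q)) = q powi (- n)"
        using q_gt_1 by simp
      ultimately show ?thesis by (simp only:)
    qed
    have int: "integrable (haar K) (g i)" for i
      unfolding g_def by (intro integrable_mult_right tf_integrable tf_sph)
    have f: "\<exists>k. inversion (bl K c n) x = g k x \<and> (\<forall>i. i \<noteq> k \<longrightarrow> g i x = 0)" for x
    proof (cases "x \<noteq> 0 \<and> nu K x \<le> - n")
      case True
      then show ?thesis unfolding b
        by (intro exI[of _ "nat (- n - nu K x)"]) (auto simp: g_def sph_def inversion_def bl_def pid_def nu_divide)
    next
      case False
      then show ?thesis unfolding b
        by (intro exI[of _ 0]) (auto simp: g_def sph_def inversion_def bl_def pid_def nu_divide)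
    qed
    note ser = integrable_disjoint_series[of "haar K" g "inversion (bl K c n)", OF int f]
    have s: "summable (\<lambda>i. LINT x|haar K. norm (g i x))" unfolding gn using geo by (rule sums_summable)
    have "(\<lambda>i. of_real (q powi (- n) * (1 - 1 / q) * (1 / q) ^ i)) sums (LINT x|haar K. inversion (bl K c n) x)"
      using ser(2)[OF s] unfolding gi .
    moreover have "(\<lambda>i. complex_of_real (q powi (- n) * (1 - 1 / q) * (1 / q) ^ i)) sums of_real (q powi (- n))"
      using geo by (rule sums_of_real)
    ultimately have "(LINT x|haar K. inversion (bl K c n) x) = of_real (q powi (- n))" by (rule sums_unique2)
    then show ?thesis using ser(1)[OF s] bl_integral by simp
  qed
next
  case (add u v)
  have "inversion (\<lambda>x. u x + v x) = (\<lambda>x. inversion u x + inversion v x)"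
    by (auto simp: inversion_def algebra_simps)
  then show ?case using add tf_integrable by simp
next
  case (cmult u c)
  have "inversion (\<lambda>x. c * u x) = (\<lambda>x. c * inversion u x)"
    by (auto simp: inversion_def algebra_simps)
  then show ?case using cmult by simp
qed

section \<open>Complex powers of q, their periods, and characters of units\<close>

abbreviation Q :: complex where "Q \<equiv> of_nat (residue_card K)"

lemma Q_nz [simp]: "Q \<noteq> 0"
  using q_nz by simp

lemma Q_ne: "Q \<noteq> 1" "Q \<noteq> - 1" "Q\<^sup>2 \<noteq> 1"
proof -
  have "of_nat (residue_card K + 1) \<noteq> (0::complex)" by (subst of_nat_eq_0_iff) simp
  then show m: "Q \<noteq> - 1" by (metis add.left_inverse of_nat_1 of_nat_add)
  show p: "Q \<noteq> 1" using q_gt_1 by simp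
  show "Q\<^sup>2 \<noteq> 1" using m p by (simp add: power2_eq_1_iff)
qed

lemma one_Q: "1 - 1 / Q \<noteq> 0"
  using q_gt_1 by simp

lemma rc_pos [simp]: "0 < residue_card K" "residue_card K \<noteq> 0"
  using q_gt_0 by auto

lemma powr_Q: "Q powr s = exp (s * of_real (ln q))"
proof -
  have "Ln Q = of_real (ln q)" using Ln_of_real[OF q_gt_0] by simp
  then show ?thesis by (simp add: powr_def)
qed

lemma ln_q_powi: "ln (q powi n) = of_int n * ln q"
  using q_gt_0 by (cases "n \<ge> 0") (auto simp: power_int_def ln_realpow ln_inverse)

lemma absv_powr: "x \<noteq> 0 \<Longrightarrow> of_real (absv K x) powr s = (Q powr s) powi (- nu K x)"
proof -
  assume "x \<noteq> 0"
  have "of_real (absv K x) powr s = exp (s * of_real (ln (q powi (- nu K x))))"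
    using \<open>x \<noteq> 0\<close> q_gt_0 by (simp add: absv_def powr_def Ln_of_real del: of_real_power_int)
  also have "ln (q powi (- nu K x)) = - nu K x * ln q"
    using q_gt_0 by (simp add: ln_q_powi)
  finally show ?thesis unfolding powr_Q exp_power_int by (simp add: mult_ac)
qed

text \<open>
  The value at \<open>x\<close> of the character \<open>chi\<close>, extended to nonzero elements by 1 at the uniformizer.
\<close>

definition ang :: "('k \<Rightarrow> complex) \<Rightarrow> 'k \<Rightarrow> complex" where
  "ang chi x = chi (unif K powi (- nu K x) * x)"

lemma qchar_eq: "x \<noteq> 0 \<Longrightarrow> qchar K chi s x = ang chi x * (Q powr s) powi (- nu K x)"
  by (simp add: qchar_def ang_def absv_powr)

lemma qchar_zero [simp]: "qchar K chi s 0 = 0"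
  by (simp add: qchar_def absv_def)

lemma unit_mult: "u \<in> unit_group K \<Longrightarrow> v \<in> unit_group K \<Longrightarrow> u * v \<in> unit_group K"
  by (simp add: unit_iff nu_mult)

lemma unit_1 [simp]: "1 \<in> unit_group K" and unit_neg [simp]: "- u \<in> unit_group K \<longleftrightarrow> u \<in> unit_group K"
  by (simp_all add: unit_iff)

lemma unit_inverse: "u \<in> unit_group K \<Longrightarrow> inverse u \<in> unit_group K"
  by (simp add: unit_iff nu_inverse)

lemma unit_pow: "u \<in> unit_group K \<Longrightarrow> u ^ n \<in> unit_group K"
  by (simp add: unit_iff nu_power)

lemma unit_part: "x \<noteq> 0 \<Longrightarrow> unif K powi (- nu K x) * x \<in> unit_group K"
  by (simp add: unit_iff nu_mult)

text \<open>Both sides are exponentials of multiples of ln q, and the kernel of exp gives the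
  periods. Parameters modulo periods can thus be replaced by values of powers.\<close>

lemma powr_eq_iff: "Q powr a = Q powr b \<longleftrightarrow> (\<exists>n::int. a = b + 2 * half_period K * of_int n)"
proof -
  have L: "complex_of_real (ln q) \<noteq> 0" using q_gt_1 by simp
  have "a * of_real (ln q) = b * of_real (ln q) + of_real (2 * of_int n * pi) * \<i> \<longleftrightarrow> a = b + 2 * half_period K * of_int n" for n
    using L by (simp add: half_period_def field_simps)
  then show ?thesis unfolding powr_Q exp_eq by simp
qed

lemma powr_half_period: "Q powr (half_period K) = -1"
proof -
  have "complex_of_real (ln q) \<noteq> 0" using q_gt_1 by simp
  then have "half_period K * of_real (ln q) = of_real pi * \<i>" by (simp add: half_period_def)
  then show ?thesis unfolding powr_Q by (simp add: exp_pi_i)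
qed

lemma powr_half_half_period: "Q powr (half_period K / 2) = \<i>"
proof -
  have "complex_of_real (ln q) \<noteq> 0" using q_gt_1 by simp
  then have "half_period K / 2 * of_real (ln q) = of_real (pi/2) * \<i>" by (simp add: half_period_def)
  then show ?thesis unfolding powr_Q by (simp only: cis_conv_exp[symmetric] mult.commute[of _ \<i>]) simp
qed

lemma powr_three_half: "Q powr (3 * half_period K / 2) = - \<i>"
proof -
  have "3 * half_period K / 2 = half_period K + half_period K / 2" by simp
  then show ?thesis by (simp only: powr_add powr_half_period powr_half_half_period) simp
qed

text \<open>Squaring doubles the exponent, so a half period becomes a full one.\<close>

lemma half_period_coset_iff: "a \<in> half_period_coset K c \<longleftrightarrow> (Q powr a)\<^sup>2 = (Q powr c)\<^sup>2"
proof -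
  have "(Q powr a)\<^sup>2 = Q powr (2 * a)" for a
    by (simp add: power2_eq_square powr_add[symmetric])
  then have "(Q powr a)\<^sup>2 = (Q powr c)\<^sup>2 \<longleftrightarrow> (\<exists>n::int. 2 * a = 2 * c + 2 * half_period K * of_int n)"
    by (simp only: powr_eq_iff)
  also have "\<dots> \<longleftrightarrow> (\<exists>n::int. a = c + half_period K * of_int n)"
  proof -
    have "2 * a = 2 * c + 2 * half_period K * of_int n \<longleftrightarrow> a = c + half_period K * of_int n" for n
      by (simp only: mult.assoc distrib_left[symmetric] mult_cancel_left) simp
    then show ?thesis by simp
  qed
  finally show ?thesis by (auto simp: half_period_coset_def)
qed

end

locale lf_char = local_field K for K :: "'k::{field,metric_space} lf" +
  fixes chi :: "'k \<Rightarrow> complex"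
  assumes uc: "unit_character K chi"
begin

lemma chi_nz: "u \<in> unit_group K \<Longrightarrow> chi u \<noteq> 0"
  and chi_mult: "u \<in> unit_group K \<Longrightarrow> v \<in> unit_group K \<Longrightarrow> chi (u * v) = chi u * chi v"
  and chi_cont: "continuous_on (unit_group K) chi"
  using uc by (auto simp: unit_character_def)

lemma chi_1 [simp]: "chi 1 = 1"
  using chi_mult[of 1 1] chi_nz[of 1] by simp

lemma chi_pow: "u \<in> unit_group K \<Longrightarrow> chi (u ^ n) = chi u ^ n"
  by (induction n) (auto simp: chi_mult unit_pow)

text \<open>By continuity chi is close to 1 on 1 + \<open>pid K m\<close> for large m. These
  elements have all their powers in the same set, so their images have powers staying near 1 and
  must be 1 by \<open>no_small_subgroups\<close>.\<close>

lemma conductor_ex: "\<exists>n\<ge>1. \<forall>h\<in>pid K n. 1 + h \<in> unit_group K \<and> chi (1 + h) = 1"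
proof -
  have "\<forall>\<^sub>F x in at 1 within unit_group K. dist (chi x) (chi 1) < 1/2"
  proof (rule tendstoD)
    show "(chi \<longlongrightarrow> chi 1) (at 1 within unit_group K)"
      using chi_cont unfolding continuous_on_def by (rule bspec) simp
  qed simp
  then have "\<forall>\<^sub>F x in nhds 1. x \<noteq> 1 \<longrightarrow> x \<in> unit_group K \<longrightarrow> dist (chi x) (chi 1) < 1/2"
    by (simp add: eventually_at_filter)
  then obtain n where n: "\<forall>h\<in>pid K n. 1 + h \<noteq> 1 \<longrightarrow> 1 + h \<in> unit_group K \<longrightarrow> dist (chi (1 + h)) (chi 1) < 1/2"
    unfolding eventually_nhds_lf by blast
  define m where "m = max n 1"
  have unit: "1 + h \<in> unit_group K" if "h \<in> pid K m" for h
    using nu_add_eq[of 1 1 h] pid_mono[OF that, of 1] by (simp add: unit_iff m_def)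
  have small: "norm (chi (1 + h) - 1) \<le> 1/2" if "h \<in> pid K m" for h
  proof (cases "h = 0")
    case False
    have "h \<in> pid K n" using that pid_mono[of h m n] by (simp add: m_def)
    then show ?thesis using bspec[OF n, of h] unit[OF that] False by (simp add: dist_norm)
  qed simp
  have pow: "(1 + h) ^ k - 1 \<in> pid K m" if "h \<in> pid K m" for h and k :: nat
  proof (induction k)
    case (Suc k)
    have "1 + h \<in> pid K 0" using pid_add[of 1 0 h] pid_mono[OF that, of 0] by (simp add: m_def)
    from pid_mult[OF this Suc] pid_add[OF that]
    have "h + (1 + h) * ((1 + h) ^ k - 1) \<in> pid K m" by simp
    then show ?case by (simp add: algebra_simps)
  qed simp
  have "chi (1 + h) = 1" if "h \<in> pid K m" for h
  proof (rule no_small_subgroups)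
    fix k :: nat
    show "norm (chi (1 + h) ^ k - 1) \<le> 1/2"
      using small[OF pow[OF that, of k]] chi_pow[OF unit[OF that], of k] by simp
  qed
  then show ?thesis using unit by (intro exI[of _ m]) (auto simp: m_def)
qed

lemma ang_mult: "x \<noteq> 0 \<Longrightarrow> y \<noteq> 0 \<Longrightarrow> ang chi (x * y) = ang chi x * ang chi y"
  using chi_mult[OF unit_part[of x] unit_part[of y]]
  by (simp add: ang_def nu_mult power_int_diff power_int_minus field_simps power_int_add)

lemma ang_unit: "u \<in> unit_group K \<Longrightarrow> ang chi u = chi u"
  by (simp add: ang_def unit_iff)

lemma ang_nz: "x \<noteq> 0 \<Longrightarrow> ang chi x \<noteq> 0"
  unfolding ang_def by (rule chi_nz[OF unit_part])

lemma ang_1 [simp]: "ang chi 1 = 1"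
  by (simp add: ang_unit)

lemma ang_inverse: "x \<noteq> 0 \<Longrightarrow> ang chi (inverse x) = inverse (ang chi x)"
  using ang_mult[of x "inverse x"] ang_nz[of x] by (simp add: field_simps)

text \<open>Since x + h = x (1 + h/x), the radius of local constancy is proportional to x and the
  conductor controls the quotient.\<close>

lemma ang_loc_const: "\<exists>n\<ge>1. \<forall>x\<noteq>0. \<forall>h\<in>pid K (nu K x + n). x + h \<noteq> 0 \<and> nu K (x + h) = nu K x \<and> ang chi (x + h) = ang chi x"
proof -
  obtain n where n: "n \<ge> 1" "\<forall>h\<in>pid K n. 1 + h \<in> unit_group K \<and> chi (1 + h) = 1"
    using conductor_ex by blast
  show ?thesis
  proof (intro exI[of _ n] conjI ballI allI impI n(1))
    fix x h assume x: "x \<noteq> 0" and h: "h \<in> pid K (nu K x + n)"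
    have "x \<notin> pid K (nu K x + n)" using x n(1) by (simp add: pid_def)
    from nu_add_eq[OF this h] show "x + h \<noteq> 0" "nu K (x + h) = nu K x" by auto
    have hx: "h / x \<in> pid K n" using h x by (simp add: pid_divide_iff add.commute)
    have "ang chi (x + h) = ang chi (x * (1 + h / x))" using x by (simp add: distrib_left)
    also have "\<dots> = ang chi x * ang chi (1 + h / x)"
      using x bspec[OF n(2) hx] by (intro ang_mult) (auto simp: unit_iff)
    also have "ang chi (1 + h / x) = 1" using bspec[OF n(2) hx] ang_unit by simp
    finally show "ang chi (x + h) = ang chi x" by simp
  qed
qed

lemma qchar_mult: "x \<noteq> 0 \<Longrightarrow> y \<noteq> 0 \<Longrightarrow> qchar K chi s (x * y) = qchar K chi s x * qchar K chi s y"
proof -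
  assume "x \<noteq> 0" "y \<noteq> 0"
  have "(Q powr s) powi (- nu K x + - nu K y) = (Q powr s) powi (- nu K x) * (Q powr s) powi (- nu K y)"
    by (rule power_int_add) simp
  then show ?thesis using \<open>x \<noteq> 0\<close> \<open>y \<noteq> 0\<close> by (simp add: qchar_eq ang_mult nu_mult)
qed

lemma qchar_nz: "x \<noteq> 0 \<Longrightarrow> qchar K chi s x \<noteq> 0"
  by (simp add: qchar_eq ang_nz)

lemma qchar_1 [simp]: "qchar K chi s 1 = 1"
  by (simp add: qchar_eq)

lemma qchar_inverse: "x \<noteq> 0 \<Longrightarrow> qchar K chi s (inverse x) = inverse (qchar K chi s x)"
  using qchar_mult[of x "inverse x" s] qchar_nz[of x s] by (simp add: field_simps)

lemma qchar_unit: "u \<in> unit_group K \<Longrightarrow> qchar K chi s u = chi u"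
  using ang_unit[of u] by (auto simp: unit_iff qchar_eq)

lemma qchar_loc_const: "\<exists>n\<ge>1. \<forall>x\<noteq>0. \<forall>h\<in>pid K (nu K x + n). x + h \<noteq> 0 \<and> qchar K chi s (x + h) = qchar K chi s x"
proof -
  obtain n where "n \<ge> 1" and n: "\<forall>x\<noteq>0. \<forall>h\<in>pid K (nu K x + n). x + h \<noteq> 0 \<and> nu K (x + h) = nu K x \<and> ang chi (x + h) = ang chi x"
    using ang_loc_const by blast
  moreover have "x + h \<noteq> 0 \<and> qchar K chi s (x + h) = qchar K chi s x" if "x \<noteq> 0" "h \<in> pid K (nu K x + n)" for x h
    using n[rule_format, OF that] that(1) by (simp add: qchar_eq)
  ultimately show ?thesis by blast
qed

end

section \<open>Two by two matrices\<close>

lemma mat2_nth [simp]: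
  "mat2 a b c d $ 1 $ 1 = a" "mat2 a b c d $ 1 $ 2 = b" "mat2 a b c d $ 2 $ 1 = c" "mat2 a b c d $ 2 $ 2 = d"
  by (simp_all add: mat2_def)

lemma mat2_eq_iff: "g = h \<longleftrightarrow> g $ 1 $ 1 = h $ 1 $ 1 \<and> g $ 1 $ 2 = h $ 1 $ 2 \<and> g $ 2 $ 1 = h $ 2 $ 1 \<and> g $ 2 $ 2 = h $ 2 $ 2"
  for g h :: "'a^2^2"
  by (auto simp: vec_eq_iff forall_2)

lemma mat2_eta: "mat2 (g $ 1 $ 1) (g $ 1 $ 2) (g $ 2 $ 1) (g $ 2 $ 2) = g" for g :: "'a::zero^2^2"
  by (simp add: mat2_eq_iff)

lemma mat2_cases:
  fixes g :: "'a::zero^2^2"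
  obtains a b c d where "g = mat2 a b c d"
  by (rule that[OF mat2_eta[symmetric]])

lemma mat2_mult: "mat2 a b c d ** mat2 a' b' c' d' =
    mat2 (a * a' + b * c') (a * b' + b * d') (c * a' + d * c') (c * b' + d * d')"
  for a :: "'a::comm_ring_1"
  by (simp add: mat2_eq_iff matrix_matrix_mult_def sum_2)

lemma mat_mat2: "mat z = mat2 z 0 0 z"
  by (simp add: mat2_eq_iff mat_def)

lemma mat2_inject [simp]: "mat2 a b c d = mat2 a' b' c' d' \<longleftrightarrow> a = a' \<and> b = b' \<and> c = c' \<and> d = d'"
  by (auto simp: mat2_eq_iff)

lemma det_mat2 [simp]: "det (mat2 a b c d) = a * d - b * c" for a :: "'a::comm_ring_1"
  by (simp add: det_2)

lemma invertible_mat2 [simp]: "invertible (mat2 a b c d) \<longleftrightarrow> a * d - b * c \<noteq> 0" for a :: "'a::field"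
  by (simp add: invertible_det_nz)

lemma nbar_mat2: "nbar x = mat2 1 0 x 1"
  by (simp add: nbar_def)

lemma invertible_nbar [simp]: "invertible (nbar x)"
  by (simp add: nbar_mat2)

lemma matrix_inv_left: "invertible A \<Longrightarrow> matrix_inv A ** A = mat 1"
  and matrix_inv_right: "invertible A \<Longrightarrow> A ** matrix_inv A = mat 1"
  unfolding invertible_def matrix_inv_def
  using someI_ex[of "\<lambda>A'. A ** A' = mat 1 \<and> A' ** A = mat 1"] by blast+

lemma matrix_inv_eqI: "A ** B = mat 1 \<Longrightarrow> matrix_inv A = B" for A B :: "'a::field^'n^'n"
proof -
  assume AB: "A ** B = mat 1"
  then have BA: "B ** A = mat 1" using matrix_left_right_inverse by blast
  then have "invertible A" using AB invertible_def by blast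
  then have "matrix_inv A ** A = mat 1" by (rule matrix_inv_left)
  have "matrix_inv A = matrix_inv A ** (A ** B)" using AB by simp
  also have "\<dots> = B" using \<open>matrix_inv A ** A = mat 1\<close> by (simp add: matrix_mul_assoc)
  finally show ?thesis .
qed

lemma invertible_matrix_inv: "invertible A \<Longrightarrow> invertible (matrix_inv A)" for A :: "'a::field^'n^'n"
  using matrix_inv_left[of A] matrix_inv_right[of A] unfolding invertible_def by blast

lemma matrix_inv_mat2: "a * d - b * c \<noteq> 0 \<Longrightarrow>
    matrix_inv (mat2 a b c d) = mat2 (d / (a * d - b * c)) (- b / (a * d - b * c)) (- c / (a * d - b * c)) (a / (a * d - b * c))"
  for a :: "'a::field"
proof (rule matrix_inv_eqI)
  let ?D = "a * d - b * c"
  assume "?D \<noteq> 0"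
  then have "a * d / ?D - b * c / ?D = 1" "d * a / ?D - c * b / ?D = 1"
    by (simp_all add: diff_divide_distrib[symmetric] mult.commute)
  then show "mat2 a b c d ** mat2 (d / ?D) (- b / ?D) (- c / ?D) (a / ?D) = mat 1"
    by (simp add: mat2_mult mat_mat2)
qed

lemma map_matrix_mat2: "map_matrix j (mat2 a b c d) = mat2 (j a) (j b) (j c) (j d)"
  by (simp add: mat2_eq_iff map_matrix_def)

definition weyl :: "'a::zero_neq_one^2^2" where
  "weyl = mat2 0 1 1 0"

lemma weyl_weyl: "weyl ** weyl = (mat 1 :: 'a::field^2^2)"
  by (simp add: weyl_def mat2_mult mat_mat2)

lemma weyl_inv: "matrix_inv weyl = (weyl :: 'a::field^2^2)"
  by (rule matrix_inv_eqI) (rule weyl_weyl)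

lemma weyl_invertible [simp]: "invertible (weyl :: 'a::field^2^2)"
  by (simp add: weyl_def)

lemma weyl_mult: "weyl ** mat2 a b c d = mat2 c d a b" for a :: "'a::field"
  by (simp add: weyl_def mat2_mult)

lemma left_translate_weyl: "left_translate weyl f g = f (weyl ** g)"
  by (simp add: left_translate_def weyl_inv)

lemma left_translate_weyl2: "left_translate weyl (left_translate weyl f) = f"
  by (simp add: fun_eq_iff left_translate_weyl matrix_mul_assoc weyl_weyl)

lemma left_translate_add: "left_translate g (\<lambda>x. f x + h x) = (\<lambda>x. left_translate g f x + left_translate g h x)"
  and left_translate_cmult: "left_translate g (\<lambda>x. c * f x) = (\<lambda>x. c * left_translate g f x)"
  by (simp_all add: left_translate_def)

context local_field
begin

lemma eventually_nhds_mat: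
  fixes g :: "'k^2^2"
  shows "(\<forall>\<^sub>F h in nhds g. P h) \<longleftrightarrow> (\<exists>n. \<forall>h. (\<forall>i l. h $ i $ l - g $ i $ l \<in> pid K n) \<longrightarrow> P h)"
proof
  assume "\<forall>\<^sub>F h in nhds g. P h"
  then obtain d where d: "d > 0" "\<And>h. dist h g < d \<Longrightarrow> P h" unfolding eventually_nhds_metric by auto
  \<comment> \<open>The distance of two matrices is at most the sum of the distances of their four
    entries.\<close>
  obtain n :: nat where n: "q powi (- int n) < d / 4" using ex_q_powi_less[of "d / 4"] d by auto
  have "P h" if h: "\<And>i l. h $ i $ l - g $ i $ l \<in> pid K (int n)" for h
  proof (rule d(2))
    have e: "dist (h $ i $ l) (g $ i $ l) < d / 4" for i l
      using dist_le_iff[of "h $ i $ l" "g $ i $ l" "int n"] h[of i l] n by simp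
    have r: "dist (h $ i) (g $ i) < d / 2" for i
    proof -
      have "dist (h $ i) (g $ i) \<le> (\<Sum>l\<in>UNIV. dist (h $ i $ l) (g $ i $ l))"
        unfolding dist_vec_def by (rule L2_set_le_sum) simp
      then show ?thesis using e[of i 1] e[of i 2] by (simp add: sum_2)
    qed
    have "dist h g \<le> (\<Sum>i\<in>UNIV. dist (h $ i) (g $ i))"
      unfolding dist_vec_def by (rule L2_set_le_sum) simp
    then show "dist h g < d" using r[of 1] r[of 2] by (simp add: sum_2)
  qed
  then show "\<exists>n. \<forall>h. (\<forall>i l. h $ i $ l - g $ i $ l \<in> pid K n) \<longrightarrow> P h" by blast
next
  assume "\<exists>n. \<forall>h. (\<forall>i l. h $ i $ l - g $ i $ l \<in> pid K n) \<longrightarrow> P h"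
  then obtain n where n: "\<forall>h. (\<forall>i l. h $ i $ l - g $ i $ l \<in> pid K n) \<longrightarrow> P h" by blast
  have "P h" if "dist h g < q powi (- n)" for h
  proof (rule n[rule_format])
    fix i l
    have "dist (h $ i $ l) (g $ i $ l) \<le> dist h g"
      using dist_vec_nth_le[of "h $ i" l "g $ i"] dist_vec_nth_le[of h i g] by linarith
    then show "h $ i $ l - g $ i $ l \<in> pid K n" using that dist_le_iff[of "h $ i $ l" "g $ i $ l" n] by simp
  qed
  then show "\<forall>\<^sub>F h in nhds g. P h"
    unfolding eventually_nhds_metric using q_gt_0 by (intro exI[of _ "q powi (- n)"]) auto
qed

lemma eventually_entry:
  fixes g :: "'k^2^2"
  shows "\<forall>\<^sub>F h in nhds g. h $ i $ l - g $ i $ l \<in> pid K n"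
  unfolding eventually_nhds_mat by (rule exI[of _ n]) simp

lemma prod_close:
  assumes "x' - x \<in> pid K m" "y' - y \<in> pid K m'" "x \<in> pid K a" "y \<in> pid K b" "n \<le> m" "n \<le> m'"
    "m \<ge> n - b" "m' \<ge> n - a" "m + m' \<ge> n"
  shows "x' * y' - x * y \<in> pid K n"
proof -
  have "x' * y' - x * y = (x' - x) * (y' - y) + (x' - x) * y + x * (y' - y)"
    by (simp add: algebra_simps)
  moreover have "(x' - x) * (y' - y) \<in> pid K n" "(x' - x) * y \<in> pid K n" "x * (y' - y) \<in> pid K n"
    using pid_mono[OF pid_mult[OF assms(1,2)], of n] pid_mono[OF pid_mult[OF assms(1,4)], of n]
      pid_mono[OF pid_mult[OF assms(3,2)], of n] assms by auto
  ultimately show ?thesis using pid_add by metis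
qed

lemma eventually_close_mult:
  fixes f g :: "'b::topological_space \<Rightarrow> 'k"
  assumes f: "\<And>n. \<forall>\<^sub>F h in nhds p. f h - f p \<in> pid K n" and g: "\<And>n. \<forall>\<^sub>F h in nhds p. g h - g p \<in> pid K n"
  shows "\<forall>\<^sub>F h in nhds p. f h * g h - f p * g p \<in> pid K n"
proof -
  define a where "a = - int (nat (- nu K (f p)))"
  define b where "b = - int (nat (- nu K (g p)))"
  have ab: "f p \<in> pid K a" "g p \<in> pid K b" by (simp_all only: a_def b_def pid_nat)
  define m where "m = max (max n (n - b)) (max (n - a) 0)"
  have m: "n \<le> m" "n - b \<le> m" "n - a \<le> m" "0 \<le> m" by (auto simp: m_def)
  show ?thesis using f[of m] g[of m]
  proof eventually_elim
    case (elim h)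
    show ?case by (rule prod_close[OF elim ab]) (use m in linarith)+
  qed
qed

lemma eventually_close_diff:
  fixes f g :: "'b::topological_space \<Rightarrow> 'k"
  assumes f: "\<And>n. \<forall>\<^sub>F h in nhds p. f h - f p \<in> pid K n" and g: "\<And>n. \<forall>\<^sub>F h in nhds p. g h - g p \<in> pid K n"
  shows "\<forall>\<^sub>F h in nhds p. f h - g h - (f p - g p) \<in> pid K n"
  using f[of n] g[of n]
proof eventually_elim
  case (elim h)
  have "(f h - f p) - (g h - g p) \<in> pid K n" by (rule pid_diff[OF elim])
  then show ?case by (simp add: algebra_simps)
qed

lemma eventually_det:
  fixes g :: "'k^2^2"
  shows "\<forall>\<^sub>F h in nhds g. det h - det g \<in> pid K n"
  unfolding det_2 by (intro eventually_close_diff eventually_close_mult eventually_entry)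

lemma eventually_nz:
  fixes f :: "'b::topological_space \<Rightarrow> 'k"
  assumes f: "\<And>n. \<forall>\<^sub>F h in nhds p. f h - f p \<in> pid K n" and "f p \<noteq> 0"
  shows "\<forall>\<^sub>F h in nhds p. f h \<noteq> 0 \<and> nu K (f h) = nu K (f p)"
proof -
  have nin: "f p \<notin> pid K (nu K (f p) + 1)" using assms(2) by (simp add: pid_def)
  show ?thesis using f[of "nu K (f p) + 1"]
    by eventually_elim (use nu_add_eq[OF nin] in fastforce)
qed

lemma eventually_invertible:
  fixes g :: "'k^2^2"
  assumes "invertible g" shows "\<forall>\<^sub>F h in nhds g. invertible h"
  using eventually_nz[where f = det and p = g] eventually_det assms
  unfolding invertible_det_nz by (auto elim: eventually_mono)

lemma eventually_close_inverse:
  fixes f :: "'b::topological_space \<Rightarrow> 'k"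
  assumes f: "\<And>n. \<forall>\<^sub>F h in nhds p. f h - f p \<in> pid K n" and nz: "f p \<noteq> 0"
  shows "\<forall>\<^sub>F h in nhds p. inverse (f h) - inverse (f p) \<in> pid K n"
  using f[of "n + 2 * nu K (f p)"] eventually_nz[of f p, OF f nz]
proof eventually_elim
  case (elim h)
  have "inverse (f h) - inverse (f p) = - ((f h - f p) / (f h * f p))"
    using elim nz by (simp add: field_simps)
  then show ?case using elim nz by (simp add: pid_divide_iff nu_mult)
qed

lemma left_mult_close:
  fixes A g :: "'k^2^2"
  shows "\<forall>\<^sub>F h in nhds g. (A ** h) $ i $ l - (A ** g) $ i $ l \<in> pid K n"
proof -
  have e: "\<forall>\<^sub>F h in nhds g. A $ i $ k * h $ k $ l - A $ i $ k * g $ k $ l \<in> pid K n" for k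
    by (rule eventually_close_mult[where f = "\<lambda>_. A $ i $ k"]) (auto intro: eventually_entry)
  show ?thesis using e[of 1] e[of 2]
  proof eventually_elim
    case (elim h)
    from pid_add[OF elim] show ?case by (simp add: matrix_matrix_mult_def sum_2 algebra_simps)
  qed
qed

lemma tendsto_left_mult:
  fixes A g :: "'k^2^2"
  assumes "\<forall>\<^sub>F h in nhds (A ** g). P h" shows "\<forall>\<^sub>F h in nhds g. P (A ** h)"
proof -
  obtain n where n: "\<forall>h. (\<forall>i l. h $ i $ l - (A ** g) $ i $ l \<in> pid K n) \<longrightarrow> P h"
    using assms unfolding eventually_nhds_mat by blast
  have "\<forall>\<^sub>F h in nhds g. \<forall>i l. (A ** h) $ i $ l - (A ** g) $ i $ l \<in> pid K n"
    by (intro eventually_all_finite left_mult_close)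
  then show ?thesis by eventually_elim (use n in blast)
qed

lemma nbar_tendsto:
  fixes x :: 'k
  assumes "\<forall>\<^sub>F h in nhds (nbar x). P h" shows "\<forall>\<^sub>F y in nhds x. P (nbar y)"
proof -
  obtain n where n: "\<forall>h. (\<forall>i l. h $ i $ l - nbar x $ i $ l \<in> pid K n) \<longrightarrow> P h"
    using assms unfolding eventually_nhds_mat by blast
  have "P (nbar (x + h))" if "h \<in> pid K n" for h
    by (rule n[rule_format]) (use that in \<open>auto simp: nbar_mat2 mat2_def forall_2 vector_def\<close>)
  then show ?thesis unfolding eventually_nhds_lf by blast
qed

end

section \<open>Principal series\<close>

text \<open>The Borel factor is normalized to lower right entry 1, which forces the scalar to be the
  determinant divided by a. The coordinate c / a is the point of the projective line given by the
  first column.\<close>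

lemma mat2_big_cell:
  fixes a :: "'a::field"
  assumes a: "a \<noteq> 0" and D: "a * d - b * c \<noteq> 0"
  shows "mat2 a b c d = mat ((a * d - b * c) / a) ** (nbar (c / a) ** mat2 (a\<^sup>2 / (a * d - b * c)) (b / ((a * d - b * c) / a)) 0 1)"
proof -
  define z where "z = (a * d - b * c) / a"
  define p where "p = a\<^sup>2 / (a * d - b * c)"
  define r where "r = b / z"
  define x where "x = c / a"
  have z: "z \<noteq> 0" using a D by (simp add: z_def)
  have "z * p = a" using a D by (simp add: z_def p_def power2_eq_square)
  moreover have b: "z * r = b" using z by (simp add: r_def)
  moreover have xa: "x * a = c" using a by (simp add: x_def)
  then have "z * (x * p) = c" using \<open>z * p = a\<close> by (simp add: mult.left_commute)
  moreover {
  have "z * a = a * d - b * c" using a by (simp add: z_def)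
  moreover have "a * (x * b + z) = (x * a) * b + z * a" by (simp add: algebra_simps)
  ultimately have "a * (x * b + z) = a * d" unfolding xa by (simp add: mult.commute)
  then have "x * b + z = d" using a by simp
  then have "z * (x * r + 1) = d" using b by (simp add: distrib_left mult.left_commute) }
  moreover have "mat z ** (nbar x ** mat2 p r 0 1) = mat2 (z * p) (z * r) (z * (x * p)) (z * (x * r + 1))"
    by (simp add: nbar_mat2 mat_mat2 mat2_mult)
  ultimately have "mat2 a b c d = mat z ** (nbar x ** mat2 p r 0 1)" by simp
  then show ?thesis unfolding r_def unfolding z_def p_def x_def .
qed

context lf_char
begin

lemma IndI:
  assumes "smooth_PGL f"
    "\<And>g a b. invertible g \<Longrightarrow> a \<noteq> 0 \<Longrightarrow> f (g ** mat2 a b 0 1) = inverse (qchar K chi (s + 1/2) a) * f g"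
  shows "f \<in> Ind K chi s"
  using assms by (simp add: Ind_def)

lemma Ind_noninv: "f \<in> Ind K chi s \<Longrightarrow> \<not> invertible g \<Longrightarrow> f g = 0"
  by (simp add: Ind_def smooth_PGL_def)

lemma Ind_scalar: "f \<in> Ind K chi s \<Longrightarrow> z \<noteq> 0 \<Longrightarrow> f (mat z ** g) = f g"
  by (simp add: Ind_def smooth_PGL_def)

lemma Ind_smooth: "f \<in> Ind K chi s \<Longrightarrow> invertible g \<Longrightarrow> \<forall>\<^sub>F h in nhds g. f h = f g"
  by (simp add: Ind_def smooth_PGL_def)

lemma Ind_equiv: "f \<in> Ind K chi s \<Longrightarrow> invertible g \<Longrightarrow> a \<noteq> 0 \<Longrightarrow>
    f (g ** mat2 a b 0 1) = inverse (qchar K chi (s + 1/2) a) * f g"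
  by (simp add: Ind_def)

lemma Ind_mat2:
  assumes f: "f \<in> Ind K chi s" and a: "a \<noteq> 0" and D: "a * d - b * c \<noteq> 0"
  shows "f (mat2 a b c d) = inverse (qchar K chi (s + 1/2) (a\<^sup>2 / (a * d - b * c))) * f (nbar (c / a))"
proof -
  let ?D = "a * d - b * c" and ?z = "(a * d - b * c) / a"
  have p: "a\<^sup>2 / ?D \<noteq> 0" and z: "?z \<noteq> 0" using a D by auto
  have "f (mat2 a b c d) = f (nbar (c / a) ** mat2 (a\<^sup>2 / ?D) (b / ?z) 0 1)"
    unfolding mat2_big_cell[OF a D] by (rule Ind_scalar[OF f z])
  also have "\<dots> = inverse (qchar K chi (s + 1/2) (a\<^sup>2 / ?D)) * f (nbar (c / a))"
    by (rule Ind_equiv[OF f _ p]) simp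
  finally show ?thesis .
qed

lemma Ind_nbar_loc_const: "f \<in> Ind K chi s \<Longrightarrow> \<forall>\<^sub>F y in nhds x. f (nbar y) = f (nbar x)"
  by (rule nbar_tendsto) (rule Ind_smooth, auto)

text \<open>The big cell is dense and the functions are locally constant: a vanishing upper left
  entry is replaced by a power of the uniformizer within the radius of local constancy.\<close>

lemma Ind_ext:
  assumes f: "f \<in> Ind K chi s" and h: "h \<in> Ind K chi s" and eq: "\<And>x. f (nbar x) = h (nbar x)"
  shows "f = h"
proof
  fix g
  have big: "f (mat2 a b c d) = h (mat2 a b c d)" if "a \<noteq> 0" "a * d - b * c \<noteq> 0" for a b c d
    using Ind_mat2[OF f that] Ind_mat2[OF h that] eq[of "c / a"] by simp
  show "f g = h g"
  proof (cases "invertible g")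
    case True
    have "\<forall>\<^sub>F k in nhds g. invertible k \<and> f k = f g \<and> h k = h g"
      by (intro eventually_conj eventually_invertible Ind_smooth[OF f] Ind_smooth[OF h] True)
    then obtain n where n: "\<forall>k. (\<forall>i l. k $ i $ l - g $ i $ l \<in> pid K n) \<longrightarrow> invertible k \<and> f k = f g \<and> h k = h g"
      unfolding eventually_nhds_mat by blast
    obtain a b c d where g: "g = mat2 a b c d" by (rule mat2_cases)
    define a' where "a' = (if a = 0 then unif K powi n else a)"
    have "\<forall>i l. mat2 a' b c d $ i $ l - g $ i $ l \<in> pid K n"
      by (auto simp: g forall_2 a'_def pid_def)
    then have k: "invertible (mat2 a' b c d) \<and> f (mat2 a' b c d) = f g \<and> h (mat2 a' b c d) = h g"
      using n by blast
    have "a' \<noteq> 0" by (simp add: a'_def)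
    then show ?thesis using big[of a' d b c] k by simp
  next
    case False
    then show ?thesis using Ind_noninv[OF f] Ind_noninv[OF h] by simp
  qed
qed

lemma Ind_add: assumes f: "f \<in> Ind K chi s" and h: "h \<in> Ind K chi s" shows "(\<lambda>g. f g + h g) \<in> Ind K chi s"
proof (rule IndI)
  show "smooth_PGL (\<lambda>g. f g + h g)"
    unfolding smooth_PGL_def
  proof (intro conjI allI impI)
    fix g :: "'k^2^2" assume g: "invertible g"
    show "\<forall>\<^sub>F k in nhds g. f k + h k = f g + h g"
      using Ind_smooth[OF f g] Ind_smooth[OF h g] by eventually_elim simp
  qed (use Ind_noninv[OF f] Ind_noninv[OF h] Ind_scalar[OF f] Ind_scalar[OF h] in auto)
qed (use Ind_equiv[OF f] Ind_equiv[OF h] in \<open>simp add: distrib_left\<close>)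

lemma Ind_cmult: assumes f: "f \<in> Ind K chi s" shows "(\<lambda>g. c * f g) \<in> Ind K chi s"
proof (rule IndI)
  show "smooth_PGL (\<lambda>g. c * f g)"
    unfolding smooth_PGL_def
  proof (intro conjI allI impI)
    fix g :: "'k^2^2" assume g: "invertible g"
    show "\<forall>\<^sub>F k in nhds g. c * f k = c * f g"
      using Ind_smooth[OF f g] by eventually_elim simp
  qed (use Ind_noninv[OF f] Ind_scalar[OF f] in auto)
qed (use Ind_equiv[OF f] in simp)

lemma Ind_zero: "(\<lambda>g. 0) \<in> Ind K chi s"
  by (rule IndI) (auto simp: smooth_PGL_def)

lemma Ind_diff: "f \<in> Ind K chi s \<Longrightarrow> h \<in> Ind K chi s \<Longrightarrow> (\<lambda>g. f g - h g) \<in> Ind K chi s"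
  using Ind_add[of f s "\<lambda>g. (-1) * h g"] Ind_cmult[of h s "-1"] by simp

lemma Ind_left_translate:
  assumes f: "f \<in> Ind K chi s" and g: "invertible g" shows "left_translate g f \<in> Ind K chi s"
proof (rule IndI)
  have i: "invertible (matrix_inv g ** h) \<longleftrightarrow> invertible h" for h :: "'k^2^2"
    using invertible_matrix_inv[OF g] by (simp add: invertible_det_nz det_mul)
  show "smooth_PGL (left_translate g f)"
    unfolding smooth_PGL_def
  proof (intro conjI allI impI)
    fix h :: "'k^2^2" and z :: 'k assume "z \<noteq> 0"
    obtain a b c d where 1: "matrix_inv g = mat2 a b c d" by (rule mat2_cases)
    obtain a' b' c' d' where 2: "h = mat2 a' b' c' d'" by (rule mat2_cases)
    have "matrix_inv g ** (mat z ** h) = mat z ** (matrix_inv g ** h)"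
      unfolding 1 2 by (simp add: mat_mat2 mat2_mult algebra_simps)
    then show "left_translate g f (mat z ** h) = left_translate g f h"
      using Ind_scalar[OF f \<open>z \<noteq> 0\<close>] by (simp add: left_translate_def)
  next
    fix h :: "'k^2^2" assume "invertible h"
    then show "\<forall>\<^sub>F k in nhds h. left_translate g f k = left_translate g f h"
      unfolding left_translate_def by (intro tendsto_left_mult Ind_smooth[OF f]) (simp add: i)
  qed (use Ind_noninv[OF f] i in \<open>auto simp: left_translate_def\<close>)
  fix h :: "'k^2^2" and a b :: 'k assume "invertible h" "a \<noteq> 0"
  then show "left_translate g f (h ** mat2 a b 0 1) = inverse (qchar K chi (s + 1 / 2) a) * left_translate g f h"
    unfolding left_translate_def by (subst matrix_mul_assoc) (rule Ind_equiv[OF f], simp_all add: i)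
qed

lemma translate_nbar: "left_translate (nbar y) f (nbar x) = f (nbar (x - y))"
  by (simp add: left_translate_def nbar_mat2 matrix_inv_mat2 mat2_mult)

lemma translate_diag:
  assumes f: "f \<in> Ind K chi s" and a: "a \<noteq> 0"
  shows "left_translate (mat2 a 0 0 1) f (nbar x) = qchar K chi (s + 1/2) a * f (nbar (a * x))"
proof -
  have "left_translate (mat2 a 0 0 1) f (nbar x) = f (mat2 (1 / a) 0 x 1)"
    using a by (simp add: left_translate_def nbar_mat2 matrix_inv_mat2 mat2_mult)
  also have "\<dots> = inverse (qchar K chi (s + 1/2) (inverse a)) * f (nbar (a * x))"
    using Ind_mat2[OF f, of "1 / a" 1 0 x] a by (simp add: power2_eq_square inverse_eq_divide mult.commute)
  finally show ?thesis using a by (simp add: qchar_inverse)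
qed

lemma translate_weyl:
  assumes f: "f \<in> Ind K chi s" and x: "x \<noteq> 0"
  shows "left_translate weyl f (nbar x) = inverse (qchar K chi (s + 1/2) (- x\<^sup>2)) * f (nbar (1 / x))"
  using Ind_mat2[OF f, of x 0 1 1] x by (simp add: left_translate_weyl nbar_mat2 weyl_mult)

text \<open>
  The function in the principal series supported in the big cell and equal to \<open>u\<close> along \<open>nbar\<close>.
\<close>

definition emb :: "complex \<Rightarrow> ('k \<Rightarrow> complex) \<Rightarrow> 'k^2^2 \<Rightarrow> complex" where
  "emb s u g = (if invertible g \<and> g $ 1 $ 1 \<noteq> 0
     then inverse (qchar K chi (s + 1/2) ((g $ 1 $ 1)\<^sup>2 / det g)) * u (g $ 2 $ 1 / g $ 1 $ 1) else 0)"

lemma emb_nbar [simp]: "emb s u (nbar x) = u x"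
  by (simp add: emb_def) (simp add: nbar_mat2)

lemma emb_mat2: "emb s u (mat2 a b c d) = (if a * d - b * c \<noteq> 0 \<and> a \<noteq> 0
    then inverse (qchar K chi (s + 1/2) (a\<^sup>2 / (a * d - b * c))) * u (c / a) else 0)"
  by (simp add: emb_def)

lemma eventually_qchar:
  fixes f :: "'b::topological_space \<Rightarrow> 'k"
  assumes f: "\<And>n. \<forall>\<^sub>F h in nhds p. f h - f p \<in> pid K n" and nz: "f p \<noteq> 0"
  shows "\<forall>\<^sub>F h in nhds p. qchar K chi s (f h) = qchar K chi s (f p)"
proof -
  obtain n where n: "\<forall>x\<noteq>0. \<forall>h\<in>pid K (nu K x + n). x + h \<noteq> 0 \<and> qchar K chi s (x + h) = qchar K chi s x"
    using qchar_loc_const by blast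
  show ?thesis using f[of "nu K (f p) + n"]
  proof eventually_elim
    case (elim h)
    have "qchar K chi s (f p + (f h - f p)) = qchar K chi s (f p)"
      using n nz elim by blast
    then show ?case by simp
  qed
qed

lemma emb_smooth:
  assumes u: "tf K u" and g: "invertible g"
  shows "\<forall>\<^sub>F h in nhds g. emb s u h = emb s u g"
proof (cases "g $ 1 $ 1 = 0")
  case False
  have e11: "\<forall>\<^sub>F h in nhds g. h $ 1 $ 1 - g $ 1 $ 1 \<in> pid K n" and e21: "\<forall>\<^sub>F h in nhds g. h $ 2 $ 1 - g $ 2 $ 1 \<in> pid K n" for n
    by (rule eventually_entry)+
  have det: "det g \<noteq> 0" using g by (simp add: invertible_det_nz)
  have c: "\<forall>\<^sub>F h in nhds g. h $ 1 $ 1 * h $ 1 $ 1 * inverse (det h) - g $ 1 $ 1 * g $ 1 $ 1 * inverse (det g) \<in> pid K n" for n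
    by (intro eventually_close_mult[where p = g] eventually_close_inverse[where f = det] eventually_det det e11)
  have q: "\<forall>\<^sub>F h in nhds g. qchar K chi (s + 1/2) (h $ 1 $ 1 * h $ 1 $ 1 * inverse (det h)) =
      qchar K chi (s + 1/2) (g $ 1 $ 1 * g $ 1 $ 1 * inverse (det g))"
    by (rule eventually_qchar[where f = "\<lambda>h. h $ 1 $ 1 * h $ 1 $ 1 * inverse (det h)"]) (use c det False in auto)
  obtain N where N: "\<forall>h\<in>pid K N. u (g $ 2 $ 1 * inverse (g $ 1 $ 1) + h) = u (g $ 2 $ 1 * inverse (g $ 1 $ 1))"
    using u unfolding tf_def by auto
  have d: "\<forall>\<^sub>F h in nhds g. h $ 2 $ 1 * inverse (h $ 1 $ 1) - g $ 2 $ 1 * inverse (g $ 1 $ 1) \<in> pid K N"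
    by (intro eventually_close_mult[where p = g] eventually_close_inverse[where f = "\<lambda>h. h $ 1 $ 1"] e11 e21 False)
  have nz: "\<forall>\<^sub>F h in nhds g. h $ 1 $ 1 \<noteq> 0 \<and> nu K (h $ 1 $ 1) = nu K (g $ 1 $ 1)"
    by (rule eventually_nz[where f = "\<lambda>h. h $ 1 $ 1"]) (use e11 False in auto)
  show ?thesis using eventually_invertible[OF g] q d nz
  proof eventually_elim
    case (elim h)
    have "u (h $ 2 $ 1 * inverse (h $ 1 $ 1)) = u (g $ 2 $ 1 * inverse (g $ 1 $ 1))"
      using bspec[OF N elim(3)] by simp
    moreover have "emb s u k = (if invertible k \<and> k $ 1 $ 1 \<noteq> 0
        then inverse (qchar K chi (s + 1/2) (k $ 1 $ 1 * k $ 1 $ 1 * inverse (det k))) * u (k $ 2 $ 1 * inverse (k $ 1 $ 1)) else 0)" for k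
      by (simp only: emb_def power2_eq_square divide_inverse)
    ultimately show ?case using elim g False by (simp only: simp_thms if_True)
  qed
next
  case True
  \<comment> \<open>Near a matrix outside the big cell the quotient of the first column is too large
    for the support of u, so the function vanishes nearby.\<close>
  obtain M where M: "\<forall>x. u x \<noteq> 0 \<longrightarrow> x \<in> pid K M" using u unfolding tf_def by auto
  have c: "g $ 2 $ 1 \<noteq> 0" using g True by (auto simp: invertible_det_nz det_2)
  have nz: "\<forall>\<^sub>F h in nhds g. h $ 2 $ 1 \<noteq> 0 \<and> nu K (h $ 2 $ 1) = nu K (g $ 2 $ 1)"
    by (rule eventually_nz[where f = "\<lambda>h. h $ 2 $ 1"]) (use eventually_entry c in auto)
  show ?thesis using nz eventually_entry[of 1 1 g "nu K (g $ 2 $ 1) - M + 1"]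
  proof eventually_elim
    case (elim h)
    have "u (h $ 2 $ 1 / h $ 1 $ 1) = 0" if "h $ 1 $ 1 \<noteq> 0"
    proof (rule ccontr)
      assume "u (h $ 2 $ 1 / h $ 1 $ 1) \<noteq> 0"
      then have "h $ 2 $ 1 / h $ 1 $ 1 \<in> pid K M" using M by blast
      then have "M + nu K (h $ 1 $ 1) \<le> nu K (h $ 2 $ 1)"
        using that elim by (simp add: pid_divide_iff) (simp add: pid_def)
      moreover have "nu K (g $ 2 $ 1) - M + 1 \<le> nu K (h $ 1 $ 1)" using elim(2) True that by (simp add: pid_def)
      ultimately show False using elim(1) by linarith
    qed
    then show ?case using True by (simp add: emb_def)
  qed
qed

lemma emb_Ind: assumes u: "tf K u" shows "emb s u \<in> Ind K chi s"
proof (rule IndI)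
  show "smooth_PGL (emb s u)"
    unfolding smooth_PGL_def
  proof (intro conjI allI impI)
    fix g :: "'k^2^2" and z :: 'k assume z: "z \<noteq> 0"
    obtain a b c d where g: "g = mat2 a b c d" by (rule mat2_cases)
    have D: "z * a * (z * d) - z * b * (z * c) = z * z * (a * d - b * c)" by (simp add: algebra_simps)
    have "(z * a)\<^sup>2 / (z * z * (a * d - b * c)) = a\<^sup>2 / (a * d - b * c)"
      using z by (simp add: power2_eq_square)
    then show "emb s u (mat z ** g) = emb s u g"
      using z by (simp only: g mat_mat2 mat2_mult emb_mat2 mult_zero_left add_0_left add_0_right D) simp
  qed (use emb_smooth[OF u] in \<open>auto simp: emb_def\<close>)
  fix g :: "'k^2^2" and p r :: 'k assume g: "invertible g" and p: "p \<noteq> 0"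
  obtain a b c d where ge: "g = mat2 a b c d" by (rule mat2_cases)
  have D: "a * p * (c * r + d) - (a * r + b) * (c * p) = p * (a * d - b * c)" by (simp add: algebra_simps)
  have D0: "a * d - b * c \<noteq> 0" using g ge by simp
  have e: "(a * p)\<^sup>2 / (p * (a * d - b * c)) = p * (a\<^sup>2 / (a * d - b * c))"
    using p by (simp add: power2_eq_square)
  have qm: "qchar K chi (s + 1/2) (p * (a\<^sup>2 / (a * d - b * c))) =
      qchar K chi (s + 1/2) p * qchar K chi (s + 1/2) (a\<^sup>2 / (a * d - b * c))" if "a \<noteq> 0"
    by (rule qchar_mult) (use p D0 that in auto)
  have "emb s u (g ** mat2 p r 0 1) = emb s u (mat2 (a * p) (a * r + b) (c * p) (c * r + d))"
    by (simp add: ge mat2_mult)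
  also have "\<dots> = inverse (qchar K chi (s + 1/2) p) * emb s u g"
    using p D0 by (cases "a = 0") (simp_all add: emb_mat2 D e ge qm del: times_divide_eq_right)
  finally show "emb s u (g ** mat2 p r 0 1) = inverse (qchar K chi (s + 1/2) p) * emb s u g" .
qed

lemma emb_eqI: "f \<in> Ind K chi s \<Longrightarrow> tf K (\<lambda>x. f (nbar x)) \<Longrightarrow> f = emb s (\<lambda>x. f (nbar x))"
  by (rule Ind_ext[OF _ emb_Ind]) auto

lemma emb_add: "emb s (\<lambda>x. u x + v x) = (\<lambda>g. emb s u g + emb s v g)"
  and emb_cmult: "emb s (\<lambda>x. c * u x) = (\<lambda>g. c * emb s u g)"
  by (auto simp: emb_def fun_eq_iff algebra_simps)

lemma emb_big_cell: "{g. emb s u g \<noteq> 0} \<subseteq> big_cell"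
proof
  fix g assume "g \<in> {g. emb s u g \<noteq> 0}"
  then have i: "invertible g" "g $ 1 $ 1 \<noteq> 0" by (auto simp: emb_def split: if_splits)
  obtain a b c d where g: "g = mat2 a b c d" by (rule mat2_cases)
  have a: "a \<noteq> 0" "a * d - b * c \<noteq> 0" using i by (auto simp: g)
  have "(a * d - b * c) / a \<noteq> 0" "a\<^sup>2 / (a * d - b * c) \<noteq> 0" using a by auto
  then show "g \<in> big_cell" unfolding big_cell_def g mat2_big_cell[OF a] by blast
qed

text \<open>The projective line is the disjoint union of the integers and of the maximal ideal moved
  to infinity by the Weyl element. Both pieces are test functions in their chart, so the kernel
  formula and equivariance under the Weyl element determine an intertwining operator on f.\<close>

lemma Ind_split:
  assumes f: "f \<in> Ind K chi s"
  defines "u \<equiv> (\<lambda>x. if x \<in> pid K 0 then f (nbar x) else 0)"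
    and "v \<equiv> (\<lambda>x. if x \<in> pid K 1 then left_translate weyl f (nbar x) else 0)"
  shows "tf K u" "tf K v" "f = (\<lambda>g. emb s u g + left_translate weyl (emb s v) g)"
proof -
  have cut: "tf K (\<lambda>x. if x \<in> pid K m then h (nbar x) else 0)" if h: "h \<in> Ind K chi s" for h m
  proof (rule loc_const_tf[where M = m])
    fix x
    have "\<forall>\<^sub>F y in nhds x. y - x \<in> pid K m" unfolding eventually_nhds_lf by (rule exI[of _ m]) simp
    then show "\<forall>\<^sub>F y in nhds x. (if y \<in> pid K m then h (nbar y) else 0) = (if x \<in> pid K m then h (nbar x) else 0)"
      using Ind_nbar_loc_const[OF h, of x]
    proof eventually_elim
      case (elim y)
      have "y \<in> pid K m \<longleftrightarrow> x \<in> pid K m" using pid_add_cancel[OF elim(1), of x] by simp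
      then show ?case using elim by simp
    qed
  qed (auto split: if_splits)
  have Lf: "left_translate weyl f \<in> Ind K chi s" by (rule Ind_left_translate[OF f]) simp
  show u: "tf K u" unfolding u_def by (rule cut[OF f])
  show v: "tf K v" unfolding v_def by (rule cut[OF Lf])
  have "left_translate weyl f = (\<lambda>g. left_translate weyl (emb s u) g + emb s v g)"
  proof (rule Ind_ext[OF Lf])
    show "(\<lambda>g. left_translate weyl (emb s u) g + emb s v g) \<in> Ind K chi s"
      by (intro Ind_add Ind_left_translate emb_Ind u v) simp
    fix x
    show "left_translate weyl f (nbar x) = left_translate weyl (emb s u) (nbar x) + emb s v (nbar x)"
    proof (cases "x = 0")
      case True
      then show ?thesis
        by (simp add: left_translate_weyl v_def) (simp add: nbar_mat2 weyl_mult emb_mat2)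
    next
      case False
      have "1 / x \<in> pid K 0 \<longleftrightarrow> x \<notin> pid K 1" using False by (auto simp: pid_def nu_divide)
      then show ?thesis
        using translate_weyl[OF f False] translate_weyl[OF emb_Ind[OF u] False] by (simp add: v_def u_def)
    qed
  qed
  then have "left_translate weyl (left_translate weyl f) = left_translate weyl (\<lambda>g. left_translate weyl (emb s u) g + emb s v g)"
    by simp
  then show "f = (\<lambda>g. emb s u g + left_translate weyl (emb s v) g)"
    by (simp only: left_translate_weyl2 left_translate_add)
qed

end

section \<open>Spherical vectors\<close>

context local_field
begin

text \<open>The exponent of the max norm of a nonzero column: q^(-\<open>cm x y\<close>) is the
  larger of |x| and |y|.\<close>

definition cm :: "'k \<Rightarrow> 'k \<Rightarrow> int" where
  "cm x y = (if x = 0 then nu K y else if y = 0 then nu K x else min (nu K x) (nu K y))"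

lemma cm_ge: "x \<noteq> 0 \<or> y \<noteq> 0 \<Longrightarrow> m \<le> cm x y \<longleftrightarrow> x \<in> pid K m \<and> y \<in> pid K m"
  by (auto simp: cm_def pid_def)

lemma cm_eqI:
  assumes "x \<noteq> 0 \<or> y \<noteq> 0" "x' \<noteq> 0 \<or> y' \<noteq> 0"
    and "\<And>m. x \<in> pid K m \<and> y \<in> pid K m \<longleftrightarrow> x' \<in> pid K m \<and> y' \<in> pid K m"
  shows "cm x y = cm x' y'"
  using assms(3)[folded cm_ge[OF assms(1)] cm_ge[OF assms(2)]] by (meson order.antisym order.refl)

lemma cm_mult: "z \<noteq> 0 \<Longrightarrow> x \<noteq> 0 \<or> y \<noteq> 0 \<Longrightarrow> cm (z * x) (z * y) = nu K z + cm x y"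
  by (auto simp: cm_def nu_mult)

lemma cm_loc_const:
  assumes nz: "x \<noteq> 0 \<or> y \<noteq> 0" and c: "x' - x \<in> pid K (cm x y + 1)" "y' - y \<in> pid K (cm x y + 1)"
  shows "cm x' y' = cm x y"
proof -
  let ?n = "cm x y + 1"
  have n: "\<not> (x \<in> pid K ?n \<and> y \<in> pid K ?n)" using cm_ge[OF nz, of ?n] by simp
  have e: "x' \<in> pid K m \<longleftrightarrow> x \<in> pid K m" "y' \<in> pid K m \<longleftrightarrow> y \<in> pid K m" if "m \<le> ?n" for m
    using pid_add_cancel[OF pid_mono[OF c(1) that], of x] pid_add_cancel[OF pid_mono[OF c(2) that], of y] by simp_all
  have nz': "x' \<noteq> 0 \<or> y' \<noteq> 0" using n e[of ?n] by auto
  show ?thesis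
  proof (rule cm_eqI[OF nz' nz])
    fix m
    show "x' \<in> pid K m \<and> y' \<in> pid K m \<longleftrightarrow> x \<in> pid K m \<and> y \<in> pid K m"
    proof (cases "m \<le> ?n")
      case False
      then have "?n \<le> m" by simp
      then show ?thesis using n e[of ?n] pid_mono[of _ m ?n] by blast
    qed (use e in blast)
  qed
qed

lemma GL2_mat2: "mat2 a b c d \<in> GL2_integers K \<longleftrightarrow>
    a \<in> pid K 0 \<and> b \<in> pid K 0 \<and> c \<in> pid K 0 \<and> d \<in> pid K 0 \<and> a * d - b * c \<in> unit_group K"
  by (auto simp: GL2_integers_def pid_0 forall_2)

lemma unit_pid: "u \<in> unit_group K \<Longrightarrow> u * x \<in> pid K m \<longleftrightarrow> x \<in> pid K m"
  by (simp add: unit_iff pid_mult_iff)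

text \<open>An integral matrix does not increase the max norm, and its inverse is integral because
  the determinant is a unit.\<close>

lemma cm_GL2:
  assumes k: "mat2 a b c d \<in> GL2_integers K" and nz: "x \<noteq> 0 \<or> y \<noteq> 0"
  shows "cm (a * x + b * y) (c * x + d * y) = cm x y"
proof -
  have k': "a \<in> pid K 0" "b \<in> pid K 0" "c \<in> pid K 0" "d \<in> pid K 0" "a * d - b * c \<in> unit_group K"
    using k by (auto simp: GL2_mat2)
  let ?x = "a * x + b * y" and ?y = "c * x + d * y"
  have e: "(a * d - b * c) * x = d * ?x - b * ?y" "(a * d - b * c) * y = a * ?y - c * ?x"
    by (simp_all add: algebra_simps)
  have D: "a * d - b * c \<noteq> 0" using k'(5) by (simp add: unit_iff)
  have nz': "?x \<noteq> 0 \<or> ?y \<noteq> 0"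
  proof (rule ccontr)
    assume "\<not> ?thesis"
    then have "(a * d - b * c) * x = 0" "(a * d - b * c) * y = 0" unfolding e by auto
    then show False using nz D by auto
  qed
  have m: "u * v \<in> pid K n" if "u \<in> pid K 0" "v \<in> pid K n" for u v n
    using pid_mult[OF that] by simp
  show ?thesis
  proof (rule cm_eqI[OF nz' nz])
    fix n
    have "x \<in> pid K n \<and> y \<in> pid K n" if "?x \<in> pid K n" "?y \<in> pid K n"
    proof -
      have "(a * d - b * c) * x \<in> pid K n" "(a * d - b * c) * y \<in> pid K n"
        unfolding e using that k' by (auto intro!: pid_diff m)
      then show ?thesis using unit_pid[OF k'(5)] by blast
    qed
    moreover have "?x \<in> pid K n" "?y \<in> pid K n" if "x \<in> pid K n" "y \<in> pid K n"
      using that k' by (auto intro!: pid_add m)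
    ultimately show "?x \<in> pid K n \<and> ?y \<in> pid K n \<longleftrightarrow> x \<in> pid K n \<and> y \<in> pid K n" by blast
  qed
qed

lemma weyl_GL2: "weyl \<in> GL2_integers K"
  by (simp add: weyl_def GL2_mat2)

lemma GL2_invertible: "k \<in> GL2_integers K \<Longrightarrow> invertible k"
  by (simp add: GL2_integers_def invertible_det_nz unit_iff)

end

context lf_char
begin

text \<open>The spherical vector in closed form: if g = k b with k integral, the max norm of the
  first column and the determinant of g recover the character of b, so no Iwasawa decomposition has
  to be chosen.\<close>

definition sphf :: "complex \<Rightarrow> 'k^2^2 \<Rightarrow> complex" where
  "sphf s g = (if invertible g
     then (Q powr (s + 1/2)) powi (2 * cm (g $ 1 $ 1) (g $ 2 $ 1) - nu K (det g)) * inverse (ang chi (det g)) else 0)"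

lemma sphf_mat2: "a * d - b * c \<noteq> 0 \<Longrightarrow> sphf s (mat2 a b c d) =
    (Q powr (s + 1/2)) powi (2 * cm a c - nu K (a * d - b * c)) * inverse (ang chi (a * d - b * c))"
  by (simp add: sphf_def)

lemma sphf_1: "sphf s (mat 1) = 1"
  by (simp add: mat_mat2 sphf_mat2 cm_def)

lemma det_nz_col: "a * d - b * c \<noteq> 0 \<Longrightarrow> a \<noteq> 0 \<or> c \<noteq> (0::'k)"
  by auto

lemma sphf_Ind:
  assumes quad: "\<And>u. u \<in> unit_group K \<Longrightarrow> (chi u)\<^sup>2 = 1"
  shows "sphf s \<in> Ind K chi s"
proof (rule IndI)
  show "smooth_PGL (sphf s)"
    unfolding smooth_PGL_def
  proof (intro conjI allI impI)
    fix g :: "'k^2^2" and z :: 'k assume z: "z \<noteq> 0"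
    obtain a b c d where g: "g = mat2 a b c d" by (rule mat2_cases)
    have D: "z * a * (z * d) - z * b * (z * c) = z * z * (a * d - b * c)" by (simp add: algebra_simps)
    have zz: "ang chi z * ang chi z = 1"
      using quad[OF unit_part[OF z]] by (simp add: ang_def power2_eq_square)
    show "sphf s (mat z ** g) = sphf s g"
    proof (cases "a * d - b * c = 0")
      case True
      then show ?thesis by (simp add: g mat_mat2 mat2_mult sphf_def D)
    next
      case False
      have "ang chi (z * z * (a * d - b * c)) = ang chi (a * d - b * c)"
        using z False zz by (simp add: ang_mult)
      moreover have "nu K (z * z * (a * d - b * c)) = 2 * nu K z + nu K (a * d - b * c)"
        using z False by (simp add: nu_mult)
      moreover have "sphf s (mat z ** g) = sphf s (mat2 (z * a) (z * b) (z * c) (z * d))"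
        by (simp add: g mat_mat2 mat2_mult)
      ultimately show ?thesis
        using z False by (simp add: g sphf_mat2 D cm_mult[OF z det_nz_col[OF False]])
    qed
  next
    fix g :: "'k^2^2" assume g: "invertible g"
    have D: "det g \<noteq> 0" using g by (simp add: invertible_det_nz)
    have nz: "g $ 1 $ 1 \<noteq> 0 \<or> g $ 2 $ 1 \<noteq> 0" using D by (auto simp: det_2)
    have q: "\<forall>\<^sub>F h in nhds g. qchar K chi 0 (det h) = qchar K chi 0 (det g)"
      by (rule eventually_qchar[where f = det]) (use D eventually_det in auto)
    have n: "\<forall>\<^sub>F h in nhds g. det h \<noteq> 0 \<and> nu K (det h) = nu K (det g)"
      by (rule eventually_nz[where f = det]) (use D eventually_det in auto)
    show "\<forall>\<^sub>F h in nhds g. sphf s h = sphf s g"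
      using q n eventually_invertible[OF g] eventually_entry[of 1 1 g "cm (g $ 1 $ 1) (g $ 2 $ 1) + 1"]
        eventually_entry[of 2 1 g "cm (g $ 1 $ 1) (g $ 2 $ 1) + 1"]
    proof eventually_elim
      case (elim h)
      have "ang chi (det h) = ang chi (det g)" using elim(1,2) D by (simp add: qchar_eq)
      moreover have "cm (h $ 1 $ 1) (h $ 2 $ 1) = cm (g $ 1 $ 1) (g $ 2 $ 1)"
        by (rule cm_loc_const[OF nz elim(4,5)])
      ultimately show ?case using elim g by (simp add: sphf_def)
    qed
  qed (simp add: sphf_def)
  fix g :: "'k^2^2" and p r :: 'k assume g: "invertible g" and p: "p \<noteq> 0"
  obtain a b c d where ge: "g = mat2 a b c d" by (rule mat2_cases)
  have D: "a * p * (c * r + d) - (a * r + b) * (c * p) = p * (a * d - b * c)" by (simp add: algebra_simps)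
  have D0: "a * d - b * c \<noteq> 0" using g ge by simp
  have "sphf s (g ** mat2 p r 0 1) = sphf s (mat2 (p * a) (a * r + b) (p * c) (c * r + d))"
    by (simp add: ge mat2_mult mult.commute)
  also have "\<dots> = (Q powr (s + 1/2)) powi (2 * cm (p * a) (p * c) - nu K (p * (a * d - b * c))) * inverse (ang chi (p * (a * d - b * c)))"
    using p D0 D by (subst sphf_mat2) (simp_all add: mult.commute)
  also have "2 * cm (p * a) (p * c) - nu K (p * (a * d - b * c)) = nu K p + (2 * cm a c - nu K (a * d - b * c))"
    using p D0 by (simp add: cm_mult[OF p det_nz_col[OF D0]] nu_mult)
  also have "ang chi (p * (a * d - b * c)) = ang chi p * ang chi (a * d - b * c)"
    by (rule ang_mult[OF p D0])
  also have "(Q powr (s + 1/2)) powi (nu K p + (2 * cm a c - nu K (a * d - b * c))) =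
      (Q powr (s + 1/2)) powi nu K p * (Q powr (s + 1/2)) powi (2 * cm a c - nu K (a * d - b * c))"
    by (rule power_int_add) simp
  finally show "sphf s (g ** mat2 p r 0 1) = inverse (qchar K chi (s + 1/2) p) * sphf s g"
    using p D0 by (simp add: ge sphf_mat2 qchar_eq power_int_minus)
qed

lemma sphf_GL2:
  assumes k: "k \<in> GL2_integers K"
  shows "sphf s (k ** g) = inverse (chi (det k)) * sphf s g"
proof -
  obtain a b c d where ge: "g = mat2 a b c d" by (rule mat2_cases)
  obtain p r v w where ke: "k = mat2 p r v w" by (rule mat2_cases)
  have u: "p * w - r * v \<in> unit_group K" using k by (simp add: ke GL2_mat2)
  have D: "(p * a + r * c) * (v * b + w * d) - (p * b + r * d) * (v * a + w * c) = (p * w - r * v) * (a * d - b * c)"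
    by (simp add: algebra_simps)
  show ?thesis
  proof (cases "a * d - b * c = 0")
    case True
    then show ?thesis by (simp add: ge ke mat2_mult sphf_def D)
  next
    case False
    have "sphf s (k ** g) = (Q powr (s + 1/2)) powi (2 * cm (p * a + r * c) (v * a + w * c) - nu K ((p * w - r * v) * (a * d - b * c))) *
        inverse (ang chi ((p * w - r * v) * (a * d - b * c)))"
      using u False by (simp only: ge ke mat2_mult) (subst sphf_mat2, simp_all add: D unit_iff)
    then show ?thesis
      using u False ang_unit[OF u] cm_GL2[OF k[unfolded ke] det_nz_col[OF False]]
      by (simp add: ge ke sphf_mat2 ang_mult nu_mult unit_iff)
  qed
qed

text \<open>Invariance under integral matrices of determinant 1 is enough, since the Iwasawa
  decomposition of \<open>nbar x\<close> can be written with such a matrix. Hence a vector with this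
  invariance is determined by its value at the identity.\<close>

lemma nbar_values:
  assumes f: "f \<in> Ind K chi s"
    and inv: "\<And>k a b. k \<in> GL2_integers K \<Longrightarrow> det k = 1 \<Longrightarrow> a \<noteq> 0 \<Longrightarrow> f (k ** mat2 a b 0 1) = f (mat2 a b 0 1)"
  shows "f (nbar x) = (if x \<in> pid K 0 then 1 else inverse (qchar K chi (s + 1/2) (x\<^sup>2))) * f (mat 1)"
proof (cases "x \<in> pid K 0")
  case True
  have "nbar x \<in> GL2_integers K" "det (nbar x) = 1" using True by (simp_all add: nbar_mat2 GL2_mat2)
  from inv[OF this, of 1 0] show ?thesis using True by (simp add: mat_mat2[symmetric])
next
  case False
  then have x: "x \<noteq> 0" "1 / x \<in> pid K 0" by (auto simp: pid_def nu_divide)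
  have k: "mat2 (1 / x) (- 1) 1 0 \<in> GL2_integers K" "det (mat2 (1 / x) (- 1) 1 0) = 1"
    using x by (simp_all add: GL2_mat2)
  \<comment> \<open>For x outside the integers 1/x is integral, so this is an Iwasawa decomposition
    up to a scalar.\<close>
  have "nbar x = mat (1 / x) ** (mat2 (1 / x) (- 1) 1 0 ** mat2 (x\<^sup>2) x 0 1)"
    using x by (simp add: nbar_mat2 mat_mat2 mat2_mult power2_eq_square)
  then have "f (nbar x) = f (mat2 (1 / x) (- 1) 1 0 ** mat2 (x\<^sup>2) x 0 1)"
    using Ind_scalar[OF f, of "1 / x"] x by simp
  also have "\<dots> = f (mat2 (x\<^sup>2) x 0 1)" using x by (intro inv[OF k]) simp
  also have "mat2 (x\<^sup>2) x 0 1 = mat 1 ** mat2 (x\<^sup>2) x 0 1" by simp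
  also have "f (mat 1 ** mat2 (x\<^sup>2) x 0 1) = inverse (qchar K chi (s + 1/2) (x\<^sup>2)) * f (mat 1)"
    using x by (intro Ind_equiv[OF f]) (simp_all add: invertible_mat2 mat_mat2)
  finally show ?thesis using False by simp
qed

lemma eigen_unique:
  assumes f: "f \<in> Ind K chi s" and h: "h \<in> Ind K chi s"
    and "\<And>k a b. k \<in> GL2_integers K \<Longrightarrow> det k = 1 \<Longrightarrow> a \<noteq> 0 \<Longrightarrow> f (k ** mat2 a b 0 1) = f (mat2 a b 0 1)"
    and "\<And>k a b. k \<in> GL2_integers K \<Longrightarrow> det k = 1 \<Longrightarrow> a \<noteq> 0 \<Longrightarrow> h (k ** mat2 a b 0 1) = h (mat2 a b 0 1)"
    and 1: "f (mat 1) = C * h (mat 1)"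
  shows "f = (\<lambda>g. C * h g)"
proof (rule Ind_ext[OF f Ind_cmult[OF h]])
  fix x
  have "f (nbar x) = (if x \<in> pid K 0 then 1 else inverse (qchar K chi (s + 1/2) (x\<^sup>2))) * f (mat 1)"
    by (rule nbar_values[OF f assms(3)])
  moreover have "h (nbar x) = (if x \<in> pid K 0 then 1 else inverse (qchar K chi (s + 1/2) (x\<^sup>2))) * h (mat 1)"
    by (rule nbar_values[OF h assms(4)])
  ultimately show "f (nbar x) = C * h (nbar x)" using 1 by simp
qed

lemma sphf_upper: "a \<noteq> 0 \<Longrightarrow> sphf s (mat2 a b 0 1) = inverse (qchar K chi (s + 1/2) a)"
  by (simp add: sphf_mat2 cm_def qchar_eq power_int_minus)

lemma spherical_eq:
  assumes quad: "\<And>u. u \<in> unit_group K \<Longrightarrow> (chi u)\<^sup>2 = 1"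
  shows "spherical K chi s = sphf s"
  unfolding spherical_def
proof (rule the_equality)
  show "sphf s \<in> Ind K chi s \<and>
        (\<forall>k\<in>GL2_integers K. \<forall>a b. a \<noteq> 0 \<longrightarrow>
           sphf s (k ** mat2 a b 0 1) = inverse (qchar K chi (s + 1/2) a) * inverse (chi (det k)))"
    using sphf_Ind[OF quad] by (simp add: sphf_GL2 sphf_upper mult.commute)
next
  fix f assume f: "f \<in> Ind K chi s \<and>
        (\<forall>k\<in>GL2_integers K. \<forall>a b. a \<noteq> 0 \<longrightarrow>
           f (k ** mat2 a b 0 1) = inverse (qchar K chi (s + 1/2) a) * inverse (chi (det k)))"
  have 1: "mat 1 \<in> GL2_integers K" by (simp add: mat_mat2 GL2_mat2)
  have up: "f (mat2 a b 0 1) = inverse (qchar K chi (s + 1/2) a)" if "a \<noteq> 0" for a b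
    using f[THEN conjunct2, rule_format, OF 1 that, of b] by simp
  have "f = (\<lambda>g. 1 * sphf s g)"
  proof (rule eigen_unique)
    show "f (mat 1) = 1 * sphf s (mat 1)" using up[of 1 0] by (simp add: sphf_1) (simp add: mat_mat2)
    show "f (k ** mat2 a b 0 1) = f (mat2 a b 0 1)" if "k \<in> GL2_integers K" "det k = 1" "a \<noteq> 0" for k a b
      using f[THEN conjunct2, rule_format, OF that(1,3), of b] that up by simp
    show "f \<in> Ind K chi s" using f by blast
    show "sphf s \<in> Ind K chi s" by (rule sphf_Ind[OF quad])
  qed (simp add: sphf_GL2)
  then show "f = sphf s" by simp
qed

abbreviation zz :: "complex \<Rightarrow> complex" where "zz s \<equiv> Q powr (s + 1/2)"

text \<open>The version of \<open>inversion_ball\<close> for an arbitrary base z: on the ball in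
  question the valuation is constant, so the power of z is a constant.\<close>

lemma inversion_twist:
  assumes c: "c \<notin> pid K n" and x: "x \<noteq> 0"
  shows "z powi (2 * nu K x) * bl K c n (1 / x) = z powi (- 2 * nu K c) * bl K (1 / c) (n - 2 * nu K c) x"
proof (cases "bl K c n (1 / x) = 0")
  case True
  then show ?thesis using inversion_ball[OF c, of x] x by (simp add: inversion_def)
next
  case False
  then have "1 / x - c \<in> pid K n" by (auto simp: bl_def split: if_splits)
  from nu_add_eq(2)[OF c this] have n: "nu K x = - nu K c" using x by (simp add: nu_divide)
  have "bl K c n (1 / x) = 1" using False by (auto simp: bl_def split: if_splits)
  then have "of_real (q powi (2 * nu K x)) = of_real (q powi (- 2 * nu K c)) * bl K (1 / c) (n - 2 * nu K c) x"
    using inversion_ball[OF c, of x] x by (simp add: inversion_def)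
  then have "bl K (1 / c) (n - 2 * nu K c) x = 1" using n by simp
  then show ?thesis using n \<open>bl K c n (1 / x) = 1\<close> by simp
qed

text \<open>A sum over digit representatives equals an integral over a coset, up to a constant. The
  integral shows that the sum depends on the coset only, and it can be transformed by
  substitution.\<close>

lemma integral_coset_sum:
  assumes v: "\<And>x h. h \<in> pid K m \<Longrightarrow> v (x + h) = v x"
  shows "(LINT y|haar K. bl K x (m - 1) y * v y) = of_real (q powi (- m)) * (\<Sum>r\<in>rp 1 ` pid K 0. v (x + unif K powi (m - 1) * r))"
proof -
  let ?R = "rp 1 ` pid K 0" and ?p = "unif K powi (m - 1)"
  have "bl K x (m - 1) y * v y = (\<Sum>r\<in>?R. v (x + ?p * r) * bl K (x + ?p * r) m y)" for y
  proof (cases "y - x \<in> pid K (m - 1)")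
    case True
    then obtain r where r: "r \<in> ?R" "y - x - ?p * r \<in> pid K m"
      using pid_split[of "m - 1"] by auto
    have u: "r' = r" if "r' \<in> ?R" "y - (x + ?p * r') \<in> pid K m" for r'
    proof -
      have "?p * (r - r') \<in> pid K m"
        using pid_diff[OF that(2) r(2)] by (simp add: algebra_simps)
      then have "r - r' \<in> pid K 1" by (simp add: pid_mult_iff)
      then have "r = r'" using rp1_disjoint r(1) that(1) by blast
      then show ?thesis ..
    qed
    have "(\<Sum>r'\<in>?R. v (x + ?p * r') * bl K (x + ?p * r') m y) = (\<Sum>r'\<in>?R. if r' = r then v y else 0)"
    proof (rule sum.cong[OF refl])
      fix r' assume r': "r' \<in> ?R"
      show "v (x + ?p * r') * bl K (x + ?p * r') m y = (if r' = r then v y else 0)"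
      proof (cases "r' = r")
        case True
        have "v (x + ?p * r + (y - x - ?p * r)) = v (x + ?p * r)" by (rule v[OF r(2)])
        then show ?thesis using True r(2) by (simp add: bl_def diff_diff_eq)
      next
        case False
        then show ?thesis using u[OF r'] by (auto simp: bl_def)
      qed
    qed
    also have "\<dots> = v y" using r(1) finite_rp1 by simp
    finally show ?thesis using True by (simp add: bl_def)
  next
    case False
    have "y - (x + ?p * r) \<notin> pid K m" if "r \<in> ?R" for r
    proof
      assume "y - (x + ?p * r) \<in> pid K m"
      then have "y - x \<in> pid K (m - 1)" using pid_split[of "m - 1"] that by (auto simp: diff_diff_eq)
      then show False using False by simp
    qed
    then show ?thesis using False by (simp add: bl_def)
  qed
  then have "(LINT y|haar K. bl K x (m - 1) y * v y) = (LINT y|haar K. (\<Sum>r\<in>?R. v (x + ?p * r) * bl K (x + ?p * r) m y))"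
    by (simp only:)
  also have "\<dots> = (\<Sum>r\<in>?R. v (x + ?p * r) * of_real (q powi (- m)))"
    by (subst Bochner_Integration.integral_sum) (auto intro!: integrable_mult_right simp: bl_integrable bl_integral)
  finally show ?thesis by (simp add: sum_distrib_left mult.commute)
qed

end

section \<open>Invariant subspaces for quadratic characters\<close>

locale quad_char = lf_char +
  assumes quad: "u \<in> unit_group K \<Longrightarrow> (chi u)\<^sup>2 = 1"
begin

text \<open>The Weyl element has determinant -1, so its translates carry this sign.\<close>

definition eps :: complex where "eps = chi (- 1)"

lemma eps_eps [simp]: "eps * eps = 1"
  using quad[of "-1"] by (simp add: eps_def power2_eq_square)

lemma eps_nz [simp]: "eps \<noteq> 0"
  using eps_eps by force

lemma inverse_qchar_neg_sq: "x \<noteq> 0 \<Longrightarrow> inverse (qchar K chi (s + 1/2) (- x\<^sup>2)) = eps * zz s powi (2 * nu K x)"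
proof -
  assume x: "x \<noteq> 0"
  have a: "ang chi x * ang chi x = 1" using quad[OF unit_part[OF x]] by (simp add: ang_def power2_eq_square)
  have "ang chi (- x\<^sup>2) = ang chi (-1) * (ang chi x * ang chi x)"
    using x ang_mult[of "-1" "x * x"] ang_mult[of x x] by (simp add: power2_eq_square)
  then have "ang chi (- x\<^sup>2) = eps" using a by (simp add: eps_def ang_unit)
  moreover have "inverse eps = eps" using eps_eps by (metis inverse_unique)
  moreover have "- nu K (x\<^sup>2) = - (2 * nu K x)" using x by (simp add: nu_power)
  ultimately show ?thesis using x by (simp add: qchar_eq power_int_minus)
qed

lemma weyl_nbar:
  "f \<in> Ind K chi s \<Longrightarrow> x \<noteq> 0 \<Longrightarrow> left_translate weyl f (nbar x) = eps * zz s powi (2 * nu K x) * f (nbar (1 / x))"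
  by (simp add: translate_weyl inverse_qchar_neg_sq)

text \<open>The behaviour at infinity is the local constancy at 0 of the Weyl translate. Outside
  level 1 - n the inverse 1/x lies in \<open>pid K n\<close>.\<close>

lemma Ind_asymp:
  assumes f: "f \<in> Ind K chi s"
  shows "\<exists>R c. \<forall>x. x \<notin> pid K R \<longrightarrow> f (nbar x) = c * zz s powi (2 * nu K x)"
proof -
  let ?g = "left_translate weyl f"
  have g: "?g \<in> Ind K chi s" by (rule Ind_left_translate[OF f]) simp
  obtain n where n: "\<forall>h\<in>pid K n. ?g (nbar (0 + h)) = ?g (nbar 0)"
    using Ind_nbar_loc_const[OF g, of 0] unfolding eventually_nhds_lf by blast
  have "f (nbar x) = eps * ?g (nbar 0) * zz s powi (2 * nu K x)" if "x \<notin> pid K (1 - n)" for x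
  proof -
    have x: "x \<noteq> 0" "1 / x \<in> pid K n" using that by (auto simp: pid_def nu_divide)
    have "f (nbar x) = eps * zz s powi (2 * nu K x) * ?g (nbar (1 / x))"
      using weyl_nbar[OF g x(1)] by (simp add: left_translate_weyl2)
    also have "?g (nbar (1 / x)) = ?g (nbar 0)" using bspec[OF n x(2)] by simp
    finally show ?thesis by simp
  qed
  then show ?thesis by blast
qed

text \<open>On a ball compactness gives a uniform radius; outside it \<open>Ind_asymp\<close> leaves
  a function of the valuation, which small translations do not change.\<close>

lemma Ind_uniform:
  assumes f: "f \<in> Ind K chi s"
  shows "\<exists>m. \<forall>x. \<forall>h\<in>pid K m. f (nbar (x + h)) = f (nbar x)"
proof -
  obtain R c where R: "\<And>x. x \<notin> pid K R \<Longrightarrow> f (nbar x) = c * zz s powi (2 * nu K x)"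
    using Ind_asymp[OF f] by auto
  let ?v = "\<lambda>x. if x \<in> pid K R then f (nbar x) else 0"
  have "tf K ?v"
  proof (rule loc_const_tf[where M = R])
    fix x
    have "\<forall>\<^sub>F y in nhds x. y - x \<in> pid K R" unfolding eventually_nhds_lf by (rule exI[of _ R]) simp
    then show "\<forall>\<^sub>F y in nhds x. ?v y = ?v x"
      using Ind_nbar_loc_const[OF f, of x]
    proof eventually_elim
      case (elim y)
      have "y \<in> pid K R \<longleftrightarrow> x \<in> pid K R" using pid_add_cancel[OF elim(1), of x] by simp
      then show ?case using elim by simp
    qed
  qed (auto split: if_splits)
  then obtain N where N: "\<forall>x. \<forall>h\<in>pid K N. ?v (x + h) = ?v x" unfolding tf_def by blast
  have "f (nbar (x + h)) = f (nbar x)" if h: "h \<in> pid K (max N R)" for x h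
  proof -
    have hN: "h \<in> pid K N" and hR: "h \<in> pid K R" using pid_mono[OF h] by auto
    show ?thesis
    proof (cases "x \<in> pid K R")
      case True
      then have "x + h \<in> pid K R" using hR pid_add by blast
      then show ?thesis using N[rule_format, OF hN, of x] True by simp
    next
      case False
      then have "x + h \<notin> pid K R" using pid_add_cancel[OF hR] by blast
      then show ?thesis using R False nu_add_eq(2)[OF False hR] by metis
    qed
  qed
  then show ?thesis by blast
qed

text \<open>Inversion maps 1 + \<open>pid K 1\<close> to itself and the valuation is 0 there, so
  only the sign survives. This vector serves to exchange mass between the two charts.\<close>

lemma emb_weyl_unit: "left_translate weyl (emb s (bl K 1 1)) = (\<lambda>g. eps * emb s (bl K 1 1) g)"
proof (rule Ind_ext[of _ s])
  show "left_translate weyl (emb s (bl K 1 1)) \<in> Ind K chi s"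
    by (intro Ind_left_translate emb_Ind tf_bl) simp
  show "(\<lambda>g. eps * emb s (bl K 1 1) g) \<in> Ind K chi s" by (intro Ind_cmult emb_Ind tf_bl)
  fix x
  show "left_translate weyl (emb s (bl K 1 1)) (nbar x) = eps * emb s (bl K 1 1) (nbar x)"
  proof (cases "x = 0")
    case True
    then show ?thesis
      by (simp add: left_translate_weyl bl_def) (simp add: nbar_mat2 weyl_mult emb_mat2)
  next
    case False
    then show ?thesis
      using weyl_nbar[OF emb_Ind[OF tf_bl] False, of s 1 1] inversion_twist[of 1 1 x "zz s"]
      by (simp add: mult.assoc)
  qed
qed

text \<open>At this parameter the twist \<open>zz s\<close>^(2 nu) is the Jacobian of inversion, so
  elements of the representation transform like densities.\<close>

lemma weyl_emb_nbar:
  assumes v: "tf K v" and z: "(zz s)\<^sup>2 = Q\<^sup>2"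
  shows "left_translate weyl (emb s v) (nbar x) = eps * inversion v x"
proof (cases "x = 0")
  case True
  then show ?thesis
    by (simp add: left_translate_weyl inversion_def) (simp add: nbar_mat2 weyl_mult emb_mat2)
next
  case False
  have "zz s powi (2 * n) = of_real (q powi (2 * n))" for n
    using z by (simp add: power_int_mult)
  then show ?thesis
    using weyl_nbar[OF emb_Ind[OF v] False, of s] False by (simp add: inversion_def mult_ac)
qed

lemma Ind_integral:
  assumes f: "f \<in> Ind K chi s" and z: "(zz s)\<^sup>2 = Q\<^sup>2"
  defines "u \<equiv> (\<lambda>x. if x \<in> pid K 0 then f (nbar x) else 0)"
    and "v \<equiv> (\<lambda>x. if x \<in> pid K 1 then left_translate weyl f (nbar x) else 0)"
  shows "integrable (haar K) (\<lambda>x. f (nbar x))"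
    and "(LINT x|haar K. f (nbar x)) = (LINT x|haar K. u x) + eps * (LINT x|haar K. v x)"
proof -
  note sp = Ind_split[OF f, folded u_def v_def]
  have e: "f (nbar x) = u x + eps * inversion v x" for x
    using fun_cong[OF sp(3), of "nbar x"] by (simp add: weyl_emb_nbar[OF sp(2) z])
  have iv: "integrable (haar K) (inversion v)" "(LINT x|haar K. inversion v x) = (LINT x|haar K. v x)"
    using inversion_integral[OF sp(2)] by auto
  show "integrable (haar K) (\<lambda>x. f (nbar x))"
    unfolding e by (intro Bochner_Integration.integrable_add integrable_mult_right tf_integrable sp iv)
  show "(LINT x|haar K. f (nbar x)) = (LINT x|haar K. u x) + eps * (LINT x|haar K. v x)"
    unfolding e using tf_integrable[OF sp(1)] iv by simp
qed

text \<open>For densities the substitution x -> 1/x preserves the integral and the sign comes from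
  the determinant. Hence the vanishing of the integral is a condition invariant under the Weyl
  element.\<close>

lemma Ind_integral_weyl:
  assumes f: "f \<in> Ind K chi s" and z: "(zz s)\<^sup>2 = Q\<^sup>2"
  shows "(LINT x|haar K. left_translate weyl f (nbar x)) = eps * (LINT x|haar K. f (nbar x))"
proof -
  define u where "u x = (if x \<in> pid K 0 then f (nbar x) else 0)" for x
  define v where "v x = (if x \<in> pid K 1 then left_translate weyl f (nbar x) else 0)" for x
  note sp = Ind_split[OF f, folded u_def v_def]
  have u: "tf K u" and v: "tf K v" using sp(1,2) by (simp_all add: u_def[abs_def] v_def[abs_def])
  have s: "f = (\<lambda>g. emb s u g + left_translate weyl (emb s v) g)"
    using sp(3) unfolding u_def[abs_def] v_def[abs_def] .
  have "f (nbar x) = u x + eps * inversion v x" for x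
    using fun_cong[OF s, of "nbar x"] by (simp add: weyl_emb_nbar[OF v z])
  moreover have "left_translate weyl f = (\<lambda>g. left_translate weyl (emb s u) g + emb s v g)"
    by (subst s) (simp add: left_translate_add left_translate_weyl2)
  then have "left_translate weyl f (nbar x) = eps * inversion u x + v x" for x
    by (simp add: weyl_emb_nbar[OF u z])
  ultimately show ?thesis
    using inversion_integral[OF u] inversion_integral[OF v] tf_integrable[OF u] tf_integrable[OF v]
    by (simp add: distrib_left mult.assoc[symmetric])
qed

end

locale invariant_subspace = quad_char +
  fixes s :: complex and W :: "('a^2^2 \<Rightarrow> complex) set"
  assumes W_sub: "W \<subseteq> Ind K chi s"
    and W_zero: "(\<lambda>g. 0) \<in> W"
    and W_add: "f \<in> W \<Longrightarrow> h \<in> W \<Longrightarrow> (\<lambda>g. f g + h g) \<in> W"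
    and W_cmult: "f \<in> W \<Longrightarrow> (\<lambda>g. c * f g) \<in> W"
    and W_translate: "invertible g \<Longrightarrow> f \<in> W \<Longrightarrow> left_translate g f \<in> W"
begin

text \<open>The subspace seen on the affine line, which loses nothing by \<open>Ind_ext\<close>.
  Translations and dilations act visibly there; the Weyl element has to be applied in W.\<close>

definition VV :: "('a \<Rightarrow> complex) set" where
  "VV = {(\<lambda>x. f (nbar x)) | f. f \<in> W}"

lemma VV_I: "f \<in> W \<Longrightarrow> (\<lambda>x. f (nbar x)) \<in> VV"
  by (auto simp: VV_def)

lemma VV_add: assumes "u \<in> VV" "v \<in> VV" shows "(\<lambda>x. u x + v x) \<in> VV"
proof -
  obtain f h where "f \<in> W" "h \<in> W" "u = (\<lambda>x. f (nbar x))" "v = (\<lambda>x. h (nbar x))"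
    using assms by (auto simp: VV_def)
  then show ?thesis using VV_I[OF W_add[of f h]] by simp
qed

lemma VV_cmult: assumes "u \<in> VV" shows "(\<lambda>x. c * u x) \<in> VV"
proof -
  obtain f where "f \<in> W" "u = (\<lambda>x. f (nbar x))" using assms by (auto simp: VV_def)
  then show ?thesis using VV_I[OF W_cmult[of f c]] by simp
qed

lemma VV_zero: "(\<lambda>x. 0) \<in> VV"
  using VV_I[OF W_zero] by simp

lemma VV_diff: "u \<in> VV \<Longrightarrow> v \<in> VV \<Longrightarrow> (\<lambda>x. u x - v x) \<in> VV"
  using VV_add[of u "\<lambda>x. (-1) * v x"] VV_cmult[of v "-1"] by simp

lemma VV_sum: "finite I \<Longrightarrow> (\<And>i. i \<in> I \<Longrightarrow> u i \<in> VV) \<Longrightarrow> (\<lambda>x. \<Sum>i\<in>I. u i x) \<in> VV"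
  by (induction I rule: finite_induct) (auto simp: VV_zero intro: VV_add)

lemma VV_shift: assumes "u \<in> VV" shows "(\<lambda>x. u (x + y)) \<in> VV"
proof -
  obtain f where f: "f \<in> W" "u = (\<lambda>x. f (nbar x))" using assms by (auto simp: VV_def)
  have "left_translate (nbar (- y)) f \<in> W" by (rule W_translate[OF _ f(1)]) simp
  from VV_I[OF this] show ?thesis using f(2) by (simp add: translate_nbar)
qed

lemma VV_dil: assumes "u \<in> VV" "a \<noteq> 0" shows "(\<lambda>x. u (a * x)) \<in> VV"
proof -
  obtain f where f: "f \<in> W" "u = (\<lambda>x. f (nbar x))" using assms by (auto simp: VV_def)
  have "left_translate (mat2 a 0 0 1) f \<in> W" by (rule W_translate[OF _ f(1)]) (simp add: assms(2))
  then have "(\<lambda>x. inverse (qchar K chi (s + 1/2) a) * left_translate (mat2 a 0 0 1) f (nbar x)) \<in> VV"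
    by (intro VV_cmult VV_I)
  moreover have "f \<in> Ind K chi s" using f(1) W_sub by blast
  ultimately show ?thesis
    using f(2) qchar_nz[OF assms(2), of "s + 1/2"] by (simp add: translate_diag[OF _ assms(2)] mult.assoc[symmetric])
qed

lemma VV_emb: assumes "u \<in> VV" "tf K u" shows "emb s u \<in> W"
proof -
  obtain f where f: "f \<in> W" "u = (\<lambda>x. f (nbar x))" using assms by (auto simp: VV_def)
  then show ?thesis using emb_eqI[of f s] W_sub assms(2) by auto
qed

text \<open>The level of a period cannot decrease without bound, since any two points differ by an
  element of some \<open>pid K n\<close> and v would be constant.\<close>

lemma VV_min_period:
  assumes v: "v \<in> VV" "v x \<noteq> v y"
  shows "\<exists>m. (\<forall>x. \<forall>h\<in>pid K m. v (x + h) = v x) \<and> \<not> (\<forall>x. \<forall>h\<in>pid K (m - 1). v (x + h) = v x)"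
proof (rule ccontr)
  let ?P = "\<lambda>m. \<forall>x. \<forall>h\<in>pid K m. v (x + h) = v x"
  assume "\<not> ?thesis"
  then have step: "?P m \<Longrightarrow> ?P (m - 1)" for m by blast
  obtain f where f: "f \<in> W" "v = (\<lambda>x. f (nbar x))" using v by (auto simp: VV_def)
  then obtain m0 where "?P m0" using Ind_uniform[of f s] W_sub by auto
  then have P0: "?P m0" .
  have dn: "?P (m0 - int n)" for n
  proof (induction n)
    case 0
    show ?case using P0 by simp
  next
    case (Suc n)
    have "m0 - int (Suc n) = m0 - int n - 1" by simp
    then show ?case using step[OF Suc] by (simp only:)
  qed
  have "m0 - int (nat (m0 - min m0 (- int (nat (- nu K (x - y)))))) = min m0 (- int (nat (- nu K (x - y))))"
    by simp
  then have P: "?P (min m0 (- int (nat (- nu K (x - y)))))" using dn by metis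
  have "x - y \<in> pid K (min m0 (- int (nat (- nu K (x - y)))))"
    by (rule pid_mono[OF pid_nat]) simp
  from P[rule_format, OF this, of y] show False using v(2) by simp
qed

text \<open>The factor 1 / Q makes the integral 0. Up to scalars this is the only function that is
  radial, invariant under \<open>pid K m\<close>, supported in \<open>pid K (m - 1)\<close> and of
  integral 0.\<close>

definition DD :: "int \<Rightarrow> 'a \<Rightarrow> complex" where
  "DD m x = bl K 0 m x - bl K 0 (m - 1) x / Q"

text \<open>
  If \<open>m\<close> is the minimal period exponent of \<open>v\<close>, then \<open>v\<close> minus its average over cosets of \<open>pid K (m - 1)\<close>
  has sum zero over each such coset; by the asymptotics of the principal series it also has compact
  support.  Averaging a translate of it over the units leaves a multiple of the difference of two balls.
\<close>

lemma nonconst_DD: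
  assumes v: "v \<in> VV" "v x \<noteq> v y"
  shows "\<exists>m. DD m \<in> VV"
proof -
  let ?R = "rp 1 ` pid K 0"
  obtain m where m: "\<forall>x. \<forall>h\<in>pid K m. v (x + h) = v x" "\<not> (\<forall>x. \<forall>h\<in>pid K (m - 1). v (x + h) = v x)"
    using VV_min_period[OF v] by blast
  let ?p = "unif K powi (m - 1)"
  define Av where "Av x = (\<Sum>r\<in>?R. v (x + ?p * r)) / Q" for x
  have pR: "?p * r \<in> pid K (m - 1)" if "r \<in> ?R" for r
    using that rp_pid_iff[of 0 1] by (auto simp: pid_mult_iff)
  \<comment> \<open>The defining sum uses chosen representatives; the integral depends visibly only
    on the coset of x modulo \<open>pid K (m - 1)\<close>.\<close>
  have Av_int: "Av x = of_real (q powi m) * (LINT y|haar K. bl K x (m - 1) y * v y) / Q" for x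
    using integral_coset_sum[of m v x] m(1) q_nz by (simp add: Av_def power_int_minus)
  have Av_inv: "Av (x + h) = Av x" if "h \<in> pid K (m - 1)" for x h
    unfolding Av_int using bl_cong[of "x + h" x "m - 1"] that by simp
  define g where "g x = v x - Av x" for x
  have Av_VV: "Av \<in> VV"
  proof -
    have "(\<lambda>x. (1 / Q) * (\<Sum>r\<in>?R. v (x + ?p * r))) \<in> VV"
      by (intro VV_cmult VV_sum finite_rp1 VV_shift v)
    then show ?thesis by (simp add: Av_def[abs_def])
  qed
  have g_VV: "g \<in> VV" unfolding g_def[abs_def] by (rule VV_diff[OF v(1) Av_VV])
  have g_inv: "g (x + h) = g x" if "h \<in> pid K m" for x h
    using m(1) that Av_inv[OF pid_mono[OF that], of x] by (simp add: g_def)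
  have g_sum: "(\<Sum>r\<in>?R. g (x + ?p * r)) = 0" for x
  proof -
    have "(\<Sum>r\<in>?R. Av (x + ?p * r)) = (\<Sum>r\<in>?R. Av x)"
      by (rule sum.cong[OF refl], rule Av_inv, rule pR)
    also have "\<dots> = Q * Av x" by (simp add: card_rp1)
    also have "\<dots> = (\<Sum>r\<in>?R. v (x + ?p * r))" by (simp add: Av_def)
    finally show ?thesis by (simp add: g_def sum_subtractf)
  qed
  have "\<exists>x. g x \<noteq> 0"
  proof (rule ccontr)
    assume "\<nexists>x. g x \<noteq> 0"
    then have "v x = Av x" for x by (simp add: g_def)
    then show False using m(2) Av_inv by metis
  qed
  then obtain x0 where x0: "g x0 \<noteq> 0" by blast
  obtain f where f: "f \<in> W" "v = (\<lambda>x. f (nbar x))" using v by (auto simp: VV_def)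
  then obtain R' c where R': "\<forall>x. x \<notin> pid K R' \<longrightarrow> v x = c * zz s powi (2 * nu K x)"
    using Ind_asymp[of f s] W_sub by auto
  \<comment> \<open>Outside this ball translation by elements of level m - 1 preserves the
    valuation, on which alone v depends there, so v equals its average and g vanishes.\<close>
  define R where "R = min R' (m - 1)"
  have g_supp: "x \<in> pid K R" if "g x \<noteq> 0" for x
  proof (rule ccontr)
    assume x: "x \<notin> pid K R"
    have "v (x + ?p * r) = v x" if "r \<in> ?R" for r
    proof -
      have h: "?p * r \<in> pid K R" using pid_mono[OF pR[OF that]] by (simp add: R_def)
      have "x \<notin> pid K R'" using x pid_mono[of x R' R] by (auto simp: R_def)
      moreover have "x + ?p * r \<notin> pid K R" using x pid_add_cancel[OF h] by blast
      then have "x + ?p * r \<notin> pid K R'" using pid_mono[of "x + ?p * r" R' R] by (auto simp: R_def)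
      ultimately show ?thesis using R' nu_add_eq(2)[OF x h] by simp
    qed
    then have "Av x = v x" by (simp add: Av_def card_rp1)
    then show False using that by (simp add: g_def)
  qed
  have g_tf: "tf K g" by (rule tfI[where N = m and M = R]) (use g_inv g_supp in auto)
  define g0 where "g0 x = g (x + x0)" for x
  have g0_VV: "g0 \<in> VV" unfolding g0_def[abs_def] by (rule VV_shift[OF g_VV])
  have g0_tf: "tf K g0" unfolding g0_def[abs_def] by (rule tf_shift[OF g_tf])
  have g0_inv: "g0 (x + h) = g0 x" if "h \<in> pid K m" for x h
    using g_inv[OF that, of "x + x0"] by (simp add: g0_def add_ac)
  have g0_sum: "(\<Sum>r\<in>?R. g0 (x + ?p * r)) = 0" for x
    using g_sum[of "x + x0"] by (simp add: g0_def add_ac)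
  obtain M where M: "\<forall>x. g0 x \<noteq> 0 \<longrightarrow> x \<in> pid K M" using g0_tf unfolding tf_def by auto
  \<comment> \<open>Level 1 preserves units and nonunits; level m - M makes h * x a period of g0 for
    every x in \<open>pid K M\<close>.\<close>
  define L where "L = max 1 (m - M)"
  define G where "G x y = sph 0 y * g0 (y * x)" for x y
  have G_inv: "G x (y + h) = G x y" if "h \<in> pid K L" for x y h
  proof -
    have h1: "h \<in> pid K 1" using pid_mono[OF that, of 1] by (simp add: L_def)
    have s: "sph 0 (y + h) = sph 0 y"
    proof (cases "y \<in> pid K 1")
      case True
      then have "y + h \<in> pid K 1" using pid_add h1 by blast
      then show ?thesis using True by (auto simp: sph_def pid_def)
    next
      case False
      from nu_add_eq[OF False h1] show ?thesis using False by (auto simp: sph_def)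
    qed
    show ?thesis
    proof (cases "sph 0 y = 0")
      case False
      then have y: "y \<in> unit_group K" "y + h \<in> unit_group K"
        using s by (auto simp: sph_def unit_iff split: if_splits)
      have "g0 ((y + h) * x) = g0 (y * x)"
      proof (cases "x \<in> pid K M")
        case True
        have "h * x \<in> pid K m" using pid_mono[OF pid_mult[OF that True], of m] by (simp add: L_def)
        then show ?thesis using g0_inv[of "h * x" "y * x"] by (simp add: distrib_right)
      next
        case False
        then have "y * x \<notin> pid K M" "(y + h) * x \<notin> pid K M"
          using y by (simp_all add: unit_iff pid_mult_iff)
        then show ?thesis using M by metis
      qed
      then show ?thesis using s by (simp add: G_def)
    qed (use s in \<open>simp add: G_def\<close>)
  qed
  have G_supp: "y \<in> pid K 0" if "G x y \<noteq> 0" for x y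
    using that by (auto simp: G_def sph_def pid_def split: if_splits)
  define U where "U = rp L ` pid K 0"
  have finU: "finite U" by (simp add: U_def finite_rp)
  define r where "r x = (\<Sum>c\<in>U. G x c)" for x
  \<comment> \<open>r is used in two forms: as a finite combination of dilates it lies in
    \<open>VV\<close>, and as an integral over the units it is invariant under them.\<close>
  have r_int: "(LINT y|haar K. G x y) = of_real (q powi (- L)) * r x" for x
  proof -
    have "(LINT y|haar K. G x y) = (LINT y|haar K. (\<Sum>c\<in>U. G x c * bl K c L y))"
      unfolding U_def by (rule Bochner_Integration.integral_cong[OF refl]) (rule tf_decomp[OF G_inv G_supp])
    also have "\<dots> = (\<Sum>c\<in>U. G x c * of_real (q powi (- L)))"
      by (subst Bochner_Integration.integral_sum) (auto intro!: integrable_mult_right simp: bl_integrable bl_integral)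
    also have "\<dots> = of_real (q powi (- L)) * r x"
      unfolding r_def by (subst sum_distrib_right[symmetric]) (rule mult.commute)
    finally show ?thesis .
  qed
  have r_rad: "r (b * x) = r x" if b: "b \<in> unit_group K" for b x
  proof -
    have G_tf: "tf K (G x)" by (rule tfI[where N = L and M = 0]) (use G_inv G_supp in auto)
    have b': "b \<noteq> 0" "nu K b = 0" using b by (auto simp: unit_iff)
    have "G (b * x) y = G x (b * y)" for y
      using b' by (auto simp: G_def sph_def nu_mult mult_ac)
    then have "(LINT y|haar K. G (b * x) y) = (LINT y|haar K. G x (b * y))" by simp
    also have "\<dots> = (LINT y|haar K. G x y)"
      using integral_scale[OF b'(1) tf_measurable[OF G_tf]] b' by simp
    finally show ?thesis using r_int q_nz by simp
  qed
  have r_VV: "r \<in> VV"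
  proof -
    have "(\<lambda>x. sph 0 c * g0 (c * x)) \<in> VV" if "c \<in> U" for c
      by (cases "c = 0") (auto simp: sph_def VV_zero intro!: VV_cmult VV_dil[OF g0_VV])
    then show ?thesis unfolding r_def[abs_def] G_def by (intro VV_sum finU)
  qed
  have Gm: "G (x + h) c = G x c" if "h \<in> pid K m" for x h c
  proof (cases "sph 0 c = 0")
    case False
    then have "c * h \<in> pid K m" using that by (auto simp: sph_def pid_mult_iff split: if_splits)
    then show ?thesis using g0_inv[of "c * h" "c * x"] by (simp add: G_def distrib_left)
  qed (simp add: G_def)
  then have r_inv: "r (x + h) = r x" if "h \<in> pid K m" for x h
    using that by (simp add: r_def)
  have r_int0: "(LINT y|haar K. bl K 0 (m - 1) y * r y) = 0"
  proof -
    have t: "tf K (\<lambda>y. bl K 0 (m - 1) y * g0 y)"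
      using tf_times[OF g0_tf, of "m - 1" "bl K 0 (m - 1)"] by (simp add: bl_0 pid_add_cancel)
    have i0: "(LINT y|haar K. bl K 0 (m - 1) y * g0 y) = 0"
      using integral_coset_sum[of m g0 0] g0_inv g0_sum[of 0] by simp
    have c: "integrable (haar K) (\<lambda>y. bl K 0 (m - 1) y * G y c) \<and> (LINT y|haar K. bl K 0 (m - 1) y * G y c) = 0" for c
    proof (cases "sph 0 c = 0")
      case False
      then have c: "c \<noteq> 0" "nu K c = 0" "sph 0 c = 1" by (auto simp: sph_def split: if_splits)
      have e: "bl K 0 (m - 1) y * G y c = bl K 0 (m - 1) (c * y) * g0 (c * y)" for y
        using c by (simp add: G_def bl_0 pid_mult_iff)
      show ?thesis unfolding e
        using integral_scale[OF c(1) tf_measurable[OF t]] i0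
          tf_integrable[OF tf_affine[OF t c(1), of 0]] by simp
    qed (simp add: G_def)
    have "(LINT y|haar K. bl K 0 (m - 1) y * r y) = (LINT y|haar K. (\<Sum>c\<in>U. bl K 0 (m - 1) y * G y c))"
      by (simp add: r_def sum_distrib_left)
    also have "\<dots> = (\<Sum>c\<in>U. 0)"
      by (subst Bochner_Integration.integral_sum) (use c in auto)
    finally show ?thesis by simp
  qed
  then have r_sum: "(\<Sum>\<rho>\<in>?R. r (?p * \<rho>)) = 0"
    using integral_coset_sum[of m r 0] r_inv q_nz by simp
  \<comment> \<open>At 0 every summand over a unit equals g0 0, so r 0 is g0 0 times the number of
    unit representatives; the representative of 1 is one of them.\<close>
  have r0: "r 0 \<noteq> 0"
  proof -
    have "r 0 = (\<Sum>c\<in>U. sph 0 c) * g0 0" by (simp add: r_def G_def sum_distrib_right)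
    moreover have "(\<Sum>c\<in>U. sph 0 c) = of_nat (card {c \<in> U. c \<noteq> 0 \<and> nu K c = 0})"
      using finU by (simp add: sph_def sum.If_cases Int_def)
    moreover have "rp L 1 \<in> {c \<in> U. c \<noteq> 0 \<and> nu K c = 0}"
    proof -
      have "1 \<notin> pid K L" by (simp add: L_def)
      from nu_add_eq[OF this rp_diff[of L 1]] show ?thesis by (auto simp: U_def)
    qed
    then have "card {c \<in> U. c \<noteq> 0 \<and> nu K c = 0} \<noteq> 0" using finU by (auto simp: card_eq_0_iff)
    ultimately show ?thesis using x0 by (simp add: g0_def)
  qed
  define v1 where "v1 = r ?p"
  have rad: "r x = r x'" if "x \<noteq> 0" "x' \<noteq> 0" "nu K x = nu K x'" for x x'
    using r_rad[of "x / x'" x'] that by (simp add: unit_iff nu_divide)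
  \<comment> \<open>Of the q cosets of \<open>pid K m\<close> in \<open>pid K (m - 1)\<close>, one
    contains 0 and r takes the value v1 on the others.\<close>
  have v1: "r 0 + (Q - 1) * v1 = 0"
  proof -
    have "r (?p * \<rho>) = (if \<rho> = rp 1 0 then r 0 else v1)" if "\<rho> \<in> ?R" for \<rho>
    proof (cases "\<rho> = rp 1 0")
      case True
      have "?p * \<rho> \<in> pid K m" using rp_diff[of 1 0] by (simp add: True pid_mult_iff)
      then show ?thesis using r_inv[of "?p * \<rho>" 0] True by simp
    next
      case False
      have "\<rho> \<notin> pid K 1"
      proof
        assume "\<rho> \<in> pid K 1"
        then have "\<rho> - rp 1 0 \<in> pid K 1" using pid_diff[OF _ rp_diff[of 1 0], of \<rho>] by simp
        then show False using False rp1_disjoint that by blast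
      qed
      moreover have "\<rho> \<in> pid K 0" using that rp_pid_iff[of 0 1] by auto
      ultimately have "\<rho> \<noteq> 0" "nu K \<rho> = 0" by (auto simp: pid_def)
      then show ?thesis using False by (simp add: v1_def) (rule rad, auto simp: nu_mult)
    qed
    then have "(\<Sum>\<rho>\<in>?R. r (?p * \<rho>)) = (\<Sum>\<rho>\<in>?R. if \<rho> = rp 1 0 then r 0 else v1)"
      by (rule sum.cong[OF refl])
    also have "\<dots> = (\<Sum>\<rho>\<in>?R. v1 + (if \<rho> = rp 1 0 then r 0 - v1 else 0))"
      by (rule sum.cong) auto
    also have "\<dots> = Q * v1 + (r 0 - v1)"
      using finite_rp1 by (simp add: sum.distrib card_rp1)
    finally show ?thesis using r_sum by (simp add: algebra_simps)
  qed
  \<comment> \<open>Outside \<open>pid K (m - 1)\<close> a radial function is constant on cosets of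
    this ideal, and the integral of r over each of them is 0.\<close>
  have r_out: "r x = 0" if x: "x \<notin> pid K (m - 1)" for x
  proof -
    have "bl K x (m - 1) y * r y = r x * bl K x (m - 1) y" for y
    proof (cases "y - x \<in> pid K (m - 1)")
      case True
      from nu_add_eq[OF x True] have "r y = r x" using x by (intro rad) auto
      then show ?thesis by simp
    qed (simp add: bl_def)
    then have "(LINT y|haar K. bl K x (m - 1) y * r y) = (LINT y|haar K. r x * bl K x (m - 1) y)"
      by (simp only:)
    then have "(LINT y|haar K. bl K x (m - 1) y * r y) = r x * of_real (q powi (- (m - 1)))"
      by (simp add: bl_integral)
    moreover have "(LINT y|haar K. bl K x (m - 1) y * r y) = 0"
    proof -
      have t: "tf K (\<lambda>y. bl K z (m - 1) y * g0 y)" for z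
        by (rule tf_times[OF g0_tf, where N = "m - 1"]) (simp add: bl_def coset_add)
      have i0: "(LINT y|haar K. bl K z (m - 1) y * g0 y) = 0" for z
        using integral_coset_sum[of m g0 z] g0_inv g0_sum[of z] by simp
      have c: "integrable (haar K) (\<lambda>y. bl K x (m - 1) y * G y c) \<and> (LINT y|haar K. bl K x (m - 1) y * G y c) = 0" for c
      proof (cases "sph 0 c = 0")
        case False
        then have c: "c \<noteq> 0" "nu K c = 0" "sph 0 c = 1" by (auto simp: sph_def split: if_splits)
        have e: "bl K x (m - 1) y * G y c = bl K (c * x) (m - 1) (c * y) * g0 (c * y)" for y
        proof -
          have "c * y - c * x \<in> pid K (m - 1) \<longleftrightarrow> y - x \<in> pid K (m - 1)"
            using c pid_mult_iff[of c "y - x" "m - 1"] by (simp add: right_diff_distrib)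
          then show ?thesis using c by (simp add: G_def bl_def)
        qed
        show ?thesis unfolding e
          using integral_scale[OF c(1) tf_measurable[OF t[of "c * x"]]] i0[of "c * x"]
            tf_integrable[OF tf_affine[OF t[of "c * x"] c(1), of 0]] by simp
      qed (simp add: G_def)
      have "(LINT y|haar K. bl K x (m - 1) y * r y) = (LINT y|haar K. (\<Sum>c\<in>U. bl K x (m - 1) y * G y c))"
        by (simp add: r_def sum_distrib_left)
      also have "\<dots> = (\<Sum>c\<in>U. 0)"
        by (subst Bochner_Integration.integral_sum) (use c in auto)
      finally show ?thesis by simp
    qed
    ultimately show ?thesis using q_nz by simp
  qed
  have Q1: "Q - 1 \<noteq> 0" using q_gt_1 by (metis eq_iff_diff_eq_0 of_nat_1 of_nat_eq_iff less_irrefl)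
  have r_DD: "r x = r 0 * Q / (Q - 1) * DD m x" for x
  proof -
    have v1': "v1 = - r 0 / (Q - 1)" using v1 Q1 by (simp add: field_simps add_eq_0_iff)
    consider "x \<in> pid K m" | "x \<notin> pid K m" "x \<in> pid K (m - 1)" | "x \<notin> pid K (m - 1)" by blast
    then show ?thesis
    proof cases
      case 1
      then have "r x = r 0" using r_inv[of x 0] by simp
      moreover have "x \<in> pid K (m - 1)" using pid_mono[OF 1] by simp
      ultimately show ?thesis using 1 Q1 by (simp add: DD_def bl_0 field_simps)
    next
      case 2
      then have "r x = v1" unfolding v1_def by (intro rad) (auto simp: pid_def)
      then show ?thesis using 2 Q1 v1' by (simp add: DD_def bl_0 field_simps)
    next
      case 3
      then have "x \<notin> pid K m" using pid_mono[of x m "m - 1"] by auto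
      then show ?thesis using 3 r_out by (simp add: DD_def bl_0)
    qed
  qed
  have "(\<lambda>x. (Q - 1) / (r 0 * Q) * r x) \<in> VV" by (rule VV_cmult[OF r_VV])
  moreover have "(Q - 1) / (r 0 * Q) * r x = DD m x" for x
    unfolding r_DD[of x] using r0 Q1 by simp
  ultimately show ?thesis by (intro exI[of _ m]) (simp add: fun_eq_iff cong: if_cong)
qed

lemma DD_all: assumes "DD m \<in> VV" shows "DD k \<in> VV"
proof -
  have "(\<lambda>x. DD m (unif K powi (m - k) * x)) \<in> VV" by (rule VV_dil[OF assms]) simp
  moreover have "DD m (unif K powi (m - k) * x) = DD k x" for x
    by (simp add: DD_def bl_0 pid_mult_iff)
  ultimately show ?thesis by (simp add: fun_eq_iff cong: if_cong)
qed

text \<open>Telescoping with translates of \<open>DD\<close>: modulo the subspace a ball is q^(-n)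
  times the concentric ball n levels larger.\<close>

lemma ball_reduce:
  assumes "DD m \<in> VV" shows "(\<lambda>x. bl K c (k + int n) x - bl K c k x / Q ^ n) \<in> VV"
proof (induction n)
  case 0
  then show ?case by (simp add: VV_zero)
next
  case (Suc n)
  have "(\<lambda>x. DD (k + int (Suc n)) (x + (- c)) + (1 / Q) * (bl K c (k + int n) x - bl K c k x / Q ^ n)) \<in> VV"
    by (intro VV_add VV_cmult VV_shift DD_all[OF assms] Suc)
  moreover have "DD (k + int (Suc n)) (x + (- c)) + (1 / Q) * (bl K c (k + int n) x - bl K c k x / Q ^ n) =
      bl K c (k + int (Suc n)) x - bl K c k x / Q ^ Suc n" for x
    by (simp add: DD_def bl_def diff_divide_distrib)
  ultimately show ?case by simp
qed

text \<open>By \<open>ball_reduce\<close> all small balls of u become the same multiple of one large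
  ball, whose total coefficient is proportional to the integral of u.\<close>

lemma VV_integral_zero:
  assumes D: "DD m \<in> VV" and u: "tf K u" and i: "(LINT x|haar K. u x) = 0"
  shows "u \<in> VV"
proof -
  obtain N M where NM: "\<forall>x. \<forall>h\<in>pid K N. u (x + h) = u x" "\<forall>x. u x \<noteq> 0 \<longrightarrow> x \<in> pid K M"
    using u unfolding tf_def by auto
  define M' where "M' = min M N"
  define C where "C = rp N ` pid K M'"
  define n where "n = nat (N - M')"
  have N: "N = M' + int n" by (simp add: n_def M'_def)
  have u': "u x = (\<Sum>c\<in>C. u c * bl K c N x)" for x unfolding C_def
  proof (rule tf_decomp)
    show "u (x + h) = u x" if "h \<in> pid K N" for x h using NM(1) that by blast
    show "x \<in> pid K M'" if "u x \<noteq> 0" for x using NM(2) that pid_mono[of x M M'] by (auto simp: M'_def)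
  qed
  have finC: "finite C" by (simp add: C_def finite_rp)
  have "c \<in> pid K M'" if "c \<in> C" for c
    using that rp_pid_iff[of M' N] by (auto simp: C_def M'_def)
  then have b: "bl K c M' = bl K 0 M'" if "c \<in> C" for c
    using bl_cong[of c 0 M'] that by simp
  have "(LINT x|haar K. u x) = (LINT x|haar K. (\<Sum>c\<in>C. u c * bl K c N x))"
    by (rule Bochner_Integration.integral_cong[OF refl u'])
  also have "\<dots> = (\<Sum>c\<in>C. u c * of_real (q powi (- N)))"
    by (subst Bochner_Integration.integral_sum) (auto intro!: integrable_mult_right simp: bl_integrable bl_integral)
  finally have "(\<Sum>c\<in>C. u c) * of_real (q powi (- N)) = 0"
    unfolding i by (subst sum_distrib_right) (rule sym)
  then have s0: "(\<Sum>c\<in>C. u c) = 0" using q_nz by simp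
  have "(\<lambda>x. \<Sum>c\<in>C. u c * (bl K c (M' + int n) x - bl K c M' x / Q ^ n)) \<in> VV"
    by (intro VV_sum VV_cmult ball_reduce[OF D] finC)
  moreover have "(\<Sum>c\<in>C. u c * (bl K c (M' + int n) x - bl K c M' x / Q ^ n)) = u x" for x
  proof -
    have "(\<Sum>c\<in>C. u c * (bl K c (M' + int n) x - bl K c M' x / Q ^ n)) =
        (\<Sum>c\<in>C. u c * bl K c N x - u c * (bl K 0 M' x / Q ^ n))"
      by (rule sum.cong[OF refl]) (simp add: b N right_diff_distrib)
    also have "\<dots> = u x - (\<Sum>c\<in>C. u c) * (bl K 0 M' x / Q ^ n)"
      unfolding sum_subtractf sum_distrib_right[symmetric] u'[symmetric] ..
    finally show ?thesis by (simp add: s0)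
  qed
  ultimately show ?thesis by simp
qed

lemma full_if_VV_tf:
  assumes "\<And>u. tf K u \<Longrightarrow> u \<in> VV" shows "W = Ind K chi s"
proof
  show "Ind K chi s \<subseteq> W"
  proof
    fix f assume f: "f \<in> Ind K chi s"
    note sp = Ind_split[OF f]
    show "f \<in> W"
      by (subst sp(3)) (intro W_add W_translate VV_emb assms sp(1,2) weyl_invertible)
  qed
qed (rule W_sub)

text \<open>The Weyl element carries some test function of integral 0 to a test function of nonzero
  integral. Subtracting a multiple of the latter makes the integral of any test function
  vanish.\<close>

lemma nonconst_full:
  assumes v: "v \<in> VV" "v x \<noteq> v y" and z: "(zz s)\<^sup>2 \<noteq> Q\<^sup>2"
  shows "W = Ind K chi s"
proof -
  obtain m where D: "DD m \<in> VV" using nonconst_DD[OF v] by blast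
  \<comment> \<open>Two balls off 0 with opposite integrals. Inversion fixes the first and enlarges
    the second with the weight \<open>zz s\<close>^(-2), so that the integral becomes 1/Q - Q /
    (\<open>zz s\<close>)^2 up to sign.\<close>
  define u where "u x = bl K 1 1 x - Q * bl K (unif K) 2 x" for x
  have u: "tf K u" unfolding u_def[abs_def] by (intro tf_diff tf_cmult tf_bl)
  have "(LINT x|haar K. u x) = of_real (q powi (- 1)) - Q * of_real (q powi (- 2))"
    unfolding u_def by (subst Bochner_Integration.integral_diff) (simp_all add: bl_integrable bl_integral integrable_mult_right)
  also have "\<dots> = 0" by (simp add: power_int_minus power2_eq_square)
  finally have "u \<in> VV" by (intro VV_integral_zero[OF D u])
  then have W: "left_translate weyl (emb s u) \<in> W" by (intro W_translate VV_emb u) simp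
  define w where "w x = eps * (bl K 1 1 x - Q * zz s powi (- 2) * bl K (1 / unif K) 0 x)" for x
  have w: "tf K w" unfolding w_def[abs_def] by (intro tf_diff tf_cmult tf_bl)
  have "left_translate weyl (emb s u) (nbar x) = w x" for x
  proof (cases "x = 0")
    case True
    have "- (1 / unif K) \<notin> pid K 0" by (simp add: pid_def nu_divide)
    then show ?thesis using True
      by (simp add: left_translate_weyl w_def bl_def) (simp add: nbar_mat2 weyl_mult emb_mat2)
  next
    case False
    have "unif K \<notin> pid K 2" by (simp add: pid_def)
    from inversion_twist[OF this False, of "zz s"] inversion_twist[of 1 1 x "zz s", OF _ False]
    have t: "zz s powi (2 * nu K x) * bl K (unif K) 2 (1 / x) = zz s powi (- 2) * bl K (1 / unif K) 0 x"
      "zz s powi (2 * nu K x) * bl K 1 1 (1 / x) = bl K 1 1 x" by simp_all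
    have "left_translate weyl (emb s u) (nbar x) = eps * (zz s powi (2 * nu K x) * bl K 1 1 (1 / x) - Q * (zz s powi (2 * nu K x) * bl K (unif K) 2 (1 / x)))"
      using weyl_nbar[OF emb_Ind[OF u] False, of s] by (simp add: u_def algebra_simps)
    then show ?thesis unfolding t by (simp add: w_def mult.assoc)
  qed
  then have w_VV: "w \<in> VV" using VV_I[OF W] by (simp add: fun_eq_iff cong: if_cong)
  have "(LINT x|haar K. w x) = eps * (of_real (q powi (- 1)) - Q * zz s powi (- 2) * of_real (q powi 0))"
    unfolding w_def by (subst Bochner_Integration.integral_mult_right_zero, subst Bochner_Integration.integral_diff)
      (simp_all add: bl_integrable bl_integral integrable_mult_right)
  also have "of_real (q powi (- 1)) - Q * zz s powi (- 2) * of_real (q powi 0) = 1 / Q - Q / (zz s)\<^sup>2"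
    by (simp add: power_int_minus inverse_eq_divide)
  finally have "(LINT x|haar K. w x) = eps * (1 / Q - Q / (zz s)\<^sup>2)" .
  then have wi: "(LINT x|haar K. w x) \<noteq> 0"
  proof -
    have "1 / Q - Q / y = (y - Q\<^sup>2) / (Q * y)" if "y \<noteq> 0" for y
      using that by (simp add: field_simps power2_eq_square)
    from this[of "(zz s)\<^sup>2"] have "1 / Q - Q / (zz s)\<^sup>2 \<noteq> 0" using z by simp
    then show ?thesis using \<open>(LINT x|haar K. w x) = eps * (1 / Q - Q / (zz s)\<^sup>2)\<close> by simp
  qed
  show ?thesis
  proof (rule full_if_VV_tf)
    fix f assume f: "tf K f"
    define c where "c = (LINT x|haar K. f x) / (LINT x|haar K. w x)"
    have "(LINT x|haar K. f x - c * w x) = (LINT x|haar K. f x) - c * (LINT x|haar K. w x)"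
      using tf_integrable[OF f] tf_integrable[OF w] by simp
    also have "\<dots> = 0" using wi by (simp add: c_def)
    finally have "(\<lambda>x. f x - c * w x) \<in> VV"
      by (intro VV_integral_zero[OF D] tf_diff tf_cmult f w)
    from VV_add[OF this VV_cmult[OF w_VV, of c]] show "f \<in> VV" by simp
  qed
qed

text \<open>If the integral of f is 0, its two charts may still have nonzero integrals. These are
  moved to the ball 1 + \<open>pid K 1\<close>, where the Weyl element acts by a sign, and there
  they cancel. As the kernel of one functional, the Steinberg space is maximal.\<close>

lemma nonconst_steinberg:
  assumes v: "v \<in> VV" "v x \<noteq> v y" and z: "(zz s)\<^sup>2 = Q\<^sup>2"
  shows "W = steinberg K chi s \<or> W = Ind K chi s" "steinberg K chi s \<subseteq> W"
proof -
  obtain m where D: "DD m \<in> VV" using nonconst_DD[OF v] by blast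
  show st: "steinberg K chi s \<subseteq> W"
  proof
    fix f assume "f \<in> steinberg K chi s"
    then have f: "f \<in> Ind K chi s" and i: "(LINT y|haar K. f (nbar y)) = 0" by (auto simp: steinberg_def)
    define u where "u = (\<lambda>x. if x \<in> pid K 0 then f (nbar x) else 0)"
    define v where "v = (\<lambda>x. if x \<in> pid K 1 then left_translate weyl f (nbar x) else 0)"
    note sp = Ind_split[OF f, folded u_def v_def]
    \<comment> \<open>The ball 1 + \<open>pid K 1\<close> has integral 1 / Q, so a and b are the
      multiples of it that carry the integrals of u and v.\<close>
    define a where "a = Q * (LINT x|haar K. u x)"
    define b where "b = Q * (LINT x|haar K. v x)"
    have ab: "a + eps * b = 0"
    proof -
      have "a + eps * b = Q * ((LINT x|haar K. u x) + eps * (LINT x|haar K. v x))"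
        by (simp add: a_def b_def algebra_simps)
      also have "(LINT x|haar K. u x) + eps * (LINT x|haar K. v x) = 0"
        using Ind_integral(2)[OF f z] i unfolding u_def v_def by (simp only:)
      finally show ?thesis by simp
    qed
    have i1: "(LINT x|haar K. bl K 1 1 x) = 1 / Q"
      by (simp add: bl_integral power_int_minus inverse_eq_divide)
    have sub: "(\<lambda>x. w x - Q * (LINT x|haar K. w x) * bl K 1 1 x) \<in> VV" if w: "tf K w" for w
    proof (rule VV_integral_zero[OF D])
      show "tf K (\<lambda>x. w x - Q * (LINT x|haar K. w x) * bl K 1 1 x)" by (intro tf_diff tf_cmult tf_bl w)
      have "(LINT x|haar K. w x - Q * (LINT x|haar K. w x) * bl K 1 1 x) = (LINT x|haar K. w x) - Q * (LINT x|haar K. w x) * (1 / Q)"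
        using tf_integrable[OF w] bl_integrable[of 1 1] by (simp add: i1)
      then show "(LINT x|haar K. w x - Q * (LINT x|haar K. w x) * bl K 1 1 x) = 0" by simp
    qed
    define u' where "u' = (\<lambda>x. u x - a * bl K 1 1 x)"
    define v' where "v' = (\<lambda>x. v x - b * bl K 1 1 x)"
    have t: "tf K u'" "tf K v'" unfolding u'_def v'_def by (intro tf_diff tf_cmult tf_bl sp)+
    have V: "u' \<in> VV" "v' \<in> VV" using sub[OF sp(1)] sub[OF sp(2)] by (simp_all only: u'_def v'_def a_def b_def)
    have uu: "u = (\<lambda>x. u' x + a * bl K 1 1 x)" "v = (\<lambda>x. v' x + b * bl K 1 1 x)"
      by (simp_all add: u'_def v'_def)
    have "f g = emb s u' g + left_translate weyl (emb s v') g" for g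
    proof -
      have "f g = emb s u g + left_translate weyl (emb s v) g" using fun_cong[OF sp(3)] .
      also have "emb s u g = emb s u' g + a * emb s (bl K 1 1) g"
        by (subst uu(1)) (simp add: emb_add emb_cmult)
      also have "left_translate weyl (emb s v) g = left_translate weyl (emb s v') g + b * (eps * emb s (bl K 1 1) g)"
        by (subst uu(2)) (simp add: emb_add emb_cmult left_translate_add left_translate_cmult emb_weyl_unit)
      finally have "f g = emb s u' g + left_translate weyl (emb s v') g + (a + eps * b) * emb s (bl K 1 1) g"
        by (simp add: algebra_simps)
      then show ?thesis by (simp add: ab)
    qed
    then have "f = (\<lambda>g. emb s u' g + left_translate weyl (emb s v') g)" by blast
    then show "f \<in> W" by (simp only:) (intro W_add W_translate VV_emb V t weyl_invertible)
  qed
  show "W = steinberg K chi s \<or> W = Ind K chi s"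
  proof (cases "W \<subseteq> steinberg K chi s")
    case False
    then obtain f where f: "f \<in> W" "(LINT y|haar K. f (nbar y)) \<noteq> 0"
      using W_sub by (auto simp: steinberg_def)
    have fI: "f \<in> Ind K chi s" using f W_sub by blast
    have "h \<in> W" if h: "h \<in> Ind K chi s" for h
    proof -
      define c where "c = (LINT y|haar K. h (nbar y)) / (LINT y|haar K. f (nbar y))"
      have "(LINT y|haar K. h (nbar y) - c * f (nbar y)) = 0"
        using Ind_integral(1)[OF h z] Ind_integral(1)[OF fI z] f(2) by (simp add: c_def)
      then have "(\<lambda>g. h g - c * f g) \<in> steinberg K chi s"
        unfolding steinberg_def using Ind_diff[OF h Ind_cmult[OF fI, of c]] by simp
      then have "(\<lambda>g. (h g - c * f g) + c * f g) \<in> W" using st f(1) by (intro W_add W_cmult) auto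
      then show ?thesis by simp
    qed
    then show ?thesis using W_sub by blast
  qed (use st in blast)
qed

text \<open>A constant has to agree with the asymptotic form k \<open>zz s\<close>^(2 nu). Two
  consecutive valuations then force the constant to be 0 unless (\<open>zz s\<close>)^2 = 1.\<close>

lemma nonzero_nonconst:
  assumes f: "f \<in> W" "f \<noteq> (\<lambda>g. 0)" and z: "(zz s)\<^sup>2 \<noteq> 1"
  shows "\<exists>v\<in>VV. \<exists>x y. v x \<noteq> v y"
proof (rule ccontr)
  assume "\<not> ?thesis"
  then have "\<forall>v\<in>VV. \<forall>x y. v x = v y" by simp
  from bspec[OF this VV_I[OF f(1)]] have c: "f (nbar x) = f (nbar y)" for x y by simp
  have fI: "f \<in> Ind K chi s" using f W_sub by blast
  obtain R k where R: "\<forall>x. x \<notin> pid K R \<longrightarrow> f (nbar x) = k * zz s powi (2 * nu K x)"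
    using Ind_asymp[OF fI] by blast
  have "f (nbar 0) = k * zz s powi (2 * n)" if "n < R" for n
    using R[rule_format, of "unif K powi n"] that c[of 0 "unif K powi n"] by (simp add: pid_def)
  from this[of "R - 1"] this[of "R - 2"]
  have e: "f (nbar 0) = k * zz s powi (2 * (R - 1))" "f (nbar 0) = k * zz s powi (2 * (R - 2))" by simp_all
  have "zz s powi (2 * (R - 1)) = zz s powi (2 * (R - 2)) * (zz s)\<^sup>2"
  proof -
    have "2 * (R - 1) = 2 * (R - 2) + 2" by simp
    moreover have "zz s powi (2 * (R - 2) + 2) = zz s powi (2 * (R - 2)) * zz s powi 2"
      by (rule power_int_add) simp
    ultimately show ?thesis by (simp only: power_int_numeral)
  qed
  then have "f (nbar 0) = (k * zz s powi (2 * (R - 2))) * (zz s)\<^sup>2"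
    by (subst e(1)) (simp only: mult.assoc)
  then have "f (nbar 0) = f (nbar 0) * (zz s)\<^sup>2" by (simp only: e(2)[symmetric])
  then have "f (nbar 0) * (1 - (zz s)\<^sup>2) = 0" by (simp add: right_diff_distrib)
  then have "f (nbar 0) = 0" using z by simp
  then have "f (nbar x) = 0" for x using c[of x 0] by simp
  then have "f = (\<lambda>g. 0)" by (intro Ind_ext[OF fI Ind_zero]) simp
  then show False using f(2) by simp
qed

end

section \<open>The quadratic extension\<close>

lemma (in local_field) haar_sigma_finite: "sigma_finite_measure (haar K)"
proof
  show "\<exists>A. countable A \<and> A \<subseteq> sets (haar K) \<and> \<Union> A = space (haar K) \<and> (\<forall>a\<in>A. emeasure (haar K) a \<noteq> \<infinity>)"
  proof (intro exI[of _ "range (\<lambda>i::nat. pid K (- int i))"] conjI ballI)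
    show "range (\<lambda>i::nat. pid K (- int i)) \<subseteq> sets (haar K)" by auto
    show "\<Union> (range (\<lambda>i::nat. pid K (- int i))) = space (haar K)"
    proof (intro set_eqI iffI)
      fix x
      show "x \<in> \<Union> (range (\<lambda>i::nat. pid K (- int i)))" using pid_nat[of x] by (rule UN_I[OF UNIV_I])
    qed simp
  qed (auto simp: emeasure_pid)
qed

locale quad_ext = F: local_field F + E: local_field E
  for F :: "'f::{field,metric_space} lf" and E :: "'e::{field,metric_space} lf" +
  fixes j :: "'f \<Rightarrow> 'e" and \<alpha> :: 'e
  assumes ext: "quadratic_extension F E j \<alpha>"
begin

lemma j_1 [simp]: "j 1 = 1" and j_add [simp]: "j (a + b) = j a + j b" and j_mult [simp]: "j (a * b) = j a * j b"
  and j_cont: "continuous_on UNIV j" and alpha_notin: "\<alpha> \<notin> range j"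
  and ex_coords: "\<exists>a b. x = j a + j b * \<alpha>"
  using ext by (simp_all add: quadratic_extension_def)

lemma j_0 [simp]: "j 0 = 0"
proof -
  have "j 0 + j 0 = j 0 + 0" using j_add[of 0 0] by (simp only: add_0_right)
  then show ?thesis by (rule add_left_imp_eq)
qed

lemma j_minus [simp]: "j (- a) = - j a"
  using j_add[of a "- a"] by (metis add.commute add.right_inverse eq_neg_iff_add_eq_0 j_0)

lemma j_diff [simp]: "j (a - b) = j a - j b"
  using j_add[of a "- b"] by (simp del: j_add)

lemma j_eq_0 [simp]: "j a = 0 \<longleftrightarrow> a = 0"
proof
  assume "j a = 0"
  then show "a = 0" using j_mult[of a "inverse a"] by (cases "a = 0") (simp_all del: j_mult)
qed simp

lemma j_inverse [simp]: "j (inverse a) = inverse (j a)"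
proof (cases "a = 0")
  case False
  then have "j a * j (inverse a) = 1" using j_mult[of a "inverse a"] by simp
  then show ?thesis by (metis inverse_unique)
qed simp

lemma j_divide [simp]: "j (a / b) = j a / j b"
  by (simp add: divide_inverse)

lemma j_power [simp]: "j (a ^ n) = j a ^ n"
  by (induction n) auto

lemma j_powi [simp]: "j (a powi n) = j a powi n"
  by (simp add: power_int_def)

lemma coords_unique: "j a + j b * \<alpha> = j a' + j b' * \<alpha> \<longleftrightarrow> a = a' \<and> b = b'"
proof
  assume e: "j a + j b * \<alpha> = j a' + j b' * \<alpha>"
  then have e': "j (b - b') * \<alpha> = j (a' - a)" by (simp add: algebra_simps)
  have "b = b'"
  proof (rule ccontr)
    assume "b \<noteq> b'"
    then have "j (b - b') \<noteq> 0" using j_eq_0[of "b - b'"] by simp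
    then have "\<alpha> = j (a' - a) / j (b - b')" using e' by (simp add: eq_divide_eq mult.commute del: j_diff)
    then have "\<alpha> = j ((a' - a) / (b - b'))" by (simp only: j_divide)
    then show False using alpha_notin by blast
  qed
  moreover from this have "j (a - a') = 0" using e by simp
  ultimately show "a = a' \<and> b = b'" using j_eq_0[of "a - a'"] by simp
qed simp

abbreviation "c1 \<equiv> coord1 j \<alpha>"
abbreviation "c2 \<equiv> coord2 j \<alpha>"

lemma c1_eq [simp]: "c1 (j a + j b * \<alpha>) = a"
  unfolding coord1_def by (rule the_equality) (auto simp: coords_unique)

lemma c2_eq [simp]: "c2 (j a + j b * \<alpha>) = b"
  unfolding coord2_def by (rule the_equality) (auto simp: coords_unique)

lemma coords: "x = j (c1 x) + j (c2 x) * \<alpha>"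
  using ex_coords[of x] by auto

lemma c1_add [simp]: "c1 (x + y) = c1 x + c1 y" and c2_add [simp]: "c2 (x + y) = c2 x + c2 y"
proof -
  have "x + y = j (c1 x + c1 y) + j (c2 x + c2 y) * \<alpha>"
    by (subst coords[of x], subst coords[of y]) (simp add: algebra_simps)
  then show "c1 (x + y) = c1 x + c1 y" "c2 (x + y) = c2 x + c2 y" using c1_eq c2_eq by metis+
qed

lemma c1_jmult [simp]: "c1 (j a * x) = a * c1 x" and c2_jmult [simp]: "c2 (j a * x) = a * c2 x"
proof -
  have "j a * x = j (a * c1 x) + j (a * c2 x) * \<alpha>"
    by (subst coords[of x]) (simp add: algebra_simps)
  then show "c1 (j a * x) = a * c1 x" "c2 (j a * x) = a * c2 x" using c1_eq c2_eq by metis+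
qed

lemma c1_j [simp]: "c1 (j a) = a" and c2_j [simp]: "c2 (j a) = 0"
  using c1_eq[of a 0] c2_eq[of a 0] by simp_all

lemma c1_0 [simp]: "c1 0 = 0" and c2_0 [simp]: "c2 0 = 0"
  using c1_j[of 0] c2_j[of 0] by simp_all

lemma c1_jalpha [simp]: "c1 (j a * \<alpha>) = 0" and c2_jalpha [simp]: "c2 (j a * \<alpha>) = a"
  using c1_eq[of 0 a] c2_eq[of 0 a] by simp_all

lemma c1_alpha [simp]: "c1 \<alpha> = 0" and c2_alpha [simp]: "c2 \<alpha> = 1"
  using c1_jalpha[of 1] c2_jalpha[of 1] by simp_all

lemma c1_minus [simp]: "c1 (- x) = - c1 x" and c2_minus [simp]: "c2 (- x) = - c2 x"
  using c1_jmult[of "-1" x] c2_jmult[of "-1" x] by (simp_all del: c1_jmult c2_jmult)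

lemma c1_diff [simp]: "c1 (x - y) = c1 x - c1 y" and c2_diff [simp]: "c2 (x - y) = c2 x - c2 y"
  using c1_add[of x "-y"] c2_add[of x "-y"] by (simp_all del: c1_add c2_add)

lemma alpha_nz [simp]: "\<alpha> \<noteq> 0"
  using alpha_notin j_0 by (metis rangeI)

abbreviation "dd \<equiv> alpha_sq j \<alpha>"

lemma j_inj: "j a = j b \<longleftrightarrow> a = b"
  using j_eq_0[of "a - b"] by (simp del: j_eq_0)

lemma j_dd: "j dd = \<alpha>\<^sup>2" and dd_nz [simp]: "dd \<noteq> 0"
proof -
  obtain d where d: "\<alpha>\<^sup>2 = j d" using ext by (auto simp: quadratic_extension_def)
  have "dd = d" unfolding alpha_sq_def by (rule the_equality) (simp_all add: d j_inj)
  then show 1: "j dd = \<alpha>\<^sup>2" by (simp add: d)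
  have "j dd \<noteq> 0" unfolding 1 by simp
  then show "dd \<noteq> 0" by auto
qed

section \<open>Ramification index and valuations on the subfield\<close>

definition ram :: int where "ram = nu E (j (unif F))"

text \<open>The comparison of the two valuations starts from topology: the continuous image of a
  compact set is bounded.\<close>

lemma j_pid0_bounded: "\<exists>M. \<forall>x\<in>pid F 0. j x \<in> pid E M"
proof -
  have "compact (j ` pid F 0)"
    by (rule compact_continuous_image[OF continuous_on_subset[OF j_cont] F.compact_pid]) simp
  then have "bounded (j ` pid F 0)" by (rule compact_imp_bounded)
  then obtain B where B: "\<forall>y\<in>j ` pid F 0. dist 0 y \<le> B" using bounded_any_center[of _ 0] by blast
  obtain n where n: "B < E.q ^ n" using real_arch_pow[OF E.q_gt_1] by blast
  have "j x \<in> pid E (- int n)" if "x \<in> pid F 0" for x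
  proof -
    have "dist (j x) 0 \<le> B" using B that by (simp add: dist_commute)
    then have "dist (j x) 0 \<le> E.q powi (- (- int n))" using n by simp
    then show ?thesis by (simp only: E.dist_le_iff diff_zero)
  qed
  then show ?thesis by blast
qed

text \<open>A unit of F with negative valuation in E would have powers of unbounded size in the
  bounded image of the integers.\<close>

lemma nu_j_unit: assumes "u \<in> unit_group F" shows "nu E (j u) = 0"
proof -
  obtain M where M: "\<And>x. x \<in> pid F 0 \<Longrightarrow> j x \<in> pid E M" using j_pid0_bounded by blast
  have *: "0 \<le> nu E (j u)" if u: "u \<in> unit_group F" for u
  proof (rule ccontr)
    assume neg: "\<not> ?thesis"
    let ?n = "nat (\<bar>M\<bar> + 1)"
    have "u ^ ?n \<in> unit_group F" by (rule F.unit_pow[OF u])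
    then have u': "u ^ ?n \<in> pid F 0" "u ^ ?n \<noteq> 0" by (auto simp: F.unit_iff pid_def)
    have "M \<le> nu E (j (u ^ ?n))" using M[OF u'(1)] u'(2) by (simp add: pid_def)
    also have "nu E (j (u ^ ?n)) = int ?n * nu E (j u)"
      using u by (simp only: j_power) (rule E.nu_power, simp add: F.unit_iff)
    also have "\<dots> \<le> int ?n * (- 1)" using neg by (intro mult_left_mono) auto
    finally show False by simp
  qed
  have "nu E (j (inverse u)) = - nu E (j u)"
    using assms by (simp add: F.unit_iff E.nu_inverse)
  then show ?thesis using *[OF assms] *[OF F.unit_inverse[OF assms]] by simp
qed

lemma nu_j: assumes "x \<noteq> 0" shows "nu E (j x) = ram * nu F x"
proof -
  let ?u = "unif F powi (- nu F x) * x"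
  have u: "?u \<in> unit_group F" by (rule F.unit_part[OF assms])
  have x: "x = unif F powi (nu F x) * ?u" by (simp add: power_int_minus)
  have "j x = j (unif F) powi (nu F x) * j ?u" by (subst x) (simp del: j_mult add: j_mult[of _ ?u])
  also have "nu E \<dots> = nu F x * ram + nu E (j ?u)"
    using assms by (subst E.nu_mult) (simp_all add: E.nu_powi ram_def)
  finally show ?thesis using nu_j_unit[OF u] by (simp add: mult.commute)
qed

lemma ram_pos: "0 < ram"
proof -
  have "open (pid E 1)" using E.open_coset[of 0 1] by simp
  then have "open (j -` pid E 1)" using continuous_on_open_vimage[OF open_UNIV, of j] j_cont by auto
  then obtain n where n: "\<forall>h\<in>pid F n. 0 + h \<in> j -` pid E 1"
    using bspec[OF iffD1[OF F.open_lf_iff], of "j -` pid E 1" 0] by auto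
  have "unif F powi (max n 1) \<in> pid F n" by (simp add: pid_def)
  then have "j (unif F powi (max n 1)) \<in> pid E 1" using n by force
  then have "1 \<le> ram * max n 1"
    using nu_j[of "unif F powi (max n 1)"] by (simp add: pid_def del: j_powi)
  then show ?thesis by (smt (verit) mult_nonpos_nonneg)
qed

lemma j_pid: "j a \<in> pid E (ram * n) \<longleftrightarrow> a \<in> pid F n"
  using ram_pos by (cases "a = 0") (auto simp: pid_def nu_j)

definition nu_alpha :: int where "nu_alpha = nu E \<alpha>"

lemma ram_cases:
  "(unramified F E j \<and> dd \<in> unit_group F) \<or> (\<not> unramified F E j \<and> nu F dd = 1)"
  using ext by (auto simp: quadratic_extension_def F.unit_iff F.nu_mult)

lemma unramified_iff: "unramified F E j \<longleftrightarrow> ram = 1"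
  by (simp add: unramified_def ram_def)

lemma two_hh: "2 * nu_alpha = ram * nu F dd"
  using nu_j[OF dd_nz] E.nu_power[OF alpha_nz, of 2] by (simp add: j_dd nu_alpha_def)

section \<open>Haar measure and balls of E in coordinates\<close>

definition coord_map :: "'f \<times> 'f \<Rightarrow> 'e" where "coord_map = (\<lambda>(x1, x2). j x1 + j x2 * \<alpha>)"

text \<open>Measurability of \<open>coord_map\<close> is not known at this point, so the usual
  formula for \<open>distr\<close> is out of reach. By its definition \<open>distr\<close> is the
  zero measure if the set function is not a measure; since \<open>pid E 0\<close> has measure 1,
  this fallback is excluded.\<close>

lemma emeasure_E:
  assumes A: "A \<in> sets borel" shows "emeasure (haar E) A = emeasure (haar F \<Otimes>\<^sub>M haar F) (coord_map -` A)"
proof -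
  let ?P = "haar F \<Otimes>\<^sub>M haar F"
  have sp: "space ?P = UNIV" by (simp add: space_pair_measure)
  have h: "haar E = measure_of UNIV (sets borel) (\<lambda>A. emeasure ?P (coord_map -` A))"
    using ext by (simp add: quadratic_extension_def distr_def coord_map_def sp)
  have ss: "sigma_sets UNIV (sets borel) = sets (borel :: 'e measure)"
    using sets.sigma_sets_eq[of "borel :: 'e measure"] by simp
  have e: "emeasure (haar E) B = (if B \<in> sets borel \<and> measure_space UNIV (sets borel) (\<lambda>A. emeasure ?P (coord_map -` A))
      then emeasure ?P (coord_map -` B) else 0)" for B
    unfolding h emeasure_measure_of_conv ss ..
  have "emeasure (haar E) (pid E 0) \<noteq> 0" by (simp add: E.emeasure_pid)
  then have "measure_space UNIV (sets borel) (\<lambda>A. emeasure ?P (coord_map -` A))"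
    using e[of "pid E 0"] by (auto split: if_splits)
  then show ?thesis using e[of A] A by simp
qed

lemma emeasure_coset_prod:
  "emeasure (haar F \<Otimes>\<^sub>M haar F) ({x. x - c \<in> pid F m} \<times> {x. x - d \<in> pid F n}) = ennreal (F.q powi (- m - n))"
proof -
  interpret sigma_finite_measure "haar F" by (rule F.haar_sigma_finite)
  have "F.q powi (- m) * F.q powi (- n) = F.q powi (- m - n)"
    using F.q_nz by (simp add: power_int_diff power_int_minus divide_inverse)
  then show ?thesis using F.q_gt_0
    by (subst emeasure_pair_measure_Times) (simp_all add: F.emeasure_coset ennreal_mult[symmetric])
qed

text \<open>
  The only use of the normalization of \<open>haar E\<close>.  In the unramified case it excludes that \<open>O\<^sub>E\<close>
  is larger than \<open>O\<^sub>F + O\<^sub>F \<alpha>\<close>, since then it would contain two disjoint translates of the latter; this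
  can happen for general \<open>\<alpha>\<close> in residue characteristic 2.
\<close>

lemma pid_coords: "x \<in> pid E m \<longleftrightarrow> j (c1 x) \<in> pid E m \<and> j (c2 x) * \<alpha> \<in> pid E m"
proof
  assume "j (c1 x) \<in> pid E m \<and> j (c2 x) * \<alpha> \<in> pid E m"
  then show "x \<in> pid E m" by (subst coords[of x]) (intro E.pid_add, auto)
next
  let ?a = "c1 x" and ?b = "c2 x"
  assume x: "x \<in> pid E m"
  show "j ?a \<in> pid E m \<and> j ?b * \<alpha> \<in> pid E m"
  proof (rule ccontr)
    assume no: "\<not> ?thesis"
    have no1: "j ?a \<notin> pid E m" and no2: "j ?b * \<alpha> \<notin> pid E m"
      using no x E.pid_diff[of x m "j ?a"] E.pid_diff[of x m "j ?b * \<alpha>"] coords[of x]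
      by (metis add_diff_cancel_left', metis add_diff_cancel_right')
    have nz: "?a \<noteq> 0" "?b \<noteq> 0" using no1 no2 by auto
    have n: "nu E (j ?a) < m" "nu E (j ?b * \<alpha>) < m" using no1 no2 by (auto simp: pid_def)
    \<comment> \<open>Otherwise one of the two terms dominates and determines the valuation of x,
      which would be too small.\<close>
    have eq: "nu E (j ?a) = nu E (j ?b * \<alpha>)"
    proof (rule ccontr)
      assume ne: "\<not> ?thesis"
      consider "nu E (j ?a) < nu E (j ?b * \<alpha>)" | "nu E (j ?b * \<alpha>) < nu E (j ?a)" using ne by linarith
      then show False
      proof cases
        case 1
        have "j ?a \<notin> pid E (nu E (j ?b * \<alpha>))" "j ?b * \<alpha> \<in> pid E (nu E (j ?b * \<alpha>))"
          using 1 nz by (auto simp: pid_def)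
        from E.nu_add_eq[OF this] show False using x n coords[of x] by (simp add: pid_def)
      next
        case 2
        have "j ?b * \<alpha> \<notin> pid E (nu E (j ?a))" "j ?a \<in> pid E (nu E (j ?a))"
          using 2 nz by (auto simp: pid_def)
        from E.nu_add_eq[OF this] show False using x n coords[of x] by (simp add: pid_def add.commute)
      qed
    qed
    have eq': "ram * nu F ?a = ram * nu F ?b + nu_alpha"
      using eq nz by (simp add: E.nu_mult nu_j nu_alpha_def)
    \<comment> \<open>If dd had valuation 1 the two sides would differ in parity, so only the
      unramified case remains.\<close>
    have par: "2 * nu F ?a = 2 * nu F ?b + nu F dd"
    proof -
      have "ram * (2 * nu F ?a) = ram * (2 * nu F ?b + nu F dd)"
        using eq' two_hh by (simp add: algebra_simps)
      then show ?thesis using ram_pos by simp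
    qed
    have un: "ram = 1" "dd \<in> unit_group F"
    proof -
      have "nu F dd \<noteq> 1" using par by presburger
      then show "ram = 1" "dd \<in> unit_group F" using ram_cases unramified_iff by auto
    qed
    then have h0: "nu_alpha = 0" and ab: "nu F ?a = nu F ?b" using two_hh eq' by (auto simp: F.unit_iff)
    define c where "c = ?a / ?b"
    have c: "c \<noteq> 0" "nu F c = 0" using nz ab by (auto simp: c_def F.nu_divide)
    let ?p = "unif F"
    have "x / j ?b \<in> pid E 1"
      using x nz n un h0 ab by (simp add: E.pid_divide_iff nu_j) (rule E.pid_mono[OF x], simp add: E.nu_mult nu_j nu_alpha_def)
    moreover have "x / j ?b = j c + \<alpha>"
      using nz by (subst coords[of x]) (simp add: c_def add_divide_distrib)
    ultimately have "(j c + \<alpha>) / j ?p \<in> pid E 0"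
      using un by (simp add: E.pid_divide_iff ram_def)
    moreover have "(j c + \<alpha>) / j ?p = coord_map (c / ?p, 1 / ?p)"
      by (simp add: coord_map_def add_divide_distrib)
    ultimately have y: "coord_map (c / ?p, 1 / ?p) \<in> pid E 0" by simp
    have T1: "coord_map (x1, x2) \<in> pid E 0" if "x1 \<in> pid F 0" "x2 \<in> pid F 0" for x1 x2
    proof -
      have "j x1 \<in> pid E 0" "j x2 \<in> pid E 0" using j_pid[of x1 0] j_pid[of x2 0] that by simp_all
      moreover have "\<alpha> \<in> pid E 0" using h0 by (simp add: pid_def nu_alpha_def)
      ultimately show ?thesis using E.pid_add E.pid_mult[of "j x2" 0 \<alpha> 0] by (simp add: coord_map_def)
    qed
    \<comment> \<open>Two disjoint product sets of measure 1 that both lie in the preimage of the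
      integers of E, whose measure is 1. The second is centred at the integral element (j c +
      \<alpha>) / j ?p, which has non-integral coordinates.\<close>
    let ?A = "{x. x - 0 \<in> pid F 0} \<times> {x. x - 0 \<in> pid F 0}"
    let ?B = "{x. x - c / ?p \<in> pid F 0} \<times> {x. x - 1 / ?p \<in> pid F 0}"
    have "?A \<subseteq> coord_map -` pid E 0" using T1 by auto
    moreover have "?B \<subseteq> coord_map -` pid E 0"
    proof
      fix z assume "z \<in> ?B"
      then obtain x1 x2 where z: "z = (x1, x2)" "x1 - c / ?p \<in> pid F 0" "x2 - 1 / ?p \<in> pid F 0" by auto
      have "coord_map z = coord_map (x1 - c / ?p, x2 - 1 / ?p) + coord_map (c / ?p, 1 / ?p)"
        by (simp add: z coord_map_def algebra_simps)
      then show "z \<in> coord_map -` pid E 0" using E.pid_add[OF T1[OF z(2,3)] y] by simp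
    qed
    moreover have "?A \<inter> ?B = {}"
    proof -
      have False if "x2 \<in> pid F 0" "x2 - 1 / ?p \<in> pid F 0" for x2
        using F.pid_diff[OF that] by (simp add: pid_def F.nu_divide)
      then show ?thesis by auto
    qed
    moreover have "?A \<in> sets (haar F \<Otimes>\<^sub>M haar F)" "?B \<in> sets (haar F \<Otimes>\<^sub>M haar F)"
      by (intro pair_measureI; simp)+
    \<comment> \<open>A set outside the sigma-algebra would have measure 0 by convention.\<close>
    moreover have m: "coord_map -` pid E 0 \<in> sets (haar F \<Otimes>\<^sub>M haar F)"
    proof (rule ccontr)
      assume "\<not> ?thesis"
      then have "emeasure (haar F \<Otimes>\<^sub>M haar F) (coord_map -` pid E 0) = 0" by (rule emeasure_notin_sets)
      then show False using emeasure_E[of "pid E 0"] by (simp add: E.emeasure_pid)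
    qed
    ultimately have "emeasure (haar F \<Otimes>\<^sub>M haar F) ?A + emeasure (haar F \<Otimes>\<^sub>M haar F) ?B \<le> emeasure (haar F \<Otimes>\<^sub>M haar F) (coord_map -` pid E 0)"
      by (subst plus_emeasure) (auto intro!: emeasure_mono)
    also have "\<dots> = 1" using emeasure_E[of "pid E 0"] by (simp add: E.emeasure_pid)
    finally show False unfolding emeasure_coset_prod by simp
  qed
qed

text \<open>In the ramified case ram = 2 nu_alpha, so the valuations on j(F) and on j(F) \<alpha>
  are multiples of nu_alpha. A uniformizer of E has a component of valuation 1, hence nu_alpha =
  1.\<close>

lemma ram_12: "(ram = 1 \<and> nu_alpha = 0 \<and> unramified F E j) \<or> (ram = 2 \<and> nu_alpha = 1 \<and> \<not> unramified F E j)"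
proof (cases "unramified F E j")
  case True
  then have "nu F dd = 0" using ram_cases by (auto simp: F.unit_iff)
  then show ?thesis using True two_hh unramified_iff by simp
next
  case False
  then have d: "2 * nu_alpha = ram" "ram \<noteq> 1" using ram_cases two_hh unramified_iff by auto
  let ?x = "unif E"
  have x: "?x \<in> pid E 1" "?x \<notin> pid E 2" by (auto simp: pid_def)
  then have "nu_alpha dvd 1"
  proof -
    have 1: "j (c1 ?x) \<in> pid E 1" "j (c2 ?x) * \<alpha> \<in> pid E 1" using pid_coords[of ?x 1] x by auto
    have "j (c1 ?x) \<notin> pid E 2 \<or> j (c2 ?x) * \<alpha> \<notin> pid E 2" using pid_coords[of ?x 2] x by auto
    then show ?thesis
    proof
      assume a: "j (c1 ?x) \<notin> pid E 2"
      then have "c1 ?x \<noteq> 0" by auto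
      then have "ram * nu F (c1 ?x) = 1" using a 1 by (auto simp: pid_def nu_j)
      then have "nu_alpha * (2 * nu F (c1 ?x)) = 1" using d(1) by (metis mult.assoc mult.commute)
      then show ?thesis by (metis dvd_triv_left)
    next
      assume a: "j (c2 ?x) * \<alpha> \<notin> pid E 2"
      then have "c2 ?x \<noteq> 0" by auto
      then have "ram * nu F (c2 ?x) + nu_alpha = 1" using a 1 by (auto simp: pid_def nu_j E.nu_mult nu_alpha_def)
      moreover have "nu_alpha * (2 * nu F (c2 ?x) + 1) = (2 * nu_alpha) * nu F (c2 ?x) + nu_alpha" by (simp add: algebra_simps)
      ultimately have "nu_alpha * (2 * nu F (c2 ?x) + 1) = 1" using d(1) by (simp only:)
      then show ?thesis by (metis dvd_triv_left)
    qed
  qed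
  then have "nu_alpha = 1" using d(1) ram_pos by auto
  then show ?thesis using d False by simp
qed

lemma alpha_c2_pid: "j b * \<alpha> \<in> pid E m \<longleftrightarrow> b = 0 \<or> m \<le> ram * nu F b + nu_alpha"
  by (cases "b = 0") (auto simp: pid_def nu_j E.nu_mult nu_alpha_def)

text \<open>
  The balls of E that are a product of a ball with itself in both coordinates.
\<close>

definition BB :: "int \<Rightarrow> 'e set" where "BB n = pid E (ram * n)"

lemma BB_iff: "x \<in> BB n \<longleftrightarrow> c1 x \<in> pid F n \<and> c2 x \<in> pid F n"
proof -
  have "j (c2 x) * \<alpha> \<in> pid E (ram * n) \<longleftrightarrow> c2 x \<in> pid F n"
    unfolding alpha_c2_pid using ram_12 by (auto simp: pid_def)
  then show ?thesis unfolding BB_def pid_coords[of x] j_pid by blast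
qed

definition box :: "int \<Rightarrow> int \<Rightarrow> 'e set" where
  "box m n = {x. c1 x \<in> pid F m \<and> c2 x \<in> pid F n}"

lemma box_open: "open (box m n)"
  unfolding E.open_lf_iff
proof (intro ballI exI)
  fix x h assume x: "x \<in> box m n" and h: "h \<in> pid E (ram * max m n)"
  have "c1 h \<in> pid F (max m n)" "c2 h \<in> pid F (max m n)" using BB_iff[of h "max m n"] h by (auto simp: BB_def)
  then show "x + h \<in> box m n" using x F.pid_mono F.pid_add by (auto simp: box_def)
qed

lemma emeasure_box: "emeasure (haar E) (box m n) = ennreal (F.q powi (- m - n))"
proof -
  have "coord_map -` box m n = {x. x - 0 \<in> pid F m} \<times> {x. x - 0 \<in> pid F n}"
    by (auto simp: coord_map_def box_def)
  then show ?thesis using emeasure_E[of "box m n"] box_open[of m n] emeasure_coset_prod[of 0 m 0 n] by simp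
qed

lemma pid1_box: "pid E 1 = box 1 (1 - nu_alpha)"
proof -
  have "j a \<in> pid E 1 \<longleftrightarrow> a \<in> pid F 1" for a
  proof (cases "a = 0")
    case False
    have "1 \<le> ram * nu F a \<longleftrightarrow> 1 \<le> nu F a" using ram_12 by (elim disjE conjE) (simp, presburger)
    then show ?thesis using False by (simp add: pid_def nu_j)
  qed simp
  moreover have "j b * \<alpha> \<in> pid E 1 \<longleftrightarrow> b \<in> pid F (1 - nu_alpha)" for b
  proof -
    have "1 \<le> ram * nu F b + nu_alpha \<longleftrightarrow> 1 - nu_alpha \<le> nu F b" using ram_12 by (elim disjE conjE) (simp, presburger)
    then show ?thesis unfolding alpha_c2_pid by (simp add: pid_def)
  qed
  ultimately have "x \<in> pid E 1 \<longleftrightarrow> x \<in> box 1 (1 - nu_alpha)" for x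
    unfolding pid_coords[of x 1] by (simp add: box_def)
  then show ?thesis by blast
qed

definition fdeg :: nat where "fdeg = (if unramified F E j then 2 else 1)"

lemma ram_fdeg: "ram * int fdeg = 2"
  using ram_12 by (auto simp: fdeg_def)

text \<open>The measure of the maximal ideal of E, once as an ideal of E and once as a product of
  balls in the coordinates.\<close>

lemma qE: "E.q = F.q ^ fdeg"
proof -
  have "ennreal (E.q powi (- 1)) = ennreal (F.q powi (- 1 - (1 - nu_alpha)))"
    using E.emeasure_pid[of 1] emeasure_box[of 1 "1 - nu_alpha"] pid1_box by simp
  then have "E.q powi (- 1) = F.q powi (- 1 - (1 - nu_alpha))"
    using E.q_gt_0 F.q_gt_0 by (subst (asm) ennreal_inj) auto
  moreover have "- 1 - (1 - nu_alpha) = - int fdeg" using ram_12 by (auto simp: fdeg_def)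
  ultimately have "inverse E.q = inverse (F.q ^ fdeg)" by (simp add: power_int_minus)
  then show ?thesis by simp
qed

definition conjg :: "'e \<Rightarrow> 'e" where "conjg x = j (c1 x) - j (c2 x) * \<alpha>"

definition nrm :: "'e \<Rightarrow> 'f" where "nrm x = (c1 x)\<^sup>2 - (c2 x)\<^sup>2 * dd"

lemma j_nrm: "j (nrm x) = x * conjg x"
  by (subst coords[of x]) (simp add: nrm_def conjg_def j_dd power2_eq_square algebra_simps)

text \<open>Conjugation changes the sign of one coordinate, which the coordinatewise description of
  balls does not see. So it preserves the valuation.\<close>

lemma conjg_pid: "conjg x \<in> pid E m \<longleftrightarrow> x \<in> pid E m"
proof -
  have e: "c1 (conjg x) = c1 x" "c2 (conjg x) = - c2 x" by (simp_all add: conjg_def)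
  show ?thesis unfolding pid_coords[of "conjg x"] pid_coords[of x] e by simp
qed

lemma nu_conjg: assumes "x \<noteq> 0" shows "conjg x \<noteq> 0" "nu E (conjg x) = nu E x"
proof -
  show nz: "conjg x \<noteq> 0"
  proof
    assume "conjg x = 0"
    then have "conjg x \<in> pid E (nu E x + 1)" by simp
    then show False using conjg_pid assms by (simp add: pid_def)
  qed
  show "nu E (conjg x) = nu E x"
    using conjg_pid[of x "nu E x"] conjg_pid[of x "nu E (conjg x)"] assms nz by (simp add: pid_def)
qed

lemma nrm_nz: "x \<noteq> 0 \<Longrightarrow> nrm x \<noteq> 0"
  using j_nrm[of x] nu_conjg[of x] by auto

lemma nu_nrm: assumes "x \<noteq> 0" shows "nu F (nrm x) = int fdeg * nu E x"
proof -
  have "ram * nu F (nrm x) = 2 * nu E x"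
    using nu_j[OF nrm_nz[OF assms]] nu_conjg[OF assms] assms by (simp add: j_nrm E.nu_mult)
  also have "\<dots> = ram * (int fdeg * nu E x)" using ram_fdeg by (metis mult.assoc)
  finally show ?thesis using ram_pos by simp
qed

lemma nu_E_lt: "c2 x \<noteq> 0 \<Longrightarrow> x \<notin> BB (nu F (c2 x) + 1)"
  by (simp add: BB_iff pid_def)

end

section \<open>Holomorphic functions of two variables\<close>

lemma holomorphic2_const: "holomorphic2 (\<lambda>_. c)"
  unfolding holomorphic2_def
proof
  fix p :: "complex \<times> complex"
  have "((\<lambda>_. c) has_derivative (\<lambda>(v, w). 0 * v + 0 * w)) (at p)"
    by (simp add: case_prod_unfold)
  then show "\<exists>a b. ((\<lambda>_. c) has_derivative (\<lambda>(v, w). a * v + b * w)) (at p)" by blast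
qed

lemma holomorphic2_add:
  assumes "holomorphic2 f" "holomorphic2 g" shows "holomorphic2 (\<lambda>p. f p + g p)"
  unfolding holomorphic2_def
proof
  fix p
  obtain a b where f: "(f has_derivative (\<lambda>(v, w). a * v + b * w)) (at p)" using assms(1) unfolding holomorphic2_def by blast
  obtain c d where g: "(g has_derivative (\<lambda>(v, w). c * v + d * w)) (at p)" using assms(2) unfolding holomorphic2_def by blast
  have "(\<lambda>h. (case h of (v, w) \<Rightarrow> a * v + b * w) + (case h of (v, w) \<Rightarrow> c * v + d * w)) = (\<lambda>(v, w). (a + c) * v + (b + d) * w)"
    by (auto simp: fun_eq_iff algebra_simps)
  then show "\<exists>a b. ((\<lambda>p. f p + g p) has_derivative (\<lambda>(v, w). a * v + b * w)) (at p)"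
    using has_derivative_add[OF f g] by (intro exI[of _ "a + c"] exI[of _ "b + d"]) simp
qed

lemma holomorphic2_mult:
  assumes "holomorphic2 f" "holomorphic2 g" shows "holomorphic2 (\<lambda>p. f p * g p)"
  unfolding holomorphic2_def
proof
  fix p
  obtain a b where f: "(f has_derivative (\<lambda>(v, w). a * v + b * w)) (at p)" using assms(1) unfolding holomorphic2_def by blast
  obtain c d where g: "(g has_derivative (\<lambda>(v, w). c * v + d * w)) (at p)" using assms(2) unfolding holomorphic2_def by blast
  have "(\<lambda>h. f p * (case h of (v, w) \<Rightarrow> c * v + d * w) + (case h of (v, w) \<Rightarrow> a * v + b * w) * g p) =
      (\<lambda>(v, w). (f p * c + a * g p) * v + (f p * d + b * g p) * w)"
    by (auto simp: fun_eq_iff algebra_simps)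
  then show "\<exists>a b. ((\<lambda>p. f p * g p) has_derivative (\<lambda>(v, w). a * v + b * w)) (at p)"
    using has_derivative_mult[OF f g] by (intro exI[of _ "f p * c + a * g p"] exI[of _ "f p * d + b * g p"]) simp
qed

lemma holomorphic2_exp: "holomorphic2 (\<lambda>p. exp (a * fst p + b * snd p + c))"
  unfolding holomorphic2_def
proof
  fix p :: "complex \<times> complex"
  let ?e = "exp (a * fst p + b * snd p + c)"
  have l: "((\<lambda>p. a * fst p + b * snd p + c) has_derivative (\<lambda>h. a * fst h + b * snd h)) (at p)"
    by (auto intro!: derivative_eq_intros)
  have "(exp has_derivative (*) ?e) (at (a * fst p + b * snd p + c))"
    using DERIV_exp unfolding has_field_derivative_def by blast
  from has_derivative_compose[OF l this]
  have "((\<lambda>p. exp (a * fst p + b * snd p + c)) has_derivative (\<lambda>h. ?e * (a * fst h + b * snd h))) (at p)" .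
  moreover have "(\<lambda>h. ?e * (a * fst h + b * snd h)) = (\<lambda>(v, w). (?e * a) * v + (?e * b) * w)"
    by (auto simp: fun_eq_iff algebra_simps)
  ultimately show "\<exists>a' b'. ((\<lambda>p. exp (a * fst p + b * snd p + c)) has_derivative (\<lambda>(v, w). a' * v + b' * w)) (at p)"
    by (intro exI[of _ "?e * a"] exI[of _ "?e * b"]) simp
qed

lemma holomorphic2_diff: "holomorphic2 f \<Longrightarrow> holomorphic2 g \<Longrightarrow> holomorphic2 (\<lambda>p. f p - g p)"
  using holomorphic2_add[of f "\<lambda>p. (-1) * g p"] holomorphic2_mult[OF holomorphic2_const[of "-1"], of g] by simp

text \<open>The exponent computation of \<open>kern_eq\<close>, with a for the valuation of the
  second coordinate and b for f times the valuation of x. Writing h for 1/2 turns it into a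
  polynomial identity modulo 2 h = 1.\<close>

lemma kern_exponent:
  fixes a b s t L h :: complex
  assumes "2 * h = 1"
  shows "- b * 2 * (s - h) * L + - (a - b) * 2 * (s - h) * L + - (a - b) * (t + h) * L =
    a * (L + - (2 * s + t + h) * L) + b * ((t + h) * L)"
  using assms by algebra

definition conv_dom :: "complex \<Rightarrow> complex \<Rightarrow> bool" where
  "conv_dom s t \<longleftrightarrow> 0 < Re (2 * s + t + 1/2) \<and> 0 < Re (2 * s - t + 1/2)"

text \<open>On the complex line through the given point and (1, 0), which lies in the domain of
  convergence, the identity theorem in one variable applies.\<close>

lemma holomorphic2_unique:
  assumes f: "holomorphic2 f" and g: "holomorphic2 g"
    and eq: "\<And>s t. conv_dom s t \<Longrightarrow> f (s, t) = g (s, t)"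
  shows "f = g"
proof
  fix p :: "complex \<times> complex"
  define l where "l z = (1 + z * (fst p - 1), z * snd p)" for z
  define D where "D z = f (l z) - g (l z)" for z
  have l: "(l has_derivative (\<lambda>h. (h * (fst p - 1), h * snd p))) (at z)" for z
    unfolding l_def by (auto intro!: derivative_eq_intros)
  have hol: "D holomorphic_on UNIV"
    unfolding holomorphic_on_def
  proof (intro ballI)
    fix z
    have "holomorphic2 (\<lambda>p. f p - g p)" by (rule holomorphic2_diff[OF f g])
    then obtain a b where d: "((\<lambda>p. f p - g p) has_derivative (\<lambda>(v, w). a * v + b * w)) (at (l z))"
      unfolding holomorphic2_def by blast
    have "(D has_derivative (\<lambda>h. (\<lambda>(v, w). a * v + b * w) (h * (fst p - 1), h * snd p))) (at z)"
      unfolding D_def by (rule has_derivative_compose[OF l d])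
    moreover have "(\<lambda>h. (\<lambda>(v, w). a * v + b * w) (h * (fst p - 1), h * snd p)) = (*) (a * (fst p - 1) + b * snd p)"
      by (auto simp: fun_eq_iff algebra_simps)
    ultimately have "(D has_field_derivative (a * (fst p - 1) + b * snd p)) (at z)"
      by (simp add: has_field_derivative_def)
    then show "D field_differentiable (at z within UNIV)" by (auto simp: field_differentiable_def)
  qed
  define U where "U = {z. conv_dom (fst (l z)) (snd (l z))}"
  have "U = {z. 0 < Re (2 * fst (l z) + snd (l z) + 1/2)} \<inter> {z. 0 < Re (2 * fst (l z) - snd (l z) + 1/2)}"
    by (auto simp: U_def conv_dom_def)
  then have "open U"
    unfolding l_def by (simp only:) (intro open_Int open_Collect_less continuous_intros)
  moreover have "0 \<in> U" by (simp add: U_def l_def conv_dom_def)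
  moreover have "D z = 0" if "z \<in> U" for z
    using eq[of "fst (l z)" "snd (l z)"] that by (simp add: U_def D_def)
  ultimately have "D 1 = 0"
    by (intro analytic_continuation_open[of U UNIV D "\<lambda>_. 0" 1, OF _ open_UNIV _ connected_UNIV subset_UNIV hol
          holomorphic_on_const]) blast+
  then show "f p = g p" by (simp add: D_def l_def)
qed

section \<open>The kernel when both L-factors are nontrivial\<close>

locale kernel_setting = quad_ext F E j \<alpha>
  for F :: "'f::{field,metric_space} lf" and E :: "'e::{field,metric_space} lf" and j \<alpha> +
  fixes chi :: "'e \<Rightarrow> complex" and eta :: "'f \<Rightarrow> complex"
  assumes uchi: "unit_character E chi" and ueta: "unit_character F eta"
    and triv1: "trivial_on_units F (\<lambda>u. chi (j u) * eta u)"
    and triv2: "trivial_on_units F (\<lambda>u. chi (j u) * inverse (eta u))"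
    and unifs: "qchar E chi 0 (j (unif F)) = 1"
begin

sublocale EC: lf_char E chi by unfold_locales (rule uchi)
sublocale FC: lf_char F eta by unfold_locales (rule ueta)

lemma chi_j: "u \<in> unit_group F \<Longrightarrow> chi (j u) = eta u"
  using triv2 FC.chi_nz[of u] unfolding trivial_on_units_def by (auto simp: field_simps)

lemma eta_sq: "u \<in> unit_group F \<Longrightarrow> (eta u)\<^sup>2 = 1"
proof -
  assume u: "u \<in> unit_group F"
  have "chi (j u) * eta u = 1" using triv1 u unfolding trivial_on_units_def by blast
  then show ?thesis using chi_j[OF u] by (simp add: power2_eq_square)
qed

sublocale FC: quad_char F eta by unfold_locales (rule eta_sq)

lemma ang_j_unif: "E.ang chi (j (unif F)) = 1"
  using unifs by (simp add: E.qchar_eq)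

text \<open>By \<open>unifs\<close> the uniformizer contributes 1, and on units the two characters
  agree and square to 1. This removes the angular part of the argument x2 / N(x) from the
  kernel.\<close>

lemma ang_j: assumes "y \<noteq> 0" shows "E.ang chi (j y) * F.ang eta y = 1"
proof -
  let ?u = "unif F powi (- nu F y) * y"
  have u: "?u \<in> unit_group F" by (rule F.unit_part[OF assms])
  have "?u \<noteq> 0" using u F.unit_iff by blast
  then have ju: "j ?u \<in> unit_group E" unfolding E.unit_iff j_eq_0 using nu_j_unit[OF u] by blast
  have y: "y = unif F powi (nu F y) * ?u" by (simp add: power_int_minus)
  have p: "E.ang chi (j (unif F) powi n) = 1" for n
  proof -
    have nat: "E.ang chi (j (unif F) ^ m) = 1" for m
      by (induction m) (auto simp: EC.ang_mult ang_j_unif)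
    show ?thesis by (cases "n \<ge> 0") (auto simp: power_int_def nat EC.ang_inverse power_inverse)
  qed
  have "j y = j (unif F) powi (nu F y) * j ?u" by (subst y) (simp only: j_mult j_powi)
  then have "E.ang chi (j y) = chi (j ?u)"
    using ju by (simp only:) (subst EC.ang_mult, simp_all only: p EC.ang_unit, simp_all add: E.unit_iff)
  moreover have "F.ang eta y = eta ?u" by (simp add: F.ang_def)
  ultimately show ?thesis using chi_j[OF u] eta_sq[OF u] by (simp add: power2_eq_square)
qed

definition kap :: "'e \<Rightarrow> complex" where "kap x = (E.ang chi x)\<^sup>2"

lemma kap_mult: "x \<noteq> 0 \<Longrightarrow> y \<noteq> 0 \<Longrightarrow> kap (x * y) = kap x * kap y"
  by (simp add: kap_def EC.ang_mult power_mult_distrib)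

lemma kap_1 [simp]: "kap 1 = 1"
  by (simp add: kap_def)

lemma kap_j: assumes "y \<noteq> 0" shows "kap (j y) = 1"
proof -
  have "(F.ang eta y)\<^sup>2 = 1" unfolding F.ang_def by (rule eta_sq[OF F.unit_part[OF assms]])
  moreover have "(E.ang chi (j y))\<^sup>2 * (F.ang eta y)\<^sup>2 = 1"
    using ang_j[OF assms] by (simp add: power_mult_distrib[symmetric])
  ultimately show ?thesis by (simp add: kap_def)
qed

lemma kap_jmult: "y \<noteq> 0 \<Longrightarrow> x \<noteq> 0 \<Longrightarrow> kap (j y * x) = kap x"
  by (simp add: kap_mult kap_j)

lemma kap_unit: "u \<in> unit_group E \<Longrightarrow> kap u = (chi u)\<^sup>2"
  by (simp add: kap_def EC.ang_unit)

text \<open>Unitarity of chi is not part of the definition of a character; compactness of the unit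
  group gives the bound.\<close>

lemma kap_bounded: "\<exists>B\<ge>0. \<forall>x. x \<noteq> 0 \<longrightarrow> norm (kap x) \<le> B"
proof -
  have "unit_group E = pid E 0 - pid E 1" by (auto simp: E.unit_iff pid_def)
  moreover have "open (pid E 1)" using E.open_coset[of 0 1] by simp
  ultimately have "compact (unit_group E)" using compact_diff[OF E.compact_pid] by simp
  then have "bounded (chi ` unit_group E)" by (intro compact_imp_bounded compact_continuous_image EC.chi_cont)
  then obtain B where B: "\<forall>u\<in>unit_group E. norm (chi u) \<le> B" unfolding bounded_iff by blast
  have "norm (kap x) \<le> B\<^sup>2" if "x \<noteq> 0" for x
    unfolding kap_def E.ang_def norm_power
    by (rule power_mono) (use B E.unit_part[OF that] in auto)
  then show ?thesis by (intro exI[of _ "B\<^sup>2"]) auto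
qed

text \<open>
  Existence of such \<open>n\<close> expresses that \<open>\<kappa>\<close> has a conductor.
\<close>

definition cond :: "int \<Rightarrow> bool" where
  "cond n \<longleftrightarrow> 1 \<le> n \<and> (\<forall>M x h. x \<notin> BB M \<longrightarrow> h \<in> BB (M + n - 1) \<longrightarrow> kap (x + h) = kap x)"

lemma condD: "cond n \<Longrightarrow> x \<notin> BB M \<Longrightarrow> h \<in> BB (M + n - 1) \<Longrightarrow> kap (x + h) = kap x"
  by (simp add: cond_def)

lemma cond_ex: "\<exists>n. cond n"
proof -
  obtain n where n: "n \<ge> 1" "\<forall>x\<noteq>0. \<forall>h\<in>pid E (nu E x + n). x + h \<noteq> 0 \<and> nu E (x + h) = nu E x \<and> E.ang chi (x + h) = E.ang chi x"
    using EC.ang_loc_const by blast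
  have "kap (x + h) = kap x" if x: "x \<notin> BB M" and h: "h \<in> BB (M + n - 1)" for M x h
  proof -
    have x': "x \<noteq> 0" "nu E x < ram * M" using x by (auto simp: BB_def pid_def)
    have "n - 1 \<le> ram * (n - 1)" using mult_right_mono[of 1 ram "n - 1"] n(1) ram_pos by simp
    then have "nu E x + n \<le> ram * (M + n - 1)" using x' by (simp add: algebra_simps)
    then have "h \<in> pid E (nu E x + n)" using h E.pid_mono unfolding BB_def by blast
    then show ?thesis using n(2) x' by (simp add: kap_def)
  qed
  then have "cond n" unfolding cond_def using n(1) by blast
  then show ?thesis by blast
qed

lemma cond_quad: assumes "trivial_on_units E (\<lambda>u. (chi u)\<^sup>2)" shows "cond 1" and "x \<noteq> 0 \<Longrightarrow> kap x = 1"
proof -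
  have k: "kap x = 1" if "x \<noteq> 0" for x
    using assms E.unit_part[OF that] by (simp add: kap_def E.ang_def trivial_on_units_def)
  then show "x \<noteq> 0 \<Longrightarrow> kap x = 1" .
  have "kap (x + h) = kap x" if "x \<notin> BB M" "h \<in> BB M" for x h M
    using E.nu_add_eq(1)[of x "ram * M" h] that k E.notin_pidD[of x "ram * M"] by (simp add: BB_def)
  then show "cond 1" by (simp add: cond_def)
qed

lemma BB_mono: "x \<in> BB n \<Longrightarrow> m \<le> n \<Longrightarrow> x \<in> BB m"
  using F.pid_mono by (auto simp: BB_iff)

lemma nu_add_BB: "x \<notin> BB n \<Longrightarrow> h \<in> BB n \<Longrightarrow> x + h \<noteq> 0 \<and> nu E (x + h) = nu E x"
  using E.nu_add_eq unfolding BB_def by blast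

text \<open>
  The kernel in terms of \<open>Y\<close> and \<open>\<tau>\<close>; its value on F, a null set, is arbitrary.
\<close>

definition Kf :: "complex \<Rightarrow> complex \<Rightarrow> 'e \<Rightarrow> complex" where
  "Kf Y \<tau> x = (if c2 x = 0 then 0 else kap x * (F.Q * Y) powi nu F (c2 x) * \<tau> powi (int fdeg * nu E x))"

text \<open>The second coordinate keeps c out of \<open>BB (nu F (c2 c) + 1)\<close>, so the
  conductor applies from level \<open>nu F (c2 c) + n0\<close> on.\<close>

lemma Kf_const:
  assumes n0: "cond n0" and c: "c2 c \<noteq> 0" and h: "h \<in> BB N" and N: "nu F (c2 c) + n0 \<le> N"
  shows "Kf Y \<tau> (c + h) = Kf Y \<tau> c"
proof -
  let ?k = "nu F (c2 c)"
  have n1: "1 \<le> n0" using n0 by (simp add: cond_def)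
  have cB: "c \<notin> BB (?k + 1)" by (rule nu_E_lt[OF c])
  have h1: "h \<in> BB (?k + 1)" and h2: "h \<in> BB (?k + 1 + n0 - 1)"
    using N n1 BB_mono[OF h] by auto
  have k: "kap (c + h) = kap c" by (rule condD[OF n0 cB h2])
  have n: "nu E (c + h) = nu E c" using nu_add_BB[OF cB h1] by simp
  have "c2 c \<notin> pid F (?k + 1)" "c2 h \<in> pid F (?k + 1)" using c h1 by (auto simp: BB_iff) (auto simp: pid_def)
  from F.nu_add_eq[OF this] show ?thesis using k n c by (simp add: Kf_def)
qed

definition Yv :: "complex \<Rightarrow> complex \<Rightarrow> complex" where "Yv s t = F.Q powr (- (2 * s + t + 1/2))"
definition Xv :: "complex \<Rightarrow> complex \<Rightarrow> complex" where "Xv s t = F.Q powr (- (2 * s - t + 1/2))"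
definition tv :: "complex \<Rightarrow> complex" where "tv t = F.Q powr (t + 1/2)"

lemma lambda_plus_eq: "lambda_plus F j chi eta s t = 1 - Yv s t"
  using triv1 by (simp add: lambda_plus_def Yv_def)

lemma lambda_minus_eq: "lambda_minus F j chi eta s t = 1 - Xv s t"
  using triv2 by (simp add: lambda_minus_def Xv_def)

lemma Yv_nz [simp]: "Yv s t \<noteq> 0" and Xv_nz [simp]: "Xv s t \<noteq> 0" and tv_nz [simp]: "tv t \<noteq> 0"
  by (simp_all add: Yv_def Xv_def tv_def)

abbreviation LL :: complex where "LL \<equiv> of_real (ln F.q)"

lemma exp_LL: "exp LL = F.Q"
  using F.q_gt_0 by (simp add: exp_of_real)

lemma Yv_exp: "Yv s t = exp (- (2 * s + t + 1/2) * LL)"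
  and Xv_exp: "Xv s t = exp (- (2 * s - t + 1/2) * LL)"
  and tv_exp: "tv t = exp ((t + 1/2) * LL)"
  by (simp_all only: Yv_def Xv_def tv_def F.powr_Q)

lemma Xv_rel: "F.Q * Xv s t = Yv s t * (tv t)\<^sup>2"
proof -
  have "F.Q * Xv s t = exp (LL + - (2 * s - t + 1/2) * LL)"
    by (simp only: exp_add exp_LL Xv_exp)
  also have "LL + - (2 * s - t + 1/2) * LL = - (2 * s + t + 1/2) * LL + ((t + 1/2) * LL + (t + 1/2) * LL)"
    by (simp add: algebra_simps)
  finally show ?thesis by (simp only: exp_add Yv_exp tv_exp power2_eq_square)
qed

lemma norm_Yv: "conv_dom s t \<Longrightarrow> norm (Yv s t) < 1" and norm_Xv: "conv_dom s t \<Longrightarrow> norm (Xv s t) < 1"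
proof -
  have L: "ln F.q > 0" using F.q_gt_1 by simp
  assume d: "conv_dom s t"
  have n: "norm (exp (- w * LL)) < 1" if "Re w > 0" for w
    using that L by simp
  show "norm (Yv s t) < 1" "norm (Xv s t) < 1"
    unfolding Yv_exp Xv_exp by (rule n, use d in \<open>simp add: conv_dom_def\<close>)+
qed

lemma QE_powr: "E.Q powr w = exp (w * of_nat fdeg * LL)"
proof -
  have "ln E.q = of_nat fdeg * ln F.q" using F.q_gt_0 by (simp add: qE ln_realpow)
  then show ?thesis by (simp add: E.powr_Q mult.assoc)
qed

text \<open>Let k be the valuation of x2 and n that of N(x). Then x2 / N(x) has valuation k - n, the
  angular parts cancel except chi(x)^2, and the powers of q regroup into (q Y)^k \<tau>^n.\<close>

lemma kern_eq: "kern F E j \<alpha> chi eta s t x = Kf (Yv s t) (tv t) x"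
proof (cases "c2 x = 0")
  case True
  then show ?thesis by (simp add: kern_def Let_def Kf_def)
next
  case False
  then have x: "x \<noteq> 0" by auto
  define z where "z = c2 x / nrm x"
  have z: "z \<noteq> 0" using False nrm_nz[OF x] by (simp add: z_def)
  define k where "k = nu F (c2 x)"
  define n where "n = int fdeg * nu E x"
  have nz: "nu F z = k - n" using False nrm_nz[OF x] nu_nrm[OF x] by (simp add: z_def F.nu_divide k_def n_def)
  have e1: "qchar E chi (s - 1/2) (x\<^sup>2) = kap x * exp (- of_int n * 2 * (s - 1/2) * LL)"
  proof -
    have "E.ang chi (x\<^sup>2) = kap x" using x by (simp add: kap_def power2_eq_square EC.ang_mult)
    moreover have "nu E (x\<^sup>2) = 2 * nu E x" using x by (simp add: E.nu_power)
    ultimately have "qchar E chi (s - 1/2) (x\<^sup>2) = kap x * exp ((s - 1/2) * of_nat fdeg * LL) powi (- (2 * nu E x))"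
      using x by (simp add: E.qchar_eq QE_powr)
    also have "exp ((s - 1/2) * of_nat fdeg * LL) powi (- (2 * nu E x)) = exp (of_int (- (2 * nu E x)) * ((s - 1/2) * of_nat fdeg * LL))"
      by (rule exp_power_int)
    also have "of_int (- (2 * nu E x)) * ((s - 1/2) * of_nat fdeg * LL) = - of_int n * 2 * (s - 1/2) * LL"
      by (simp add: n_def)
    finally show ?thesis .
  qed
  have e2: "qchar E chi (s - 1/2) (j z) = E.ang chi (j z) * exp (- of_int (k - n) * 2 * (s - 1/2) * LL)"
  proof -
    have "qchar E chi (s - 1/2) (j z) = E.ang chi (j z) * exp ((s - 1/2) * of_nat fdeg * LL) powi (- (ram * (k - n)))"
      using z by (simp add: E.qchar_eq QE_powr nu_j nz)
    also have "exp ((s - 1/2) * of_nat fdeg * LL) powi (- (ram * (k - n))) = exp (of_int (- (ram * (k - n))) * ((s - 1/2) * of_nat fdeg * LL))"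
      by (rule exp_power_int)
    also have "of_int (- (ram * (k - n))) * ((s - 1/2) * of_nat fdeg * LL) = - of_int (k - n) * of_int (ram * int fdeg) * (s - 1/2) * LL"
      by (simp only: of_int_minus of_int_mult of_int_diff of_int_of_nat_eq) (simp add: algebra_simps)
    finally show ?thesis unfolding ram_fdeg by simp
  qed
  have e3: "qchar F eta (t + 1/2) z = F.ang eta z * exp (- of_int (k - n) * (t + 1/2) * LL)"
  proof -
    have "qchar F eta (t + 1/2) z = F.ang eta z * exp ((t + 1/2) * LL) powi (- (k - n))"
      unfolding F.qchar_eq[OF z] F.powr_Q nz ..
    also have "exp ((t + 1/2) * LL) powi (- (k - n)) = exp (of_int (- (k - n)) * ((t + 1/2) * LL))"
      by (rule exp_power_int)
    finally show ?thesis by (simp add: mult.assoc)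
  qed
  have r1: "(F.Q * Yv s t) powi k = exp (of_int k * (LL + - (2 * s + t + 1/2) * LL))"
    unfolding Yv_exp exp_LL[symmetric] exp_add[symmetric] by (rule exp_power_int)
  have r2: "tv t powi n = exp (of_int n * ((t + 1/2) * LL))"
    unfolding tv_exp by (rule exp_power_int)
  have "kern F E j \<alpha> chi eta s t x = qchar E chi (s - 1/2) (x\<^sup>2) * (qchar E chi (s - 1/2) (j z) * qchar F eta (t + 1/2) z)"
    by (simp only: kern_def Let_def z_def nrm_def)
  also have "\<dots> = kap x * (E.ang chi (j z) * F.ang eta z) *
      (exp (- of_int n * 2 * (s - 1/2) * LL) * exp (- of_int (k - n) * 2 * (s - 1/2) * LL) * exp (- of_int (k - n) * (t + 1/2) * LL))"
    unfolding e1 e2 e3 by (simp only: mult_ac)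
  also have "\<dots> = kap x * exp (- of_int n * 2 * (s - 1/2) * LL + - of_int (k - n) * 2 * (s - 1/2) * LL + - of_int (k - n) * (t + 1/2) * LL)"
    unfolding ang_j[OF z] exp_add by simp
  also have "- of_int n * 2 * (s - 1/2) * LL + - of_int (k - n) * 2 * (s - 1/2) * LL + - of_int (k - n) * (t + 1/2) * LL =
      of_int k * (LL + - (2 * s + t + 1/2) * LL) + of_int n * ((t + 1/2) * LL)"
    unfolding of_int_diff by (rule kern_exponent) simp
  also have "exp (of_int k * (LL + - (2 * s + t + 1/2) * LL) + of_int n * ((t + 1/2) * LL)) =
      (F.Q * Yv s t) powi k * tv t powi n"
    by (simp only: exp_add r1 r2)
  finally show ?thesis using False unfolding Kf_def k_def n_def
    by (simp only: if_False mult.assoc)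
qed

lemma holomorphic2_XY:
  "holomorphic2 (\<lambda>p. Yv (fst p) (snd p) powi k)" "holomorphic2 (\<lambda>p. Xv (fst p) (snd p) powi k)"
  "holomorphic2 (\<lambda>p. tv (snd p) powi k)" "holomorphic2 (\<lambda>p. Yv (fst p) (snd p))"
  "holomorphic2 (\<lambda>p. Xv (fst p) (snd p))" "holomorphic2 (\<lambda>p. tv (snd p))"
proof -
  have Y: "holomorphic2 (\<lambda>p. Yv (fst p) (snd p) powi k)" for k
    unfolding Yv_exp exp_power_int
    using holomorphic2_exp[of "- 2 * of_int k * LL" "- of_int k * LL" "- of_int k * LL / 2"] by (simp add: algebra_simps)
  have X: "holomorphic2 (\<lambda>p. Xv (fst p) (snd p) powi k)" for k
    unfolding Xv_exp exp_power_int
    using holomorphic2_exp[of "- 2 * of_int k * LL" "of_int k * LL" "- of_int k * LL / 2"] by (simp add: algebra_simps)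
  have T: "holomorphic2 (\<lambda>p. tv (snd p) powi k)" for k
    unfolding tv_exp exp_power_int
    using holomorphic2_exp[of 0 "of_int k * LL" "of_int k * LL / 2"] by (simp add: algebra_simps)
  show "holomorphic2 (\<lambda>p. Yv (fst p) (snd p) powi k)" "holomorphic2 (\<lambda>p. Xv (fst p) (snd p) powi k)"
    "holomorphic2 (\<lambda>p. tv (snd p) powi k)" "holomorphic2 (\<lambda>p. Yv (fst p) (snd p))"
    "holomorphic2 (\<lambda>p. Xv (fst p) (snd p))" "holomorphic2 (\<lambda>p. tv (snd p))"
    using Y X T Y[of 1] X[of 1] T[of 1] by simp_all
qed

section \<open>Test functions on E in coordinates\<close>

lemma tf_E_iff: "tf E u \<longleftrightarrow> (\<exists>N M. (\<forall>x. \<forall>h\<in>BB N. u (x + h) = u x) \<and> (\<forall>x. u x \<noteq> 0 \<longrightarrow> x \<in> BB M))"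
proof
  assume "tf E u"
  then obtain N M where NM: "\<forall>x. \<forall>h\<in>pid E N. u (x + h) = u x" "\<forall>x. u x \<noteq> 0 \<longrightarrow> x \<in> pid E M"
    unfolding tf_def by blast
  have a: "m \<le> ram * int (nat m)" for m
  proof -
    have "1 * int (nat m) \<le> ram * int (nat m)" using ram_pos by (intro mult_right_mono) auto
    moreover have "m \<le> int (nat m)" by simp
    ultimately show ?thesis by linarith
  qed
  have "BB (int (nat N)) \<subseteq> pid E N" unfolding BB_def using a[of N] E.pid_mono by blast
  moreover have "pid E M \<subseteq> BB (- int (nat (- M)))"
    unfolding BB_def using a[of "- M"] E.pid_mono[of _ M "ram * - int (nat (- M))"] by auto
  ultimately show "\<exists>N M. (\<forall>x. \<forall>h\<in>BB N. u (x + h) = u x) \<and> (\<forall>x. u x \<noteq> 0 \<longrightarrow> x \<in> BB M)"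
    using NM by blast
qed (auto simp: tf_def BB_def)

definition bB :: "'e \<Rightarrow> int \<Rightarrow> 'e \<Rightarrow> complex" where "bB c N = bl E c (ram * N)"

lemma bB_eq: "bB c N x = (if x - c \<in> BB N then 1 else 0)"
  by (simp add: bB_def bl_def BB_def)

lemma tf_bB [simp]: "tf E (bB c N)"
  unfolding bB_def by (rule E.tf_bl)

lemma E_powi: "E.q powi (- (ram * N)) = F.q powi (- 2 * N)"
proof -
  have "E.q = F.q powi int fdeg" by (simp add: qE)
  then have "E.q powi (- (ram * N)) = F.q powi (int fdeg * - (ram * N))"
    by (simp only: power_int_mult)
  also have "int fdeg * - (ram * N) = - (ram * int fdeg) * N" by simp
  finally show ?thesis by (simp only: ram_fdeg)
qed

lemma bB_integral: "(LINT x|haar E. bB c N x) = of_real (F.q powi (- 2 * N))"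
  unfolding bB_def E.bl_integral E_powi ..

lemma bB_decomp:
  assumes "\<And>x h. h \<in> BB N \<Longrightarrow> u (x + h) = u x" "\<And>x. u x \<noteq> 0 \<Longrightarrow> x \<in> BB M"
  shows "u x = (\<Sum>c\<in>E.rp (ram * N) ` BB M. u c * bB c N x)"
  unfolding bB_def BB_def by (rule E.tf_decomp[OF assms[unfolded BB_def]])

lemma finite_rpB: "finite (E.rp n ` BB M)"
  unfolding BB_def by (rule E.finite_rp)

lemma bB_induct [consumes 1, case_names ball add cmult]:
  assumes "tf E u"
    and ball: "\<And>c n. n \<ge> N0 \<Longrightarrow> P (bB c n)"
    and add: "\<And>u v. tf E u \<Longrightarrow> P u \<Longrightarrow> tf E v \<Longrightarrow> P v \<Longrightarrow> P (\<lambda>x. u x + v x)"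
    and cm: "\<And>u c. tf E u \<Longrightarrow> P u \<Longrightarrow> P (\<lambda>x. c * u x)"
  shows "P u"
proof -
  obtain N M where NM: "\<forall>x. \<forall>h\<in>BB N. u (x + h) = u x" "\<forall>x. u x \<noteq> 0 \<longrightarrow> x \<in> BB M"
    using assms(1) unfolding tf_E_iff by blast
  let ?N = "max N N0" let ?C = "E.rp (ram * ?N) ` BB M"
  have u: "u x = (\<Sum>c\<in>?C. u c * bB c ?N x)" for x
  proof (rule bB_decomp)
    show "u (x + h) = u x" if "h \<in> BB ?N" for x h using NM(1) BB_mono[OF that, of N] by simp
  qed (use NM in blast)
  have "tf E (\<lambda>x. \<Sum>c\<in>C. u c * bB c ?N x) \<and> P (\<lambda>x. \<Sum>c\<in>C. u c * bB c ?N x)" if "finite C" for C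
    using that
  proof (induction C)
    case empty
    show ?case using cm[OF tf_bB ball[OF order.refl], of 0 0] by (simp add: E.tf_0)
  next
    case (insert a C)
    have "P (\<lambda>x. u a * bB a ?N x)" by (intro cm tf_bB ball) simp
    then have "P (\<lambda>x. u a * bB a ?N x + (\<Sum>c\<in>C. u c * bB c ?N x))"
      using insert.IH by (intro add E.tf_cmult tf_bB) auto
    moreover have "tf E (\<lambda>x. u a * bB a ?N x + (\<Sum>c\<in>C. u c * bB c ?N x))"
      using insert.IH by (intro E.tf_add E.tf_cmult tf_bB) auto
    ultimately show ?case using insert.hyps by simp
  qed
  from this[OF finite_rpB, THEN conjunct2, of "ram * ?N" M]
  have "P (\<lambda>x. \<Sum>c\<in>?C. u c * bB c ?N x)" .
  moreover have "u = (\<lambda>x. \<Sum>c\<in>?C. u c * bB c ?N x)" by (rule HOL.ext) (rule u)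
  ultimately show ?thesis by (rule ssubst[rotated])
qed

lemma slice_tf: assumes "tf E u" shows "tf F (\<lambda>x2. u (j x1 + j x2 * \<alpha>))"
proof -
  obtain N M where NM: "\<forall>x. \<forall>h\<in>BB N. u (x + h) = u x" "\<forall>x. u x \<noteq> 0 \<longrightarrow> x \<in> BB M"
    using assms unfolding tf_E_iff by blast
  show ?thesis
  proof (rule F.tfI[where N = N and M = M])
    fix x2 h assume "h \<in> pid F N"
    then have "j h * \<alpha> \<in> BB N" by (simp add: BB_iff)
    from NM(1)[rule_format, OF this, of "j x1 + j x2 * \<alpha>"]
    show "u (j x1 + j (x2 + h) * \<alpha>) = u (j x1 + j x2 * \<alpha>)" by (simp add: algebra_simps)
  next
    fix x2 assume "u (j x1 + j x2 * \<alpha>) \<noteq> 0"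
    then have "j x1 + j x2 * \<alpha> \<in> BB M" using NM(2) by blast
    then show "x2 \<in> pid F M" unfolding BB_iff by simp
  qed
qed

text \<open>It suffices to check balls \<open>bB\<close>, whose indicators are products in the two
  coordinates. That the inner integral is again a test function is carried along in order to add
  outer integrals.\<close>

lemma fubini:
  assumes "tf E u"
  shows "tf F (\<lambda>x1. LINT x2|haar F. u (j x1 + j x2 * \<alpha>)) \<and>
     (LINT x|haar E. u x) = (LINT x1|haar F. LINT x2|haar F. u (j x1 + j x2 * \<alpha>))"
  using assms
proof (induction rule: bB_induct[where ?N0.0 = 0])
  case (ball c n)
  have e: "bB c n (j x1 + j x2 * \<alpha>) = bl F (c1 c) n x1 * bl F (c2 c) n x2" for x1 x2
    by (simp add: bB_eq bl_def BB_iff)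
  have q: "of_real (F.q powi (- n)) * of_real (F.q powi (- n)) = complex_of_real (F.q powi (- 2 * n))"
    using F.q_nz by (simp only: of_real_mult[symmetric]) (simp add: power_int_add[symmetric])
  have i: "(LINT x2|haar F. bB c n (j x1 + j x2 * \<alpha>)) = of_real (F.q powi (- n)) * bl F (c1 c) n x1" for x1
    unfolding e by (subst Bochner_Integration.integral_mult_right_zero) (simp only: F.bl_integral mult.commute)
  show ?case unfolding i bB_integral
    by (subst Bochner_Integration.integral_mult_right_zero) (simp only: F.bl_integral q F.tf_cmult F.tf_bl simp_thms)
next
  case (add u v)
  have "(LINT x2|haar F. u (j x1 + j x2 * \<alpha>) + v (j x1 + j x2 * \<alpha>)) =
      (LINT x2|haar F. u (j x1 + j x2 * \<alpha>)) + (LINT x2|haar F. v (j x1 + j x2 * \<alpha>))" for x1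
    by (intro Bochner_Integration.integral_add F.tf_integrable slice_tf add)
  then show ?case using add F.tf_integrable E.tf_integrable by (simp add: F.tf_add)
next
  case (cmult u c)
  then show ?case by (simp add: F.tf_cmult)
qed

definition prodf :: "('f \<Rightarrow> complex) \<Rightarrow> ('f \<Rightarrow> complex) \<Rightarrow> 'e \<Rightarrow> complex" where
  "prodf v w x = v (c1 x) * w (c2 x)"

lemma tf_prodf: assumes "tf F v" "tf F w" shows "tf E (prodf v w)"
proof -
  obtain N M where v': "\<forall>N'\<ge>N. \<forall>x. \<forall>h\<in>pid F N'. v (x + h) = v x" "\<forall>M'\<le>M. \<forall>x. v x \<noteq> 0 \<longrightarrow> x \<in> pid F M'"
    using F.tf_ex[OF assms(1)] by blast
  obtain N' M' where w': "\<forall>N\<ge>N'. \<forall>x. \<forall>h\<in>pid F N. w (x + h) = w x" "\<forall>M\<le>M'. \<forall>x. w x \<noteq> 0 \<longrightarrow> x \<in> pid F M"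
    using F.tf_ex[OF assms(2)] by blast
  show ?thesis unfolding tf_E_iff
  proof (intro exI conjI allI impI ballI)
    fix x h assume "h \<in> BB (max N N')"
    then have h: "c1 h \<in> pid F (max N N')" "c2 h \<in> pid F (max N N')" by (simp_all add: BB_iff)
    have "v (c1 x + c1 h) = v (c1 x)" by (rule v'(1)[rule_format, OF max.cobounded1 h(1)])
    moreover have "w (c2 x + c2 h) = w (c2 x)" by (rule w'(1)[rule_format, OF max.cobounded2 h(2)])
    ultimately have "v (c1 x + c1 h) = v (c1 x)" "w (c2 x + c2 h) = w (c2 x)" .
    then show "prodf v w (x + h) = prodf v w x" by (simp add: prodf_def)
  next
    fix x assume "prodf v w x \<noteq> 0"
    then have "v (c1 x) \<noteq> 0" "w (c2 x) \<noteq> 0" by (auto simp: prodf_def)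
    then show "x \<in> BB (min M M')"
      using v'(2)[rule_format, OF min.cobounded1] w'(2)[rule_format, OF min.cobounded2] by (simp add: BB_iff)
  qed
qed

lemma integral_prodf:
  assumes "tf F v" "tf F w"
  shows "(LINT x|haar E. prodf v w x) = (LINT x|haar F. v x) * (LINT x|haar F. w x)"
proof -
  have "(LINT x|haar E. prodf v w x) = (LINT x1|haar F. LINT x2|haar F. v x1 * w x2)"
    using fubini[OF tf_prodf[OF assms], THEN conjunct2] unfolding prodf_def c1_eq c2_eq .
  also have "\<dots> = (LINT x1|haar F. (LINT x2|haar F. w x2) * v x1)"
    by (subst Bochner_Integration.integral_mult_right_zero) (simp only: mult.commute)
  also have "\<dots> = (LINT x|haar F. v x) * (LINT x|haar F. w x)"
    by (subst Bochner_Integration.integral_mult_right_zero) (rule mult.commute)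
  finally show ?thesis .
qed

section \<open>Holomorphic extension of the kernel\<close>

text \<open>
  Integrability is part of the definition because the Bochner integral of a nonintegrable function is 0.
\<close>

definition kext :: "('e \<Rightarrow> complex) \<Rightarrow> (complex \<times> complex \<Rightarrow> complex) \<Rightarrow> bool" where
  "kext u \<Phi> \<longleftrightarrow> holomorphic2 \<Phi> \<and> (\<forall>s t. conv_dom s t \<longrightarrow>
     integrable (haar E) (\<lambda>x. Kf (Yv s t) (tv t) x * u x) \<and>
     \<Phi> (s, t) = (1 - Yv s t) * (1 - Xv s t) * (LINT x|haar E. Kf (Yv s t) (tv t) x * u x))"

lemma Ktilde_eq: assumes "kext u \<Phi>" shows "Ktilde F E j \<alpha> chi eta s t u = \<Phi> (s, t)"
proof -
  have "(THE \<Phi>. holomorphic2 \<Phi> \<and>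
        (\<forall>s t. 0 < Re (2 * s + t + 1/2) \<and> 0 < Re (2 * s - t + 1/2) \<longrightarrow>
           \<Phi> (s, t) = lambda_plus F j chi eta s t * lambda_minus F j chi eta s t *
                      (LINT x|haar E. kern F E j \<alpha> chi eta s t x * u x))) = \<Phi>"
    unfolding conv_dom_def[symmetric] lambda_plus_eq lambda_minus_eq kern_eq
  proof (rule the_equality)
    show "holomorphic2 \<Phi> \<and> (\<forall>s t. conv_dom s t \<longrightarrow> \<Phi> (s, t) = (1 - Yv s t) * (1 - Xv s t) * (LINT x|haar E. Kf (Yv s t) (tv t) x * u x))"
      using assms unfolding kext_def by blast
    fix \<Psi> assume "holomorphic2 \<Psi> \<and> (\<forall>s t. conv_dom s t \<longrightarrow> \<Psi> (s, t) = (1 - Yv s t) * (1 - Xv s t) * (LINT x|haar E. Kf (Yv s t) (tv t) x * u x))"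
    then show "\<Psi> = \<Phi>" using assms unfolding kext_def by (intro holomorphic2_unique) auto
  qed
  then show ?thesis by (simp add: Ktilde_def)
qed

lemma kext_add: assumes "kext u \<Phi>" "kext v \<Psi>" shows "kext (\<lambda>x. u x + v x) (\<lambda>p. \<Phi> p + \<Psi> p)"
proof -
  have i: "integrable (haar E) (\<lambda>x. Kf (Yv s t) (tv t) x * u x)" "integrable (haar E) (\<lambda>x. Kf (Yv s t) (tv t) x * v x)"
    if "conv_dom s t" for s t using assms that by (simp_all add: kext_def)
  then show ?thesis using assms unfolding kext_def
    by (auto intro!: holomorphic2_add Bochner_Integration.integrable_add simp: distrib_left)
qed

lemma kext_cmult: assumes "kext u \<Phi>" shows "kext (\<lambda>x. c * u x) (\<lambda>p. c * \<Phi> p)"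
proof -
  have e: "(\<lambda>x. Kf Y \<tau> x * (c * u x)) = (\<lambda>x. c * (Kf Y \<tau> x * u x))" for Y \<tau>
    by (simp add: fun_eq_iff)
  show ?thesis using assms unfolding kext_def e
    by (auto intro!: holomorphic2_mult holomorphic2_const integrable_mult_right)
qed

lemma Kf_ball_off:
  assumes n0: "cond n0" and c: "c2 c \<noteq> 0" and N: "nu F (c2 c) + n0 \<le> N"
  shows "Kf Y \<tau> x * bB c N x = Kf Y \<tau> c * bB c N x"
  using Kf_const[OF n0 c _ N, of "x - c"] by (simp add: bB_eq)

lemma bB_integrable [simp]: "integrable (haar E) (bB c N)"
  by (rule E.tf_integrable[OF tf_bB])

lemma kext_off:
  assumes n0: "cond n0" and c: "c2 c \<noteq> 0" and N: "nu F (c2 c) + n0 \<le> N"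
  shows "kext (bB c N) (\<lambda>p. (1 - Yv (fst p) (snd p)) * (1 - Xv (fst p) (snd p)) * (Kf (Yv (fst p) (snd p)) (tv (snd p)) c * F.Q powi (- 2 * N)))"
proof -
  have "Kf (Yv (fst p) (snd p)) (tv (snd p)) c = kap c * F.Q powi nu F (c2 c) * Yv (fst p) (snd p) powi nu F (c2 c) * tv (snd p) powi (int fdeg * nu E c)" for p
    using c by (simp add: Kf_def power_int_mult_distrib mult.assoc)
  then have "holomorphic2 (\<lambda>p. (1 - Yv (fst p) (snd p)) * (1 - Xv (fst p) (snd p)) * (Kf (Yv (fst p) (snd p)) (tv (snd p)) c * F.Q powi (- 2 * N)))"
    by (simp only:) (intro holomorphic2_mult holomorphic2_diff holomorphic2_const holomorphic2_XY)
  moreover have "(LINT x|haar E. Kf Y \<tau> x * bB c N x) = Kf Y \<tau> c * F.Q powi (- 2 * N)" for Y \<tau>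
    unfolding Kf_ball_off[OF n0 c N] by (simp add: bB_integral)
  moreover have "integrable (haar E) (\<lambda>x. Kf Y \<tau> x * bB c N x)" for Y \<tau>
    unfolding Kf_ball_off[OF n0 c N] by (intro integrable_mult_right) simp
  ultimately show ?thesis unfolding kext_def by simp
qed

lemma integral_norm_prodf_sph:
  "(LINT x|haar E. norm (prodf (bl F y a) (F.sph k) x)) = F.q powi (- a) * (F.q powi (- k) * (1 - 1 / F.q))"
proof -
  have "(LINT x|haar E. norm (prodf (bl F y a) (F.sph k) x)) = (LINT x|haar E. Re (prodf (bl F y a) (F.sph k) x))"
    by (intro Bochner_Integration.integral_cong) (auto simp: prodf_def F.sph_def bl_def)
  also have "\<dots> = Re (LINT x|haar E. prodf (bl F y a) (F.sph k) x)"
    by (intro integral_Re E.tf_integrable tf_prodf F.tf_bl F.tf_sph)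
  also have "(LINT x|haar E. prodf (bl F y a) (F.sph k) x) = of_real (F.q powi (- a) * (F.q powi (- k) * (1 - 1 / F.q)))"
    unfolding integral_prodf[OF F.tf_bl F.tf_sph] F.bl_integral F.integral_sph by simp
  finally show ?thesis by (simp only: Re_complex_of_real)
qed

text \<open>
  Expands an integral over E along the sets on which \<open>\<nu>(x\<^sub>2)\<close> is constant.
\<close>

lemma shell_series:
  fixes \<rho> :: "nat \<Rightarrow> 'e \<Rightarrow> complex"
  assumes \<rho>: "\<And>i. tf E (\<rho> i)"
    and bound: "\<And>i x. norm (\<rho> i x) \<le> B * norm (prodf (bl F y a) (F.sph (b + int i)) x)"
    and f0: "\<And>x. c2 x = 0 \<or> nu F (c2 x) < b \<Longrightarrow> f x = 0"
    and f1: "\<And>x i. c2 x \<noteq> 0 \<Longrightarrow> nu F (c2 x) = b + int i \<Longrightarrow> f x = (F.Q * Y) powi (b + int i) * \<rho> i x"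
    and Y: "norm Y < 1" "Y \<noteq> 0" and B: "0 \<le> B"
  shows "integrable (haar E) f" and "(\<lambda>i. (F.Q * Y) powi (b + int i) * (LINT x|haar E. \<rho> i x)) sums (LINT x|haar E. f x)"
proof -
  define g where "g = (\<lambda>i x. (F.Q * Y) powi (b + int i) * \<rho> i x)"
  have int: "integrable (haar E) (g i)" for i
    unfolding g_def by (intro integrable_mult_right E.tf_integrable \<rho>)
  have \<rho>0: "\<rho> i x = 0" if "c2 x = 0 \<or> nu F (c2 x) \<noteq> b + int i" for i x
  proof -
    have "prodf (bl F y a) (F.sph (b + int i)) x = 0" using that by (auto simp: prodf_def F.sph_def)
    then show ?thesis using bound[of i x] by simp
  qed
  have dis: "\<exists>k. f x = g k x \<and> (\<forall>i. i \<noteq> k \<longrightarrow> g i x = 0)" for x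
  proof (cases "c2 x = 0 \<or> nu F (c2 x) < b")
    case True
    then have "g i x = 0" for i using \<rho>0[of x i] by (auto simp: g_def)
    then show ?thesis using f0[OF True] by auto
  next
    case False
    then have k: "nu F (c2 x) = b + int (nat (nu F (c2 x) - b))" by simp
    have "f x = g (nat (nu F (c2 x) - b)) x" using f1[OF _ k] False by (simp add: g_def)
    moreover have "g i x = 0" if "i \<noteq> nat (nu F (c2 x) - b)" for i
      using that \<rho>0[of x i] k by (auto simp: g_def)
    ultimately show ?thesis by blast
  qed
  \<comment> \<open>The factor q^k of the kernel on the slice of level k cancels the measure q^(-k)
    of the slice, so the L1 norms decay like |Y|^i.\<close>
  define C where "C = norm (F.Q * Y) powi b * (B * (F.q powi (- a) * (F.q powi (- b) * (1 - 1 / F.q))))"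
  have le: "(LINT x|haar E. norm (g i x)) \<le> C * norm Y ^ i" for i
  proof -
    have nQ: "norm (F.Q * Y) = F.q * norm Y" by (simp add: norm_mult)
    have pos: "0 < norm (F.Q * Y)" unfolding nQ using Y F.q_gt_0 by simp
    have "(LINT x|haar E. norm (g i x)) \<le> (LINT x|haar E. norm (F.Q * Y) powi (b + int i) * (B * norm (prodf (bl F y a) (F.sph (b + int i)) x)))"
    proof (rule integral_mono)
      show "integrable (haar E) (\<lambda>x. norm (g i x))" by (intro integrable_norm int)
      show "integrable (haar E) (\<lambda>x. norm (F.Q * Y) powi (b + int i) * (B * norm (prodf (bl F y a) (F.sph (b + int i)) x)))"
        by (intro integrable_mult_right integrable_norm E.tf_integrable tf_prodf F.tf_bl F.tf_sph)
      show "norm (g i x) \<le> norm (F.Q * Y) powi (b + int i) * (B * norm (prodf (bl F y a) (F.sph (b + int i)) x))" for x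
        unfolding g_def norm_mult[of "(F.Q * Y) powi (b + int i)"] norm_power_int
        by (intro mult_left_mono bound) (use pos in simp)
    qed
    also have "\<dots> = norm (F.Q * Y) powi (b + int i) * (B * (F.q powi (- a) * (F.q powi (- (b + int i)) * (1 - 1 / F.q))))"
      by (subst Bochner_Integration.integral_mult_right_zero, subst Bochner_Integration.integral_mult_right_zero)
        (simp only: integral_norm_prodf_sph)
    also have "norm (F.Q * Y) powi (b + int i) = norm (F.Q * Y) powi b * (F.q ^ i * norm Y ^ i)"
      using pos by (subst power_int_add) (auto simp: nQ power_mult_distrib)
    also have "F.q powi (- (b + int i)) = F.q powi (- b) / F.q ^ i"
      using F.q_nz by (simp add: power_int_diff)
    also have "norm (F.Q * Y) powi b * (F.q ^ i * norm Y ^ i) * (B * (F.q powi (- a) * (F.q powi (- b) / F.q ^ i * (1 - 1 / F.q)))) = C * norm Y ^ i"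
      unfolding C_def using F.q_nz by simp
    finally show ?thesis .
  qed
  have "summable (\<lambda>i. LINT x|haar E. norm (g i x))"
  proof (rule summable_comparison_test')
    show "summable (\<lambda>i. C * norm Y ^ i)" using Y by (intro summable_mult summable_geometric) simp
    show "norm (LINT x|haar E. norm (g i x)) \<le> C * norm Y ^ i" for i using le[of i] by simp
  qed
  from integrable_disjoint_series[of "haar E" g f, OF int dis this]
  show "integrable (haar E) f" "(\<lambda>i. (F.Q * Y) powi (b + int i) * (LINT x|haar E. \<rho> i x)) sums (LINT x|haar E. f x)"
    by (simp_all add: g_def)
qed

lemma QY_powi: "F.Q powi (- k) * (F.Q * Y) powi k = Y powi k"
  by (simp add: power_int_mult_distrib power_int_minus)

lemma kap_near_j:
  assumes n0: "cond n0" and y: "y \<noteq> 0" and N: "nu F y + n0 \<le> N" and h: "x - j y \<in> BB N"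
  shows "x \<noteq> 0" "nu E x = ram * nu F y" "kap x = 1"
proof -
  have n1: "1 \<le> n0" using n0 by (simp add: cond_def)
  have B: "j y \<notin> BB (nu F y + 1)" using y by (simp add: BB_iff pid_def)
  have h1: "x - j y \<in> BB (nu F y + 1)" "x - j y \<in> BB (nu F y + 1 + n0 - 1)"
    using BB_mono[OF h] N n1 by auto
  show "x \<noteq> 0" "nu E x = ram * nu F y" using nu_add_BB[OF B h1(1)] nu_j[OF y] by simp_all
  show "kap x = 1" using condD[OF n0 B h1(2)] kap_j[OF y] by simp
qed

lemma fdeg_ram: "int fdeg * (ram * k) = 2 * k"
  using ram_fdeg by (metis mult.assoc mult.commute)

text \<open>Near a nonzero point of F the kernel depends only on the valuation k of x2; each slice
  contributes a multiple of Y^k, and k starts at N.\<close>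

lemma integral_near_j:
  assumes n0: "cond n0" and y: "y \<noteq> 0" and N: "nu F y + n0 \<le> N" and Y: "norm Y < 1" "Y \<noteq> 0"
  shows "integrable (haar E) (\<lambda>x. Kf Y \<tau> x * bB (j y) N x)"
    and "(LINT x|haar E. Kf Y \<tau> x * bB (j y) N x) = \<tau> powi (2 * nu F y) * F.Q powi (- N) * (1 - 1 / F.Q) * Y powi N / (1 - Y)"
proof -
  define \<rho> where "\<rho> i x = \<tau> powi (2 * nu F y) * prodf (bl F y N) (F.sph (N + int i)) x" for i :: nat and x
  have val: "Kf Y \<tau> x * bB (j y) N x = (F.Q * Y) powi nu F (c2 x) * (\<tau> powi (2 * nu F y) * prodf (bl F y N) (F.sph (nu F (c2 x))) x)"
    if "c2 x \<noteq> 0" "N \<le> nu F (c2 x)" for x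
  proof -
    have c: "c2 x \<in> pid F N" using that by (simp add: pid_def)
    have b: "bB (j y) N x = bl F y N (c1 x)" using c by (simp add: bB_eq BB_iff bl_def)
    show ?thesis
    proof (cases "x - j y \<in> BB N")
      case True
      have "int fdeg * nu E x = 2 * nu F y" unfolding kap_near_j(2)[OF n0 y N True] by (rule fdeg_ram)
      then show ?thesis using that b kap_near_j(3)[OF n0 y N True] by (simp add: Kf_def prodf_def F.sph_def)
    next
      case False
      then show ?thesis using b by (simp add: bB_eq prodf_def split: if_splits)
    qed
  qed
  have val0: "Kf Y \<tau> x * bB (j y) N x = 0" if "c2 x = 0 \<or> nu F (c2 x) < N" for x
    using that by (auto simp: Kf_def bB_eq BB_iff pid_def)
  note ss = shell_series[where \<rho> = \<rho> and f = "\<lambda>x. Kf Y \<tau> x * bB (j y) N x" and b = N and B = "norm (\<tau> powi (2 * nu F y))" and y = y and a = N and Y = Y]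
  have tf: "tf E (\<rho> i)" for i unfolding \<rho>_def[abs_def] by (intro E.tf_cmult tf_prodf F.tf_bl F.tf_sph)
  have bd: "norm (\<rho> i x) \<le> norm (\<tau> powi (2 * nu F y)) * norm (prodf (bl F y N) (F.sph (N + int i)) x)" for i x
    by (simp add: \<rho>_def norm_mult)
  have v1: "Kf Y \<tau> x * bB (j y) N x = (F.Q * Y) powi (N + int i) * \<rho> i x" if "c2 x \<noteq> 0" "nu F (c2 x) = N + int i" for x i
    using val[of x] that by (simp add: \<rho>_def)
  show "integrable (haar E) (\<lambda>x. Kf Y \<tau> x * bB (j y) N x)"
    by (rule ss(1)[OF tf bd val0 v1 Y]) auto
  have "(\<lambda>i. (F.Q * Y) powi (N + int i) * (LINT x|haar E. \<rho> i x)) sums (LINT x|haar E. Kf Y \<tau> x * bB (j y) N x)"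
    by (rule ss(2)[OF tf bd val0 v1 Y]) auto
  moreover have "(F.Q * Y) powi (N + int i) * (LINT x|haar E. \<rho> i x) = \<tau> powi (2 * nu F y) * F.Q powi (- N) * (1 - 1 / F.Q) * Y powi N * Y ^ i" for i
  proof -
    have "(LINT x|haar E. \<rho> i x) = \<tau> powi (2 * nu F y) * (F.Q powi (- N) * (F.Q powi (- (N + int i)) * (1 - 1 / F.Q)))"
      unfolding \<rho>_def by (subst Bochner_Integration.integral_mult_right_zero, subst integral_prodf)
        (simp_all add: F.tf_bl F.tf_sph F.bl_integral F.integral_sph)
    then have "(F.Q * Y) powi (N + int i) * (LINT x|haar E. \<rho> i x) =
        \<tau> powi (2 * nu F y) * F.Q powi (- N) * (1 - 1 / F.Q) * (F.Q powi (- (N + int i)) * (F.Q * Y) powi (N + int i))"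
      by (simp only: mult_ac)
    also have "\<dots> = \<tau> powi (2 * nu F y) * F.Q powi (- N) * (1 - 1 / F.Q) * Y powi (N + int i)"
      unfolding QY_powi ..
    finally show ?thesis using Y(2) by (simp add: power_int_add)
  qed
  ultimately have 1: "(\<lambda>i. \<tau> powi (2 * nu F y) * F.Q powi (- N) * (1 - 1 / F.Q) * Y powi N * Y ^ i) sums (LINT x|haar E. Kf Y \<tau> x * bB (j y) N x)"
    by (simp only:)
  have "(\<lambda>i. \<tau> powi (2 * nu F y) * F.Q powi (- N) * (1 - 1 / F.Q) * Y powi N * Y ^ i) sums (\<tau> powi (2 * nu F y) * F.Q powi (- N) * (1 - 1 / F.Q) * Y powi N * (1 / (1 - Y)))"
    by (intro sums_mult geometric_sums Y)
  from sums_unique2[OF 1 this]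
  show "(LINT x|haar E. Kf Y \<tau> x * bB (j y) N x) = \<tau> powi (2 * nu F y) * F.Q powi (- N) * (1 - 1 / F.Q) * Y powi N / (1 - Y)"
    by simp
qed

lemma kext_near_j:
  assumes n0: "cond n0" and y: "y \<noteq> 0" and N: "nu F y + n0 \<le> N"
  shows "kext (bB (j y) N) (\<lambda>p. (1 - Xv (fst p) (snd p)) * (tv (snd p) powi (2 * nu F y) * F.Q powi (- N) * (1 - 1 / F.Q) * Yv (fst p) (snd p) powi N))"
proof -
  have "holomorphic2 (\<lambda>p. (1 - Xv (fst p) (snd p)) * (tv (snd p) powi (2 * nu F y) * F.Q powi (- N) * (1 - 1 / F.Q) * Yv (fst p) (snd p) powi N))"
    by (intro holomorphic2_mult holomorphic2_diff holomorphic2_const holomorphic2_XY)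
  moreover have "1 - Yv s t \<noteq> 0" if "conv_dom s t" for s t using norm_Yv[OF that] by auto
  ultimately show ?thesis unfolding kext_def
    using integral_near_j[OF n0 y N norm_Yv Yv_nz] by simp
qed

definition PP :: "'e \<Rightarrow> complex" where "PP x = (if x \<in> BB 0 \<and> x \<notin> BB 1 then 1 else 0)"

text \<open>For k > 0 a point of the shell needs a unit as first coordinate; for k = 0 the second
  coordinate already is one and the first ranges over all integers.\<close>

definition pik :: "nat \<Rightarrow> 'e \<Rightarrow> complex" where
  "pik k = prodf (if k = 0 then bl F 0 0 else F.sph 0) (F.sph (int k))"

lemma tf_pik: "tf E (pik k)"
  unfolding pik_def by (intro tf_prodf F.tf_sph) (simp add: F.tf_bl F.tf_sph)

lemma pik_PP: "c2 x \<noteq> 0 \<Longrightarrow> nu F (c2 x) = int k \<Longrightarrow> pik k x = PP x"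
  by (auto simp: pik_def prodf_def F.sph_def PP_def BB_iff bl_def pid_def)

lemma pik_zero: "c2 x = 0 \<or> nu F (c2 x) \<noteq> int k \<Longrightarrow> pik k x = 0"
  by (auto simp: pik_def prodf_def F.sph_def)

text \<open>For ram = 2 the shell contains two valuations; the odd one is the source of the extra
  factor \<tau> in the ramified formulas.\<close>

lemma fnu_01: "x \<in> BB 0 \<Longrightarrow> x \<notin> BB 1 \<Longrightarrow> int fdeg * nu E x = 0 \<or> (int fdeg * nu E x = 1 \<and> \<not> unramified F E j)"
proof -
  assume "x \<in> BB 0" "x \<notin> BB 1"
  then have "x \<noteq> 0" "0 \<le> nu E x" "nu E x < ram" by (auto simp: BB_def pid_def)
  then show ?thesis using ram_12 by (auto simp: fdeg_def)
qed

text \<open>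
  The kernel, up to the factor \<open>(q Y)^k\<close>, on the part of the shell \<open>BB 0 - BB 1\<close> with \<open>\<nu>(x\<^sub>2) = k\<close>.
\<close>

definition rho :: "complex \<Rightarrow> nat \<Rightarrow> 'e \<Rightarrow> complex" where
  "rho \<tau> k x = kap x * \<tau> powi (int fdeg * nu E x) * pik k x"

lemma pik_supp: "pik k x \<noteq> 0 \<Longrightarrow> x \<in> BB 0 \<and> x \<notin> BB 1"
proof -
  assume p: "pik k x \<noteq> 0"
  then have "c2 x \<noteq> 0" "nu F (c2 x) = int k" using pik_zero by blast+
  from pik_PP[OF this] p show ?thesis by (auto simp: PP_def split: if_splits)
qed

lemma tf_rho: "tf E (rho \<tau> k)"
proof -
  obtain n0 where n0: "cond n0" using cond_ex by blast
  have n1: "1 \<le> n0" using n0 by (simp add: cond_def)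
  show ?thesis unfolding rho_def[abs_def]
  proof (rule E.tf_times[OF tf_pik, where N = "ram * n0"])
    fix x h assume "pik k x \<noteq> 0" "h \<in> pid E (ram * n0)"
    then have x: "x \<notin> BB 1" and h: "h \<in> BB n0" using pik_supp by (auto simp: BB_def)
    have "kap (x + h) = kap x" using condD[OF n0 x, of h] h by simp
    moreover have "nu E (x + h) = nu E x" using nu_add_BB[OF x BB_mono[OF h n1]] by simp
    ultimately show "kap (x + h) * \<tau> powi (int fdeg * nu E (x + h)) = kap x * \<tau> powi (int fdeg * nu E x)" by simp
  qed
qed

lemma integral_PP:
  assumes Y: "norm Y < 1" "Y \<noteq> 0"
  shows "integrable (haar E) (\<lambda>x. Kf Y \<tau> x * PP x)"
    and "(\<lambda>k. (F.Q * Y) ^ k * (LINT x|haar E. rho \<tau> k x)) sums (LINT x|haar E. Kf Y \<tau> x * PP x)"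
proof -
  obtain B where B: "B \<ge> 0" "\<And>x. x \<noteq> 0 \<Longrightarrow> norm (kap x) \<le> B" using kap_bounded by blast
  have bd: "norm (rho \<tau> i x) \<le> B * (1 + norm \<tau>) * norm (prodf (bl F 0 0) (F.sph (0 + int i)) x)" for i x
  proof (cases "pik i x = 0")
    case False
    from pik_supp[OF False] have x: "x \<in> BB 0" "x \<notin> BB 1" by auto
    have x0: "x \<noteq> 0" using x(2) by (auto simp: BB_def)
    have "norm (\<tau> powi (int fdeg * nu E x)) \<le> 1 + norm \<tau>" using fnu_01[OF x] by auto
    then have "norm (kap x * \<tau> powi (int fdeg * nu E x)) \<le> B * (1 + norm \<tau>)"
      unfolding norm_mult using B(2)[OF x0] B(1) by (intro mult_mono) auto
    moreover have "norm (prodf (bl F 0 0) (F.sph (0 + int i)) x) = 1"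
      using False x by (auto simp: pik_def prodf_def F.sph_def bl_def BB_iff split: if_splits)
    moreover have "norm (pik i x) = 1" using False by (auto simp: pik_def prodf_def F.sph_def bl_def split: if_splits)
    ultimately show ?thesis by (simp add: rho_def norm_mult)
  qed (use B(1) in \<open>simp add: rho_def\<close>)
  have z: "Kf Y \<tau> x * PP x = 0" if "c2 x = 0 \<or> nu F (c2 x) < 0" for x
    using that by (auto simp: Kf_def PP_def BB_iff pid_def)
  have v: "Kf Y \<tau> x * PP x = (F.Q * Y) powi (0 + int i) * rho \<tau> i x" if "c2 x \<noteq> 0" "nu F (c2 x) = 0 + int i" for x i
    using that pik_PP[of x i] by (simp add: Kf_def rho_def)
  have B': "0 \<le> B * (1 + norm \<tau>)" using B(1) by simp
  show "integrable (haar E) (\<lambda>x. Kf Y \<tau> x * PP x)"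
    by (rule shell_series(1)[OF tf_rho bd z v Y B'])
  show "(\<lambda>k. (F.Q * Y) ^ k * (LINT x|haar E. rho \<tau> k x)) sums (LINT x|haar E. Kf Y \<tau> x * PP x)"
    using shell_series(2)[OF tf_rho bd z v Y B'] by simp
qed

text \<open>On F the character kap is trivial and the norm is the square, so dilations by F multiply
  the kernel by a power.\<close>

lemma Kf_jmult: assumes "y \<noteq> 0" "Y \<noteq> 0" "\<tau> \<noteq> 0" shows "Kf Y \<tau> (j y * x) = (F.Q * Y * \<tau>\<^sup>2) powi nu F y * Kf Y \<tau> x"
proof (cases "c2 x = 0")
  case False
  then have x: "x \<noteq> 0" by auto
  have "int fdeg * nu E (j y * x) = 2 * nu F y + int fdeg * nu E x"
    using x assms fdeg_ram[of "nu F y"] by (simp add: E.nu_mult nu_j distrib_left)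
  moreover have "nu F (c2 (j y * x)) = nu F y + nu F (c2 x)" using False assms by (simp add: F.nu_mult)
  ultimately have "Kf Y \<tau> (j y * x) = kap x * (F.Q * Y) powi (nu F y + nu F (c2 x)) * \<tau> powi (2 * nu F y + int fdeg * nu E x)"
    using False assms kap_jmult[OF assms(1) x] by (simp add: Kf_def)
  also have "(F.Q * Y) powi (nu F y + nu F (c2 x)) = (F.Q * Y) powi nu F y * (F.Q * Y) powi nu F (c2 x)"
    using assms by (intro power_int_add) simp
  also have "\<tau> powi (2 * nu F y + int fdeg * nu E x) = (\<tau>\<^sup>2) powi nu F y * \<tau> powi (int fdeg * nu E x)"
    using assms by (subst power_int_add) (simp_all add: power_int_mult)
  finally show ?thesis using False by (simp add: Kf_def power_int_mult_distrib mult_ac)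
qed (simp add: Kf_def)

lemma BB_level: assumes "x \<noteq> 0" shows "x \<in> BB m \<longleftrightarrow> m \<le> nu E x div ram"
  using assms ram_12 by (auto simp: BB_def pid_def)

lemma BB_jmult: "y \<noteq> 0 \<Longrightarrow> j y * x \<in> BB n \<longleftrightarrow> x \<in> BB (n - nu F y)"
  by (simp add: BB_iff F.pid_mult_iff)

text \<open>
  Scaling by powers of the uniformizer of F reduces the ball to the shell \<open>BB 0 - BB 1\<close>.
\<close>

lemma integral_zero_ball:
  assumes Y: "norm Y < 1" "Y \<noteq> 0" and \<tau>: "\<tau> \<noteq> 0" and X: "F.Q * X = Y * \<tau>\<^sup>2" "norm X < 1"
  shows "integrable (haar E) (\<lambda>x. Kf Y \<tau> x * bB 0 N x)"
    and "(LINT x|haar E. Kf Y \<tau> x * bB 0 N x) = X powi N * (LINT x|haar E. Kf Y \<tau> x * PP x) / (1 - X)"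
proof -
  let ?p = "unif F"
  have X0: "X \<noteq> 0" using X Y \<tau> by auto
  define f0 where "f0 x = Kf Y \<tau> x * PP x" for x
  have f0i: "integrable (haar E) f0" unfolding f0_def[abs_def] by (rule integral_PP[OF Y])
  have f0m: "f0 \<in> borel_measurable borel" using borel_measurable_integrable[OF f0i] by simp
  define g where "g i x = (F.Q\<^sup>2 * X) powi (N + int i) * f0 (j (?p powi (- (N + int i))) * x)" for i :: nat and x
  \<comment> \<open>The homogeneity factor per step is q^2 X, and the Jacobian of the dilation on E
    takes away q^2, so that a geometric series in X remains.\<close>
  have QX: "F.Q * Y * \<tau>\<^sup>2 = F.Q\<^sup>2 * X" using X(1) by (simp add: power2_eq_square mult.assoc)
  have nz: "j (?p powi n) \<noteq> 0" for n by (simp del: j_powi)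
  have g_val: "g i x = (if x \<in> BB (N + int i) \<and> x \<notin> BB (N + int i + 1) then Kf Y \<tau> x else 0)" for i x
  proof -
    let ?n = "N + int i"
    have "Kf Y \<tau> (j (?p powi (- ?n)) * x) = (F.Q\<^sup>2 * X) powi (- ?n) * Kf Y \<tau> x"
      using Kf_jmult[OF F.unif_powi_nz Y(2) \<tau>, of "- ?n" x] by (simp only: F.nu_unif_powi QX)
    moreover have "PP (j (?p powi (- ?n)) * x) = (if x \<in> BB ?n \<and> x \<notin> BB (?n + 1) then 1 else 0)"
    proof -
      have "0 - - ?n = ?n" "1 - - ?n = ?n + 1" by simp_all
      then show ?thesis unfolding PP_def BB_jmult[OF F.unif_powi_nz] F.nu_unif_powi by (simp only:)
    qed
    moreover have "(F.Q\<^sup>2 * X) powi ?n * (F.Q\<^sup>2 * X) powi (- ?n) = 1"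
      using X0 by (subst power_int_add[symmetric]) auto
    ultimately show ?thesis unfolding g_def f0_def by (simp add: mult.assoc[symmetric] del: j_powi)
  qed
  have dis: "\<exists>k. Kf Y \<tau> x * bB 0 N x = g k x \<and> (\<forall>i. i \<noteq> k \<longrightarrow> g i x = 0)" for x
  proof (cases "x = 0 \<or> x \<notin> BB N")
    case True
    have "g i x = 0" for i using True g_val[of i x] BB_mono[of x "N + int i" N] by (auto simp: Kf_def)
    moreover have "Kf Y \<tau> x * bB 0 N x = 0" using True by (cases "x = 0") (auto simp: Kf_def bB_eq)
    ultimately show ?thesis by auto
  next
    case False
    define l where "l = nu E x div ram"
    have l: "x \<in> BB m \<longleftrightarrow> m \<le> l" for m using BB_level[of x m] False by (simp add: l_def)
    have "N \<le> l" using False l by blast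
    then show ?thesis using False unfolding g_val bB_eq diff_zero l
      by (intro exI[of _ "nat (l - N)"]) auto
  qed
  have nuE: "nu E (j (?p powi (- n))) = - (ram * n)" for n using nu_j[OF F.unif_powi_nz, of "- n"] by simp
  have sc: "E.q powi nu E (j (?p powi (- n))) = F.q powi (- 2 * n)" for n
    unfolding nuE by (rule E_powi)
  have QXn: "(F.Q\<^sup>2 * X) powi n * F.Q powi (- 2 * n) = X powi n" for n
  proof -
    have "(F.Q\<^sup>2 * X) powi n = F.Q powi (2 * n) * X powi n"
      by (simp add: power_int_mult_distrib power_int_mult)
    moreover have "F.Q powi (2 * n) * F.Q powi (- 2 * n) = 1"
      by (subst power_int_add[symmetric]) auto
    ultimately show ?thesis by (simp add: mult_ac)
  qed
  have gi: "integrable (haar E) (g i)" for i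
    unfolding g_def[abs_def] using E.integrable_scale_iff[OF nz f0m] f0i by (intro integrable_mult_right) (simp del: j_powi)
  have gI: "(LINT x|haar E. g i x) = X powi N * (LINT x|haar E. f0 x) * X ^ i" for i
  proof -
    have "(LINT x|haar E. g i x) = (F.Q\<^sup>2 * X) powi (N + int i) * (of_real (F.q powi (- 2 * (N + int i))) * (LINT x|haar E. f0 x))"
      unfolding g_def by (subst Bochner_Integration.integral_mult_right_zero, subst E.integral_scale[OF nz f0m]) (simp only: sc)
    also have "\<dots> = X powi (N + int i) * (LINT x|haar E. f0 x)"
      using QXn[of "N + int i"] by (simp add: mult.assoc[symmetric])
    finally show ?thesis using X0 by (simp add: power_int_add)
  qed
  have gN: "(LINT x|haar E. norm (g i x)) = norm X powi N * (LINT x|haar E. norm (f0 x)) * norm X ^ i" for i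
  proof -
    let ?h = "\<lambda>x. complex_of_real (norm (f0 x))"
    have hm: "?h \<in> borel_measurable borel" using f0m by measurable
    have r: "(LINT x|haar E. norm (f0 (j (?p powi (- n)) * x))) = F.q powi (- 2 * n) * (LINT x|haar E. norm (f0 x))" for n
    proof -
      have "complex_of_real (LINT x|haar E. norm (f0 (j (?p powi (- n)) * x))) = (LINT x|haar E. ?h (j (?p powi (- n)) * x))"
        by (simp only: integral_complex_of_real)
      also have "\<dots> = of_real (F.q powi (- 2 * n)) * (LINT x|haar E. ?h x)"
        unfolding E.integral_scale[OF nz hm] sc ..
      also have "\<dots> = complex_of_real (F.q powi (- 2 * n) * (LINT x|haar E. norm (f0 x)))"
        by (simp only: integral_complex_of_real of_real_mult)
      finally show ?thesis by (simp only: of_real_eq_iff)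
    qed
    have "(LINT x|haar E. norm (g i x)) = norm (F.Q\<^sup>2 * X) powi (N + int i) * (F.q powi (- 2 * (N + int i)) * (LINT x|haar E. norm (f0 x)))"
      unfolding g_def norm_mult[of "(F.Q\<^sup>2 * X) powi (N + int i)"] norm_power_int
      by (subst Bochner_Integration.integral_mult_right_zero) (simp only: r)
    also have "norm (F.Q\<^sup>2 * X) powi (N + int i) * (F.q powi (- 2 * (N + int i)) * (LINT x|haar E. norm (f0 x))) =
        norm ((F.Q\<^sup>2 * X) powi (N + int i) * F.Q powi (- 2 * (N + int i))) * (LINT x|haar E. norm (f0 x))"
      by (simp add: norm_mult norm_power_int)
    finally show ?thesis unfolding QXn using X0 by (simp add: norm_mult norm_power norm_power_int power_int_add)
  qed
  have summ: "summable (\<lambda>i. LINT x|haar E. norm (g i x))"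
    unfolding gN using X(2) by (intro summable_mult summable_geometric) simp
  note ser = integrable_disjoint_series[of "haar E" g "\<lambda>x. Kf Y \<tau> x * bB 0 N x", OF gi dis summ]
  show "integrable (haar E) (\<lambda>x. Kf Y \<tau> x * bB 0 N x)" by (rule ser(1))
  have "(\<lambda>i. X powi N * (LINT x|haar E. f0 x) * X ^ i) sums (X powi N * (LINT x|haar E. f0 x) * (1 / (1 - X)))"
    using X(2) by (intro sums_mult geometric_sums) simp
  from sums_unique2[OF ser(2)[unfolded gI] this]
  show "(LINT x|haar E. Kf Y \<tau> x * bB 0 N x) = X powi N * (LINT x|haar E. Kf Y \<tau> x * PP x) / (1 - X)"
    by (simp add: f0_def)
qed

lemma kext_zero_ball:
  assumes M: "holomorphic2 M" "\<And>s t. conv_dom s t \<Longrightarrow> (1 - Yv s t) * (LINT x|haar E. Kf (Yv s t) (tv t) x * PP x) = M (s, t)"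
  shows "kext (bB 0 N) (\<lambda>p. Xv (fst p) (snd p) powi N * M p)"
proof -
  have "holomorphic2 (\<lambda>p. Xv (fst p) (snd p) powi N * M p)"
    by (intro holomorphic2_mult M holomorphic2_XY)
  moreover have "1 - Xv s t \<noteq> 0" if "conv_dom s t" for s t using norm_Xv[OF that] by auto
  ultimately show ?thesis unfolding kext_def
    using integral_zero_ball[OF norm_Yv Yv_nz tv_nz Xv_rel norm_Xv] M(2)
    by (simp add: mult.assoc[symmetric] mult.commute[of _ "Xv _ _ powi N"])
qed

text \<open>
  A ball of level \<open>N\<close> that meets F but does not contain 0 is a disjoint union of balls of level \<open>N + n0\<close>,
  whose centres can be taken in F or are far from F.
\<close>

lemma tf_refine:
  assumes n0: "cond n0" and u: "tf E u"
    and ball: "\<And>N. P (bB 0 N)"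
    and off: "\<And>c N. c2 c \<noteq> 0 \<Longrightarrow> nu F (c2 c) + n0 \<le> N \<Longrightarrow> P (bB c N)"
    and near: "\<And>y N. y \<noteq> 0 \<Longrightarrow> nu F y + n0 \<le> N \<Longrightarrow> P (bB (j y) N)"
    and add: "\<And>u v. tf E u \<Longrightarrow> P u \<Longrightarrow> tf E v \<Longrightarrow> P v \<Longrightarrow> P (\<lambda>x. u x + v x)"
    and cm: "\<And>u c. tf E u \<Longrightarrow> P u \<Longrightarrow> P (\<lambda>x. c * u x)"
  shows "P u"
proof -
  have n1: "1 \<le> n0" using n0 by (simp add: cond_def)
  have cong: "bB c N = bB c' N" if "c - c' \<in> BB N" for c c' N
    using E.bl_cong[of c c' "ram * N"] that by (simp add: bB_def BB_def)
  have refine: "P (bB c N)" if sub: "\<And>d. d - c \<in> BB N \<Longrightarrow> P (bB d N')" and le: "N \<le> N'" for c N N'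
  proof -
    have "\<exists>M. \<forall>x. bB c N x \<noteq> 0 \<longrightarrow> x \<in> BB M" using tf_bB[of c N] unfolding tf_E_iff by blast
    then obtain M where M: "\<And>x. bB c N x \<noteq> 0 \<Longrightarrow> x \<in> BB M" by blast
    have inv: "bB c N (x + h) = bB c N x" if "h \<in> BB N'" for x h
      using E.coset_add[of h "ram * N" x c] BB_mono[OF that le] by (simp add: bB_eq BB_def)
    let ?C = "E.rp (ram * N') ` BB M"
    have e: "bB c N = (\<lambda>x. \<Sum>d\<in>?C. bB c N d * bB d N' x)"
      by (rule HOL.ext) (rule bB_decomp[OF inv M])
    have "tf E (\<lambda>x. \<Sum>d\<in>C. bB c N d * bB d N' x) \<and> P (\<lambda>x. \<Sum>d\<in>C. bB c N d * bB d N' x)" if "finite C" for C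
      using that
    proof (induction C)
      case empty
      show ?case using cm[OF tf_bB ball, of 0 0] by (simp add: E.tf_0)
    next
      case (insert a C)
      have "P (\<lambda>x. bB c N a * bB a N' x)"
      proof (cases "a - c \<in> BB N")
        case True
        then show ?thesis by (intro cm tf_bB sub)
      next
        case False
        then show ?thesis using cm[OF tf_bB ball, of 0 0] by (simp add: bB_eq)
      qed
      then have "P (\<lambda>x. bB c N a * bB a N' x + (\<Sum>d\<in>C. bB c N d * bB d N' x))"
        using insert.IH by (intro add E.tf_cmult tf_bB) auto
      moreover have "tf E (\<lambda>x. bB c N a * bB a N' x + (\<Sum>d\<in>C. bB c N d * bB d N' x))"
        using insert.IH by (intro E.tf_add E.tf_cmult tf_bB) auto
      ultimately show ?case using insert.hyps by simp
    qed
    from this[OF finite_rpB, THEN conjunct2, of "ram * N'" M] e show ?thesis by (rule ssubst[rotated])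
  qed
  have step1: "P (bB c N)" if c: "c2 c \<notin> pid F N" for c N
  proof (rule refine[of c N "N + n0"])
    fix d assume "d - c \<in> BB N"
    then have "c2 d - c2 c \<in> pid F N" by (simp add: BB_iff)
    from F.nu_add_eq[OF c this] have "c2 d \<noteq> 0" "nu F (c2 d) = nu F (c2 c)" by simp_all
    moreover have "nu F (c2 c) < N" using F.notin_pidD[OF c] by simp
    ultimately show "P (bB d (N + n0))" by (intro off) simp_all
  qed (use n1 in simp)
  have step2: "P (bB (j y) N)" if y: "y \<notin> pid F N" for y N
  proof (rule refine[of "j y" N "N + n0"])
    fix d assume "d - j y \<in> BB N"
    then have d: "c1 d - y \<in> pid F N" "c2 d \<in> pid F N" by (simp_all add: BB_iff)
    from F.nu_add_eq[OF y d(1)] have c1d: "c1 d \<noteq> 0" "nu F (c1 d) = nu F y" by simp_all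
    have yN: "nu F y < N" using F.notin_pidD[OF y] by simp
    show "P (bB d (N + n0))"
    proof (cases "c2 d \<in> pid F (N + n0)")
      case True
      have "bB d (N + n0) = bB (j (c1 d)) (N + n0)" by (rule cong) (use True in \<open>simp add: BB_iff\<close>)
      then show ?thesis using near[OF c1d(1), of "N + n0"] c1d yN by simp
    next
      case False
      then show ?thesis by (rule step1)
    qed
  qed (use n1 in simp)
  have b: "P (bB c N)" for c N
  proof (cases "c2 c \<in> pid F N")
    case True
    have e: "bB c N = bB (j (c1 c)) N" by (rule cong) (use True in \<open>simp add: BB_iff\<close>)
    show ?thesis
    proof (cases "c1 c \<in> pid F N")
      case True
      have "bB (j (c1 c)) N = bB 0 N" by (rule cong) (use True in \<open>simp add: BB_iff\<close>)
      then show ?thesis using e ball by simp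
    next
      case False
      then show ?thesis using e step2 by simp
    qed
  qed (rule step1)
  show ?thesis by (rule bB_induct[OF u, of 0 P, OF b add cm])
qed

abbreviation quadratic_chi :: bool where "quadratic_chi \<equiv> trivial_on_units E (\<lambda>u. (chi u)\<^sup>2)"

lemma pid1_iff: "x \<in> BB 0 \<Longrightarrow> x \<in> pid E 1 \<longleftrightarrow> c1 x \<in> pid F 1 \<and> (unramified F E j \<longrightarrow> c2 x \<in> pid F 1)"
  using ram_12 by (auto simp: pid1_box box_def BB_iff)

lemma unit_E_iff: "x \<in> unit_group E \<longleftrightarrow> x \<in> BB 0 \<and> x \<notin> pid E 1"
  by (auto simp: E.unit_iff pid_def BB_def)

lemma rho_c1_unit: assumes "k \<ge> 1" shows "rho \<tau> k x = kap x * pik k x"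
proof (cases "pik k x = 0")
  case False
  then have c: "c1 x \<noteq> 0" "nu F (c1 x) = 0" "c2 x \<noteq> 0" "nu F (c2 x) = int k"
    using assms by (auto simp: pik_def prodf_def F.sph_def split: if_splits)
  have "x \<in> BB 0" using c by (simp add: BB_iff pid_def)
  moreover have "x \<notin> pid E 1" using pid1_iff[OF \<open>x \<in> BB 0\<close>] c by (auto simp: pid_def)
  ultimately have "nu E x = 0" using unit_E_iff E.unit_iff by blast
  then show ?thesis by (simp add: rho_def)
qed (simp add: rho_def)

lemma F_sph_integral: "(LINT x|haar F. F.sph k x) = F.Q powi (- k) * (1 - 1 / F.Q)"
  by (simp add: F.integral_sph)

lemma quad_rho:
  assumes quad: quadratic_chi
  shows "k \<ge> 1 \<Longrightarrow> (LINT x|haar E. rho \<tau> k x) = (1 - 1 / F.Q) * (F.Q powi (- int k) * (1 - 1 / F.Q))"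
    and "(LINT x|haar E. rho \<tau> 0 x) = (if unramified F E j then 1 - 1 / F.Q else (1 - 1 / F.Q)\<^sup>2 + \<tau> * (1 - 1 / F.Q) / F.Q)"
proof -
  have kp: "kap x * pik k x = pik k x" for k x
    using cond_quad(2)[OF quad, of x] by (cases "x = 0") (auto simp: pik_def prodf_def F.sph_def)
  {
    assume k: "k \<ge> 1"
    have "(LINT x|haar E. rho \<tau> k x) = (LINT x|haar E. prodf (F.sph 0) (F.sph (int k)) x)"
      unfolding rho_c1_unit[OF k] kp using k by (simp add: pik_def)
    then show "(LINT x|haar E. rho \<tau> k x) = (1 - 1 / F.Q) * (F.Q powi (- int k) * (1 - 1 / F.Q))"
      unfolding integral_prodf[OF F.tf_sph F.tf_sph] F_sph_integral by simp
  }
  have r0: "rho \<tau> 0 x = \<tau> powi (int fdeg * nu E x) * prodf (bl F 0 0) (F.sph 0) x" for x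
    using kp[of x 0] by (simp add: rho_def pik_def mult_ac)
  show "(LINT x|haar E. rho \<tau> 0 x) = (if unramified F E j then 1 - 1 / F.Q else (1 - 1 / F.Q)\<^sup>2 + \<tau> * (1 - 1 / F.Q) / F.Q)"
  proof (cases "unramified F E j")
    case True
    have "rho \<tau> 0 x = prodf (bl F 0 0) (F.sph 0) x" for x
    proof (cases "pik 0 x = 0")
      case False
      from pik_supp[OF this] fnu_01[of x] True show ?thesis by (auto simp: r0)
    qed (simp add: r0 pik_def)
    then show ?thesis using True integral_prodf[OF F.tf_bl F.tf_sph, of 0 0 0] by (simp add: F.bl_integral F_sph_integral)
  next
    case False
    \<comment> \<open>On the support x2 is a unit, and x has valuation 0 or 1 according to whether
      x1 is a unit or lies in the maximal ideal.\<close>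
    have "rho \<tau> 0 x = prodf (F.sph 0) (F.sph 0) x + \<tau> * prodf (bl F 0 1) (F.sph 0) x" for x
    proof (cases "pik 0 x = 0")
      case True
      then show ?thesis by (auto simp: r0 pik_def prodf_def F.sph_def bl_def pid_def)
    next
      case p: False
      from pik_supp[OF this] have x: "x \<in> BB 0" "x \<notin> BB 1" by auto
      have c2: "c2 x \<noteq> 0" "nu F (c2 x) = 0" "c1 x \<in> pid F 0" using p by (auto simp: pik_def prodf_def F.sph_def bl_def split: if_splits)
      show ?thesis
      proof (cases "c1 x \<in> pid F 1")
        case True
        then have "x \<notin> unit_group E" using pid1_iff[OF x(1)] False unit_E_iff by simp
        moreover have "x \<noteq> 0" using c2 by auto
        ultimately have "nu E x \<noteq> 0" by (simp add: E.unit_iff)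
        moreover have "fdeg = 1" using False by (simp add: fdeg_def)
        ultimately have "int fdeg * nu E x = 1" using fnu_01[OF x] by simp
        then show ?thesis using True c2 by (auto simp: r0 prodf_def F.sph_def bl_def pid_def)
      next
        case nc: False
        then have "x \<in> unit_group E" using pid1_iff[OF x(1)] x(1) unit_E_iff by simp
        then have "nu E x = 0" by (simp add: E.unit_iff)
        then show ?thesis using nc c2 by (auto simp: r0 prodf_def F.sph_def bl_def pid_def)
      qed
    qed
    then have "(LINT x|haar E. rho \<tau> 0 x) = (LINT x|haar E. prodf (F.sph 0) (F.sph 0) x) + \<tau> * (LINT x|haar E. prodf (bl F 0 1) (F.sph 0) x)"
      using E.tf_integrable[OF tf_prodf[OF F.tf_sph F.tf_sph]] E.tf_integrable[OF tf_prodf[OF F.tf_bl F.tf_sph]] by simp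
    then show ?thesis using False unfolding integral_prodf[OF F.tf_sph F.tf_sph] integral_prodf[OF F.tf_bl F.tf_sph]
      by (simp add: F.bl_integral F_sph_integral power2_eq_square power_int_minus inverse_eq_divide)
  qed
qed

lemma QYk: "(F.Q * Y) ^ k * (F.Q powi (- int k) * c) = Y ^ k * c"
  by (simp add: power_mult_distrib power_int_minus)

text \<open>The slices k >= 1 follow a geometric series with constant (1 - 1/q)^2; only the slice k
  = 0 deviates, and it alone can involve \<tau>.\<close>

lemma M_quad:
  assumes quad: quadratic_chi and Y: "norm Y < 1" "Y \<noteq> 0"
  shows "(1 - Y) * (LINT x|haar E. Kf Y \<tau> x * PP x) =
    (if unramified F E j then (1 - 1 / F.Q) * (1 - Y / F.Q) else (1 - 1 / F.Q) * (1 - 1 / F.Q + \<tau> / F.Q * (1 - Y)))"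
proof -
  define C0 where "C0 = (LINT x|haar E. rho \<tau> 0 x)"
  let ?c = "(1 - 1 / F.Q)\<^sup>2"
  have "(F.Q * Y) ^ k * (LINT x|haar E. rho \<tau> k x) = ?c * Y ^ k + (if k = 0 then C0 - ?c else 0)" for k
  proof (cases "k = 0")
    case False
    then have k: "k \<ge> 1" by simp
    have "(F.Q * Y) ^ k * (LINT x|haar E. rho \<tau> k x) = (1 - 1 / F.Q) * ((F.Q * Y) ^ k * (F.Q powi (- int k) * (1 - 1 / F.Q)))"
      unfolding quad_rho(1)[OF quad k] by (simp only: mult_ac)
    then show ?thesis using False unfolding QYk by (simp add: power2_eq_square)
  qed (simp add: C0_def)
  then have 1: "(\<lambda>k. ?c * Y ^ k + (if k = 0 then C0 - ?c else 0)) sums (LINT x|haar E. Kf Y \<tau> x * PP x)"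
    using integral_PP(2)[OF Y, of \<tau>] by simp
  have "(\<lambda>k. ?c * Y ^ k + (if k = 0 then (\<lambda>_. C0 - ?c) k else 0)) sums (?c * (1 / (1 - Y)) + (C0 - ?c))"
    by (intro sums_add sums_mult geometric_sums Y sums_single)
  from sums_unique2[OF 1 this[simplified]]
  have "(LINT x|haar E. Kf Y \<tau> x * PP x) = ?c / (1 - Y) + (C0 - ?c)" by simp
  moreover have "1 - Y \<noteq> 0" using Y by auto
  ultimately have e: "(1 - Y) * (LINT x|haar E. Kf Y \<tau> x * PP x) = ?c + (1 - Y) * (C0 - ?c)"
    by (simp add: distrib_left)
  show ?thesis unfolding e unfolding C0_def quad_rho(2)[OF quad]
    by (simp add: power2_eq_square field_simps)
qed

text \<open>
  A decreasing chain of subgroups of the units of E with \<open>\<kappa>\<close> trivial on all but finitely many of them;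
  \<open>\<kappa>\<close> integrates to 0 over those on which it is not trivial.
\<close>

definition Hset :: "nat \<Rightarrow> 'e set" where
  "Hset k = (if k = 0 then unit_group E else {x. c1 x \<in> unit_group F \<and> c2 x \<in> pid F (int k)})"

definition Hk :: "nat \<Rightarrow> 'e \<Rightarrow> complex" where "Hk k x = (if x \<in> Hset k then 1 else 0)"

lemma H_unit: "x \<in> Hset k \<Longrightarrow> x \<in> unit_group E"
proof (cases "k = 0")
  case False
  assume "x \<in> Hset k"
  then have x: "c1 x \<in> unit_group F" "c2 x \<in> pid F (int k)" using False by (auto simp: Hset_def)
  have "x \<in> BB 0" using x F.pid_mono[OF x(2), of 0] by (simp add: BB_iff F.unit_iff) (simp add: pid_def)
  moreover have "c1 x \<notin> pid F 1" using x by (auto simp: F.unit_iff pid_def)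
  ultimately show ?thesis using pid1_iff unit_E_iff by blast
qed (simp add: Hset_def)

lemma H_mono: "x \<in> Hset (Suc k) \<Longrightarrow> x \<in> Hset k"
  using H_unit[of x "Suc k"] F.pid_mono[of "c2 x" "int (Suc k)" "int k"] by (cases "k = 0") (auto simp: Hset_def)

lemma H_antimono: "m \<le> n \<Longrightarrow> x \<in> Hset n \<Longrightarrow> x \<in> Hset m"
  by (induction n rule: dec_induct) (auto dest: H_mono)

lemma dd_int: "dd \<in> pid F 0"
  using ram_cases by (auto simp: F.unit_iff pid_def)

lemma c_mult: "c1 (x * y) = c1 x * c1 y + c2 x * c2 y * dd" "c2 (x * y) = c1 x * c2 y + c2 x * c1 y"
proof -
  have "x * y = j (c1 x * c1 y + c2 x * c2 y * dd) + j (c1 x * c2 y + c2 x * c1 y) * \<alpha>"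
    by (subst coords[of x], subst coords[of y]) (simp add: j_dd power2_eq_square algebra_simps)
  then show "c1 (x * y) = c1 x * c1 y + c2 x * c2 y * dd" "c2 (x * y) = c1 x * c2 y + c2 x * c1 y"
    using c1_eq c2_eq by metis+
qed

lemma H_mult: assumes "x \<in> Hset k" "y \<in> Hset k" shows "x * y \<in> Hset k"
proof (cases "k = 0")
  case True
  then show ?thesis using assms E.unit_mult by (simp add: Hset_def)
next
  case False
  then have x: "c1 x \<in> unit_group F" "c2 x \<in> pid F (int k)" and y: "c1 y \<in> unit_group F" "c2 y \<in> pid F (int k)"
    using assms by (auto simp: Hset_def)
  have u: "c1 x * c1 y \<in> unit_group F" by (rule F.unit_mult[OF x(1) y(1)])
  have "c2 x * c2 y * dd \<in> pid F (int k + int k + 0)" by (intro F.pid_mult x y dd_int)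
  then have p: "c2 x * c2 y * dd \<in> pid F 1" by (rule F.pid_mono) (use False in simp)
  have nu: "c1 x * c1 y \<notin> pid F 1" using u by (auto simp: F.unit_iff pid_def)
  have "c1 (x * y) \<in> unit_group F"
    using F.nu_add_eq[OF nu p] u by (simp add: c_mult F.unit_iff)
  moreover have "c2 (x * y) \<in> pid F (int k)"
    using F.unit_pid[OF x(1), of "c2 y" "int k"] F.unit_pid[OF y(1), of "c2 x" "int k"] x y
    by (simp add: c_mult mult.commute[of "c2 x"] F.pid_add)
  ultimately show ?thesis using False by (simp add: Hset_def)
qed

lemma H_inverse: assumes "x \<in> Hset k" shows "inverse x \<in> Hset k"
proof (cases "k = 0")
  case True
  then show ?thesis using assms E.unit_inverse by (simp add: Hset_def)
next
  case False
  then have x: "c1 x \<in> unit_group F" "c2 x \<in> pid F (int k)" using assms by (auto simp: Hset_def)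
  have ux: "x \<noteq> 0" "nu E x = 0" using H_unit[OF assms] by (auto simp: E.unit_iff)
  have n: "nrm x \<noteq> 0" "nu F (nrm x) = 0" using nrm_nz[OF ux(1)] nu_nrm[OF ux(1)] ux by auto
  have "x * (j (inverse (nrm x)) * conjg x) = j (inverse (nrm x)) * j (nrm x)" by (simp add: j_nrm mult_ac)
  also have "\<dots> = 1" using n by simp
  finally have "inverse x = j (inverse (nrm x)) * conjg x" by (rule inverse_unique)
  then have c: "c1 (inverse x) = inverse (nrm x) * c1 x" "c2 (inverse x) = inverse (nrm x) * - c2 x"
    by (simp_all add: conjg_def del: j_inverse)
  have u: "inverse (nrm x) \<in> unit_group F" using n by (simp add: F.unit_iff F.nu_inverse)
  have "c1 (inverse x) \<in> unit_group F" unfolding c by (rule F.unit_mult[OF u x(1)])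
  moreover have "c2 (inverse x) \<in> pid F (int k)" unfolding c F.unit_pid[OF u] using x(2) by simp
  ultimately show ?thesis using False by (simp add: Hset_def)
qed

lemma Hk_shift: assumes "h \<in> Hset k" shows "Hk k (h * x) = Hk k x"
proof -
  have "h \<noteq> 0" using H_unit[OF assms] by (simp add: E.unit_iff)
  then have "h * x \<in> Hset k \<longleftrightarrow> x \<in> Hset k"
    using H_mult[OF H_inverse[OF assms], of "h * x"] H_mult[OF assms, of x] by (auto simp: mult.assoc[symmetric])
  then show ?thesis by (simp add: Hk_def)
qed

lemma Hk_0: "Hk 0 x = bl E 0 0 x - bl E 0 1 x"
  by (auto simp: Hk_def Hset_def E.unit_iff bl_def pid_def)

lemma Hk_prod: "k \<ge> 1 \<Longrightarrow> Hk k = prodf (F.sph 0) (bl F 0 (int k))"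
  by (auto simp: Hk_def Hset_def prodf_def F.sph_def bl_def F.unit_iff fun_eq_iff)

lemma tf_Hk: "tf E (Hk k)"
proof (cases "k = 0")
  case True
  then show ?thesis using E.tf_diff[OF E.tf_bl E.tf_bl, of 0 0 0 1] by (simp add: Hk_0[abs_def])
next
  case False
  then show ?thesis using Hk_prod[of k] tf_prodf[OF F.tf_sph F.tf_bl] by simp
qed

lemma tf_kap_times:
  assumes u: "tf E u" and z: "\<And>x. u x \<noteq> 0 \<Longrightarrow> x \<notin> BB M"
  shows "tf E (\<lambda>x. kap x * u x)"
proof -
  obtain n0 where n0: "cond n0" using cond_ex by blast
  show ?thesis
  proof (rule E.tf_times[OF u, where N = "ram * (M + n0 - 1)"])
    fix x h assume "u x \<noteq> 0" "h \<in> pid E (ram * (M + n0 - 1))"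
    then show "kap (x + h) = kap x" using condD[OF n0 z] by (simp add: BB_def)
  qed
qed

lemma tf_kap_Hk: "tf E (\<lambda>x. kap x * Hk k x)"
proof (rule tf_kap_times[OF tf_Hk, where M = 1])
  fix x assume "Hk k x \<noteq> 0"
  then have "x \<in> unit_group E" using H_unit[of x k] by (auto simp: Hk_def split: if_splits)
  then show "x \<notin> BB 1" using ram_pos by (auto simp: E.unit_iff BB_def pid_def)
qed

definition mk :: "nat \<Rightarrow> complex" where "mk k = (LINT x|haar E. kap x * Hk k x)"

text \<open>Orthogonality: the substitution x -> h x has modulus 1, preserves \<open>Hset k\<close>
  and multiplies the integrand by \<open>kap h\<close>.\<close>

lemma mk_zero: assumes h: "h \<in> Hset k" "kap h \<noteq> 1" shows "mk k = 0"
proof -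
  have h0: "h \<noteq> 0" "nu E h = 0" using H_unit[OF h(1)] by (auto simp: E.unit_iff)
  have e: "kap (h * x) * Hk k (h * x) = kap h * (kap x * Hk k x)" for x
  proof (cases "x = 0")
    case True
    then show ?thesis using H_unit[of 0 k] by (auto simp: Hk_def E.unit_iff)
  next
    case False
    then show ?thesis using Hk_shift[OF h(1)] h0 by (simp add: kap_mult)
  qed
  have "mk k = (LINT x|haar E. kap (h * x) * Hk k (h * x))"
    using E.integral_scale[OF h0(1) E.tf_measurable[OF tf_kap_Hk[of k]]] h0 by (simp add: mk_def)
  also have "\<dots> = kap h * mk k" unfolding e mk_def by simp
  finally show ?thesis using h(2) by simp
qed

lemma mk_full: assumes "\<forall>x\<in>Hset k. kap x = 1" "k \<ge> 1" shows "mk k = (1 - 1 / F.Q) * F.Q powi (- int k)"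
proof -
  have "kap x * Hk k x = prodf (F.sph 0) (bl F 0 (int k)) x" for x
    using assms Hk_prod[OF assms(2), THEN fun_cong, of x] by (auto simp: Hk_def)
  then show ?thesis unfolding mk_def using integral_prodf[OF F.tf_sph F.tf_bl, of 0 0 "int k"]
    by (simp add: F.bl_integral F_sph_integral)
qed

text \<open>n is the least index with kap trivial on \<open>Hset n\<close>. It exists by
  \<open>kap_near_j\<close>, and it is positive because chi^2 is nontrivial on the units.\<close>

lemma H_conductor:
  assumes nq: "\<not> quadratic_chi"
  shows "\<exists>n\<ge>1. (\<forall>k<n. mk k = 0) \<and> (\<forall>k\<ge>n. mk k = (1 - 1 / F.Q) * F.Q powi (- int k))"
proof -
  let ?S = "\<lambda>k. \<forall>x\<in>Hset k. kap x = 1"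
  obtain n0 where n0: "cond n0" using cond_ex by blast
  have n1: "1 \<le> n0" using n0 by (simp add: cond_def)
  have ex: "?S (nat n0)"
  proof
    fix x assume "x \<in> Hset (nat n0)"
    then have x: "c1 x \<in> unit_group F" "c2 x \<in> pid F n0" using n1 by (auto simp: Hset_def)
    have "x - j (c1 x) \<in> BB n0" using x by (simp add: BB_iff)
    then show "kap x = 1" using x by (intro kap_near_j(3)[OF n0, of "c1 x" n0]) (auto simp: F.unit_iff)
  qed
  define n where "n = (LEAST k. ?S k)"
  have Sn: "?S n" unfolding n_def by (rule LeastI[of ?S, OF ex])
  have lt: "\<not> ?S k" if "k < n" for k using that not_less_Least unfolding n_def by blast
  have "\<not> ?S 0" using nq by (auto simp: Hset_def trivial_on_units_def kap_unit)
  then have "n \<ge> 1" using Sn by (cases "n = 0") auto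
  moreover have "mk k = 0" if "k < n" for k using lt[OF that] mk_zero by blast
  moreover have "mk k = (1 - 1 / F.Q) * F.Q powi (- int k)" if "k \<ge> n" for k
    using Sn H_antimono[OF that] that \<open>n \<ge> 1\<close> by (intro mk_full) auto
  ultimately show ?thesis by blast
qed

text \<open>For k >= 1 the k-th slice of the shell is \<open>Hset k\<close> minus
  \<open>Hset (Suc k)\<close>.\<close>

lemma rho_int_pos: assumes "k \<ge> 1" shows "(LINT x|haar E. rho \<tau> k x) = mk k - mk (Suc k)"
proof -
  have "rho \<tau> k x = kap x * Hk k x - kap x * Hk (Suc k) x" for x
    unfolding rho_c1_unit[OF assms] Hk_prod[OF assms] using Hk_prod[of "Suc k"] assms
    by (simp add: pik_def prodf_def F.sph_bl algebra_simps)
  then show ?thesis unfolding mk_def using E.tf_integrable[OF tf_kap_Hk] by simp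
qed

text \<open>In the ramified case the slice k = 0 also contains \<alpha> times the units of E, with
  weight \<tau>. The integral over it is a multiple of \<open>mk 0\<close> and vanishes, so \<tau>
  drops out.\<close>

lemma rho_int_0: assumes "mk 0 = 0" shows "(LINT x|haar E. rho \<tau> 0 x) = mk 0 - mk 1"
proof -
  note [simp del] = One_nat_def
  define AA where "AA x = (if x \<noteq> 0 \<and> nu E x = 1 \<and> \<not> unramified F E j then 1 else 0 :: complex)" for x
  have AA0: "AA x = (if unramified F E j then 0 else Hk 0 (inverse \<alpha> * x))" for x
  proof (cases "x = 0 \<or> unramified F E j")
    case False
    then have "nu E (inverse \<alpha> * x) = nu E x - 1" using ram_12 by (auto simp: E.nu_mult E.nu_inverse nu_alpha_def)
    then show ?thesis using False by (auto simp: AA_def Hk_def Hset_def E.unit_iff)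
  qed (auto simp: AA_def Hk_def Hset_def E.unit_iff)
  have ia: "integrable (haar E) (\<lambda>x. kap x * AA x) \<and> (LINT x|haar E. kap x * AA x) = 0"
  proof (cases "unramified F E j")
    case False
    have e: "kap x * AA x = kap \<alpha> * (kap (inverse \<alpha> * x) * Hk 0 (inverse \<alpha> * x))" for x
    proof (cases "x = 0")
      case True
      then show ?thesis by (simp add: AA_def Hk_def Hset_def E.unit_iff)
    next
      case xn: False
      have "kap \<alpha> * kap (inverse \<alpha> * x) = kap x" using xn kap_mult[of \<alpha> "inverse \<alpha> * x"] by (simp add: mult.assoc[symmetric])
      then show ?thesis using False by (simp add: AA0 mult.assoc[symmetric])
    qed
    have a: "inverse \<alpha> \<noteq> 0" by simp
    have m: "(\<lambda>x. kap x * Hk 0 x) \<in> borel_measurable borel" by (rule E.tf_measurable[OF tf_kap_Hk])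
    show ?thesis unfolding e
      using E.integrable_scale_iff[OF a m] E.integral_scale[OF a m] E.tf_integrable[OF tf_kap_Hk[of 0]] assms
      by (simp add: mk_def)
  qed (simp add: AA_def)
  have "rho \<tau> 0 x = (kap x * Hk 0 x - kap x * Hk 1 x) + \<tau> * (kap x * AA x)" for x
  proof -
    have pk: "pik 0 x = (if c1 x \<in> pid F 0 \<and> c2 x \<in> unit_group F then 1 else 0)"
      by (auto simp: pik_def prodf_def bl_def F.sph_def F.unit_iff)
    have h1: "x \<in> Hset 1 \<longleftrightarrow> c1 x \<in> unit_group F \<and> c2 x \<in> pid F 1" by (simp add: Hset_def)
    have h0: "x \<in> Hset 0 \<longleftrightarrow> x \<in> BB 0 \<and> \<not> (c1 x \<in> pid F 1 \<and> (unramified F E j \<longrightarrow> c2 x \<in> pid F 1))"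
      using pid1_iff[of x] unit_E_iff[of x] by (auto simp: Hset_def)
    have u: "a \<in> unit_group F \<longleftrightarrow> a \<in> pid F 0 \<and> a \<notin> pid F 1" for a by (auto simp: F.unit_iff pid_def)
    have m: "a \<in> pid F 1 \<Longrightarrow> a \<in> pid F 0" for a by (rule F.pid_mono) auto
    show ?thesis
    proof (cases "x \<in> BB 0")
      case False
      then have "pik 0 x = 0" "Hk 0 x = 0" "Hk 1 x = 0" using m u by (auto simp: pk Hk_def h0 h1 BB_iff)
      moreover have "AA x = 0" using False ram_12 by (auto simp: AA_def BB_def pid_def)
      ultimately show ?thesis by (simp add: rho_def)
    next
      case x: True
      then have c: "c1 x \<in> pid F 0" "c2 x \<in> pid F 0" by (auto simp: BB_iff)
      show ?thesis
      proof (cases "x \<in> BB 1")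
        case True
        then have c: "c1 x \<in> pid F 1" "c2 x \<in> pid F 1" by (auto simp: BB_iff)
        then have "pik 0 x = 0" "Hk 0 x = 0" "Hk 1 x = 0" using u by (auto simp: pk Hk_def h0 h1)
        moreover have "AA x = 0" using True ram_12 by (auto simp: AA_def BB_def pid_def)
        ultimately show ?thesis by (simp add: rho_def)
      next
        case nx: False
        then have x0: "x \<noteq> 0" by (auto simp: BB_def)
        have z: "nu E x = 0 \<longleftrightarrow> x \<in> Hset 0" using x0 by (auto simp: Hset_def E.unit_iff)
        show ?thesis
        proof (cases "x \<in> Hset 0")
          case True
          then have "nu E x = 0" using z by simp
          then have "AA x = 0" "rho \<tau> 0 x = kap x * pik 0 x" by (auto simp: AA_def rho_def)
          moreover have "pik 0 x = Hk 0 x - Hk 1 x"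
            using True c nx unfolding pk Hk_def h1 u by (auto simp: h0 BB_iff)
          ultimately show ?thesis by (simp add: algebra_simps)
        next
          case False
          then have r: "\<not> unramified F E j" "c1 x \<in> pid F 1" using h0 x nx by (auto simp: BB_iff)
          have "nu E x \<noteq> 0" using z False by simp
          moreover have "fdeg = 1" using r by (simp add: fdeg_def)
          ultimately have n: "nu E x = 1" "int fdeg * nu E x = 1" using fnu_01[OF x nx] by auto
          have "c2 x \<in> unit_group F" using nx r c u by (auto simp: BB_iff)
          then have "pik 0 x = 1" using c by (simp add: pk)
          moreover have "Hk 0 x = 0" "Hk 1 x = 0" using False H_mono[of x 0] by (auto simp: Hk_def One_nat_def)
          moreover have "AA x = 1" using r n x0 by (simp add: AA_def)
          ultimately show ?thesis using n by (simp add: rho_def)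
        qed
      qed
    qed
  qed
  then have "(LINT x|haar E. rho \<tau> 0 x) = mk 0 - mk 1 + \<tau> * (LINT x|haar E. kap x * AA x)"
    unfolding mk_def using E.tf_integrable[OF tf_kap_Hk] ia by simp
  then show ?thesis using ia by simp
qed

text \<open>The slice integrals \<open>mk k - mk (Suc k)\<close> vanish for k < n - 1, equal
  \<open>- mk n\<close> at k = n - 1 and are geometric from n on.\<close>

lemma M_nonquad:
  assumes nq: "\<not> quadratic_chi"
  shows "\<exists>n\<ge>1. \<forall>Y \<tau>. norm Y < 1 \<longrightarrow> Y \<noteq> 0 \<longrightarrow>
     (1 - Y) * (LINT x|haar E. Kf Y \<tau> x * PP x) = (1 - 1 / F.Q) * (Y ^ n - Y ^ (n - 1) / F.Q)"
proof -
  obtain n where n: "n \<ge> 1" "\<And>k. k < n \<Longrightarrow> mk k = 0" "\<And>k. k \<ge> n \<Longrightarrow> mk k = (1 - 1 / F.Q) * F.Q powi (- int k)"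
    using H_conductor[OF nq] by blast
  let ?a = "1 - 1 / F.Q"
  have C: "(LINT x|haar E. rho \<tau> k x) = mk k - mk (Suc k)" for k \<tau>
    using rho_int_pos[of k] rho_int_0 n(2)[of 0] n(1) by (cases "k = 0") auto
  have "(1 - Y) * (LINT x|haar E. Kf Y \<tau> x * PP x) = ?a * (Y ^ n - Y ^ (n - 1) / F.Q)"
    if Y: "norm Y < 1" "Y \<noteq> 0" for Y \<tau>
  proof -
    have t: "(F.Q * Y) ^ k * (LINT x|haar E. rho \<tau> k x) =
        (if k = n - 1 then - (?a * Y ^ (n - 1) / F.Q) else 0) + (if k < n then 0 else ?a\<^sup>2 * Y ^ k)" for k
    proof -
      consider "k < n - 1" | "k = n - 1" | "k \<ge> n" by linarith
      then show ?thesis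
      proof cases
        case 1
        then have "k < n" "Suc k < n" by simp_all
        then show ?thesis using n(2)[of k] n(2)[of "Suc k"] 1 by (simp add: C)
      next
        case 2
        then have "mk k = 0" "mk (Suc k) = ?a * F.Q powi (- int (Suc k))" "k < n" using n(1,2,3) by auto
        moreover have "F.Q powi (- int (Suc k)) = inverse (F.Q * F.Q ^ k)"
          by (simp only: power_int_minus power_int_of_nat power_Suc)
        then have "(F.Q * Y) ^ k * (F.Q powi (- int (Suc k))) = Y ^ k / F.Q"
          by (simp add: power_mult_distrib field_simps)
        ultimately show ?thesis using 2 by (simp add: C mult.left_commute)
      next
        case 3
        have "mk k - mk (Suc k) = ?a * (F.Q powi (- int k) - F.Q powi (- int (Suc k)))"
          using n(3)[of k] n(3)[of "Suc k"] 3 by (simp add: right_diff_distrib)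
        also have "F.Q powi (- int k) - F.Q powi (- int (Suc k)) = F.Q powi (- int k) * ?a"
        proof -
          have "F.Q powi (- int (Suc k)) = inverse (F.Q * F.Q ^ k)" "F.Q powi (- int k) = inverse (F.Q ^ k)"
            by (simp_all only: power_int_minus power_int_of_nat power_Suc)
          then show ?thesis by (simp only:) (simp add: field_simps)
        qed
        finally have "(F.Q * Y) ^ k * (LINT x|haar E. rho \<tau> k x) = ?a * ((F.Q * Y) ^ k * (F.Q powi (- int k) * ?a))"
          by (simp only: C mult_ac)
        moreover have "k \<noteq> n - 1" "\<not> k < n" using 3 n(1) by auto
        ultimately show ?thesis unfolding QYk by (simp add: power2_eq_square)
      qed
    qed
    have 1: "(\<lambda>k. (if k = n - 1 then - (?a * Y ^ (n - 1) / F.Q) else 0) + (if k < n then 0 else ?a\<^sup>2 * Y ^ k)) sums (LINT x|haar E. Kf Y \<tau> x * PP x)"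
      using integral_PP(2)[OF Y, of \<tau>] unfolding t .
    have "(\<lambda>k. if k + n < n then 0 else ?a\<^sup>2 * Y ^ (k + n)) sums (?a\<^sup>2 * Y ^ n * (1 / (1 - Y)))"
      using sums_mult[OF geometric_sums[OF Y(1)], of "?a\<^sup>2 * Y ^ n"] by (simp add: power_add mult_ac)
    then have s: "(\<lambda>k. if k < n then 0 else ?a\<^sup>2 * Y ^ k) sums (?a\<^sup>2 * Y ^ n * (1 / (1 - Y)))"
      by (subst (asm) sums_iff_shift) simp
    have s2: "(\<lambda>k. if k = n - 1 then (\<lambda>_. - (?a * Y ^ (n - 1) / F.Q)) k else 0) sums (- (?a * Y ^ (n - 1) / F.Q))"
      by (rule sums_single)
    from sums_unique2[OF 1 sums_add[OF s2 s]]
    have "(LINT x|haar E. Kf Y \<tau> x * PP x) = - (?a * Y ^ (n - 1) / F.Q) + ?a\<^sup>2 * Y ^ n / (1 - Y)" by simp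
    moreover have "(1 - Y) * (- p + r / (1 - Y)) = - ((1 - Y) * p) + r" for p r
    proof -
      have "1 - Y \<noteq> 0" using Y by auto
      then show ?thesis by (simp only: distrib_left mult_minus_right nonzero_mult_div_cancel_left times_divide_eq_right not_False_eq_True)
    qed
    ultimately have "(1 - Y) * (LINT x|haar E. Kf Y \<tau> x * PP x) = - ((1 - Y) * (?a * Y ^ (n - 1) / F.Q)) + ?a\<^sup>2 * Y ^ n"
      by (simp only:)
    also have "\<dots> = ?a * (Y ^ n - Y ^ (n - 1) / F.Q)"
    proof -
      obtain m where m: "n = Suc m" using n(1) by (cases n) auto
      show ?thesis unfolding m by (simp add: power2_eq_square field_simps)
    qed
    finally show ?thesis .
  qed
  then show ?thesis using n(1) by blast
qed

lemma M_ex: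
  "\<exists>M. holomorphic2 M \<and> (\<forall>s t. conv_dom s t \<longrightarrow> (1 - Yv s t) * (LINT x|haar E. Kf (Yv s t) (tv t) x * PP x) = M (s, t)) \<and>
     (quadratic_chi \<longrightarrow> (\<forall>s t. M (s, t) = (if unramified F E j then (1 - 1 / F.Q) * (1 - Yv s t / F.Q)
        else (1 - 1 / F.Q) * (1 - 1 / F.Q + tv t / F.Q * (1 - Yv s t))))) \<and>
     (\<not> quadratic_chi \<longrightarrow> (\<exists>n\<ge>1. \<forall>s t. M (s, t) = (1 - 1 / F.Q) * (Yv s t ^ n - Yv s t ^ (n - 1) / F.Q)))"
proof (cases quadratic_chi)
  case True
  define M where "M p = (if unramified F E j then (1 - 1 / F.Q) * (1 - Yv (fst p) (snd p) * (1 / F.Q))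
        else (1 - 1 / F.Q) * (1 - 1 / F.Q + tv (snd p) * (1 / F.Q) * (1 - Yv (fst p) (snd p))))" for p
  have "holomorphic2 M"
    unfolding M_def by (cases "unramified F E j") (simp_all only: if_True if_False,
      (intro holomorphic2_mult holomorphic2_diff holomorphic2_add holomorphic2_const holomorphic2_XY)+)
  moreover have "(1 - Yv s t) * (LINT x|haar E. Kf (Yv s t) (tv t) x * PP x) = M (s, t)" if "conv_dom s t" for s t
    unfolding M_quad[OF True norm_Yv[OF that] Yv_nz] by (simp add: M_def)
  ultimately show ?thesis using True by (intro exI[of _ M]) (simp add: M_def)
next
  case False
  obtain n where n: "n \<ge> 1" "\<And>Y \<tau>. norm Y < 1 \<Longrightarrow> Y \<noteq> 0 \<Longrightarrow>
     (1 - Y) * (LINT x|haar E. Kf Y \<tau> x * PP x) = (1 - 1 / F.Q) * (Y ^ n - Y ^ (n - 1) / F.Q)"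
    using M_nonquad[OF False] by blast
  define M where "M p = (1 - 1 / F.Q) * (Yv (fst p) (snd p) powi (int n) - Yv (fst p) (snd p) powi (int (n - 1)) * (1 / F.Q))" for p
  have "holomorphic2 M"
    unfolding M_def by (intro holomorphic2_mult holomorphic2_diff holomorphic2_add holomorphic2_const holomorphic2_XY)
  moreover have "(1 - Yv s t) * (LINT x|haar E. Kf (Yv s t) (tv t) x * PP x) = M (s, t)" if "conv_dom s t" for s t
    unfolding n(2)[OF norm_Yv[OF that] Yv_nz] by (simp only: M_def power_int_of_nat fst_conv snd_conv) simp
  moreover have "M (s, t) = (1 - 1 / F.Q) * (Yv s t ^ n - Yv s t ^ (n - 1) / F.Q)" for s t
    by (simp only: M_def power_int_of_nat fst_conv snd_conv) simp
  ultimately show ?thesis using False n(1) by (intro exI[of _ M]) blast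
qed

text \<open>The regularized integral of the kernel over the shell \<open>BB 0 - BB 1\<close>, hence
  the value on a ball around 0 up to a power of X. The choice bundles its closed forms for trivial
  and nontrivial kap under one name.\<close>

definition Mf :: "complex \<times> complex \<Rightarrow> complex" where
  "Mf = (SOME M. holomorphic2 M \<and> (\<forall>s t. conv_dom s t \<longrightarrow> (1 - Yv s t) * (LINT x|haar E. Kf (Yv s t) (tv t) x * PP x) = M (s, t)) \<and>
     (quadratic_chi \<longrightarrow> (\<forall>s t. M (s, t) = (if unramified F E j then (1 - 1 / F.Q) * (1 - Yv s t / F.Q)
        else (1 - 1 / F.Q) * (1 - 1 / F.Q + tv t / F.Q * (1 - Yv s t))))) \<and>
     (\<not> quadratic_chi \<longrightarrow> (\<exists>n\<ge>1. \<forall>s t. M (s, t) = (1 - 1 / F.Q) * (Yv s t ^ n - Yv s t ^ (n - 1) / F.Q))))"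

lemma Mf_kext: "kext (bB 0 N) (\<lambda>p. Xv (fst p) (snd p) powi N * Mf p)"
  and Mf_quad: "quadratic_chi \<Longrightarrow> Mf (s, t) = (if unramified F E j then (1 - 1 / F.Q) * (1 - Yv s t / F.Q)
        else (1 - 1 / F.Q) * (1 - 1 / F.Q + tv t / F.Q * (1 - Yv s t)))"
  and Mf_nonquad: "\<not> quadratic_chi \<Longrightarrow> \<exists>n\<ge>1. \<forall>s t. Mf (s, t) = (1 - 1 / F.Q) * (Yv s t ^ n - Yv s t ^ (n - 1) / F.Q)"
  using someI_ex[OF M_ex, folded Mf_def] kext_zero_ball[of Mf N] by blast+

lemma tf_kext: assumes "tf E u" shows "\<exists>\<Phi>. kext u \<Phi>"
proof -
  obtain n0 where n0: "cond n0" using cond_ex by blast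
  show ?thesis
  proof (rule tf_refine[OF n0 assms])
    show "\<exists>\<Phi>. kext (bB 0 N) \<Phi>" for N using Mf_kext by blast
    show "\<exists>\<Phi>. kext (bB c N) \<Phi>" if "c2 c \<noteq> 0" "nu F (c2 c) + n0 \<le> N" for c N
      using kext_off[OF n0 that] by blast
    show "\<exists>\<Phi>. kext (bB (j y) N) \<Phi>" if "y \<noteq> 0" "nu F y + n0 \<le> N" for y N
      using kext_near_j[OF n0 that] by blast
  qed (use kext_add kext_cmult in blast)+
qed

section \<open>The regularized kernel as a functional on test functions\<close>

definition Kt :: "complex \<Rightarrow> complex \<Rightarrow> ('e \<Rightarrow> complex) \<Rightarrow> complex" where
  "Kt s t u = Ktilde F E j \<alpha> chi eta s t u"

lemma Kt_eq: "kext u \<Phi> \<Longrightarrow> Kt s t u = \<Phi> (s, t)"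
  unfolding Kt_def by (rule Ktilde_eq)

lemma Kt_add: assumes "tf E u" "tf E v" shows "Kt s t (\<lambda>x. u x + v x) = Kt s t u + Kt s t v"
proof -
  obtain \<Phi> \<Psi> where "kext u \<Phi>" "kext v \<Psi>" using tf_kext assms by meson
  then show ?thesis using Kt_eq[OF kext_add] Kt_eq by simp
qed

lemma Kt_cmult: assumes "tf E u" shows "Kt s t (\<lambda>x. c * u x) = c * Kt s t u"
proof -
  obtain \<Phi> where "kext u \<Phi>" using tf_kext assms by meson
  then show ?thesis using Kt_eq[OF kext_cmult] Kt_eq by simp
qed

lemma Kt_off: "cond n0 \<Longrightarrow> c2 c \<noteq> 0 \<Longrightarrow> nu F (c2 c) + n0 \<le> N \<Longrightarrow>
    Kt s t (bB c N) = (1 - Yv s t) * (1 - Xv s t) * (Kf (Yv s t) (tv t) c * F.Q powi (- 2 * N))"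
  using Kt_eq[OF kext_off] by simp

lemma Kt_near: "cond n0 \<Longrightarrow> y \<noteq> 0 \<Longrightarrow> nu F y + n0 \<le> N \<Longrightarrow>
    Kt s t (bB (j y) N) = (1 - Xv s t) * (tv t powi (2 * nu F y) * F.Q powi (- N) * (1 - 1 / F.Q) * Yv s t powi N)"
  using Kt_eq[OF kext_near_j] by simp

lemma Kt_zero: "Kt s t (bB 0 N) = Xv s t powi N * Mf (s, t)"
  using Kt_eq[OF Mf_kext] by simp

lemma Kt_scale: assumes u: "tf E u" and a: "a \<noteq> 0" shows "Kt s t (\<lambda>x. u (j a * x)) = Xv s t powi (- nu F a) * Kt s t u"
proof -
  obtain \<Phi> where \<Phi>: "kext u \<Phi>" using tf_kext u by meson
  have ja: "j a \<noteq> 0" using a by simp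
  have "kext (\<lambda>x. u (j a * x)) (\<lambda>p. Xv (fst p) (snd p) powi (- nu F a) * \<Phi> p)"
    unfolding kext_def
  proof (intro conjI allI impI)
    show "holomorphic2 (\<lambda>p. Xv (fst p) (snd p) powi (- nu F a) * \<Phi> p)"
      using \<Phi> unfolding kext_def by (intro holomorphic2_mult holomorphic2_XY) auto
    fix s t assume d: "conv_dom s t"
    let ?X = "Xv s t" and ?Y = "Yv s t" and ?t = "tv t"
    let ?f = "\<lambda>x. Kf ?Y ?t x * u x"
    have f: "integrable (haar E) ?f" "\<Phi> (s, t) = (1 - ?Y) * (1 - ?X) * (LINT x|haar E. ?f x)"
      using \<Phi> d unfolding kext_def by auto
    have fm: "?f \<in> borel_measurable borel" using borel_measurable_integrable[OF f(1)] by simp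
    have QX: "F.Q * ?Y * ?t\<^sup>2 = F.Q\<^sup>2 * ?X" using Xv_rel[of s t] by (simp add: power2_eq_square mult.assoc)
    have e: "Kf ?Y ?t x * u (j a * x) = (F.Q\<^sup>2 * ?X) powi (- nu F a) * ?f (j a * x)" for x
    proof -
      have "Kf ?Y ?t (j a * x) = (F.Q\<^sup>2 * ?X) powi nu F a * Kf ?Y ?t x"
        unfolding Kf_jmult[OF a Yv_nz tv_nz] QX ..
      then show ?thesis by (simp add: power_int_minus)
    qed
    have sc: "(LINT x|haar E. ?f (j a * x)) = of_real (F.q powi (- 2 * (- nu F a))) * (LINT x|haar E. ?f x)"
      unfolding E.integral_scale[OF ja fm] nu_j[OF a] using E_powi[of "- nu F a"] by simp
    have p: "(F.Q\<^sup>2 * ?X) powi (- nu F a) * F.Q powi (- 2 * (- nu F a)) = ?X powi (- nu F a)"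
    proof -
      have "(F.Q\<^sup>2 * ?X) powi (- nu F a) = F.Q powi (2 * (- nu F a)) * ?X powi (- nu F a)"
        by (simp only: power_int_mult_distrib power_int_mult) simp
      moreover have "F.Q powi (2 * (- nu F a)) * F.Q powi (- 2 * (- nu F a)) = 1"
        by (subst power_int_add[symmetric]) auto
      ultimately show ?thesis by (simp add: mult_ac)
    qed
    show "integrable (haar E) (\<lambda>x. Kf ?Y ?t x * u (j a * x))"
      unfolding e using E.integrable_scale_iff[OF ja fm] f(1) by (intro integrable_mult_right) simp
    have "(LINT x|haar E. Kf ?Y ?t x * u (j a * x)) = ?X powi (- nu F a) * (LINT x|haar E. ?f x)"
      unfolding e by (subst Bochner_Integration.integral_mult_right_zero, subst sc)
        (simp only: mult.assoc[symmetric] of_real_power_int of_real_of_nat_eq p)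
    then show "(\<lambda>p. Xv (fst p) (snd p) powi (- nu F a) * \<Phi> p) (s, t) = (1 - ?Y) * (1 - ?X) * (LINT x|haar E. Kf ?Y ?t x * u (j a * x))"
      unfolding f(2) fst_conv snd_conv by (simp only: mult_ac)
  qed
  then show ?thesis using Kt_eq \<Phi> Kt_eq[OF \<Phi>] by simp
qed

lemma slice1_tf: assumes "tf E u" shows "tf F (\<lambda>x1. u (j x1 + j x2 * \<alpha>))"
proof -
  obtain N M where NM: "\<forall>x. \<forall>h\<in>BB N. u (x + h) = u x" "\<forall>x. u x \<noteq> 0 \<longrightarrow> x \<in> BB M"
    using assms unfolding tf_E_iff by blast
  show ?thesis
  proof (rule F.tfI[where N = N and M = M])
    fix x1 h assume "h \<in> pid F N"
    then have "j h \<in> BB N" by (simp add: BB_iff)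
    from NM(1)[rule_format, OF this, of "j x1 + j x2 * \<alpha>"]
    show "u (j (x1 + h) + j x2 * \<alpha>) = u (j x1 + j x2 * \<alpha>)" by (simp add: algebra_simps)
  next
    fix x1 assume "u (j x1 + j x2 * \<alpha>) \<noteq> 0"
    then have "j x1 + j x2 * \<alpha> \<in> BB M" using NM(2) by blast
    then show "x1 \<in> pid F M" unfolding BB_iff by simp
  qed
qed

lemma fubini1:
  assumes "tf E u"
  shows "tf F (\<lambda>x2. LINT x1|haar F. u (j x1 + j x2 * \<alpha>)) \<and>
     (LINT x|haar E. u x) = (LINT x2|haar F. LINT x1|haar F. u (j x1 + j x2 * \<alpha>))"
  using assms
proof (induction rule: bB_induct[where ?N0.0 = 0])
  case (ball c n)
  have e: "bB c n (j x1 + j x2 * \<alpha>) = bl F (c2 c) n x2 * bl F (c1 c) n x1" for x1 x2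
    by (simp add: bB_eq bl_def BB_iff)
  have q: "of_real (F.q powi (- n)) * of_real (F.q powi (- n)) = complex_of_real (F.q powi (- 2 * n))"
    using F.q_nz by (simp only: of_real_mult[symmetric]) (simp add: power_int_add[symmetric])
  have i: "(LINT x1|haar F. bB c n (j x1 + j x2 * \<alpha>)) = of_real (F.q powi (- n)) * bl F (c2 c) n x2" for x2
    unfolding e by (subst Bochner_Integration.integral_mult_right_zero) (simp only: F.bl_integral mult.commute)
  show ?case unfolding i bB_integral
    by (subst Bochner_Integration.integral_mult_right_zero) (simp only: F.bl_integral q F.tf_cmult F.tf_bl simp_thms)
next
  case (add u v)
  have "(LINT x1|haar F. u (j x1 + j x2 * \<alpha>) + v (j x1 + j x2 * \<alpha>)) =
      (LINT x1|haar F. u (j x1 + j x2 * \<alpha>)) + (LINT x1|haar F. v (j x1 + j x2 * \<alpha>))" for x2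
    by (intro Bochner_Integration.integral_add F.tf_integrable slice1_tf add)
  then show ?case using add F.tf_integrable E.tf_integrable by (simp add: F.tf_add)
next
  case (cmult u c)
  then show ?case by (simp add: F.tf_cmult)
qed

text \<open>
  The kernel on the line \<open>\<alpha> + F\<close>; the inversion of F maps the part outside the integers to a ball.
\<close>

definition Gf :: "complex \<Rightarrow> 'f \<Rightarrow> complex" where
  "Gf \<tau> y = kap (\<alpha> - j y) * \<tau> powi (int fdeg * nu E (\<alpha> - j y))"

lemma alpha_minus_nz [simp]: "\<alpha> - j y \<noteq> 0"
proof
  assume "\<alpha> - j y = 0"
  then have "c2 (\<alpha> - j y) = c2 0" by (simp only:)
  then show False by simp
qed

lemma Kf_G: "Kf Y \<tau> (\<alpha> - j y) = Gf \<tau> y"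
  by (simp add: Kf_def Gf_def)

definition u0 :: "complex \<Rightarrow> 'f \<Rightarrow> complex" where "u0 \<tau> y = (if y \<in> pid F 0 then Gf \<tau> y else 0)"
definition v0 :: "'f \<Rightarrow> complex" where "v0 z = (if z \<in> pid F 1 then kap (1 - j z * \<alpha>) else 0)"

lemma pik0: "pik 0 x = (if c1 x \<in> pid F 0 \<and> c2 x \<in> unit_group F then 1 else 0)"
  by (auto simp: pik_def prodf_def bl_def F.sph_def F.unit_iff)

lemma rho_slice: assumes x2: "x2 \<in> unit_group F" shows "rho \<tau> 0 (j x1 + j x2 * \<alpha>) = u0 \<tau> (- (1 / x2) * x1)"
proof -
  let ?y = "- (1 / x2) * x1"
  have n: "x2 \<noteq> 0" "nu F x2 = 0" using x2 F.unit_iff by auto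
  have "j x2 * j ?y = j (x2 * ?y)" by (simp only: j_mult)
  also have "x2 * ?y = - x1" using n by simp
  finally have e: "j x1 + j x2 * \<alpha> = j x2 * (\<alpha> - j ?y)" by (simp only: right_diff_distrib j_minus) simp
  have "nu E (j x2 * (\<alpha> - j ?y)) = nu E (j x2) + nu E (\<alpha> - j ?y)"
    by (rule E.nu_mult[OF _ alpha_minus_nz]) (use n in simp)
  then have "nu E (j x2 * (\<alpha> - j ?y)) = nu E (\<alpha> - j ?y)" using nu_j_unit[OF x2] by (simp only: add_0)
  moreover have "kap (j x2 * (\<alpha> - j ?y)) = kap (\<alpha> - j ?y)" by (rule kap_jmult[OF n(1) alpha_minus_nz])
  ultimately have "rho \<tau> 0 (j x1 + j x2 * \<alpha>) = Gf \<tau> ?y * pik 0 (j x1 + j x2 * \<alpha>)"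
    unfolding rho_def Gf_def e by (simp only:)
  moreover have "x1 \<in> pid F 0 \<longleftrightarrow> ?y \<in> pid F 0"
    using n by (simp add: F.pid_divide_iff)
  ultimately show ?thesis using x2 by (simp add: pik0 u0_def)
qed

lemma tf_u0: "tf F (u0 \<tau>)"
proof -
  have "tf F (\<lambda>y. rho \<tau> 0 (j ((-1) * y + 0) + j 1 * \<alpha>))"
    by (rule F.tf_affine[OF slice1_tf[OF tf_rho], where b = 0]) simp
  moreover have "rho \<tau> 0 (j ((-1) * y + 0) + j 1 * \<alpha>) = u0 \<tau> y" for y
    using rho_slice[of 1 \<tau> "- y"] by simp
  ultimately show ?thesis by (simp only:)
qed

text \<open>For a unit x2 the substitution x1 = - x2 y turns x1 + x2 \<alpha> into x2 (\<alpha> -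
  y); neither kap nor the valuation nor the measure changes. So all slices over units give the
  integral of u0.\<close>

lemma integral_u0: "(LINT x|haar E. rho \<tau> 0 x) = (1 - 1 / F.Q) * (LINT y|haar F. u0 \<tau> y)"
proof -
  have "(LINT x1|haar F. rho \<tau> 0 (j x1 + j x2 * \<alpha>)) = (LINT y|haar F. u0 \<tau> y) * F.sph 0 x2" for x2
  proof (cases "x2 \<in> unit_group F")
    case True
    then have n: "- (1 / x2) \<noteq> 0" "nu F (- (1 / x2)) = 0" "F.sph 0 x2 = 1"
      by (auto simp: F.unit_iff F.nu_divide F.sph_def)
    show ?thesis unfolding rho_slice[OF True] F.integral_scale[OF n(1) F.tf_measurable[OF tf_u0]] n by simp
  next
    case False
    then have "F.sph 0 x2 = 0" "rho \<tau> 0 (j x1 + j x2 * \<alpha>) = 0" for x1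
      by (auto simp: F.unit_iff F.sph_def rho_def pik0)
    then show ?thesis by simp
  qed
  then have "(LINT x|haar E. rho \<tau> 0 x) = (LINT y|haar F. u0 \<tau> y) * (LINT x|haar F. F.sph 0 x)"
    using fubini1[OF tf_rho, of \<tau> 0] by simp
  then show ?thesis by (simp add: F_sph_integral)
qed

lemma H1_slice: assumes x1: "x1 \<in> unit_group F"
  shows "kap (j x1 + j x2 * \<alpha>) * Hk 1 (j x1 + j x2 * \<alpha>) = v0 (- (1 / x1) * x2)"
proof -
  let ?z = "- (1 / x1) * x2"
  have n: "x1 \<noteq> 0" "nu F x1 = 0" using x1 F.unit_iff by auto
  have "j x1 * (j ?z * \<alpha>) = j (x1 * ?z) * \<alpha>" by (simp only: j_mult mult.assoc)
  also have "x1 * ?z = - x2" using n by simp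
  finally have e: "j x1 + j x2 * \<alpha> = j x1 * (1 - j ?z * \<alpha>)" by (simp only: right_diff_distrib j_minus) simp
  have "c1 (j 1 - j ?z * \<alpha>) = 1" by (simp only: c1_diff c1_j c1_jalpha) simp
  then have c: "c1 (1 - j ?z * \<alpha>) = 1" by (simp only: j_1)
  have nz: "1 - j ?z * \<alpha> \<noteq> 0"
  proof
    assume "1 - j ?z * \<alpha> = 0"
    from c[unfolded this] show False by simp
  qed
  have "x2 \<in> pid F 1 \<longleftrightarrow> ?z \<in> pid F 1" using n by (simp add: F.pid_divide_iff)
  then have "Hk 1 (j x1 + j x2 * \<alpha>) = (if ?z \<in> pid F 1 then 1 else 0)"
    using x1 by (simp add: Hk_def Hset_def)
  then show ?thesis unfolding e kap_jmult[OF n(1) nz] v0_def by simp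
qed

lemma tf_v0: "tf F v0"
proof -
  have "tf F (\<lambda>y. kap (j 1 + j ((-1) * y + 0) * \<alpha>) * Hk 1 (j 1 + j ((-1) * y + 0) * \<alpha>))"
    by (rule F.tf_affine[OF slice_tf[OF tf_kap_Hk], where b = 0]) simp
  moreover have "kap (j 1 + j ((-1) * y + 0) * \<alpha>) * Hk 1 (j 1 + j ((-1) * y + 0) * \<alpha>) = v0 y" for y
    using H1_slice[of 1 "- y"] by simp
  ultimately show ?thesis by (simp only:)
qed

text \<open>As for u0 with the coordinates exchanged: for a unit x1 one has x1 + x2 \<alpha> = x1 (1
  - z \<alpha>) with z = - x2 / x1.\<close>

lemma integral_v0: "mk 1 = (1 - 1 / F.Q) * (LINT y|haar F. v0 y)"
proof -
  have "(LINT x2|haar F. kap (j x1 + j x2 * \<alpha>) * Hk 1 (j x1 + j x2 * \<alpha>)) = (LINT y|haar F. v0 y) * F.sph 0 x1" for x1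
  proof (cases "x1 \<in> unit_group F")
    case True
    then have n: "- (1 / x1) \<noteq> 0" "nu F (- (1 / x1)) = 0" "F.sph 0 x1 = 1"
      by (auto simp: F.unit_iff F.nu_divide F.sph_def)
    show ?thesis unfolding H1_slice[OF True] F.integral_scale[OF n(1) F.tf_measurable[OF tf_v0]] n by simp
  next
    case False
    then have "F.sph 0 x1 = 0" "Hk 1 (j x1 + j x2 * \<alpha>) = 0" for x2
      by (auto simp: F.unit_iff F.sph_def Hk_def Hset_def)
    then show ?thesis by simp
  qed
  then have "mk 1 = (LINT y|haar F. v0 y) * (LINT x|haar F. F.sph 0 x)"
    unfolding mk_def using fubini[OF tf_kap_Hk, of 1] by simp
  then show ?thesis by (simp add: F_sph_integral)
qed

lemma Gf_off:
  assumes y: "y \<notin> pid F 0"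
  shows "Gf \<tau> y = \<tau> powi (2 * nu F y) * kap (1 - j (1 / y) * \<alpha>)"
proof -
  have y0: "y \<noteq> 0" "nu F y < 0" using F.notin_pidD[OF y] by auto
  let ?h = "1 - j (1 / y) * \<alpha>"
  have "c1 (j 1 - j (1 / y) * \<alpha>) = 1" "c2 (j 1 - j (1 / y) * \<alpha>) = - (1 / y)"
    by (simp_all only: c1_diff c2_diff c1_j c2_j c1_jalpha c2_jalpha) simp_all
  then have c: "c1 ?h = 1" "c2 ?h = - (1 / y)" by (simp_all only: j_1)
  have "- (1 / y) \<in> pid F 1" using y0 by (simp add: pid_def F.nu_divide)
  moreover have "Hset 1 = {x. c1 x \<in> unit_group F \<and> c2 x \<in> pid F 1}" by (simp add: Hset_def)
  ultimately have "?h \<in> Hset 1" by (simp only: mem_Collect_eq c F.unit_1 simp_thms)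
  then have h: "?h \<noteq> 0" "nu E ?h = 0" using H_unit[of ?h 1] E.unit_iff by auto
  have "j (- y) * ?h = j (- y) - j (- y * (1 / y)) * \<alpha>" by (simp only: right_diff_distrib j_mult mult_1_right mult.assoc)
  also have "- y * (1 / y) = - 1" using y0 by simp
  finally have e: "\<alpha> - j y = j (- y) * ?h" by simp
  have my: "- y \<noteq> 0" "nu F (- y) = nu F y" using y0 by auto
  have "nu E (j (- y) * ?h) = ram * nu F y"
    using E.nu_mult[of "j (- y)" ?h] h my nu_j[OF my(1)] by (simp only: j_eq_0) simp
  then have f: "int fdeg * nu E (j (- y) * ?h) = 2 * nu F y" by (simp only: fdeg_ram)
  have k: "kap (j (- y) * ?h) = kap ?h" by (rule kap_jmult[OF my(1) h(1)])
  show ?thesis unfolding Gf_def e f k by (rule mult.commute)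
qed

text \<open>For y outside the integers \<alpha> - y = - y (1 - \<alpha> / y) carries the weight
  \<tau>^(2 nu(y)), which for this \<tau> is the Jacobian of inversion.\<close>

lemma Gf_decomp: assumes t: "\<tau>\<^sup>2 = F.Q\<^sup>2" shows "Gf \<tau> y = u0 \<tau> y + F.inversion v0 y"
proof (cases "y \<in> pid F 0")
  case True
  have "F.inversion v0 y = 0"
  proof (cases "y = 0")
    case False
    then have "1 / y \<notin> pid F 1" using True by (auto simp: pid_def F.nu_divide)
    then show ?thesis by (simp add: F.inversion_def v0_def)
  qed (simp add: F.inversion_def)
  then show ?thesis using True by (simp add: u0_def)
next
  case False
  then have y0: "y \<noteq> 0" "nu F y < 0" using F.notin_pidD by auto
  then have z: "1 / y \<in> pid F 1" by (simp add: pid_def F.nu_divide)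
  have "\<tau> powi (2 * n) = F.Q powi (2 * n)" for n using t by (simp add: power_int_mult)
  then show ?thesis using y0 z False unfolding Gf_off[OF False] by (simp add: F.inversion_def v0_def u0_def)
qed

lemma Gf_integral:
  assumes t: "\<tau>\<^sup>2 = F.Q\<^sup>2"
  shows "integrable (haar F) (Gf \<tau>)"
    and "(1 - 1 / F.Q) * (LINT y|haar F. Gf \<tau> y) = (LINT x|haar E. rho \<tau> 0 x) + mk 1"
proof -
  have G: "Gf \<tau> = (\<lambda>y. u0 \<tau> y + F.inversion v0 y)" by (rule HOL.ext) (rule Gf_decomp[OF t])
  note i = F.tf_integrable[OF tf_u0[of \<tau>]] F.inversion_integral[OF tf_v0]
  show "integrable (haar F) (Gf \<tau>)" unfolding G using i by simp
  have "(LINT y|haar F. Gf \<tau> y) = (LINT y|haar F. u0 \<tau> y) + (LINT y|haar F. v0 y)"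
    unfolding G using i by simp
  then show "(1 - 1 / F.Q) * (LINT y|haar F. Gf \<tau> y) = (LINT x|haar E. rho \<tau> 0 x) + mk 1"
    unfolding integral_u0 integral_v0 by (simp only: distrib_left)
qed

text \<open>If kap is nontrivial on units, the part \<open>mk 0 - mk 1\<close> over the integers and
  the part \<open>mk 1\<close> at infinity add up to \<open>mk 0\<close> = 0. Otherwise the integral
  is (q + 1) / q in the unramified and (q + \<tau>) / q in the ramified case.\<close>

lemma Gf_integral_zero_iff:
  assumes t: "\<tau>\<^sup>2 = F.Q\<^sup>2"
  shows "(LINT y|haar F. Gf \<tau> y) = 0 \<longleftrightarrow> \<not> quadratic_chi \<or> (\<not> unramified F E j \<and> \<tau> = - F.Q)"
proof (cases quadratic_chi)
  case False
  then obtain n where n: "n \<ge> 1" "\<And>k. k < n \<Longrightarrow> mk k = 0" using H_conductor by blast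
  have "mk 0 = 0" using n(1) by (intro n(2)) simp
  then have "(1 - 1 / F.Q) * (LINT y|haar F. Gf \<tau> y) = 0"
    using Gf_integral(2)[OF t] rho_int_0[of \<tau>] by simp
  then show ?thesis using False F.one_Q by (simp only: mult_eq_0_iff simp_thms)
next
  case True
  have "kap x = 1" if "x \<in> Hset 1" for x
    using H_unit[OF that] cond_quad(2)[OF True] E.unit_iff by blast
  then have m: "mk 1 = (1 - 1 / F.Q) * (1 / F.Q)"
    using mk_full[of 1] by (simp add: power_int_minus inverse_eq_divide)
  have Q1: "F.Q + 1 \<noteq> 0" using F.Q_ne(2) by (simp add: add_eq_0_iff2)
  show ?thesis
  proof (cases "unramified F E j")
    case unram: True
    have "(1 - 1 / F.Q) * (LINT y|haar F. Gf \<tau> y) = (1 - 1 / F.Q) * ((F.Q + 1) / F.Q)"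
      unfolding Gf_integral(2)[OF t] quad_rho(2)[OF True] m using unram by (simp add: field_simps)
    then have "(LINT y|haar F. Gf \<tau> y) = (F.Q + 1) / F.Q" using F.one_Q by (simp only: mult_cancel_left simp_thms)
    then show ?thesis using True unram Q1 by simp
  next
    case ram: False
    have "(1 - 1 / F.Q) * (LINT y|haar F. Gf \<tau> y) = (1 - 1 / F.Q) * ((F.Q + \<tau>) / F.Q)"
      unfolding Gf_integral(2)[OF t] quad_rho(2)[OF True] m using ram by (simp add: power2_eq_square field_simps)
    then have "(LINT y|haar F. Gf \<tau> y) = (F.Q + \<tau>) / F.Q" using F.one_Q by (simp only: mult_cancel_left simp_thms)
    moreover have "F.Q + \<tau> = 0 \<longleftrightarrow> \<tau> = - F.Q" by (metis add.commute add_eq_0_iff)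
    ultimately show ?thesis using True ram by simp
  qed
qed

end

section \<open>Spherical vectors and the intertwining operator\<close>

text \<open>Kept apart from the kernel: if eta differs from chi on the units of F, the spherical
  vector is killed by equivariance alone.\<close>

locale equivariant = quad_ext F E j \<alpha>
  for F :: "'f::{field,metric_space} lf" and E :: "'e::{field,metric_space} lf" and j \<alpha> +
  fixes chi :: "'e \<Rightarrow> complex" and eta :: "'f \<Rightarrow> complex" and s t :: complex
    and A :: "('e^2^2 \<Rightarrow> complex) \<Rightarrow> ('f^2^2 \<Rightarrow> complex)"
  assumes uchi: "unit_character E chi" and ueta: "unit_character F eta"
    and atilde: "is_Atilde F E j \<alpha> chi eta s t A"
    and qchi: "u \<in> unit_group E \<Longrightarrow> (chi u)\<^sup>2 = 1"
begin

sublocale EC: lf_char E chi by unfold_locales (rule uchi)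
sublocale FC: lf_char F eta by unfold_locales (rule ueta)

lemma A_sph_Ind: "A (EC.sphf s) \<in> Ind F eta t"
  by (rule atilde[unfolded is_Atilde_def, THEN conjunct1, THEN bspec, OF EC.sphf_Ind[OF qchi]])

lemma map_GL2: assumes "k \<in> GL2_integers F" shows "map_matrix j k \<in> GL2_integers E" "det (map_matrix j k) = j (det k)"
proof -
  obtain a b c d where k: "k = mat2 a b c d" by (rule mat2_cases)
  have k': "a \<in> pid F 0" "b \<in> pid F 0" "c \<in> pid F 0" "d \<in> pid F 0" "a * d - b * c \<in> unit_group F"
    using assms by (simp_all add: k F.GL2_mat2)
  show "det (map_matrix j k) = j (det k)" by (simp add: k map_matrix_mat2)
  have "j (a * d - b * c) \<in> unit_group E" using k'(5) nu_j_unit[OF k'(5)] F.unit_iff E.unit_iff j_eq_0 by blast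
  moreover have "j x \<in> pid E 0" if "x \<in> pid F 0" for x using that j_pid[of x 0] by simp
  ultimately show "map_matrix j k \<in> GL2_integers E" using k' by (simp add: k map_matrix_mat2 E.GL2_mat2)
qed

lemma A_sph_GL2:
  assumes k: "k \<in> GL2_integers F"
  shows "A (EC.sphf s) (k ** g) = inverse (chi (j (det k))) * A (EC.sphf s) g"
proof -
  let ?k = "map_matrix j k" and ?c = "chi (j (det k))"
  have u: "j (det k) \<in> unit_group E" using map_GL2[OF k] by (simp add: GL2_integers_def)
  then have c: "?c \<noteq> 0" by (rule EC.chi_nz)
  have i: "invertible ?k" "invertible k" using E.GL2_invertible[OF map_GL2(1)[OF k]] F.GL2_invertible[OF k] by simp_all
  have 1: "left_translate ?k (EC.sphf s) = (\<lambda>h. ?c * EC.sphf s h)"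
  proof
    fix h
    have "EC.sphf s (?k ** (matrix_inv ?k ** h)) = inverse ?c * EC.sphf s (matrix_inv ?k ** h)"
      using EC.sphf_GL2[OF map_GL2(1)[OF k]] map_GL2(2)[OF k] by simp
    moreover have "?k ** (matrix_inv ?k ** h) = h" by (simp add: matrix_mul_assoc matrix_inv_right i)
    ultimately show "left_translate ?k (EC.sphf s) h = ?c * EC.sphf s h" using c by (simp add: left_translate_def)
  qed
  have 2: "A (left_translate ?k (EC.sphf s)) = left_translate k (A (EC.sphf s))"
    by (rule atilde[unfolded is_Atilde_def, THEN conjunct2, THEN conjunct2, THEN conjunct2, THEN conjunct1, THEN spec, THEN mp, THEN bspec, OF i(2) EC.sphf_Ind[OF qchi]])
  have 3: "A (\<lambda>h. ?c * EC.sphf s h) = (\<lambda>h. ?c * A (EC.sphf s) h)"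
    by (rule atilde[unfolded is_Atilde_def, THEN conjunct2, THEN conjunct2, THEN conjunct1, THEN spec, THEN bspec, OF EC.sphf_Ind[OF qchi]])
  have "left_translate k (A (EC.sphf s)) (k ** g) = ?c * A (EC.sphf s) (k ** g)"
    unfolding 2[symmetric] 1 3 ..
  moreover have "matrix_inv k ** (k ** g) = g" by (simp add: matrix_mul_assoc matrix_inv_left i)
  ultimately show ?thesis using c by (simp add: left_translate_def)
qed

lemma A_sph_inv: "k \<in> GL2_integers F \<Longrightarrow> det k = 1 \<Longrightarrow> A (EC.sphf s) (k ** g) = A (EC.sphf s) g"
  using A_sph_GL2[of k g] by simp

text \<open>The matrix diag(u, 1) can be pulled out at the identity on the left, through chi(j u),
  and on the right, through eta(u). If these differ the value there is 0, and that value determines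
  the vector.\<close>

lemma A_sph_zero:
  assumes ne: "\<not> (\<forall>u\<in>unit_group F. eta u = chi (j u))"
  shows "A (EC.sphf s) = (\<lambda>g. 0)"
proof -
  let ?f = "A (EC.sphf s)"
  obtain u where u: "u \<in> unit_group F" "eta u \<noteq> chi (j u)" using ne by blast
  have u0: "u \<noteq> 0" using u F.unit_iff by blast
  have "mat2 u 0 0 1 \<in> GL2_integers F" using u by (simp add: F.GL2_mat2) (simp add: F.unit_iff pid_def)
  from A_sph_GL2[OF this, of "mat 1"] have "?f (mat2 u 0 0 1) = inverse (chi (j u)) * ?f (mat 1)" by simp
  moreover have "?f (mat 1 ** mat2 u 0 0 1) = inverse (qchar F eta (t + 1/2) u) * ?f (mat 1)"
    by (rule FC.Ind_equiv[OF A_sph_Ind _ u0]) (simp add: mat_mat2)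
  ultimately have "?f (mat 1) = 0" using u FC.qchar_unit by auto
  then have "?f (nbar x) = 0" for x
    using FC.nbar_values[OF A_sph_Ind A_sph_inv, of x] by simp
  then show ?thesis by (intro FC.Ind_ext[OF A_sph_Ind FC.Ind_zero]) simp
qed

end

section \<open>The image of the intertwining operator\<close>

locale intertwiner = kernel_setting F E j \<alpha> chi eta
  for F :: "'f::{field,metric_space} lf" and E :: "'e::{field,metric_space} lf" and j \<alpha> chi eta +
  fixes s t :: complex and A :: "('e^2^2 \<Rightarrow> complex) \<Rightarrow> ('f^2^2 \<Rightarrow> complex)"
  assumes atilde: "is_Atilde F E j \<alpha> chi eta s t A"
begin

lemmas atilde_parts = atilde[unfolded is_Atilde_def]

lemma A_Ind: "f \<in> Ind E chi s \<Longrightarrow> A f \<in> Ind F eta t"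
  by (rule atilde_parts[THEN conjunct1, THEN bspec])

lemma A_add: "f \<in> Ind E chi s \<Longrightarrow> h \<in> Ind E chi s \<Longrightarrow> A (\<lambda>g. f g + h g) = (\<lambda>g. A f g + A h g)"
  by (rule atilde_parts[THEN conjunct2, THEN conjunct1, THEN bspec, THEN bspec])

lemma A_cmult: "f \<in> Ind E chi s \<Longrightarrow> A (\<lambda>g. c * f g) = (\<lambda>g. c * A f g)"
  by (rule atilde_parts[THEN conjunct2, THEN conjunct2, THEN conjunct1, THEN spec, THEN bspec])

lemma A_translate: "invertible g \<Longrightarrow> f \<in> Ind E chi s \<Longrightarrow> A (left_translate (map_matrix j g) f) = left_translate g (A f)"
  by (rule atilde_parts[THEN conjunct2, THEN conjunct2, THEN conjunct2, THEN conjunct1, THEN spec, THEN mp, THEN bspec])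

lemma A_emb:
  assumes u: "tf E u"
  shows "A (EC.emb s u) (nbar y) = Kt s t (\<lambda>x. u (x + j y))"
proof -
  have "compact (closure {x. EC.emb s u (nbar x) \<noteq> 0})"
    unfolding EC.emb_nbar by (rule E.tf_compact_closure[OF u])
  then have "A (EC.emb s u) (nbar y) = Ktilde F E j \<alpha> chi eta s t (\<lambda>x. EC.emb s u (nbar (x + j y)))"
    by (intro atilde_parts[THEN conjunct2, THEN conjunct2, THEN conjunct2, THEN conjunct2, THEN bspec, THEN mp, THEN spec]
        EC.emb_Ind[OF u] conjI EC.emb_big_cell)
  then show ?thesis by (simp add: Kt_def)
qed

lemma map_weyl: "map_matrix j weyl = weyl"
  by (simp add: weyl_def map_matrix_mat2)

lemma A_weyl: "f \<in> Ind E chi s \<Longrightarrow> A (left_translate weyl f) = left_translate weyl (A f)"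
  using A_translate[OF weyl_invertible, of f] by (simp add: map_weyl)

lemma invertible_map: "invertible g \<Longrightarrow> invertible (map_matrix j g)" for g :: "'f^2^2"
proof -
  assume g: "invertible g"
  obtain a b c d where e: "g = mat2 a b c d" by (rule mat2_cases)
  then have "a * d - b * c \<noteq> 0" using g by simp
  then have "j (a * d - b * c) \<noteq> 0" by (simp only: j_eq_0) simp
  then show ?thesis by (simp add: e map_matrix_mat2)
qed

lemma image_split:
  assumes "h \<in> A ` Ind E chi s"
  shows "\<exists>u v. tf E u \<and> tf E v \<and> h = (\<lambda>g. A (EC.emb s u) g + left_translate weyl (A (EC.emb s v)) g)"
proof -
  obtain f where f: "f \<in> Ind E chi s" "h = A f" using assms by blast
  note sp = EC.Ind_split[OF f(1)]
  have "A f = (\<lambda>g. A (EC.emb s (\<lambda>x. if x \<in> pid E 0 then f (nbar x) else 0)) g +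
      left_translate weyl (A (EC.emb s (\<lambda>x. if x \<in> pid E 1 then left_translate weyl f (nbar x) else 0))) g)"
    by (subst sp(3)) (simp only: A_add EC.emb_Ind sp(1,2) EC.Ind_left_translate weyl_invertible A_weyl)
  then show ?thesis using sp(1,2) f(2) by blast
qed

sublocale WS: invariant_subspace F eta t "A ` Ind E chi s"
proof
  show "A ` Ind E chi s \<subseteq> Ind F eta t" using A_Ind by blast
  show "(\<lambda>g. 0) \<in> A ` Ind E chi s"
    using A_cmult[OF EC.Ind_zero, of 0] EC.Ind_zero by (intro image_eqI[of _ _ "\<lambda>g. 0"]) auto
  show "(\<lambda>g. f g + h g) \<in> A ` Ind E chi s" if fh: "f \<in> A ` Ind E chi s" "h \<in> A ` Ind E chi s" for f h
  proof -
    obtain f' h' where f': "f' \<in> Ind E chi s" "f = A f'" and h': "h' \<in> Ind E chi s" "h = A h'" using fh by blast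
    show ?thesis unfolding f'(2) h'(2) A_add[OF f'(1) h'(1), symmetric] by (intro imageI EC.Ind_add f' h')
  qed
  show "(\<lambda>g. c * f g) \<in> A ` Ind E chi s" if f: "f \<in> A ` Ind E chi s" for f c
  proof -
    obtain f' where f': "f' \<in> Ind E chi s" "f = A f'" using f by blast
    show ?thesis unfolding f'(2) A_cmult[OF f'(1), symmetric] by (intro imageI EC.Ind_cmult f')
  qed
  show "left_translate g f \<in> A ` Ind E chi s" if g: "invertible g" and f: "f \<in> A ` Ind E chi s" for g f
  proof -
    obtain h where h: "h \<in> Ind E chi s" "f = A h" using f by blast
    show ?thesis
      by (rule image_eqI[of _ _ "left_translate (map_matrix j g) h"])
        (simp_all add: h(2) A_translate[OF g h(1)] EC.Ind_left_translate[OF h(1) invertible_map[OF g]])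
  qed
qed

definition vv :: "('e \<Rightarrow> complex) \<Rightarrow> 'f \<Rightarrow> complex" where
  "vv u y = Kt s t (\<lambda>x. u (x + j y))"

abbreviation "X \<equiv> Xv s t"
abbreviation "Y \<equiv> Yv s t"
abbreviation "\<tau> \<equiv> tv t"

lemma tau_zz: "F.Q powr (t + 1/2) = \<tau>"
  by (simp add: tv_def)

lemma X_rel: "F.Q * X = Y * \<tau>\<^sup>2"
  by (rule Xv_rel)

lemma vv_VV: assumes "tf E u" shows "vv u \<in> WS.VV"
proof -
  have "vv u = (\<lambda>y. A (EC.emb s u) (nbar y))" by (simp add: fun_eq_iff vv_def A_emb[OF assms])
  then show ?thesis using WS.VV_I[OF imageI[OF EC.emb_Ind[OF assms, of s]]] by simp
qed

lemma vv_shift: "vv (\<lambda>x. u (x + j b)) y = vv u (y + b)"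
  by (simp add: vv_def algebra_simps)

lemma bB_shift: "(\<lambda>x. bB c N (x + j y)) = bB (c - j y) N"
  by (simp add: fun_eq_iff bB_eq algebra_simps)

lemma vv_bB: "vv (bB c N) y = Kt s t (bB (c - j y) N)"
  by (simp add: vv_def bB_shift)

text \<open>Every small ball not centred at 0 has a factor 1 - X in its value, and balls around 0
  have values independent of their radius because X^N = 1.\<close>

lemma Kt_X1: assumes X: "X = 1" and u: "tf E u" shows "Kt s t u = Mf (s, t) * u 0"
proof -
  obtain n0 where n0: "cond n0" using cond_ex by blast
  have n1: "1 \<le> n0" using n0 by (simp add: cond_def)
  show ?thesis
  proof (rule tf_refine[OF n0 u])
    show "Kt s t (bB 0 N) = Mf (s, t) * bB 0 N 0" for N by (simp add: Kt_zero X bB_eq BB_def)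
    show "Kt s t (bB c N) = Mf (s, t) * bB c N 0" if c: "c2 c \<noteq> 0" "nu F (c2 c) + n0 \<le> N" for c N
      using Kt_off[OF n0 c, of s t] c n1 by (auto simp: X bB_eq BB_iff pid_def)
    show "Kt s t (bB (j y) N) = Mf (s, t) * bB (j y) N 0" if y: "y \<noteq> 0" "nu F y + n0 \<le> N" for y N
      using Kt_near[OF n0 y, of s t] y n1 by (auto simp: X bB_eq BB_iff pid_def)
  qed (simp_all add: Kt_add Kt_cmult distrib_left)
qed

lemma A_emb_zero: assumes "tf E u" "\<And>y. vv u y = 0" shows "A (EC.emb s u) = (\<lambda>g. 0)"
  by (rule FC.Ind_ext[OF A_Ind[OF EC.emb_Ind[OF assms(1)]] FC.Ind_zero])
    (use assms(2) in \<open>simp add: A_emb[OF assms(1)] vv_def\<close>)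

lemma image_zero: assumes "X = 1" "Mf (s, t) = 0" shows "A ` Ind E chi s = {\<lambda>g. 0}"
proof -
  have z: "A (EC.emb s u) = (\<lambda>g. 0)" if "tf E u" for u
    by (rule A_emb_zero[OF that]) (simp add: vv_def Kt_X1[OF assms(1) E.tf_shift[OF that]] assms(2))
  have "h = (\<lambda>g. 0)" if h: "h \<in> A ` Ind E chi s" for h
  proof -
    obtain u v where uv: "tf E u" "tf E v" "h = (\<lambda>g. A (EC.emb s u) g + left_translate weyl (A (EC.emb s v)) g)"
      using image_split[OF h] by blast
    then show ?thesis by (simp add: z left_translate_def)
  qed
  then show ?thesis using WS.W_zero by blast
qed

text \<open>The ball \<open>BB 0\<close> yields a multiple of the indicator of the integers of F. It
  is not constant and has nonzero integral, which excludes every proper invariant subspace.\<close>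

lemma image_delta: assumes X: "X = 1" and M: "Mf (s, t) \<noteq> 0" shows "A ` Ind E chi s = Ind F eta t"
proof -
  let ?v = "vv (bB 0 0)"
  have v: "?v y = Mf (s, t) * bl F 0 0 y" for y
    unfolding vv_def Kt_X1[OF X E.tf_shift[OF tf_bB]] by (simp add: bB_eq bl_def BB_iff)
  have V: "?v \<in> WS.VV" by (rule vv_VV) simp
  have p: "inverse (unif F) \<notin> pid F 0" by (simp add: pid_def F.nu_inverse)
  have ne: "?v 0 \<noteq> ?v (inverse (unif F))" using M p by (simp add: v bl_def)
  show ?thesis
  proof (cases "(FC.zz t)\<^sup>2 = F.Q\<^sup>2")
    case False
    then show ?thesis by (rule WS.nonconst_full[OF V ne])
  next
    case True
    have "A (EC.emb s (bB 0 0)) \<in> A ` Ind E chi s" by (intro imageI EC.emb_Ind) simp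
    moreover have "(LINT y|haar F. A (EC.emb s (bB 0 0)) (nbar y)) = Mf (s, t)"
      using v by (simp add: A_emb vv_def F.bl_integral)
    then have "A (EC.emb s (bB 0 0)) \<notin> steinberg F eta t" using M by (simp add: steinberg_def)
    ultimately have "A ` Ind E chi s \<noteq> steinberg F eta t" by blast
    then show ?thesis using WS.nonconst_steinberg(1)[OF V ne True] by blast
  qed
qed

text \<open>A small ball around 1 has as its value 1 - X times a nonzero number.\<close>

lemma nonzero: assumes X: "X \<noteq> 1" shows "\<exists>f\<in>A ` Ind E chi s. f \<noteq> (\<lambda>g. 0)"
proof -
  obtain n0 where n0: "cond n0" using cond_ex by blast
  let ?f = "A (EC.emb s (bB (j 1) n0))"
  have "?f (nbar 0) = Kt s t (bB (j 1) n0)" by (simp add: A_emb)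
  also have "\<dots> \<noteq> 0" using X F.one_Q by (subst Kt_near[OF n0]) auto
  finally have "?f \<noteq> (\<lambda>g. 0)" by (metis (no_types))
  then show ?thesis using EC.emb_Ind[OF tf_bB] by blast
qed

lemma image_generic: assumes X: "X \<noteq> 1" and t: "\<tau>\<^sup>2 \<noteq> 1" "\<tau>\<^sup>2 \<noteq> F.Q\<^sup>2" shows "A ` Ind E chi s = Ind F eta t"
proof -
  obtain f where "f \<in> A ` Ind E chi s" "f \<noteq> (\<lambda>g. 0)" using nonzero[OF X] by blast
  from WS.nonzero_nonconst[OF this] t obtain v x y where "v \<in> WS.VV" "v x \<noteq> v y" unfolding tau_zz by blast
  then show ?thesis by (rule WS.nonconst_full) (use t in \<open>simp add: tau_zz\<close>)
qed

definition JJ :: "('e \<Rightarrow> complex) \<Rightarrow> complex" where "JJ u = (LINT y|haar F. vv u y)"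

lemma image_steinberg:
  assumes X: "X \<noteq> 1" and t: "\<tau>\<^sup>2 = F.Q\<^sup>2"
  shows "A ` Ind E chi s = (if \<forall>u. tf E u \<longrightarrow> JJ u = 0 then steinberg F eta t else Ind F eta t)"
proof -
  have z: "(FC.zz t)\<^sup>2 = F.Q\<^sup>2" using t by (simp add: tau_zz)
  note Q1 = F.Q_ne(3)
  obtain f where "f \<in> A ` Ind E chi s" "f \<noteq> (\<lambda>g. 0)" using nonzero[OF X] by blast
  from WS.nonzero_nonconst[OF this] z Q1 obtain v x y where v: "v \<in> WS.VV" "v x \<noteq> v y" by auto
  note st = WS.nonconst_steinberg[OF v z]
  have J: "JJ u = (LINT y|haar F. A (EC.emb s u) (nbar y))" if "tf E u" for u
    by (simp add: JJ_def vv_def A_emb[OF that])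
  show ?thesis
  proof (cases "\<forall>u. tf E u \<longrightarrow> JJ u = 0")
    case True
    have "A ` Ind E chi s \<subseteq> steinberg F eta t"
    proof
      fix h assume h: "h \<in> A ` Ind E chi s"
      then obtain u v where uv: "tf E u" "tf E v" "h = (\<lambda>g. A (EC.emb s u) g + left_translate weyl (A (EC.emb s v)) g)"
        using image_split by blast
      have I: "A (EC.emb s u) \<in> Ind F eta t" "A (EC.emb s v) \<in> Ind F eta t" "left_translate weyl (A (EC.emb s v)) \<in> Ind F eta t"
        using uv(1,2) by (auto intro!: A_Ind EC.emb_Ind FC.Ind_left_translate)
      \<comment> \<open>The part of h that comes from the other chart contributes its integral with
        the sign eps, so test functions alone decide.\<close>
      have "(LINT y|haar F. h (nbar y)) = JJ u + FC.eps * JJ v"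
        unfolding uv(3) J[OF uv(1)] J[OF uv(2)] FC.Ind_integral_weyl[OF I(2) z, symmetric]
        by (intro Bochner_Integration.integral_add FC.Ind_integral(1)[OF _ z] I)
      then have "(LINT y|haar F. h (nbar y)) = 0" using True uv by simp
      then show "h \<in> steinberg F eta t" using h WS.W_sub by (auto simp: steinberg_def)
    qed
    then show ?thesis using True st(2) by auto
  next
    case False
    then obtain u where u: "tf E u" "JJ u \<noteq> 0" by blast
    then have "A (EC.emb s u) \<notin> steinberg F eta t" by (simp add: steinberg_def J)
    moreover have "A (EC.emb s u) \<in> A ` Ind E chi s" by (intro imageI EC.emb_Ind u)
    ultimately have "A ` Ind E chi s \<noteq> steinberg F eta t" by blast
    then show ?thesis unfolding if_not_P[OF False] using st(1) by blast
  qed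
qed

lemma image_constants:
  assumes X: "X \<noteq> 1" and t: "\<tau>\<^sup>2 = 1"
  shows "A ` Ind E chi s = (if \<forall>u y. tf E u \<longrightarrow> vv u y = vv u 0 then {\<lambda>g. c * spherical F eta t g | c. True} else Ind F eta t)"
proof (cases "\<forall>u y. tf E u \<longrightarrow> vv u y = vv u 0")
  case False
  then obtain u y where u: "tf E u" "vv u y \<noteq> vv u 0" by blast
  have "A ` Ind E chi s = Ind F eta t"
    by (intro WS.nonconst_full[OF vv_VV[OF u(1)] u(2)]) (use t F.Q_ne in \<open>simp add: tau_zz\<close>)
  then show ?thesis unfolding if_not_P[OF False] .
next
  case True
  let ?p = "FC.sphf t"
  have p: "spherical F eta t = ?p" by (rule FC.spherical_eq[OF FC.quad])
  have pI: "?p \<in> Ind F eta t" by (rule FC.sphf_Ind[OF FC.quad])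
  \<comment> \<open>The exponent of \<tau> in \<open>sphf\<close> is even at \<open>nbar y\<close>,
    so the spherical vector is the constant 1 on the affine line.\<close>
  have pn: "?p (nbar y) = 1" for y
  proof -
    have "\<tau> powi (2 * n) = 1" for n using t by (simp add: power_int_mult)
    then show ?thesis by (simp add: nbar_mat2 FC.sphf_mat2 tau_zz)
  qed
  have e: "A (EC.emb s u) = (\<lambda>g. vv u 0 * ?p g)" if u: "tf E u" for u
  proof (rule FC.Ind_ext[OF A_Ind[OF EC.emb_Ind[OF u]] FC.Ind_cmult[OF pI]])
    show "A (EC.emb s u) (nbar y) = vv u 0 * ?p (nbar y)" for y
    proof -
      have "A (EC.emb s u) (nbar y) = vv u y" by (simp add: A_emb[OF u] vv_def)
      also have "\<dots> = vv u 0" by (rule True[rule_format, OF u])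
      finally show ?thesis by (simp add: pn)
    qed
  qed
  have w: "left_translate weyl ?p = (\<lambda>g. inverse (eta (det weyl)) * ?p g)"
    by (simp add: fun_eq_iff left_translate_weyl FC.sphf_GL2[OF F.weyl_GL2])
  have sub: "\<exists>c. h = (\<lambda>g. c * ?p g)" if hW: "h \<in> A ` Ind E chi s" for h
  proof -
    obtain u v where uv: "tf E u" "tf E v" "h = (\<lambda>g. A (EC.emb s u) g + left_translate weyl (A (EC.emb s v)) g)"
      using image_split[OF hW] by blast
    have "h = (\<lambda>g. (vv u 0 + vv v 0 * inverse (eta (det weyl))) * ?p g)"
      unfolding uv(3) e[OF uv(1)] e[OF uv(2)] left_translate_cmult w by (simp add: distrib_right mult.assoc)
    then show ?thesis by blast
  qed
  obtain f where f: "f \<in> A ` Ind E chi s" "f \<noteq> (\<lambda>g. 0)" using nonzero[OF X] by blast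
  obtain c where c: "f = (\<lambda>g. c * ?p g)" using sub[OF f(1)] by blast
  have c0: "c \<noteq> 0" using f(2) c by auto
  have "(\<lambda>g. d * ?p g) \<in> A ` Ind E chi s" for d
  proof -
    have "(\<lambda>g. d / c * f g) \<in> A ` Ind E chi s" by (rule WS.W_cmult[OF f(1)])
    then show ?thesis using c0 by (simp add: c)
  qed
  then show ?thesis unfolding if_P[OF True] p using sub by blast
qed

lemma vv_integrable: assumes u: "tf E u" and t: "\<tau>\<^sup>2 = F.Q\<^sup>2" shows "integrable (haar F) (vv u)"
proof -
  have "integrable (haar F) (\<lambda>y. A (EC.emb s u) (nbar y))"
    by (rule FC.Ind_integral(1)[OF A_Ind[OF EC.emb_Ind[OF u]]]) (use t in \<open>simp add: tau_zz\<close>)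
  moreover have "(\<lambda>y. A (EC.emb s u) (nbar y)) = vv u" by (simp add: fun_eq_iff vv_def A_emb[OF u])
  ultimately show ?thesis by simp
qed

lemma vv_add: "tf E u \<Longrightarrow> tf E v \<Longrightarrow> vv (\<lambda>x. u x + v x) y = vv u y + vv v y"
  unfolding vv_def by (intro Kt_add E.tf_shift)

lemma vv_cmult: "tf E u \<Longrightarrow> vv (\<lambda>x. c * u x) y = c * vv u y"
  unfolding vv_def by (intro Kt_cmult E.tf_shift)

context
  assumes t: "\<tau>\<^sup>2 = F.Q\<^sup>2"
begin

lemma JJ_add: assumes "tf E u" "tf E v" shows "JJ (\<lambda>x. u x + v x) = JJ u + JJ v"
  unfolding JJ_def vv_add[OF assms] by (intro Bochner_Integration.integral_add vv_integrable t assms)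

lemma JJ_cmult: "tf E u \<Longrightarrow> JJ (\<lambda>x. c * u x) = c * JJ u"
  by (simp add: JJ_def vv_cmult)

lemma JJ_zero: "JJ (\<lambda>x. 0) = 0"
  using JJ_cmult[OF E.tf_0, of 0] by simp

lemma JJ_sum: "finite C \<Longrightarrow> JJ (\<lambda>x. \<Sum>c\<in>C. a c * bB (p c) N x) = (\<Sum>c\<in>C. a c * JJ (bB (p c) N))"
proof (induction C rule: finite_induct)
  case (insert c C)
  have "tf E (\<lambda>x. \<Sum>c\<in>C. a c * bB (p c) N x)" by (intro E.tf_sum E.tf_cmult tf_bB)
  then show ?case using insert by (simp add: JJ_add E.tf_cmult JJ_cmult)
qed (simp add: JJ_zero)

lemma JJ_shift: assumes "tf E u" shows "JJ (\<lambda>x. u (x + j b)) = JJ u"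
  unfolding JJ_def vv_shift
  by (rule F.integral_shift) (use borel_measurable_integrable[OF vv_integrable[OF assms t]] in simp)

lemma JJ_j: "JJ (bB (j y) N) = JJ (bB 0 N)"
  using JJ_shift[OF tf_bB, of 0 N "- y"] by (simp only: bB_shift) simp

lemma JJ_scale: assumes u: "tf E u" and a: "a \<noteq> 0" shows "JJ (\<lambda>x. u (j a * x)) = X powi (- nu F a) * F.Q powi nu F a * JJ u"
proof -
  have "vv (\<lambda>x. u (j a * x)) y = X powi (- nu F a) * vv u (a * y)" for y
    using Kt_scale[OF E.tf_shift[OF u, of "j (a * y)"] a, of s t] by (simp add: vv_def distrib_left)
  then show ?thesis
    using F.integral_scale[OF a, of "vv u"] borel_measurable_integrable[OF vv_integrable[OF u t]] by (simp add: JJ_def)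
qed

text \<open>The points c - y are multiples by \<open>c2 c\<close> of points of the line \<alpha> +
  F, so \<open>vv\<close> is \<open>Gf\<close> after an affine substitution, times both
  L-factors.\<close>

lemma JJ_off:
  assumes n0: "cond n0" and c: "c2 c \<noteq> 0" and N: "nu F (c2 c) + n0 \<le> N"
  shows "\<exists>k. k \<noteq> 0 \<and> JJ (bB c N) = (1 - Y) * (1 - X) * k * (LINT y|haar F. Gf \<tau> y)"
proof -
  let ?a = "c2 c" and ?b = "c1 c / c2 c"
  have "c - j y = j ?a * (\<alpha> - j (1 / ?a * y + (- ?b)))" for y
  proof -
    have e: "?a * (1 / ?a * y + (- ?b)) = y - c1 c" using c by (simp add: field_simps)
    have "j ?a * (\<alpha> - j (1 / ?a * y + (- ?b))) = j ?a * \<alpha> - j (?a * (1 / ?a * y + (- ?b)))"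
      by (simp only: right_diff_distrib j_mult)
    also have "\<dots> = j ?a * \<alpha> - (j y - j (c1 c))" unfolding e by (simp only: j_diff)
    also have "\<dots> = (j (c1 c) + j ?a * \<alpha>) - j y" by simp
    finally show ?thesis using coords[of c] by (simp only:)
  qed
  then have K: "Kf Y \<tau> (c - j y) = (F.Q * Y * \<tau>\<^sup>2) powi nu F ?a * Gf \<tau> (1 / ?a * y + (- ?b))" for y
    by (simp only: Kf_jmult[OF c Yv_nz tv_nz] Kf_G)
  have vv: "vv (bB c N) y = ((1 - Y) * (1 - X) * F.Q powi (- 2 * N) * (F.Q * Y * \<tau>\<^sup>2) powi nu F ?a) * Gf \<tau> (1 / ?a * y + (- ?b))" for y
    unfolding vv_bB using c N by (subst Kt_off[OF n0]) (simp_all only: c2_diff c2_j diff_zero K mult_ac not_False_eq_True)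
  have Gm: "Gf \<tau> \<in> borel_measurable borel" using borel_measurable_integrable[OF Gf_integral(1)[OF t]] by simp
  have "integrable (haar F) (\<lambda>y. Gf \<tau> (y + (- ?b)))"
    using F.integrable_shift_iff[OF Gm] Gf_integral(1)[OF t] by blast
  from borel_measurable_integrable[OF this] have Gm': "(\<lambda>y. Gf \<tau> (y + (- ?b))) \<in> borel_measurable borel" by simp
  have "1 / ?a \<noteq> 0" using c by simp
  from F.integral_scale[OF this Gm'] F.integral_shift[OF Gm, of "- ?b"]
  have "(LINT y|haar F. Gf \<tau> (1 / ?a * y + (- ?b))) = F.Q powi nu F (1 / ?a) * (LINT y|haar F. Gf \<tau> y)" by simp
  then have "JJ (bB c N) = (1 - Y) * (1 - X) * (F.Q powi (- 2 * N) * (F.Q * Y * \<tau>\<^sup>2) powi nu F ?a * F.Q powi nu F (1 / ?a)) * (LINT y|haar F. Gf \<tau> y)"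
    unfolding JJ_def vv by (subst Bochner_Integration.integral_mult_right_zero) (simp only: mult_ac)
  moreover have "F.Q powi (- 2 * N) * (F.Q * Y * \<tau>\<^sup>2) powi nu F ?a * F.Q powi nu F (1 / ?a) \<noteq> 0" by simp
  ultimately show ?thesis by blast
qed

text \<open>
  If \<open>JJ\<close> vanishes on functions supported off F, then splitting the ball \<open>BB 0\<close> into balls of level 1
  and scaling both give \<open>JJ (bB 0 0) = q * JJ (bB 0 1) = X * JJ (bB 0 0)\<close>.
\<close>

lemma JJ_all_zero:
  assumes X: "X \<noteq> 1" and off: "Y = 1 \<or> (LINT y|haar F. Gf \<tau> y) = 0" and u: "tf E u"
  shows "JJ u = 0"
proof -
  obtain n0 where n0: "cond n0" using cond_ex by blast
  have off': "JJ (bB c N) = 0" if "c2 c \<noteq> 0" "nu F (c2 c) + n0 \<le> N" for c N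
    using JJ_off[OF n0 that] off by auto
  \<comment> \<open>A test function that vanishes near F is a combination of balls to which off'
    applies.\<close>
  have vanish: "JJ u = 0" if u: "tf E u" and z: "\<And>x. c2 x \<in> pid F N \<Longrightarrow> u x = 0" for u N
  proof -
    obtain N' M where N': "\<forall>x. \<forall>h\<in>BB N'. u (x + h) = u x" and M: "\<forall>x. u x \<noteq> 0 \<longrightarrow> x \<in> BB M"
      using u unfolding tf_E_iff by blast
    let ?N = "max N' (N + n0)"
    have inv: "u (x + h) = u x" if "h \<in> BB ?N" for x h
      by (rule N'[rule_format]) (rule BB_mono[OF that], simp)
    let ?C = "E.rp (ram * ?N) ` BB M"
    have "u = (\<lambda>x. \<Sum>c\<in>?C. u c * bB c ?N x)"
      by (rule HOL.ext) (rule bB_decomp[OF inv M[rule_format]])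
    then have "JJ u = JJ (\<lambda>x. \<Sum>c\<in>?C. u c * bB c ?N x)" by (rule arg_cong)
    also have "\<dots> = (\<Sum>c\<in>?C. u c * JJ (bB c ?N))" by (rule JJ_sum[OF finite_rpB])
    also have "\<dots> = 0"
    proof (rule sum.neutral, rule ballI)
      fix c
      show "u c * JJ (bB c ?N) = 0"
      proof (cases "c2 c \<in> pid F N")
        case False
        then have "c2 c \<noteq> 0" "nu F (c2 c) < N" using F.notin_pidD by auto
        then show ?thesis using off'[of c ?N] by simp
      qed (simp add: z)
    qed
    finally show ?thesis .
  qed
  let ?R = "F.rp 1 ` pid F 0"
  \<comment> \<open>Near F the ball \<open>BB 0\<close> coincides with the union of the q balls of
    level 1 centred at the digits; w is the rest.\<close>
  define w where "w x = bB 0 0 x + (-1) * (\<Sum>r\<in>?R. bl F 0 0 r * bB (j r) 1 x)" for x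
  have tS: "tf E (\<lambda>x. \<Sum>r\<in>?R. bl F 0 0 r * bB (j r) 1 x)" by (intro E.tf_sum E.tf_cmult tf_bB)
  have tw: "tf E w" unfolding w_def[abs_def] by (intro E.tf_add E.tf_cmult tf_bB tS)
  have "w x = 0" if x: "c2 x \<in> pid F 1" for x
  proof -
    have x0: "c2 x \<in> pid F 0" by (rule F.pid_mono[OF x]) simp
    have "bl F 0 0 (c1 x) = (\<Sum>r\<in>?R. bl F 0 0 r * bl F r 1 (c1 x))"
    proof (rule F.tf_decomp)
      show "bl F 0 0 (y + h) = bl F 0 0 y" if "h \<in> pid F 1" for y h
        using F.pid_add_cancel[of h 0 y] F.pid_mono[OF that, of 0] by (simp add: bl_def)
    qed (simp add: bl_def split: if_splits)
    moreover have "bB 0 0 x = bl F 0 0 (c1 x)" "bB (j r) 1 x = bl F r 1 (c1 x)" for r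
      using x x0 by (simp_all add: bB_eq BB_iff bl_def)
    ultimately show ?thesis by (simp add: w_def)
  qed
  from vanish[OF tw this] have "JJ w = 0" .
  moreover have "JJ w = JJ (bB 0 0) + (-1) * (\<Sum>r\<in>?R. bl F 0 0 r * JJ (bB (j r) 1))"
    unfolding w_def[abs_def] by (simp only: JJ_add JJ_cmult tf_bB E.tf_cmult tS JJ_sum F.finite_rp1)
  moreover have "(\<Sum>r\<in>?R. bl F 0 0 r * JJ (bB (j r) 1)) = (\<Sum>r\<in>?R. JJ (bB 0 1))"
  proof (rule sum.cong[OF refl])
    fix r assume "r \<in> ?R"
    then have "r \<in> pid F 0" using F.rp_pid_iff[of 0 1] by auto
    then show "bl F 0 0 r * JJ (bB (j r) 1) = JJ (bB 0 1)" by (simp add: JJ_j bl_def)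
  qed
  ultimately have 1: "JJ (bB 0 0) = F.Q * JJ (bB 0 1)" by (simp add: F.card_rp1)
  have sc: "JJ (bB 0 N) = X powi N * F.Q powi (- N) * JJ (bB 0 0)" for N
  proof -
    have "(\<lambda>x. bB 0 0 (j (unif F powi (- N)) * x)) = bB 0 N"
      by (simp add: fun_eq_iff bB_eq BB_jmult del: j_powi)
    then show ?thesis using JJ_scale[OF tf_bB F.unif_powi_nz, of 0 0 "- N"] by simp
  qed
  have "JJ (bB 0 0) = F.Q * (X powi 1 * F.Q powi (- 1) * JJ (bB 0 0))" using 1 unfolding sc[of 1] .
  also have "\<dots> = X * JJ (bB 0 0)" by (simp add: power_int_minus)
  finally have "JJ (bB 0 0) = X * JJ (bB 0 0)" .
  then have "(1 - X) * JJ (bB 0 0) = 0" by (simp add: left_diff_distrib)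
  then have "JJ (bB 0 0) = 0" using X by simp
  then have z: "JJ (bB 0 N) = 0" for N using sc[of N] by simp
  show ?thesis
  proof (rule tf_refine[OF n0 u])
    show "JJ (bB 0 N) = 0" for N by (rule z)
    show "JJ (bB c N) = 0" if "c2 c \<noteq> 0" "nu F (c2 c) + n0 \<le> N" for c N by (rule off'[OF that])
    show "JJ (bB (j y) N) = 0" for y N by (simp add: JJ_j z)
  qed (simp_all add: JJ_add JJ_cmult)
qed

lemma JJ_zero_iff:
  assumes X: "X \<noteq> 1"
  shows "(\<forall>u. tf E u \<longrightarrow> JJ u = 0) \<longleftrightarrow> Y = 1 \<or> (LINT y|haar F. Gf \<tau> y) = 0"
proof
  assume J: "\<forall>u. tf E u \<longrightarrow> JJ u = 0"
  obtain n0 where n0: "cond n0" using cond_ex by blast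
  have "\<exists>k. k \<noteq> 0 \<and> JJ (bB \<alpha> n0) = (1 - Y) * (1 - X) * k * (LINT y|haar F. Gf \<tau> y)"
    by (rule JJ_off[OF n0]) simp_all
  then show "Y = 1 \<or> (LINT y|haar F. Gf \<tau> y) = 0" using J X by auto
qed (use JJ_all_zero[OF X] in blast)

end

lemma image_sq_Q:
  assumes X: "X \<noteq> 1" and t: "\<tau>\<^sup>2 = F.Q\<^sup>2"
  shows "A ` Ind E chi s = (if Y = 1 \<or> \<not> quadratic_chi \<or> (\<not> unramified F E j \<and> \<tau> = - F.Q)
    then steinberg F eta t else Ind F eta t)"
  unfolding image_steinberg[OF X t] JJ_zero_iff[OF t X] Gf_integral_zero_iff[OF t] ..

text \<open>
  Translation invariance makes \<open>Gf\<close> constant; the constant is 1, as one sees at points of F of large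
  absolute value, and every element of E off F is a multiple of a point of \<open>\<alpha> + F\<close>.
\<close>

lemma const_imp:
  assumes X: "X \<noteq> 1" and t: "\<tau>\<^sup>2 = 1" and Y: "Y \<noteq> 1" and const: "\<And>u y. tf E u \<Longrightarrow> vv u y = vv u 0"
  shows "quadratic_chi \<and> (unramified F E j \<or> \<tau> = 1)"
proof -
  have tp: "\<tau> powi (2 * n) = 1" for n using t by (simp add: power_int_mult)
  obtain n0 where n0: "cond n0" using cond_ex by blast
  have n1: "1 \<le> n0" using n0 by (simp add: cond_def)
  have v: "vv (bB \<alpha> n0) y = (1 - Y) * (1 - X) * (Gf \<tau> y * F.Q powi (- 2 * n0))" for y
    unfolding vv_bB by (subst Kt_off[OF n0]) (simp_all add: Kf_G)
  have G0: "Gf \<tau> y = Gf \<tau> 0" for y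
  proof -
    have "(1 - Y) * (1 - X) * (Gf \<tau> y * F.Q powi (- 2 * n0)) = (1 - Y) * (1 - X) * (Gf \<tau> 0 * F.Q powi (- 2 * n0))"
      unfolding v[symmetric] by (rule const) (rule tf_bB)
    moreover have "1 - Y \<noteq> 0" "1 - X \<noteq> 0" "F.Q powi (- 2 * n0) \<noteq> 0" using X Y by auto
    ultimately show ?thesis by (simp only: mult_cancel_left mult_cancel_right simp_thms mult_eq_0_iff)
  qed
  \<comment> \<open>So large that 1 - \<alpha> / y lies in the neighbourhood of 1 given by the
    conductor, which fixes the constant.\<close>
  define y where "y = unif F powi (- n0)"
  have y: "y \<notin> pid F 0" using n1 by (simp add: y_def pid_def)
  have h: "- (j (1 / y) * \<alpha>) \<in> BB (1 + n0 - 1)"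
  proof -
    have "c1 (j (1 / y) * \<alpha>) = 0" "c2 (j (1 / y) * \<alpha>) = 1 / y" by (simp_all only: c1_jalpha c2_jalpha)
    moreover have "1 / y \<in> pid F n0" by (simp add: y_def pid_def F.nu_divide)
    ultimately show ?thesis by (simp add: BB_iff)
  qed
  have o: "1 \<notin> BB 1"
  proof
    assume "1 \<in> BB 1"
    then have "j 1 \<in> BB 1" by simp
    then have "(1::'f) \<in> pid F 1" unfolding BB_iff c1_j c2_j by blast
    then show False by (simp add: pid_def)
  qed
  have "kap (1 - j (1 / y) * \<alpha>) = 1" using condD[OF n0 o h] by simp
  then have "Gf \<tau> y = 1" unfolding Gf_off[OF y] tp by simp
  then have G: "Gf \<tau> y = 1" for y using G0[of y] G0[of "unif F powi (- n0)"] by (simp add: y_def)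
  have q: "kap x = 1" if x: "x \<in> unit_group E" for x
  proof (cases "c2 x = 0")
    case True
    then have e: "x = j (c1 x)" using coords[of x] by simp
    have "c1 x \<noteq> 0"
    proof
      assume "c1 x = 0"
      then have "x = 0" using e by simp
      then show False using x E.unit_iff by blast
    qed
    then have "kap (j (c1 x)) = 1" by (rule kap_j)
    then show ?thesis using e by simp
  next
    case False
    let ?a = "c2 x" and ?y = "- (c1 x / c2 x)"
    have "j ?a * (\<alpha> - j ?y) = j ?a * \<alpha> - j (?a * ?y)" by (simp only: right_diff_distrib j_mult)
    also have "?a * ?y = - c1 x" using False by simp
    also have "j ?a * \<alpha> - j (- c1 x) = j (c1 x) + j ?a * \<alpha>" by simp
    also have "\<dots> = x" by (rule coords[symmetric])
    finally have e: "x = j ?a * (\<alpha> - j ?y)" by (rule sym)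
    have k: "kap x = kap (\<alpha> - j ?y)" using kap_jmult[OF False alpha_minus_nz, of ?y] e by simp
    have "nu E (j ?a * (\<alpha> - j ?y)) = nu E (j ?a) + nu E (\<alpha> - j ?y)"
      by (rule E.nu_mult[OF _ alpha_minus_nz]) (use False in simp)
    then have "nu E (\<alpha> - j ?y) = - (ram * nu F ?a)"
      using e x nu_j[OF False] E.unit_iff[of x] by simp
    then have "int fdeg * nu E (\<alpha> - j ?y) = 2 * (- nu F ?a)" using fdeg_ram[of "nu F ?a"] by simp
    then have "Gf \<tau> ?y = kap (\<alpha> - j ?y)" unfolding Gf_def by (simp only: tp mult_1_right)
    then show ?thesis using G[of ?y] k by simp
  qed
  have qc: quadratic_chi
    unfolding trivial_on_units_def
  proof
    fix x assume "x \<in> unit_group E"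
    then show "(chi x)\<^sup>2 = 1" using q kap_unit by simp
  qed
  moreover have "\<tau> = 1" if "\<not> unramified F E j"
  proof -
    have "int fdeg * nu E \<alpha> = 1" using that ram_12 by (simp add: fdeg_def nu_alpha_def)
    moreover have "kap \<alpha> = 1" by (rule cond_quad(2)[OF qc alpha_nz])
    ultimately show ?thesis using G[of 0] by (simp add: Gf_def)
  qed
  ultimately show ?thesis by blast
qed

lemma Mf_Y1: assumes Y: "Y = 1" shows "Mf (s, t) = (1 - 1 / F.Q)\<^sup>2"
proof (cases quadratic_chi)
  case True
  then show ?thesis by (simp add: Mf_quad Y power2_eq_square)
next
  case False
  then show ?thesis using Mf_nonquad Y by (auto simp: power2_eq_square)
qed

text \<open>Balls off F have the factor 1 - Y = 0. Here X = 1/q, so X^N is the measure of a ball of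
  level N in F and the kernel becomes integration along F.\<close>

lemma const_Y1:
  assumes t: "\<tau>\<^sup>2 = 1" and Y: "Y = 1" and u: "tf E u"
  shows "Kt s t u = (1 - 1 / F.Q)\<^sup>2 * (LINT y|haar F. u (j y))"
proof -
  obtain n0 where n0: "cond n0" using cond_ex by blast
  have X: "X = 1 / F.Q" using X_rel t Y by (simp add: field_simps)
  have tp: "\<tau> powi (2 * n) = 1" for n using t by (simp add: power_int_mult)
  have ty: "tf F (\<lambda>y. u (j y))" if "tf E u" for u using slice1_tf[OF that, of 0] by simp
  have b: "(LINT z|haar F. bB (j y) N (j z)) = F.Q powi (- N)" for y N
  proof -
    have "bB (j y) N (j z) = bl F y N z" for z by (simp add: bB_eq bl_def BB_iff)
    then show ?thesis by (simp add: F.bl_integral)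
  qed
  have Xp: "X powi N = F.Q powi (- N)" for N by (simp add: X power_int_minus power_int_inverse[symmetric] inverse_eq_divide power_int_divide_distrib)
  show ?thesis
  proof (rule tf_refine[OF n0 u])
    show "Kt s t (bB 0 N) = (1 - 1 / F.Q)\<^sup>2 * (LINT y|haar F. bB 0 N (j y))" for N
      using b[of 0 N] by (simp add: Kt_zero Mf_Y1[OF Y] Xp)
    show "Kt s t (bB c N) = (1 - 1 / F.Q)\<^sup>2 * (LINT y|haar F. bB c N (j y))"
      if c: "c2 c \<noteq> 0" "nu F (c2 c) + n0 \<le> N" for c N
    proof -
      have "1 \<le> n0" using n0 by (simp add: cond_def)
      then have "bB c N (j y) = 0" for y using c by (auto simp: bB_eq BB_iff pid_def)
      then show ?thesis using Kt_off[OF n0 c, of s t] Y by simp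
    qed
    show "Kt s t (bB (j y) N) = (1 - 1 / F.Q)\<^sup>2 * (LINT z|haar F. bB (j y) N (j z))"
      if y: "y \<noteq> 0" "nu F y + n0 \<le> N" for y N
      unfolding Kt_near[OF n0 y] b using tp X Y by (simp add: power2_eq_square)
  next
    fix u v assume uv: "tf E u" "tf E v" "Kt s t u = (1 - 1 / F.Q)\<^sup>2 * (LINT y|haar F. u (j y))"
      "Kt s t v = (1 - 1 / F.Q)\<^sup>2 * (LINT y|haar F. v (j y))"
    have "(LINT y|haar F. u (j y) + v (j y)) = (LINT y|haar F. u (j y)) + (LINT y|haar F. v (j y))"
      by (intro Bochner_Integration.integral_add F.tf_integrable ty uv(1,2))
    then show "Kt s t (\<lambda>x. u x + v x) = (1 - 1 / F.Q)\<^sup>2 * (LINT y|haar F. u (j y) + v (j y))"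
      using uv by (simp add: Kt_add distrib_left)
  next
    fix u c assume "tf E u" "Kt s t u = (1 - 1 / F.Q)\<^sup>2 * (LINT y|haar F. u (j y))"
    then show "Kt s t (\<lambda>x. c * u x) = (1 - 1 / F.Q)\<^sup>2 * (LINT y|haar F. c * u (j y))"
      by (simp add: Kt_cmult)
  qed
qed

text \<open>Here all powers of \<tau> that occur are 1, so off F the kernel depends on x2 alone. On
  F the relation X = Y/q gives \<open>Mf\<close> = (1 - X) (1 - 1/q), which makes the values of
  balls around 0 and around other points agree.\<close>

lemma const_quad:
  assumes t: "\<tau>\<^sup>2 = 1" and qc: quadratic_chi and r: "unramified F E j \<or> \<tau> = 1" and u: "tf E u"
  shows "vv u b = vv u 0"
proof -
  note n0 = cond_quad(1)[OF qc]
  have X: "X = Y / F.Q" using X_rel t by (simp add: field_simps)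
  have tp: "\<tau> powi (2 * n) = 1" for n using t by (simp add: power_int_mult)
  have M: "Mf (s, t) = (1 - X) * (1 - 1 / F.Q)"
    using r unfolding Mf_quad[OF qc] X by (auto simp: field_simps)
  have near: "Kt s t (bB (j y) N) = (1 - X) * (1 - 1 / F.Q) * X powi N" for y N
  proof (cases "y \<in> pid F N")
    case True
    then have "bB (j y) N = bB 0 N" using E.bl_cong[of "j y" 0 "ram * N"] by (simp add: bB_def j_pid)
    then show ?thesis by (simp add: Kt_zero M)
  next
    case False
    then have y: "y \<noteq> 0" "nu F y + 1 \<le> N" using F.notin_pidD by fastforce+
    show ?thesis unfolding Kt_near[OF n0 y] tp X by (simp add: power_int_divide_distrib power_int_minus field_simps)
  qed
  have off: "Kt s t (bB c N) = Kt s t (bB c' N)" if c: "c2 c \<noteq> 0" "nu F (c2 c) + 1 \<le> N" and e: "c2 c' = c2 c" for c c' N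
  proof -
    have "\<tau> powi (int fdeg * n) = 1" for n
      using r tp[of n] by (cases "unramified F E j") (auto simp: fdeg_def)
    moreover have "c \<noteq> 0" "c' \<noteq> 0" using c(1) e by auto
    ultimately have "Kf Y \<tau> c = Kf Y \<tau> c'" using e by (simp add: Kf_def cond_quad(2)[OF qc])
    moreover have c': "c2 c' \<noteq> 0" "nu F (c2 c') + 1 \<le> N" using c e by auto
    ultimately show ?thesis by (simp only: Kt_off[OF n0 c] Kt_off[OF n0 c'])
  qed
  show ?thesis
  proof (rule tf_refine[OF n0 u])
    show "vv (bB 0 N) b = vv (bB 0 N) 0" for N
      unfolding vv_bB using near[of "- b" N] near[of 0 N] by simp
    show "vv (bB c N) b = vv (bB c N) 0" if "c2 c \<noteq> 0" "nu F (c2 c) + 1 \<le> N" for c N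
      unfolding vv_bB by (rule off) (use that in simp_all)
    show "vv (bB (j y) N) b = vv (bB (j y) N) 0" for y N
      unfolding vv_bB using near[of "y - b" N] near[of y N] by simp
  qed (simp_all add: vv_add vv_cmult)
qed

lemma image_sq_1:
  assumes X: "X \<noteq> 1" and t: "\<tau>\<^sup>2 = 1"
  shows "A ` Ind E chi s = (if Y = 1 \<or> quadratic_chi \<and> (unramified F E j \<or> \<tau> = 1)
    then {\<lambda>g. c * spherical F eta t g | c. True} else Ind F eta t)"
proof -
  have Y1: "vv u y = vv u 0" if "Y = 1" "tf E u" for u y
  proof -
    have m: "(\<lambda>y. u (j y)) \<in> borel_measurable borel"
      using F.tf_measurable[OF slice1_tf[OF that(2), of 0]] by simp
    have "vv u y = (1 - 1 / F.Q)\<^sup>2 * (LINT z|haar F. u (j (z + y)))" for y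
      unfolding vv_def const_Y1[OF t that(1) E.tf_shift[OF that(2)]] by (simp only: j_add)
    then show ?thesis unfolding F.integral_shift[OF m] by simp
  qed
  have "(\<forall>u y. tf E u \<longrightarrow> vv u y = vv u 0) \<longleftrightarrow> Y = 1 \<or> quadratic_chi \<and> (unramified F E j \<or> \<tau> = 1)"
    using Y1 const_quad[OF t] const_imp[OF X t] by blast
  then show ?thesis unfolding image_constants[OF X t] by simp
qed

section \<open>The scalar by which the spherical vector is mapped\<close>

lemma Kt_sum: "finite C \<Longrightarrow> (\<And>c. c \<in> C \<Longrightarrow> tf E (u c)) \<Longrightarrow> Kt s t (\<lambda>x. \<Sum>c\<in>C. u c x) = (\<Sum>c\<in>C. Kt s t (u c))"
proof (induction C rule: finite_induct)
  case empty
  then show ?case using Kt_cmult[OF E.tf_0, of s t 0] by simp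
next
  case (insert c C)
  have "tf E (\<lambda>x. \<Sum>c\<in>C. u c x)" using insert.prems by (intro E.tf_sum) simp
  then show ?case using insert by (simp add: Kt_add)
qed

lemma Y_tau_exp: "Y * \<tau> = exp (- 2 * s * LL)"
  unfolding Yv_exp tv_exp exp_add[symmetric] by (simp add: algebra_simps)

lemma X_Y_exp: "X * Y = exp (- (4 * s + 1) * LL)"
  unfolding Yv_exp Xv_exp exp_add[symmetric] by (simp add: algebra_simps)

text \<open>For ram = 1 the ball of level 1 around -1 is a ball \<open>bB\<close> centred in F, so
  \<open>Kt_near\<close> applies directly.\<close>

lemma spherical_constant_unram:
  assumes qc: quadratic_chi and r: "unramified F E j"
  shows "Mf (s, t) + Kt s t (bl E (-1) 1) = (1 - 1 / F.Q) * (1 - X * Y / F.Q)"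
proof -
  note n0 = cond_quad(1)[OF qc]
  have "ram = 1" using r ram_12 by auto
  then have "bl E (-1) 1 = bB (j (-1)) 1" by (simp add: bB_def)
  moreover have "Kt s t (bB (j (-1)) 1) = (1 - X) * ((1 - 1 / F.Q) * Y / F.Q)"
    by (subst Kt_near[OF n0]) (simp_all add: power_int_minus inverse_eq_divide mult_ac)
  ultimately have "Kt s t (bl E (-1) 1) = (1 - X) * ((1 - 1 / F.Q) * Y / F.Q)" by (simp only:)
  moreover have "Mf (s, t) = (1 - 1 / F.Q) * (1 - Y / F.Q)" using r Mf_quad[OF qc] by simp
  ultimately have "Mf (s, t) + Kt s t (bl E (-1) 1) = (1 - 1 / F.Q) * (1 - Y / F.Q) + (1 - X) * ((1 - 1 / F.Q) * Y / F.Q)"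
    by (simp only:)
  also have "\<dots> = (1 - 1 / F.Q) * (1 - X * Y / F.Q)" by (simp add: field_simps)
  finally show ?thesis .
qed

text \<open>For ram = 2 the maximal ideal of E is one level wider in the direction of \<alpha>. The
  ball around -1 splits into q balls \<open>bB\<close>, one centred in F and the others off
  F.\<close>

lemma spherical_constant_ram:
  assumes qc: quadratic_chi and r: "\<not> unramified F E j"
  shows "Mf (s, t) + Kt s t (bl E (-1) 1) = (1 - 1 / F.Q) * ((1 - Y * \<tau> / F.Q) * (1 + \<tau> / F.Q))"
proof -
  note n0 = cond_quad(1)[OF qc]
  have rh: "ram = 2" "nu_alpha = 1" using r ram_12 by auto
  let ?R = "F.rp 1 ` pid F 0"
  have b: "bl E (-1) 1 x = (\<Sum>r\<in>?R. bB (j (-1) + j r * \<alpha>) 1 x)" for x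
  proof -
    have "bl F 0 0 (c2 x) = (\<Sum>r\<in>?R. bl F 0 0 r * bl F r 1 (c2 x))"
    proof (rule F.tf_decomp)
      show "bl F 0 0 (y + h) = bl F 0 0 y" if "h \<in> pid F 1" for y h
        using F.pid_add_cancel[of h 0 y] F.pid_mono[OF that, of 0] by (simp add: bl_def)
    qed (simp add: bl_def split: if_splits)
    also have "\<dots> = (\<Sum>r\<in>?R. bl F r 1 (c2 x))"
      by (rule sum.cong[OF refl]) (use F.rp_pid_iff[of 0 1] in \<open>auto simp: bl_def\<close>)
    finally have "bl F (-1) 1 (c1 x) * bl F 0 0 (c2 x) = (\<Sum>r\<in>?R. bl F (-1) 1 (c1 x) * bl F r 1 (c2 x))"
      by (simp only: sum_distrib_left)
    moreover have "bl F (-1) 1 (c1 x) * bl F r 1 (c2 x) = bB (j (-1) + j r * \<alpha>) 1 x" for r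
      using c1_j[of 1] c2_j[of 1] by (simp add: bB_eq BB_iff bl_def)
    moreover have "bl F (-1) 1 (c1 x) * bl F 0 0 (c2 x) = bl E (-1) 1 x"
    proof -
      have "x + 1 \<in> pid E 1 \<longleftrightarrow> c1 (x + 1) \<in> pid F 1 \<and> c2 (x + 1) \<in> pid F 0"
        unfolding pid1_box box_def rh by simp
      moreover have "c1 (x + 1) = c1 x + 1" "c2 (x + 1) = c2 x" using c1_j[of 1] c2_j[of 1] by simp_all
      ultimately show ?thesis by (simp add: bl_def)
    qed
    ultimately show ?thesis by simp
  qed
  \<comment> \<open>a is the value on the ball centred in F, d the value on each of the q - 1
    others.\<close>
  define a where "a = (1 - X) * ((1 - 1 / F.Q) * Y / F.Q)"
  define d where "d = (1 - Y) * (1 - X) / F.Q\<^sup>2"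
  have v: "Kt s t (bB (j (-1) + j r * \<alpha>) 1) = d + (if r = F.rp 1 0 then a - d else 0)" if r: "r \<in> ?R" for r
  proof -
    have r0: "r \<in> pid F 0" "F.rp 1 r = r" using r F.rp_pid_iff[of 0 1] by auto
    have e: "r = F.rp 1 0 \<longleftrightarrow> r \<in> pid F 1" using F.rp_eq_iff[of 1 r 0] r0(2) by simp
    show ?thesis
    proof (cases "r \<in> pid F 1")
      case True
      have "j r * \<alpha> \<in> BB 1" unfolding BB_iff c1_jalpha c2_jalpha using True by simp
      then have "bB (j (-1) + j r * \<alpha>) 1 = bB (j (-1)) 1" unfolding bB_def BB_def by (intro E.bl_cong) simp
      then show ?thesis using True e Kt_near[OF n0, of "-1" 1 s t]
        by (simp add: a_def power_int_minus inverse_eq_divide mult_ac)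
    next
      case False
      then have n: "r \<noteq> 0" "nu F r = 0" using r0(1) by (auto simp: pid_def)
      let ?c = "j (-1) + j r * \<alpha>"
      have c: "c1 ?c = -1" "c2 ?c = r" by (simp_all only: c1_add c2_add c1_j c2_j c1_jalpha c2_jalpha add_0 add_0_right)
      have "?c \<in> BB 0" unfolding BB_iff c using r0 by (simp add: pid_def)
      moreover have "?c \<notin> pid E 1" unfolding pid1_iff[OF \<open>?c \<in> BB 0\<close>] c by (simp add: pid_def)
      ultimately have u: "nu E ?c = 0" "?c \<noteq> 0" using unit_E_iff E.unit_iff by blast+
      have "Kf Y \<tau> ?c = 1" unfolding Kf_def c u cond_quad(2)[OF qc u(2)] using n by simp
      moreover have "Kt s t (bB ?c 1) = (1 - Y) * (1 - X) * (Kf Y \<tau> ?c * F.Q powi (- 2 * 1))"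
        by (rule Kt_off[OF n0]) (simp_all only: c n not_False_eq_True add_0 order_refl)
      ultimately show ?thesis using False e by (simp add: d_def power_int_minus divide_inverse)
    qed
  qed
  have "Kt s t (bl E (-1) 1) = (\<Sum>r\<in>?R. Kt s t (bB (j (-1) + j r * \<alpha>) 1))"
    unfolding b[abs_def] by (rule Kt_sum[OF F.finite_rp1 tf_bB])
  also have "\<dots> = (\<Sum>r\<in>?R. d + (if r = F.rp 1 0 then a - d else 0))" by (rule sum.cong[OF refl v])
  also have "\<dots> = F.Q * d + (a - d)"
  proof -
    have "F.rp 1 0 \<in> ?R" by (rule imageI) (simp add: pid_def)
    then show ?thesis using F.finite_rp1 by (simp add: sum.distrib F.card_rp1)
  qed
  finally have K: "Kt s t (bl E (-1) 1) = F.Q * d + (a - d)" .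
  have X: "X = Y * \<tau>\<^sup>2 / F.Q" using X_rel by (simp add: field_simps)
  have M: "Mf (s, t) = (1 - 1 / F.Q) * (1 - 1 / F.Q + \<tau> / F.Q * (1 - Y))" using r Mf_quad[OF qc] by simp
  have d: "F.Q * d + (a - d) = (1 - 1 / F.Q) * ((1 - X) * Y / F.Q + (1 - Y) * (1 - X) / F.Q)"
    by (simp add: a_def d_def power2_eq_square field_simps)
  have "1 - 1 / F.Q + \<tau> / F.Q * (1 - Y) + ((1 - X) * Y / F.Q + (1 - Y) * (1 - X) / F.Q) = (1 - Y * \<tau> / F.Q) * (1 + \<tau> / F.Q)"
    unfolding X by (simp add: power2_eq_square field_simps)
  then show ?thesis unfolding K M d by (simp only: distrib_left[symmetric])
qed

text \<open>One half of \<open>Ind_split\<close> is a Weyl translate, which \<open>weyl_nbar\<close>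
  evaluates only at nonzero points, and 1 is fixed by inversion. The translation by 1 moves the
  maximal ideal to the ball around -1.\<close>

lemma A_spherical:
  assumes qc: quadratic_chi
  shows "A (spherical E chi s) = (\<lambda>g. (Mf (s, t) + Kt s t (bl E (-1) 1)) * spherical F eta t g)"
proof -
  have q: "u \<in> unit_group E \<Longrightarrow> (chi u)\<^sup>2 = 1" for u using qc unfolding trivial_on_units_def by blast
  interpret eq: equivariant F E j \<alpha> chi eta s t A
    by unfold_locales (use uchi ueta atilde q in auto)
  let ?f = "EC.sphf s"
  have fI: "?f \<in> Ind E chi s" by (rule EC.sphf_Ind[OF q])
  have f1: "?f (nbar x) = 1" if "x \<in> pid E 0" for x
  proof -
    have "E.cm 1 x = 0" using that by (auto simp: E.cm_def pid_def)
    then show ?thesis by (simp add: nbar_mat2 EC.sphf_mat2)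
  qed
  let ?k = "inverse (chi (det weyl))"
  have w: "left_translate weyl ?f (nbar x) = ?k * ?f (nbar x)" for x
    by (simp add: left_translate_weyl EC.sphf_GL2[OF E.weyl_GL2])
  have u: "(\<lambda>x. if x \<in> pid E 0 then ?f (nbar x) else 0) = bB 0 0"
    by (simp add: fun_eq_iff bB_eq BB_def f1)
  have v: "(\<lambda>x. if x \<in> pid E 1 then left_translate weyl ?f (nbar x) else 0) = (\<lambda>x. ?k * bl E 0 1 x)"
    using f1 E.pid_mono[of _ 1 0] by (auto simp: fun_eq_iff bl_def w)
  have tv': "tf E (\<lambda>x. ?k * bl E 0 1 x)" by (intro E.tf_cmult E.tf_bl)
  have s: "?f = (\<lambda>g. EC.emb s (bB 0 0) g + left_translate weyl (EC.emb s (\<lambda>x. ?k * bl E 0 1 x)) g)"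
    using EC.Ind_split(3)[OF fI] unfolding u v .
  have "A ?f = (\<lambda>g. A (EC.emb s (bB 0 0)) g + left_translate weyl (A (EC.emb s (\<lambda>x. ?k * bl E 0 1 x))) g)"
    by (subst s) (simp only: A_add EC.emb_Ind tf_bB tv' EC.Ind_left_translate weyl_invertible A_weyl)
  then have "A ?f (nbar 1) = A (EC.emb s (bB 0 0)) (nbar 1) + left_translate weyl (A (EC.emb s (\<lambda>x. ?k * bl E 0 1 x))) (nbar 1)"
    by (simp only:)
  also have "left_translate weyl (A (EC.emb s (\<lambda>x. ?k * bl E 0 1 x))) (nbar 1) = FC.eps * A (EC.emb s (\<lambda>x. ?k * bl E 0 1 x)) (nbar 1)"
    using FC.weyl_nbar[OF A_Ind[OF EC.emb_Ind[OF tv']], of 1] by simp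
  also have "A (EC.emb s (\<lambda>x. ?k * bl E 0 1 x)) (nbar 1) = ?k * Kt s t (bl E (-1) 1)"
  proof -
    have "(\<lambda>x. ?k * bl E 0 1 (x + j 1)) = (\<lambda>x. ?k * bl E (-1) 1 x)" by (simp add: bl_def)
    then show ?thesis unfolding A_emb[OF tv'] using Kt_cmult[OF E.tf_bl] by simp
  qed
  also have "A (EC.emb s (bB 0 0)) (nbar 1) = Mf (s, t)"
  proof -
    have "bB (0 - j 1) 0 = bB 0 0" unfolding bB_def by (rule E.bl_cong) (simp add: pid_def)
    then show ?thesis unfolding A_emb[OF tf_bB] bB_shift using Kt_zero[of s t 0] by simp
  qed
  \<comment> \<open>The sign of the Weyl element of F cancels the factor chi(-1)^(-1) of the Weyl
    element of E.\<close>
  also have "FC.eps * (?k * Kt s t (bl E (-1) 1)) = Kt s t (bl E (-1) 1)"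
  proof -
    have "det (weyl :: 'e^2^2) = j (-1)" by (simp add: weyl_def)
    then have "?k = inverse FC.eps" using chi_j[of "-1"] by (simp add: FC.eps_def)
    then show ?thesis by (simp add: mult.assoc[symmetric])
  qed
  finally have n1: "A ?f (nbar 1) = Mf (s, t) + Kt s t (bl E (-1) 1)" .
  have "A ?f (mat 1) = A ?f (nbar 1)"
    using FC.nbar_values[OF eq.A_sph_Ind eq.A_sph_inv, of 1] by (simp add: pid_def)
  then have "A ?f = (\<lambda>g. (Mf (s, t) + Kt s t (bl E (-1) 1)) * FC.sphf t g)"
    using n1 by (intro FC.eigen_unique[OF eq.A_sph_Ind FC.sphf_Ind[OF FC.quad]])
      (simp_all add: eq.A_sph_inv FC.sphf_GL2 FC.sphf_1)
  moreover have "spherical E chi s = EC.sphf s" by (rule EC.spherical_eq[OF q])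
  moreover have "spherical F eta t = FC.sphf t" by (rule FC.spherical_eq[OF FC.quad])
  ultimately show ?thesis by (simp only:)
qed

section \<open>The image in terms of X, Y and \<tau>\<close>

abbreviation "image_A \<equiv> A ` Ind E chi s"
abbreviation "psi_line \<equiv> {\<lambda>g. c * spherical F eta t g | c. True}"

lemma image_X1: "X = 1 \<Longrightarrow> image_A = (if Mf (s, t) = 0 then {\<lambda>g. 0} else Ind F eta t)"
  using image_zero image_delta by simp

lemma image_not_X1: "X \<noteq> 1 \<Longrightarrow> image_A =
   (if \<tau>\<^sup>2 = F.Q\<^sup>2 then if Y = 1 \<or> \<not> quadratic_chi \<or> (\<not> unramified F E j \<and> \<tau> = - F.Q) then steinberg F eta t else Ind F eta t
    else if \<tau>\<^sup>2 = 1 then if Y = 1 \<or> quadratic_chi \<and> (unramified F E j \<or> \<tau> = 1) then psi_line else Ind F eta t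
    else Ind F eta t)"
  using image_sq_Q image_sq_1 image_generic by (simp split: if_splits)

lemma X_1_iff: "X = 1 \<longleftrightarrow> Y * \<tau>\<^sup>2 = F.Q"
  using X_rel by (metis F.Q_nz mult_cancel_left mult.right_neutral)

lemma sq_cases: "\<tau>\<^sup>2 = F.Q\<^sup>2 \<longleftrightarrow> \<tau> = F.Q \<or> \<tau> = - F.Q" "\<tau>\<^sup>2 = 1 \<longleftrightarrow> \<tau> = 1 \<or> \<tau> = - 1"
  by (simp_all add: power2_eq_iff power2_eq_1_iff)

text \<open>\<open>Mf\<close> vanishes for Y q = 1, and for \<tau>^2 = q^2 this is the same
  condition as X = 1. For other \<tau> the two conditions exclude each other.\<close>

lemma image_nonquad:
  assumes nq: "\<not> quadratic_chi"
  shows "\<tau>\<^sup>2 = F.Q\<^sup>2 \<Longrightarrow> Y * F.Q = 1 \<Longrightarrow> image_A = {\<lambda>g. 0}"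
    and "\<tau>\<^sup>2 = 1 \<Longrightarrow> Y = 1 \<Longrightarrow> image_A = psi_line"
    and "\<tau>\<^sup>2 = F.Q\<^sup>2 \<Longrightarrow> Y * F.Q \<noteq> 1 \<Longrightarrow> image_A = steinberg F eta t"
    and "\<tau>\<^sup>2 \<noteq> F.Q\<^sup>2 \<Longrightarrow> \<not> (\<tau>\<^sup>2 = 1 \<and> Y = 1) \<Longrightarrow> image_A = Ind F eta t"
proof -
  have M: "Mf (s, t) = 0 \<longleftrightarrow> Y * F.Q = 1"
  proof -
    obtain n where n: "n \<ge> 1" "Mf (s, t) = (1 - 1 / F.Q) * (Y ^ n - Y ^ (n - 1) / F.Q)"
      using Mf_nonquad[OF nq] by blast
    obtain m where m: "n = Suc m" using n(1) by (cases n) auto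
    have "Y ^ n - Y ^ (n - 1) / F.Q = Y ^ m * ((Y * F.Q - 1) / F.Q)" unfolding m by (simp add: field_simps)
    then show ?thesis unfolding n(2) using F.one_Q by simp
  qed
  have X: "X = 1 \<longleftrightarrow> Y * F.Q = 1" if "\<tau>\<^sup>2 = F.Q\<^sup>2"
    unfolding X_1_iff that by (simp add: power2_eq_square)
  show "image_A = {\<lambda>g. 0}" if "\<tau>\<^sup>2 = F.Q\<^sup>2" "Y * F.Q = 1"
    using image_X1 X[OF that(1)] that M by simp
  show "image_A = steinberg F eta t" if "\<tau>\<^sup>2 = F.Q\<^sup>2" "Y * F.Q \<noteq> 1"
    using image_not_X1 X[OF that(1)] that nq by simp
  show "image_A = psi_line" if "\<tau>\<^sup>2 = 1" "Y = 1"
  proof -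
    have "X \<noteq> 1" unfolding X_1_iff using that F.Q_ne by simp
    then show ?thesis using image_not_X1 that F.Q_ne by simp
  qed
  show "image_A = Ind F eta t" if a: "\<tau>\<^sup>2 \<noteq> F.Q\<^sup>2" "\<not> (\<tau>\<^sup>2 = 1 \<and> Y = 1)"
  proof (cases "X = 1")
    case True
    have "Y * F.Q \<noteq> 1"
    proof
      assume y: "Y * F.Q = 1"
      have "\<tau>\<^sup>2 = Y * F.Q * \<tau>\<^sup>2" using y by simp
      also have "\<dots> = F.Q * (Y * \<tau>\<^sup>2)" by simp
      also have "\<dots> = F.Q\<^sup>2" using True unfolding X_1_iff by (simp only: power2_eq_square)
      finally show False using a(1) by simp
    qed
    then show ?thesis using image_X1[OF True] M by simp
  next
    case False
    then show ?thesis using image_not_X1[OF False] a nq by auto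
  qed
qed

text \<open>\<open>Mf\<close> vanishes for Y = q, and X = 1 means Y \<tau>^2 = q, so both occur
  together only if \<tau>^2 = 1.\<close>

lemma image_quad_unram:
  assumes qc: quadratic_chi and r: "unramified F E j"
  shows "\<tau>\<^sup>2 = 1 \<Longrightarrow> Y = F.Q \<Longrightarrow> image_A = {\<lambda>g. 0}"
    and "\<tau>\<^sup>2 = 1 \<Longrightarrow> Y \<noteq> F.Q \<Longrightarrow> image_A = psi_line"
    and "\<tau>\<^sup>2 = F.Q\<^sup>2 \<Longrightarrow> Y = 1 \<Longrightarrow> image_A = steinberg F eta t"
    and "\<tau>\<^sup>2 \<noteq> 1 \<Longrightarrow> \<not> (\<tau>\<^sup>2 = F.Q\<^sup>2 \<and> Y = 1) \<Longrightarrow> image_A = Ind F eta t"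
proof -
  have M: "Mf (s, t) = 0 \<longleftrightarrow> Y = F.Q"
  proof -
    have "1 - Y / F.Q = 0 \<longleftrightarrow> Y = F.Q" by auto
    then show ?thesis unfolding Mf_quad[OF qc] using r F.one_Q by simp
  qed
  show "image_A = {\<lambda>g. 0}" if "\<tau>\<^sup>2 = 1" "Y = F.Q" using image_X1 that M by (simp add: X_1_iff)
  show "image_A = psi_line" if "\<tau>\<^sup>2 = 1" "Y \<noteq> F.Q"
    using image_not_X1 that qc r F.Q_ne by (simp add: X_1_iff)
  show "image_A = steinberg F eta t" if "\<tau>\<^sup>2 = F.Q\<^sup>2" "Y = 1"
    using image_not_X1 that F.Q_ne by (simp add: X_1_iff power2_eq_square)
  show "image_A = Ind F eta t" if a: "\<tau>\<^sup>2 \<noteq> 1" "\<not> (\<tau>\<^sup>2 = F.Q\<^sup>2 \<and> Y = 1)"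
  proof (cases "X = 1")
    case True
    then have "Y \<noteq> F.Q" using a(1) by (auto simp: X_1_iff)
    then show ?thesis using image_X1[OF True] M by simp
  next
    case False
    then show ?thesis using image_not_X1[OF False] a qc r by auto
  qed
qed

lemma image_quad_ram:
  assumes qc: quadratic_chi and r: "\<not> unramified F E j"
  shows "(\<tau> = 1 \<and> Y = F.Q) \<or> (\<tau> = - F.Q \<and> Y * F.Q = 1) \<Longrightarrow> image_A = {\<lambda>g. 0}"
    and "(\<tau> = 1 \<and> Y \<noteq> F.Q) \<or> (\<tau> = - 1 \<and> Y = 1) \<Longrightarrow> image_A = psi_line"
    and "(\<tau> = - F.Q \<and> Y * F.Q \<noteq> 1) \<or> (\<tau> = F.Q \<and> Y = 1) \<Longrightarrow> image_A = steinberg F eta t"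
    and "\<tau> \<noteq> 1 \<Longrightarrow> \<tau> \<noteq> - F.Q \<Longrightarrow> \<not> (\<tau> = - 1 \<and> Y = 1) \<Longrightarrow> \<not> (\<tau> = F.Q \<and> Y = 1) \<Longrightarrow> image_A = Ind F eta t"
proof -
  have M: "Mf (s, t) = 0 \<longleftrightarrow> F.Q - 1 + \<tau> * (1 - Y) = 0"
  proof -
    have "1 - 1 / F.Q + \<tau> / F.Q * (1 - Y) = (F.Q - 1 + \<tau> * (1 - Y)) / F.Q" by (simp add: field_simps)
    then show ?thesis unfolding Mf_quad[OF qc] using r F.one_Q by simp
  qed
  have X: "X = 1 \<longleftrightarrow> Y * F.Q = 1" if "\<tau>\<^sup>2 = F.Q\<^sup>2"
    unfolding X_1_iff that by (simp add: power2_eq_square)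
  show "image_A = {\<lambda>g. 0}" if a: "(\<tau> = 1 \<and> Y = F.Q) \<or> (\<tau> = - F.Q \<and> Y * F.Q = 1)"
  proof -
    have "X = 1" "Mf (s, t) = 0" using a X unfolding M by (auto simp: X_1_iff algebra_simps)
    then show ?thesis using image_X1 by simp
  qed
  show "image_A = psi_line" if a: "(\<tau> = 1 \<and> Y \<noteq> F.Q) \<or> (\<tau> = - 1 \<and> Y = 1)"
  proof -
    have "X \<noteq> 1" "\<tau>\<^sup>2 = 1" using a F.Q_ne by (auto simp: X_1_iff)
    then show ?thesis using image_not_X1 a qc F.Q_ne by auto
  qed
  show "image_A = steinberg F eta t" if a: "(\<tau> = - F.Q \<and> Y * F.Q \<noteq> 1) \<or> (\<tau> = F.Q \<and> Y = 1)"
  proof -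
    have "\<tau>\<^sup>2 = F.Q\<^sup>2" "X \<noteq> 1" using a X F.Q_ne by auto
    then show ?thesis using image_not_X1 a r by auto
  qed
  show "image_A = Ind F eta t" if a: "\<tau> \<noteq> 1" "\<tau> \<noteq> - F.Q" "\<not> (\<tau> = - 1 \<and> Y = 1)" "\<not> (\<tau> = F.Q \<and> Y = 1)"
  proof (cases "X = 1")
    case True
    have "Mf (s, t) \<noteq> 0"
    proof
      assume "Mf (s, t) = 0"
      then have "F.Q - 1 + \<tau> * (1 - Y) = 0" unfolding M .
      \<comment> \<open>Multiplication by \<tau> allows Y \<tau>^2 = q to eliminate Y, and the
        remaining quadratic in \<tau> factors.\<close>
      then have "\<tau> * (F.Q - 1 + \<tau> * (1 - Y)) = 0" by simp
      moreover have "Y * \<tau>\<^sup>2 = F.Q" using True X_1_iff by simp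
      ultimately have "(\<tau> - 1) * (\<tau> + F.Q) = 0" by (simp add: power2_eq_square algebra_simps)
      then show False using a by (auto simp: add_eq_0_iff2)
    qed
    then show ?thesis using image_X1[OF True] by simp
  next
    case False
    then show ?thesis using image_not_X1[OF False] a qc r by (auto simp: sq_cases)
  qed
qed

section \<open>From Y and \<tau> back to the parameters s and t\<close>

abbreviation "S \<equiv> E.Q powr s"

lemma tau_eq_iff: "F.Q powr t = F.Q powr t' \<longleftrightarrow> \<tau> = tv t'"
  by (simp add: tv_def powr_add)

lemma mod_periods_iff: "(s, t) \<in> mod_periods F E P \<longleftrightarrow> (\<exists>(s', t')\<in>P. S = E.Q powr s' \<and> \<tau> = tv t')"
  unfolding mod_periods_def tau_eq_iff[symmetric] E.powr_eq_iff F.powr_eq_iff by fastforce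

lemma tv_values: "tv (1/2) = F.Q" "tv (-1/2) = 1" "tv (1/2 + half_period F) = - F.Q" "tv (-1/2 + half_period F) = - 1"
proof -
  show 1: "tv (1/2) = F.Q" by (simp add: tv_def)
  show 2: "tv (-1/2) = 1" by (simp add: tv_def)
  have h: "tv (a + half_period F) = tv a * F.Q powr (half_period F)" for a
    unfolding tv_def powr_add[symmetric] by (simp add: algebra_simps)
  show "tv (1/2 + half_period F) = - F.Q" "tv (-1/2 + half_period F) = - 1"
    unfolding h 1 2 F.powr_half_period by simp_all
qed

lemma t_coset: "t \<in> half_period_coset F c \<longleftrightarrow> \<tau>\<^sup>2 = (tv c)\<^sup>2"
  unfolding F.half_period_coset_iff tv_def by (simp add: powr_add power_mult_distrib)

lemma S_values: "E.Q powr 0 = 1" "E.Q powr (half_period E) = - 1" "E.Q powr (half_period E / 2) = \<i>"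
  "E.Q powr (3 * half_period E / 2) = - \<i>" "E.Q powr (- 1/2 + half_period E) = - (E.Q powr (-1/2))"
  by (simp_all only: E.powr_half_period E.powr_half_half_period E.powr_three_half powr_add) simp_all

lemma E_half_unram: "unramified F E j \<Longrightarrow> E.Q powr (-1/2) = 1 / F.Q"
  unfolding QE_powr by (simp add: fdeg_def exp_minus exp_LL inverse_eq_divide)

lemma E_half_ram: "\<not> unramified F E j \<Longrightarrow> (E.Q powr (-1/2))\<^sup>2 = 1 / F.Q"
proof -
  assume r: "\<not> unramified F E j"
  have "(E.Q powr (-1/2))\<^sup>2 = exp (- LL)"
    unfolding QE_powr power2_eq_square exp_add[symmetric] using r by (simp add: fdeg_def)
  then show ?thesis by (simp add: exp_minus exp_LL inverse_eq_divide)
qed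

text \<open>The only link between Y and s. It determines S in the unramified case but only its
  square in the ramified case, where q_E = q; hence the pairs of values of s, with square roots of
  -1, in the ramified tables.\<close>

lemma YS_unram: "unramified F E j \<Longrightarrow> Y * \<tau> * S = 1"
  unfolding Y_tau_exp QE_powr exp_add[symmetric] by (simp add: fdeg_def)

lemma YS_ram: "\<not> unramified F E j \<Longrightarrow> Y * \<tau> * S\<^sup>2 = 1"
  unfolding Y_tau_exp QE_powr power2_eq_square exp_add[symmetric] by (simp add: fdeg_def algebra_simps)

lemma i_sq: "S\<^sup>2 = - 1 \<longleftrightarrow> S = \<i> \<or> S = - \<i>"
proof -
  have "S\<^sup>2 = - 1 \<longleftrightarrow> S\<^sup>2 = \<i>\<^sup>2" by simp
  then show ?thesis by (simp only: power2_eq_iff)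
qed

lemma eq_inverse_iff: "a * b = 1 \<Longrightarrow> b = c \<longleftrightarrow> a * c = 1" for a b c :: complex
  by (metis mult.commute mult.left_commute mult.right_neutral)

lemmas table_simps = Let_def image_table_def mod_periods_iff Diff_iff Un_iff mem_Times_iff t_coset
  bex_simps(5,7) bex_empty prod.case fst_conv snd_conv tv_values S_values UNIV_I simp_thms

lemma table_2a:
  assumes nq: "\<not> quadratic_chi" and r: "unramified F E j"
  shows "let L = mod_periods F E {(0, 1/2), (half_period E, 1/2 + half_period F)} in
     image_table F E chi eta s t A L
       (mod_periods F E {(0, -1/2), (half_period E, -1/2 + half_period F)})
       (UNIV \<times> half_period_coset F (1/2) - L)"
proof -
  note e = eq_inverse_iff[OF YS_unram[OF r]]
  have Z: "S = 1 \<and> \<tau> = F.Q \<or> S = -1 \<and> \<tau> = - F.Q \<longleftrightarrow> \<tau>\<^sup>2 = F.Q\<^sup>2 \<and> Y * F.Q = 1"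
    unfolding sq_cases e by auto
  have P: "S = 1 \<and> \<tau> = 1 \<or> S = -1 \<and> \<tau> = - 1 \<longleftrightarrow> \<tau>\<^sup>2 = 1 \<and> Y = 1"
    unfolding sq_cases e by auto
  show ?thesis
    unfolding table_simps Z P using image_nonquad[OF nq] by blast
qed

lemma S_sq_cases: "S = 1 \<or> S = - 1 \<longleftrightarrow> S\<^sup>2 = 1" "S = \<i> \<or> S = - \<i> \<longleftrightarrow> S\<^sup>2 = - 1"
  by (simp_all add: power2_eq_1_iff i_sq)

lemma table_2b:
  assumes nq: "\<not> quadratic_chi" and r: "\<not> unramified F E j"
  shows "let L = mod_periods F E {(0, 1/2), (half_period E, 1/2),
         (half_period E / 2, 1/2 + half_period F), (3 * half_period E / 2, 1/2 + half_period F)} in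
     image_table F E chi eta s t A L
       (mod_periods F E {(0, -1/2), (half_period E, -1/2),
         (half_period E / 2, -1/2 + half_period F), (3 * half_period E / 2, -1/2 + half_period F)})
       (UNIV \<times> half_period_coset F (1/2) - L)"
proof -
  note e = eq_inverse_iff[OF YS_ram[OF r]]
  have g: "S = 1 \<and> \<tau> = a \<or> S = - 1 \<and> \<tau> = a \<or> S = \<i> \<and> \<tau> = b \<or> S = - \<i> \<and> \<tau> = b \<longleftrightarrow>
      (S = 1 \<or> S = - 1) \<and> \<tau> = a \<or> (S = \<i> \<or> S = - \<i>) \<and> \<tau> = b" for a b
    by blast
  have Z: "(S = 1 \<or> S = - 1) \<and> \<tau> = F.Q \<or> (S = \<i> \<or> S = - \<i>) \<and> \<tau> = - F.Q \<longleftrightarrow> \<tau>\<^sup>2 = F.Q\<^sup>2 \<and> Y * F.Q = 1"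
    unfolding S_sq_cases sq_cases e by auto
  have P: "(S = 1 \<or> S = - 1) \<and> \<tau> = 1 \<or> (S = \<i> \<or> S = - \<i>) \<and> \<tau> = - 1 \<longleftrightarrow> \<tau>\<^sup>2 = 1 \<and> Y = 1"
    unfolding S_sq_cases sq_cases e by auto
  show ?thesis
    unfolding table_simps g Z P using image_nonquad[OF nq] by blast
qed

lemma table_2c:
  assumes qc: quadratic_chi and r: "unramified F E j"
  shows "let L = mod_periods F E {(-1/2, -1/2), (-1/2 + half_period E, -1/2 + half_period F)} in
     image_table F E chi eta s t A L
       (UNIV \<times> half_period_coset F (-1/2) - L)
       (mod_periods F E {(-1/2, 1/2), (-1/2 + half_period E, 1/2 + half_period F)})"
proof -
  note e = eq_inverse_iff[OF YS_unram[OF r]]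
  have Z: "S = 1 / F.Q \<and> \<tau> = 1 \<or> S = - (1 / F.Q) \<and> \<tau> = - 1 \<longleftrightarrow> \<tau>\<^sup>2 = 1 \<and> Y = F.Q"
    unfolding sq_cases e by (auto simp: field_simps)
  have P: "S = 1 / F.Q \<and> \<tau> = F.Q \<or> S = - (1 / F.Q) \<and> \<tau> = - F.Q \<longleftrightarrow> \<tau>\<^sup>2 = F.Q\<^sup>2 \<and> Y = 1"
    unfolding sq_cases e by auto
  have 1: "\<tau>\<^sup>2 = 1\<^sup>2 \<longleftrightarrow> \<tau>\<^sup>2 = 1" by simp
  show ?thesis
    unfolding table_simps E_half_unram[OF r] Z P 1 using image_quad_unram[OF qc r] by blast
qed

lemma table_2d:
  assumes qc: quadratic_chi and r: "\<not> unramified F E j"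
  shows "image_table F E chi eta s t A
       (mod_periods F E {(-1/2, -1/2), (-1/2 + half_period E, -1/2),
         (half_period E / 2, 1/2 + half_period F), (3 * half_period E / 2, 1/2 + half_period F)})
       (mod_periods F E ((UNIV - half_period_coset E (-1/2)) \<times> {-1/2} \<union>
         {(half_period E / 2, -1/2 + half_period F), (3 * half_period E / 2, -1/2 + half_period F)}))
       ((mod_periods F E (UNIV \<times> {1/2 + half_period F}) -
          mod_periods F E {(half_period E / 2, 1/2 + half_period F), (3 * half_period E / 2, 1/2 + half_period F)}) \<union>
         mod_periods F E {(-1/2, 1/2), (-1/2 + half_period E, 1/2)})"
proof -
  note e = eq_inverse_iff[OF YS_ram[OF r]]
  let ?r = "E.Q powr (-1/2)"
  have rr: "S = ?r \<or> S = - ?r \<longleftrightarrow> S\<^sup>2 = 1 / F.Q"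
    unfolding E_half_ram[OF r, symmetric] power2_eq_iff ..
  have Z: "(s, t) \<in> mod_periods F E {(-1/2, -1/2), (-1/2 + half_period E, -1/2),
         (half_period E / 2, 1/2 + half_period F), (3 * half_period E / 2, 1/2 + half_period F)} \<longleftrightarrow>
      (\<tau> = 1 \<and> Y = F.Q) \<or> (\<tau> = - F.Q \<and> Y * F.Q = 1)"
  proof -
    have "(S = ?r \<or> S = - ?r) \<and> \<tau> = 1 \<or> (S = \<i> \<or> S = - \<i>) \<and> \<tau> = - F.Q \<longleftrightarrow> (\<tau> = 1 \<and> Y = F.Q) \<or> (\<tau> = - F.Q \<and> Y * F.Q = 1)"
      unfolding rr S_sq_cases e by auto
    then show ?thesis unfolding table_simps by blast
  qed
  \<comment> \<open>The removed coset of s is the set S^2 = 1/q, which at \<tau> = 1 is the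
    condition Y = q.\<close>
  have C: "(\<exists>s'. s' \<notin> half_period_coset E (-1/2) \<and> S = E.Q powr s') \<longleftrightarrow> S\<^sup>2 \<noteq> 1 / F.Q"
    unfolding E.half_period_coset_iff E_half_ram[OF r] by metis
  have P: "(s, t) \<in> mod_periods F E ((UNIV - half_period_coset E (-1/2)) \<times> {-1/2} \<union>
         {(half_period E / 2, -1/2 + half_period F), (3 * half_period E / 2, -1/2 + half_period F)}) \<longleftrightarrow>
      (\<tau> = 1 \<and> Y \<noteq> F.Q) \<or> (\<tau> = - 1 \<and> Y = 1)"
  proof -
    have "S\<^sup>2 \<noteq> 1 / F.Q \<and> \<tau> = 1 \<or> (S = \<i> \<or> S = - \<i>) \<and> \<tau> = - 1 \<longleftrightarrow> (\<tau> = 1 \<and> Y \<noteq> F.Q) \<or> (\<tau> = - 1 \<and> Y = 1)"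
      unfolding S_sq_cases e by auto
    moreover have "(\<exists>(s', t')\<in>(UNIV - half_period_coset E (-1/2)) \<times> {-1/2}. S = E.Q powr s' \<and> \<tau> = tv t') \<longleftrightarrow>
        (\<exists>s'. s' \<notin> half_period_coset E (-1/2) \<and> S = E.Q powr s') \<and> \<tau> = 1"
      by (auto simp: tv_values(2)[simplified])
    ultimately show ?thesis unfolding mod_periods_iff bex_Un C by (simp only: table_simps) blast
  qed
  have T: "(s, t) \<in> mod_periods F E (UNIV \<times> {1/2 + half_period F}) \<longleftrightarrow> \<tau> = - F.Q"
    unfolding mod_periods_iff by (auto simp: tv_values(3))
  have S: "(s, t) \<in> (mod_periods F E (UNIV \<times> {1/2 + half_period F}) -
          mod_periods F E {(half_period E / 2, 1/2 + half_period F), (3 * half_period E / 2, 1/2 + half_period F)}) \<union>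
         mod_periods F E {(-1/2, 1/2), (-1/2 + half_period E, 1/2)} \<longleftrightarrow>
      (\<tau> = - F.Q \<and> Y * F.Q \<noteq> 1) \<or> (\<tau> = F.Q \<and> Y = 1)"
  proof -
    have "\<tau> = - F.Q \<and> \<not> ((S = \<i> \<or> S = - \<i>) \<and> \<tau> = - F.Q) \<or> (S = ?r \<or> S = - ?r) \<and> \<tau> = F.Q \<longleftrightarrow>
        (\<tau> = - F.Q \<and> Y * F.Q \<noteq> 1) \<or> (\<tau> = F.Q \<and> Y = 1)"
      unfolding rr S_sq_cases e by auto
    then show ?thesis unfolding Un_iff Diff_iff T by (simp only: table_simps) blast
  qed
  show ?thesis
    unfolding image_table_def Un_iff[of "(s, t)" "_ \<union> _"] Un_iff[of "(s, t)" "mod_periods F E {(-1/2, -1/2), _, _, _}"] Z P S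
    using image_quad_ram[OF qc r] by blast
qed

lemma A_spherical_value:
  assumes qc: quadratic_chi
  shows "A (spherical E chi s) =
    (\<lambda>g. (1 - 1 / F.Q) * spherical F eta t g *
       (if unramified F E j then 1 - E.Q powr (- (2 * s + 1))
        else (1 - E.Q powr (- (2 * s + 1))) * (1 + F.Q powr (t - 1/2))))"
proof (cases "unramified F E j")
  case True
  have "E.Q powr (- (2 * s + 1)) * F.Q = exp (- (2 * s + 1) * 2 * LL + LL)"
    unfolding QE_powr exp_add exp_LL using True by (simp add: fdeg_def)
  also have "- (2 * s + 1) * 2 * LL + LL = - (4 * s + 1) * LL" by (simp add: algebra_simps)
  also have "exp \<dots> = X * Y" by (rule X_Y_exp[symmetric])
  finally have "X * Y / F.Q = E.Q powr (- (2 * s + 1))" by (simp add: field_simps)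
  then show ?thesis
    unfolding A_spherical[OF qc] spherical_constant_unram[OF qc True] using True by (simp add: mult_ac)
next
  case False
  have "E.Q powr (- (2 * s + 1)) * F.Q = exp (- (2 * s + 1) * LL + LL)"
    unfolding QE_powr exp_add exp_LL using False by (simp add: fdeg_def)
  also have "- (2 * s + 1) * LL + LL = - 2 * s * LL" by (simp add: algebra_simps)
  also have "exp \<dots> = Y * \<tau>" by (rule Y_tau_exp[symmetric])
  finally have y: "Y * \<tau> / F.Q = E.Q powr (- (2 * s + 1))" by (simp add: field_simps)
  have "F.Q powr (t - 1/2) * F.Q = exp ((t - 1/2) * LL + LL)"
    unfolding F.powr_Q exp_add exp_LL ..
  also have "(t - 1/2) * LL + LL = (t + 1/2) * LL" by (simp add: algebra_simps)
  also have "exp \<dots> = \<tau>" by (rule tv_exp[symmetric])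
  finally have "\<tau> / F.Q = F.Q powr (t - 1/2)" by (simp add: field_simps)
  with y show ?thesis
    unfolding A_spherical[OF qc] spherical_constant_ram[OF qc False] using False by (simp add: mult_ac)
qed

end

theorem theoremD:
  fixes F :: "'f::{field,metric_space} lf" and E :: "'e::{field,metric_space} lf"
    and j :: "'f \<Rightarrow> 'e" and \<alpha> :: 'e
    and chi :: "'e \<Rightarrow> complex" and eta :: "'f \<Rightarrow> complex" and s t :: complex
    and A :: "('e^2^2 \<Rightarrow> complex) \<Rightarrow> ('f^2^2 \<Rightarrow> complex)"
  assumes ext: "quadratic_extension F E j \<alpha>"
    and chi_character: "unit_character E chi"
    and eta_character: "unit_character F eta"
    and uniformizers:
      "trivial_on_units F (\<lambda>u. chi (j u) * eta u) \<or>
       trivial_on_units F (\<lambda>u. chi (j u) * inverse (eta u)) \<Longrightarrow>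
       qchar E chi 0 (j (unif F)) = 1"
    and A: "is_Atilde F E j \<alpha> chi eta s t A"
  shows
    "(trivial_on_units E (\<lambda>u. (chi u)\<^sup>2) \<longrightarrow>
       (\<not> (\<forall>u\<in>unit_group F. eta u = chi (j u)) \<longrightarrow> A (spherical E chi s) = (\<lambda>g. 0)) \<and>
       ((\<forall>u\<in>unit_group F. eta u = chi (j u)) \<longrightarrow>
          A (spherical E chi s) =
            (\<lambda>g. (1 - 1 / of_nat (residue_card F)) * spherical F eta t g *
               (if unramified F E j
                then 1 - of_nat (residue_card E) powr (- (2 * s + 1))
                else (1 - of_nat (residue_card E) powr (- (2 * s + 1))) *
                     (1 + of_nat (residue_card F) powr (t - 1/2))))))
     \<and>
     (trivial_on_units F (\<lambda>u. chi (j u) * eta u) \<and>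
      trivial_on_units F (\<lambda>u. chi (j u) * inverse (eta u)) \<longrightarrow>
       (let hE = half_period E; hF = half_period F in
         (\<not> trivial_on_units E (\<lambda>u. (chi u)\<^sup>2) \<and> unramified F E j \<longrightarrow>
           (let L = mod_periods F E {(0, 1/2), (hE, 1/2 + hF)} in
            image_table F E chi eta s t A
              L
              (mod_periods F E {(0, -1/2), (hE, -1/2 + hF)})
              (UNIV \<times> half_period_coset F (1/2) - L)))
         \<and>
         (\<not> trivial_on_units E (\<lambda>u. (chi u)\<^sup>2) \<and> \<not> unramified F E j \<longrightarrow>
           (let L = mod_periods F E {(0, 1/2), (hE, 1/2), (hE/2, 1/2 + hF), (3*hE/2, 1/2 + hF)} in
            image_table F E chi eta s t A
              L
              (mod_periods F E {(0, -1/2), (hE, -1/2), (hE/2, -1/2 + hF), (3*hE/2, -1/2 + hF)})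
              (UNIV \<times> half_period_coset F (1/2) - L)))
         \<and>
         (trivial_on_units E (\<lambda>u. (chi u)\<^sup>2) \<and> unramified F E j \<longrightarrow>
           (let L = mod_periods F E {(-1/2, -1/2), (-1/2 + hE, -1/2 + hF)} in
            image_table F E chi eta s t A
              L
              (UNIV \<times> half_period_coset F (-1/2) - L)
              (mod_periods F E {(-1/2, 1/2), (-1/2 + hE, 1/2 + hF)})))
         \<and>
         (trivial_on_units E (\<lambda>u. (chi u)\<^sup>2) \<and> \<not> unramified F E j \<longrightarrow>
            image_table F E chi eta s t A
              (mod_periods F E
                 {(-1/2, -1/2), (-1/2 + hE, -1/2), (hE/2, 1/2 + hF), (3*hE/2, 1/2 + hF)})
              (mod_periods F E
                 ((UNIV - half_period_coset E (-1/2)) \<times> {-1/2} \<union>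
                  {(hE/2, -1/2 + hF), (3*hE/2, -1/2 + hF)}))
              ((mod_periods F E (UNIV \<times> {1/2 + hF}) -
                mod_periods F E {(hE/2, 1/2 + hF), (3*hE/2, 1/2 + hF)}) \<union>
               mod_periods F E {(-1/2, 1/2), (-1/2 + hE, 1/2)}))))"
proof -
  interpret quad_ext F E j \<alpha>
    using ext by unfold_locales (simp_all add: quadratic_extension_def)
  have kernel: "intertwiner F E j \<alpha> chi eta s t A"
    if "trivial_on_units F (\<lambda>u. chi (j u) * eta u)" "trivial_on_units F (\<lambda>u. chi (j u) * inverse (eta u))"
    by unfold_locales (use that uniformizers chi_character eta_character A in auto)
  have zero: "A (spherical E chi s) = (\<lambda>g. 0)"
    if q: "trivial_on_units E (\<lambda>u. (chi u)\<^sup>2)" and ne: "\<not> (\<forall>u\<in>unit_group F. eta u = chi (j u))"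
  proof -
    have q': "(chi u)\<^sup>2 = 1" if "u \<in> unit_group E" for u
      using q that unfolding trivial_on_units_def by blast
    interpret equivariant F E j \<alpha> chi eta s t A
      by unfold_locales (use chi_character eta_character A q' in auto)
    have "spherical E chi s = EC.sphf s" by (rule EC.spherical_eq[OF q'])
    then show ?thesis using A_sph_zero[OF ne] by (simp only:)
  qed
  have scalar: "A (spherical E chi s) =
      (\<lambda>g. (1 - 1 / of_nat (residue_card F)) * spherical F eta t g *
         (if unramified F E j then 1 - of_nat (residue_card E) powr (- (2 * s + 1))
          else (1 - of_nat (residue_card E) powr (- (2 * s + 1))) * (1 + of_nat (residue_card F) powr (t - 1/2))))"
    if q: "trivial_on_units E (\<lambda>u. (chi u)\<^sup>2)" and eq: "\<forall>u\<in>unit_group F. eta u = chi (j u)"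
  proof -
    have ju: "(chi (j u))\<^sup>2 = 1" "chi (j u) \<noteq> 0" if "u \<in> unit_group F" for u
    proof -
      have "j u \<in> unit_group E" using that nu_j_unit[OF that] F.unit_iff E.unit_iff j_eq_0 by blast
      then show "(chi (j u))\<^sup>2 = 1" using q unfolding trivial_on_units_def by blast
      then show "chi (j u) \<noteq> 0" by auto
    qed
    \<comment> \<open>chi(j u) squares to 1 and is its own inverse, so agreement of eta with chi on
      the units of F makes both products trivial.\<close>
    have "trivial_on_units F (\<lambda>u. chi (j u) * eta u)" "trivial_on_units F (\<lambda>u. chi (j u) * inverse (eta u))"
      using eq ju unfolding trivial_on_units_def by (simp_all add: power2_eq_square)
    from intertwiner.A_spherical_value[OF kernel[OF this] q] show ?thesis .
  qed
  show ?thesis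
    unfolding Let_def[of "half_period E"] Let_def[of "half_period F"]
  proof (intro conjI impI, goal_cases)
    case 1
    then show ?case by (intro zero)
  next
    case 2
    then show ?case by (intro scalar)
  next
    case 3
    then show ?case by (intro intertwiner.table_2a[OF kernel]) simp_all
  next
    case 4
    then show ?case by (intro intertwiner.table_2b[OF kernel]) simp_all
  next
    case 5
    then show ?case by (intro intertwiner.table_2c[OF kernel]) simp_all
  next
    case 6
    then show ?case by (intro intertwiner.table_2d[OF kernel]) simp_all
  qed
qed

end
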